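(* Let $\nu\in\mathcal{BID}$ be compactly supported, and let $\{\nu_\varepsilon\}_{\varepsilon\ge0}$ be the $\boxplus\boxplus$-semigroup generated by $\nu$. Let $R_\nu(z,w)=\sum_{m,n\ge0}\kappa_{m,n}z^mw^n$ be the power series expansion of $R_\nu$ near $(0,0)$. Then there exists a unique triple $(\rho_1,\rho_2,\rho)$ of two compactly supported positive Borel measures $\rho_1$ and $\rho_2$ on $\mathbb{R}^2$ and a compactly supported Borel signed measure $\rho$ on $\mathbb{R}^2$ such that: (1) The weak convergences $$\frac{s^2}{\varepsilon}\,d\nu_\varepsilon(s,t)\Rightarrow\rho_1,\qquad \frac{t^2}{\varepsilon}\,d\nu_\varepsilon(s,t)\Rightarrow\rho_2,\qquad \frac{st}{\varepsilon}\,d\nu_\varepsilon(s,t)\Rightarrow\rho$$ on $\mathbb{R}^2$ and the limits $$\frac1\varepsilon\int_{\mathbb{R}^2}s\,d\nu_\varepsilon(s,t)\to\kappa_{1,0}\quad\text{and}\quad\frac1\varepsilon\int_{\mathbb{R}^2}t\,d\nu_\varepsilon(s,t)\to\kappa_{0,1}$$ hold simultaneously as $\varepsilon\to0^+$. (2) We have $$R_\nu(z,w)=\kappa_{1,0}z+\kappa_{0,1}w+\int_{\mathbb{R}^2}\frac{z^2}{1-zs}\,d\rho_1(s,t)+\int_{\mathbb{R}^2}\frac{w^2}{1-wt}\,d\rho_2(s,t)+\int_{\mathbb{R}^2}\frac{zw}{(1-zs)(1-wt)}\,d\rho(s,t)$$ for $(z,w)$ in $(\mathbb{C}\setminus\mathbb{R})^2\cup\{(0,0)\}$.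 (3) The total mass $\rho_j(\mathbb{R}^2)$ is equal to the variance of the marginal $\nu^{(j)}$ for $j=1,2$, the number $\rho(\mathbb{R}^2)$ is the covariance of $\nu$, and the measures $\rho_1$, $\rho_2$ and $\rho$ satisfy $$t\,d\rho_1=s\,d\rho,\qquad s\,d\rho_2=t\,d\rho,$$ and $$|\rho(\{(0,0)\})|^2\le\rho_1(\{(0,0)\})\,\rho_2(\{(0,0)\}).$$
   Context: For a Borel probability measure $\mu$ on $\mathbb{R}^2$, its marginals are $\mu^{(j)}=\mu\circ\pi_j^{-1}$, $j=1,2$, where $\pi_1(s,t)=s$, $\pi_2(s,t)=t$, and its Cauchy transform is $G_\mu(z,w)=\int_{\mathbb{R}^2}\frac{1}{(z-s)(w-t)}\,d\mu(s,t)$ for $z,w\in\mathbb{C}\setminus\mathbb{R}$. The covariance of $\nu$ is $\int st\,d\nu-\int s\,d\nu\int t\,d\nu$. For a probability measure $m$ on $\mathbb{R}$, $G_m(z)=\int_{\mathbb{R}}\frac{1}{z-x}\,dm(x)$, $z\notin\mathbb{R}$. For $\alpha,\beta>0$ the Stolz angle is $\Delta=\Delta_{\alpha,\beta}=\{x+iy\in\mathbb{C}: y<0,\ |x|<-\alpha y,\ y>-\beta\}$, $\overline{\Delta}=\{\bar z:z\in\Delta\}$ is its reflection, and the associated product domain is $\Omega=(\Delta\cup\overline\Delta)\times(\Delta\cup\overline\Delta)$. The one-dimensional $R$-transform $R_m$ of a probability measure $m$ on $\mathbb{R}$ is the holomorphic function on $\Delta\cup\overline\Delta$ (for a sufficiently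 small Stolz angle $\Delta$) with $1/z+R_m(z)\notin\mathbb{R}$, $G_m(1/z+R_m(z))=z$, and $zR_m(z)\to0$ as $z\to0$ in $\Delta\cup\overline\Delta$. The bi-free partial $R$-transform of a probability measure $\mu$ on $\mathbb{R}^2$ is $$R_\mu(z,w)=zR_{\mu^{(1)}}(z)+wR_{\mu^{(2)}}(w)+\left[1-\frac{1}{h_\mu(z,w)}\right],\quad h_\mu(z,w)=\frac{G_\mu\left(1/z+R_{\mu^{(1)}}(z),\,1/w+R_{\mu^{(2)}}(w)\right)}{zw},$$ which is defined and holomorphic on a product domain (with $\Delta$ small enough) on which $R_{\mu^{(1)}},R_{\mu^{(2)}}$ are defined and $h_\mu$ has no zeros. If $\mu$ is compactly supported, $R_\mu$ extends holomorphically to a bidisk centered at $(0,0)$, where it has an absolutely convergent power series expansion with real coefficients. $\mathcal{BID}$ is the class of bi-freely infinitely divisible laws: probability measures $\nu$ on $\mathbb{R}^2$ such that for each integer $m\ge2$ there is a probability measure $\mu_m$ on $\mathbb{R}^2$ with $R_\nu=mR_{\mu_m}$ on the domain $\Omega$ of $R_\nu$. For $\nu\in\mathcal{BID}$, $R_\nu$ extends holomorphically to $(\mathbb{C}\setminus\mathbb{R})^2$, and the extension is still denoted $R_\nu$. The $\boxplus\boxplus$-semigroup generated by $\nu\in\mathcal{BID}$ is the family $\{\nu_\varepsilon\}_{\varepsilon\ge0}\subset\mathcal{BID}$ determined by $R_{\nu_\varepsilon}=\varepsilon R_\nu$ in $(\mathbb{C}\setminus\mathbb{R})^2$ (so $\nu_0=\delta_{(0,0)}$,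 $\nu_1=\nu$). $\Rightarrow$ denotes weak convergence of finite (signed) Borel measures, i.e. convergence against bounded continuous functions. *)

theory Defs
  imports "HOL-Probability.Probability"
begin

definition borel_prob :: "'a::topological_space measure \<Rightarrow> bool" where
  "borel_prob M \<longleftrightarrow> prob_space M \<and> sets M = sets borel"

definition finite_borel :: "'a::topological_space measure \<Rightarrow> bool" where
  "finite_borel M \<longleftrightarrow> finite_measure M \<and> sets M = sets borel"

definition compactly_supported :: "'a::topological_space measure \<Rightarrow> bool" where
  "compactly_supported M \<longleftrightarrow> (\<exists>K. compact K \<and> emeasure M (- K) = 0)"

definition marginal1 :: "(real \<times> real) measure \<Rightarrow> real measure" where
  "marginal1 \<mu> = distr \<mu> borel fst"

definition marginal2 :: "(real \<times> real) measure \<Rightarrow> real measure" where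
  "marginal2 \<mu> = distr \<mu> borel snd"

definition covariance :: "(real \<times> real) measure \<Rightarrow> real" where
  "covariance \<nu> = (LINT (s, t)|\<nu>. s * t) - (LINT (s, t)|\<nu>. s) * (LINT (s, t)|\<nu>. t)"

text \<open>A signed measure is a countably additive real-valued function of Borel sets. As for
  \<^const>\<open>measure\<close>, its value on all other sets is 0, so that equality of signed
  measures is equality of functions. Real values make such a measure finite.\<close>

definition signed_borel :: "('a::topological_space set \<Rightarrow> real) \<Rightarrow> bool" where
  "signed_borel \<rho> \<longleftrightarrow>
     \<rho> {} = 0 \<and>
     (\<forall>A. A \<notin> sets borel \<longrightarrow> \<rho> A = 0) \<and>
     (\<forall>A::nat \<Rightarrow> 'a set. range A \<subseteq> sets borel \<longrightarrow> disjoint_family A \<longrightarrow>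
        (\<lambda>i. \<rho> (A i)) sums \<rho> (\<Union>i. A i))"

definition signed_compactly_supported :: "('a::topological_space set \<Rightarrow> real) \<Rightarrow> bool" where
  "signed_compactly_supported \<rho> \<longleftrightarrow>
     (\<exists>K. compact K \<and> (\<forall>A\<in>sets borel. A \<inter> K = {} \<longrightarrow> \<rho> A = 0))"

text \<open>The Jordan decomposition: the positive part of \<open>\<rho>\<close> maps \<open>A\<close> to the supremum of
  \<open>\<rho> B\<close> over the Borel subsets \<open>B\<close> of \<open>A\<close>; the negative part is the positive part
  of \<open>- \<rho>\<close>.\<close>

definition positive_part :: "('a::topological_space set \<Rightarrow> real) \<Rightarrow> 'a measure" where
  "positive_part \<rho> =
     measure_of UNIV (sets borel) (\<lambda>A. SUP B\<in>{B \<in> sets borel. B \<subseteq> A}. ennreal (\<rho> B))"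

definition negative_part :: "('a::topological_space set \<Rightarrow> real) \<Rightarrow> 'a measure" where
  "negative_part \<rho> = positive_part (\<lambda>A. - \<rho> A)"

definition signed_integral ::
  "('a::topological_space set \<Rightarrow> real) \<Rightarrow> ('a \<Rightarrow> 'b::{banach, second_countable_topology}) \<Rightarrow> 'b"
where
  "signed_integral \<rho> f = (LINT x|positive_part \<rho>. f x) - (LINT x|negative_part \<rho>. f x)"

text \<open>The measures \<open>f dM\<close> and \<open>f d\<rho>\<close> of a positive measure \<open>M\<close> and a signed measure
  \<open>\<rho>\<close>. They are only meaningful for integrable \<open>f\<close>, since non-integrable functions have
  integral 0.\<close>

definition times_measure :: "('a::topological_space \<Rightarrow> real) \<Rightarrow> 'a measure \<Rightarrow> 'a set \<Rightarrow> real" where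
  "times_measure f M A = (if A \<in> sets borel then (LINT x:A|M. f x) else 0)"

definition times_signed ::
  "('a::topological_space \<Rightarrow> real) \<Rightarrow> ('a set \<Rightarrow> real) \<Rightarrow> 'a set \<Rightarrow> real" where
  "times_signed f \<rho> A =
     (if A \<in> sets borel then signed_integral \<rho> (\<lambda>x. indicator A x * f x) else 0)"

definition weakly_converges ::
  "('i \<Rightarrow> 'a::topological_space measure) \<Rightarrow> 'a measure \<Rightarrow> 'i filter \<Rightarrow> bool" where
  "weakly_converges M L F \<longleftrightarrow>
     (\<forall>f::'a \<Rightarrow> real. continuous_on UNIV f \<longrightarrow> bounded (range f) \<longrightarrow>
        ((\<lambda>i. LINT x|M i. f x) \<longlongrightarrow> (LINT x|L. f x)) F)"

definition signed_weakly_converges ::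
  "('i \<Rightarrow> 'a::topological_space set \<Rightarrow> real) \<Rightarrow> ('a set \<Rightarrow> real) \<Rightarrow> 'i filter \<Rightarrow> bool" where
  "signed_weakly_converges M L F \<longleftrightarrow>
     (\<forall>f::'a \<Rightarrow> real. continuous_on UNIV f \<longrightarrow> bounded (range f) \<longrightarrow>
        ((\<lambda>i. signed_integral (M i) f) \<longlongrightarrow> signed_integral L f) F)"

definition cauchy_transform :: "real measure \<Rightarrow> complex \<Rightarrow> complex" where
  "cauchy_transform m z = (LINT x|m. 1 / (z - of_real x))"

definition cauchy_transform2 :: "(real \<times> real) measure \<Rightarrow> complex \<Rightarrow> complex \<Rightarrow> complex" where
  "cauchy_transform2 \<mu> z w = (LINT (s, t)|\<mu>. 1 / ((z - of_real s) * (w - of_real t)))"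

definition stolz :: "real \<Rightarrow> real \<Rightarrow> complex set" where
  "stolz \<alpha> \<beta> = {z. Im z < 0 \<and> \<bar>Re z\<bar> < - \<alpha> * Im z \<and> Im z > - \<beta>}"

definition stolz_pair :: "real \<Rightarrow> real \<Rightarrow> complex set" where
  "stolz_pair \<alpha> \<beta> = stolz \<alpha> \<beta> \<union> cnj ` stolz \<alpha> \<beta>"

text \<open>The R-transform only exists on sufficiently small Stolz angles. It is therefore a
  relation: \<open>f\<close> is the R-transform of \<open>m\<close> on the Stolz angle with parameters \<open>\<alpha>\<close> and
  \<open>\<beta>\<close> together with its reflection. The values of \<open>f\<close> elsewhere are irrelevant.\<close>

definition is_R_transform :: "real measure \<Rightarrow> real \<Rightarrow> real \<Rightarrow> (complex \<Rightarrow> complex) \<Rightarrow> bool" where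
  "is_R_transform m \<alpha> \<beta> f \<longleftrightarrow>
     f holomorphic_on stolz_pair \<alpha> \<beta> \<and>
     (\<forall>z\<in>stolz_pair \<alpha> \<beta>. 1 / z + f z \<notin> \<real> \<and> cauchy_transform m (1 / z + f z) = z) \<and>
     ((\<lambda>z. z * f z) \<longlongrightarrow> 0) (at 0 within stolz_pair \<alpha> \<beta>)"

definition is_bifree_R ::
  "(real \<times> real) measure \<Rightarrow> real \<Rightarrow> real \<Rightarrow> (complex \<Rightarrow> complex \<Rightarrow> complex) \<Rightarrow> bool" where
  "is_bifree_R \<mu> \<alpha> \<beta> R \<longleftrightarrow>
     \<alpha> > 0 \<and> \<beta> > 0 \<and>
     (\<exists>R1 R2. is_R_transform (marginal1 \<mu>) \<alpha> \<beta> R1 \<and> is_R_transform (marginal2 \<mu>) \<alpha> \<beta> R2 \<and>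
        (\<forall>z\<in>stolz_pair \<alpha> \<beta>. \<forall>w\<in>stolz_pair \<alpha> \<beta>.
           let h = cauchy_transform2 \<mu> (1 / z + R1 z) (1 / w + R2 w) / (z * w)
           in h \<noteq> 0 \<and> R z w = z * R1 z + w * R2 w + (1 - 1 / h)))"

definition bifree_id :: "(real \<times> real) measure \<Rightarrow> bool" where
  "bifree_id \<nu> \<longleftrightarrow> borel_prob \<nu> \<and>
     (\<exists>\<alpha> \<beta> R. is_bifree_R \<nu> \<alpha> \<beta> R \<and>
        (\<forall>m\<ge>2. \<exists>\<mu> Rm. borel_prob \<mu> \<and> is_bifree_R \<mu> \<alpha> \<beta> Rm \<and>
           (\<forall>z\<in>stolz_pair \<alpha> \<beta>. \<forall>w\<in>stolz_pair \<alpha> \<beta>. R z w = of_nat m * Rm z w)))"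

text \<open>Complex differentiability in two variables: the derivative exists and is
  complex-linear. To be used on open sets.\<close>

definition holomorphic2_on ::
  "(complex \<Rightarrow> complex \<Rightarrow> complex) \<Rightarrow> (complex \<times> complex) set \<Rightarrow> bool" where
  "holomorphic2_on f D \<longleftrightarrow>
     (\<forall>p\<in>D. \<exists>a b. ((\<lambda>(z, w). f z w) has_derivative (\<lambda>(u, v). a * u + b * v)) (at p))"

text \<open>\<open>R\<close> is the holomorphic extension of the bi-free R-transform of \<open>\<nu>\<close> to all pairs of
  non-real numbers. It is unique there, because the product of two Stolz angles and their
  reflections meets each of the four components of that set.\<close>

definition is_extended_bifree_R ::
  "(real \<times> real) measure \<Rightarrow> (complex \<Rightarrow> complex \<Rightarrow> complex) \<Rightarrow> bool" where
  "is_extended_bifree_R \<nu> R \<longleftrightarrow>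
     holomorphic2_on R ((- \<real>) \<times> (- \<real>)) \<and> (\<exists>\<alpha> \<beta>. is_bifree_R \<nu> \<alpha> \<beta> R)"

definition bifree_semigroup ::
  "(real \<times> real) measure \<Rightarrow> (real \<Rightarrow> (real \<times> real) measure) \<Rightarrow> bool" where
  "bifree_semigroup \<nu> N \<longleftrightarrow>
     (\<exists>R. is_extended_bifree_R \<nu> R \<and>
        (\<forall>\<epsilon>\<ge>0. bifree_id (N \<epsilon>) \<and>
           is_extended_bifree_R (N \<epsilon>) (\<lambda>z w. of_real \<epsilon> * R z w)))"

end

theory Submission
  imports Defs "HOL-Complex_Analysis.Complex_Analysis"
begin

text \<open>
  Near the origin \<open>\<epsilon> R z 0\<close> equals \<open>z R1 z\<close> for the R-transform \<open>R1\<close> of the first marginal of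
  \<open>N \<epsilon>\<close>, so inverting \<open>z / (1 + \<epsilon> R z 0)\<close> extends the Cauchy transform of that marginal analytically
  across infinity. Hence all \<open>N \<epsilon>\<close> with \<open>\<epsilon> \<le> 1\<close> live in one box, and with
  \<open>\<Psi>\<^sub>\<epsilon> u v = \<integral> 1 / ((1 - u s) (1 - v t)) dN\<^sub>\<epsilon>\<close> the definition of the bi-free R-transform becomes a
  functional equation near \<open>(0, 0)\<close>, valid without any reference to Stolz angles. From it
  \<open>(\<Psi>\<^sub>\<epsilon> - 1) / \<epsilon> \<rightarrow> R\<close>, that is, every moment of \<open>N \<epsilon>\<close> divided by \<open>\<epsilon>\<close> tends to the corresponding cumulant.

  The densities \<open>s\<^sup>2 / \<epsilon>\<close>, \<open>t\<^sup>2 / \<epsilon>\<close> and \<open>(s \<plusminus> t)\<^sup>2 / (4 \<epsilon>)\<close> therefore have convergent moments, and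
  compactness of measures on a box (reduced to the line by a space-filling curve) gives their weak
  limits \<open>\<rho>1\<close>, \<open>\<rho>2\<close>, \<open>P\<close>, \<open>Q\<close>; then \<open>\<rho> = P - Q\<close> since \<open>s t = (s + t)\<^sup>2 / 4 - (s - t)\<^sup>2 / 4\<close>.
  Expanding \<open>1 / ((1 - z s) (1 - w t))\<close> in the limit gives (2) near the origin, and the identity theorem
  everywhere. The relations in (3) are limits of trivial identities, the inequality at the origin being
  the discriminant condition for \<open>(s + l t)\<^sup>2 \<ge> 0\<close>.
\<close>

section \<open>Signed Borel measures\<close>

text \<open>An R-transform is given only on Stolz angles, which says nothing directly about
  supports. What helps is that the power series controls \<open>R\<close> on a whole bidisc: its
  Lipschitz constant B is fixed before the radius, and shrinking the radius \<rho> until B \<rho>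
  \<le> 1 / 4 makes z / (1 + \<epsilon> R z 0) invertible on one disc for all \<epsilon> \<le> 1.
  Division by \<epsilon> is harmless because the one-variable resolvents differ from 1 by at most
  \<epsilon> / 4. Their values at x and -x together bound second moments by a multiple of
  \<epsilon>, and on a box second moments dominate all higher ones. The resulting geometric bounds
  are uniform in \<epsilon> and turn convergence of generating functions into convergence of each
  moment. Compactness is available for positive measures, while s t / \<epsilon> has no sign; this
  forces the two squares. As P and Q may overlap, they need not be the Jordan parts in which
  \<open>signed_integral\<close> is expressed, so integrals must be shown to depend on the
  difference P - Q alone. Uniqueness rests on the uniqueness of weak limits.\<close>

lemma signed_borel_sums:
  assumes "signed_borel \<rho>" "range A \<subseteq> sets borel" "disjoint_family (A :: nat \<Rightarrow> _)"
  shows "(\<lambda>i. \<rho> (A i)) sums \<rho> (\<Union>i. A i)"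
  using assms unfolding signed_borel_def by blast

lemma signed_borel_empty: "signed_borel \<rho> \<Longrightarrow> \<rho> {} = 0"
  unfolding signed_borel_def by blast

lemma signed_borel_Un:
  assumes \<rho>: "signed_borel \<rho>" and [measurable]: "A \<in> sets borel" "B \<in> sets borel" and "A \<inter> B = {}"
  shows "\<rho> (A \<union> B) = \<rho> A + \<rho> B"
proof -
  have "range (binaryset A B) \<subseteq> sets borel"
    by (auto simp: binaryset_def)
  moreover have "disjoint_family (binaryset A B)"
    using assms(4) by (auto simp: disjoint_family_on_def binaryset_def)
  ultimately have "(\<lambda>i. \<rho> (binaryset A B i)) sums \<rho> (A \<union> B)"
    using signed_borel_sums[OF \<rho>] UN_binaryset_eq[of A B] by metis
  moreover have "(\<lambda>i. \<rho> (binaryset A B i)) sums (\<rho> A + \<rho> B)"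
    by (rule binaryset_sums) (rule signed_borel_empty[OF \<rho>])
  ultimately show ?thesis by (rule sums_unique2)
qed

lemma signed_borel_Diff:
  assumes \<rho>: "signed_borel \<rho>" and [measurable]: "A \<in> sets borel" "B \<in> sets borel" and "B \<subseteq> A"
  shows "\<rho> (A - B) = \<rho> A - \<rho> B"
proof -
  have "\<rho> ((A - B) \<union> B) = \<rho> (A - B) + \<rho> B"
    by (rule signed_borel_Un[OF \<rho>]) auto
  moreover have "(A - B) \<union> B = A" using assms(4) by auto
  ultimately show ?thesis by simp
qed

lemma signed_borel_uminus: "signed_borel \<rho> \<Longrightarrow> signed_borel (\<lambda>A. - \<rho> A)"
  unfolding signed_borel_def by (auto intro: sums_minus)

lemma disjoint_family_UN_lessThan:
  fixes A :: "nat \<Rightarrow> 'a set"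
  assumes "disjoint_family A"
  shows "(\<Union>i<n. A i) \<inter> A n = {}"
proof -
  have "A i \<inter> A n = {}" if "i < n" for i
    using assms that unfolding disjoint_family_on_def by auto
  then show ?thesis by blast
qed

text \<open>The set function from which \<open>positive_part\<close> is generated. Since
  \<open>measure_of\<close> returns it only if it is countably additive, additivity has to be proved
  before \<open>positive_part\<close> can be evaluated. Negative values of \<rho> count as 0 under
  \<open>ennreal\<close>.\<close>

definition pos_sup :: "('a::topological_space set \<Rightarrow> real) \<Rightarrow> 'a set \<Rightarrow> ennreal" where
  "pos_sup \<rho> A = (SUP B\<in>{B \<in> sets borel. B \<subseteq> A}. ennreal (\<rho> B))"

lemma pos_sup_upper: "B \<in> sets borel \<Longrightarrow> B \<subseteq> A \<Longrightarrow> ennreal (\<rho> B) \<le> pos_sup \<rho> A"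
  unfolding pos_sup_def by (intro SUP_upper) auto

lemma pos_sup_mono: "A \<subseteq> A' \<Longrightarrow> pos_sup \<rho> A \<le> pos_sup \<rho> A'"
  unfolding pos_sup_def by (intro SUP_subset_mono) auto

text \<open>Two competitors \<open>B\<close> and \<open>B'\<close> of nonnegative value combine into
  \<open>B \<union> B'\<close>. If one value is negative, it counts as 0 and the other set alone
  already competes in the union.\<close>

lemma pos_sup_Un_superadd:
  assumes \<rho>: "signed_borel \<rho>" and "A \<inter> A' = {}"
  shows "pos_sup \<rho> A + pos_sup \<rho> A' \<le> pos_sup \<rho> (A \<union> A')"
proof -
  have *: "ennreal (\<rho> B) + ennreal (\<rho> B') \<le> pos_sup \<rho> (A \<union> A')"
    if "B \<in> sets borel" "B \<subseteq> A" "B' \<in> sets borel" "B' \<subseteq> A'" for B B'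
  proof (cases "\<rho> B \<ge> 0 \<and> \<rho> B' \<ge> 0")
    case True
    then have "ennreal (\<rho> B) + ennreal (\<rho> B') = ennreal (\<rho> (B \<union> B'))"
      using that assms(2) by (subst signed_borel_Un[OF \<rho>]) auto
    also have "\<dots> \<le> pos_sup \<rho> (A \<union> A')"
      using that by (intro pos_sup_upper) auto
    finally show ?thesis .
  next
    case False
    then have "ennreal (\<rho> B) = 0 \<or> ennreal (\<rho> B') = 0" by (auto simp: ennreal_neg)
    moreover have "B \<subseteq> A \<union> A'" "B' \<subseteq> A \<union> A'" using that by auto
    ultimately show ?thesis
      using that(1,3) pos_sup_upper[of B "A \<union> A'" \<rho>] pos_sup_upper[of B' "A \<union> A'" \<rho>] by auto
  qed
  have ne: "{B \<in> sets borel. B \<subseteq> X} \<noteq> {}" for X :: "'a set" by auto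
  show ?thesis
    unfolding pos_sup_def[of \<rho> A] pos_sup_def[of \<rho> A']
    by (subst ennreal_SUP_add_left[OF ne, symmetric], rule SUP_least,
        subst ennreal_SUP_add_right[OF ne], rule SUP_least) (use * in auto)
qed

text \<open>Superadditivity bounds the partial sums from above. Conversely, a competitor
  \<open>B\<close> for the union is cut into the pieces \<open>B \<inter> A i\<close>, whose values
  add up to that of \<open>B\<close> and which compete separately.\<close>

lemma pos_sup_countably_additive:
  assumes \<rho>: "signed_borel \<rho>"
  shows "countably_additive (sets borel) (pos_sup \<rho>)"
proof (rule countably_additiveI)
  fix A :: "nat \<Rightarrow> 'a set"
  assume A: "range A \<subseteq> sets borel" "disjoint_family A" "(\<Union>i. A i) \<in> sets borel"
  show "(\<Sum>i. pos_sup \<rho> (A i)) = pos_sup \<rho> (\<Union>i. A i)"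
  proof (rule antisym)
    have "(\<Sum>i<n. pos_sup \<rho> (A i)) \<le> pos_sup \<rho> (\<Union>i<n. A i)" for n
    proof (induction n)
      case (Suc n)
      have disj: "(\<Union>i<n. A i) \<inter> A n = {}"
        by (rule disjoint_family_UN_lessThan[OF A(2)])
      have "(\<Sum>i<Suc n. pos_sup \<rho> (A i)) \<le> pos_sup \<rho> (\<Union>i<n. A i) + pos_sup \<rho> (A n)"
        using Suc by (simp add: add_right_mono)
      also have "\<dots> \<le> pos_sup \<rho> ((\<Union>i<n. A i) \<union> A n)"
        by (rule pos_sup_Un_superadd[OF \<rho> disj])
      also have "(\<Union>i<n. A i) \<union> A n = (\<Union>i<Suc n. A i)" by (auto simp: less_Suc_eq)
      finally show ?case .
    qed simp
    also have "pos_sup \<rho> (\<Union>i<n. A i) \<le> pos_sup \<rho> (\<Union>i. A i)" for n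
      by (rule pos_sup_mono) auto
    finally show "(\<Sum>i. pos_sup \<rho> (A i)) \<le> pos_sup \<rho> (\<Union>i. A i)"
      by (intro suminf_le_const) (auto simp: summableI)
    show "pos_sup \<rho> (\<Union>i. A i) \<le> (\<Sum>i. pos_sup \<rho> (A i))"
      unfolding pos_sup_def[of \<rho> "\<Union>i. A i"]
    proof (rule SUP_least)
      fix B assume B: "B \<in> {B \<in> sets borel. B \<subseteq> (\<Union>i. A i)}"
      have r: "range (\<lambda>i. B \<inter> A i) \<subseteq> sets borel"
        using A B by auto
      have "(\<lambda>i. \<rho> (B \<inter> A i)) sums \<rho> (\<Union>i. B \<inter> A i)"
        using A(2) by (intro signed_borel_sums[OF \<rho> r]) (auto simp: disjoint_family_on_def)
      also have "(\<Union>i. B \<inter> A i) = B" using B by auto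
      finally have s: "(\<lambda>i. \<rho> (B \<inter> A i)) sums \<rho> B" .
      then have "(\<lambda>n. ennreal (\<Sum>i<n. \<rho> (B \<inter> A i))) \<longlonglongrightarrow> ennreal (\<rho> B)"
        unfolding sums_def by (rule tendsto_ennrealI)
      moreover have "ennreal (\<Sum>i<n. \<rho> (B \<inter> A i)) \<le> (\<Sum>i. pos_sup \<rho> (A i))" for n
      proof -
        \<comment> \<open>Dropping the pieces of negative value can only enlarge the sum, and
          \<open>ennreal\<close> maps exactly these to 0.\<close>
        have "ennreal (\<Sum>i<n. \<rho> (B \<inter> A i)) \<le> ennreal (\<Sum>i<n. max 0 (\<rho> (B \<inter> A i)))"
          by (intro ennreal_leI sum_mono) auto
        also have "\<dots> = (\<Sum>i<n. ennreal (max 0 (\<rho> (B \<inter> A i))))"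
          by (rule sum_ennreal[symmetric]) auto
        also have "\<dots> = (\<Sum>i<n. ennreal (\<rho> (B \<inter> A i)))"
          by (intro sum.cong) (auto simp: max_def ennreal_neg)
        also have "\<dots> \<le> (\<Sum>i<n. pos_sup \<rho> (A i))"
          using r by (intro sum_mono pos_sup_upper) auto
        also have "\<dots> \<le> (\<Sum>i. pos_sup \<rho> (A i))"
          by (intro sum_le_suminf) auto
        finally show ?thesis .
      qed
      ultimately show "ennreal (\<rho> B) \<le> (\<Sum>i. pos_sup \<rho> (A i))"
        by (intro LIMSEQ_le_const2[of _ "ennreal (\<rho> B)"]) auto
    qed
  qed
qed

text \<open>A set \<open>A\<close> of infinite supremum contains some \<open>B\<close> with \<rho> B
  > 1 + |\<rho> A|. Then both \<open>B\<close> and \<open>A - B\<close> have values of modulus at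
  least 1, and one of them again has infinite supremum. Iterating peels off disjoint sets of modulus
  at least 1, which countable additivity forbids.\<close>

lemma pos_sup_finite:
  assumes \<rho>: "signed_borel \<rho>"
  shows "pos_sup \<rho> UNIV < \<infinity>"
proof (rule ccontr)
  assume "\<not> ?thesis"
  then have inf: "pos_sup \<rho> UNIV = \<infinity>" by (auto simp: less_top[symmetric])
  have split: "\<exists>B. B \<in> sets borel \<and> B \<subseteq> A \<and> \<bar>\<rho> (A - B)\<bar> \<ge> 1 \<and> pos_sup \<rho> B = \<infinity>"
    if A: "A \<in> sets borel" "pos_sup \<rho> A = \<infinity>" for A
  proof -
    have "ennreal (1 + \<bar>\<rho> A\<bar>) < pos_sup \<rho> A" unfolding A(2) by (rule ennreal_less_top[folded infinity_ennreal_def])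
    then obtain B where B: "B \<in> sets borel" "B \<subseteq> A" "ennreal (1 + \<bar>\<rho> A\<bar>) < ennreal (\<rho> B)"
      unfolding pos_sup_def less_SUP_iff by blast
    have B3: "1 + \<bar>\<rho> A\<bar> < \<rho> B" using iffD1[OF ennreal_less_iff B(3)] by simp
    have d: "\<rho> (A - B) = \<rho> A - \<rho> B" using A B by (intro signed_borel_Diff[OF \<rho>]) auto
    have AB: "A - (A - B) = B" using B by auto
    have "pos_sup \<rho> A \<le> pos_sup \<rho> B + pos_sup \<rho> (A - B)"
    proof -
      have "pos_sup \<rho> (\<Union>i. binaryset B (A - B) i) = (\<Sum>i. pos_sup \<rho> (binaryset B (A - B) i))"
        using A B
        by (intro pos_sup_countably_additive[OF \<rho>, unfolded countably_additive_def, rule_format, symmetric])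
           (auto simp: binaryset_def disjoint_family_on_def)
      moreover have "pos_sup \<rho> {} = 0"
        unfolding pos_sup_def using signed_borel_empty[OF \<rho>] by (auto simp: SUP_constant)
      then have "(\<Sum>i. pos_sup \<rho> (binaryset B (A - B) i)) = pos_sup \<rho> B + pos_sup \<rho> (A - B)"
        by (intro suminf_binaryset_eq) auto
      moreover have "B \<union> (A - B) = A" using B by auto
      ultimately show ?thesis unfolding UN_binaryset_eq by simp
    qed
    then have "pos_sup \<rho> B = \<infinity> \<or> pos_sup \<rho> (A - B) = \<infinity>"
      using A(2) by (metis ennreal_add_eq_top infinity_ennreal_def neq_top_trans)
    then show ?thesis
    proof
      assume "pos_sup \<rho> B = \<infinity>"
      then show ?thesis using B B3 d by (intro exI[of _ B]) auto
    next
      assume "pos_sup \<rho> (A - B) = \<infinity>"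
      then show ?thesis using A B B3 AB by (intro exI[of _ "A - B"]) auto
    qed
  qed
  define P where "P A \<longleftrightarrow> A \<in> sets borel \<and> pos_sup \<rho> A = \<infinity>" for A
  have "\<exists>F. \<forall>n. P (F n) \<and> F (Suc n) \<subseteq> F n \<and> \<bar>\<rho> (F n - F (Suc n))\<bar> \<ge> 1"
    by (rule dependent_nat_choice[where P="\<lambda>_. P" and Q="\<lambda>_ A B. B \<subseteq> A \<and> \<bar>\<rho> (A - B)\<bar> \<ge> 1"])
       (use inf split in \<open>auto simp: P_def\<close>)
  then obtain F where F: "\<And>n. P (F n)" "\<And>n. F (Suc n) \<subseteq> F n" "\<And>n. \<bar>\<rho> (F n - F (Suc n))\<bar> \<ge> 1"
    by blast
  have dec: "decseq F" using F(2) by (simp add: decseq_Suc_iff)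
  define D where "D n = F n - F (Suc n)" for n
  have disj: "disjoint_family D"
    unfolding disjoint_family_on_def
  proof (intro ballI impI)
    fix m n :: nat assume "m \<noteq> n"
    then consider "Suc m \<le> n" | "Suc n \<le> m" by linarith
    then show "D m \<inter> D n = {}"
      by cases (use decseqD[OF dec] in \<open>auto simp: D_def\<close>)
  qed
  have "(\<lambda>i. \<rho> (D i)) sums \<rho> (\<Union>i. D i)"
    using F(1) unfolding P_def by (intro signed_borel_sums[OF \<rho> _ disj]) (auto simp: D_def)
  then have "(\<lambda>i. \<rho> (D i)) \<longlonglongrightarrow> 0" by (intro summable_LIMSEQ_zero) (auto simp: sums_iff)
  then have "\<forall>\<^sub>F i in sequentially. \<bar>\<rho> (D i)\<bar> < 1"
    using order_tendstoD(2)[OF tendsto_rabs_zero, of "\<lambda>i. \<rho> (D i)"] by auto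
  then obtain i where "\<bar>\<rho> (D i)\<bar> < 1" using eventually_happens'[OF sequentially_bot] by blast
  then show False using F(3)[of i] by (auto simp: D_def)
qed

section \<open>The Jordan decomposition\<close>

lemma sets_positive_part: "sets (positive_part \<rho>) = sets borel"
  unfolding positive_part_def
  using sets.sigma_sets_eq[of borel] by (simp add: sets_measure_of)

lemma emeasure_positive_part:
  assumes \<rho>: "signed_borel \<rho>" and A: "A \<in> sets borel"
  shows "emeasure (positive_part \<rho>) A = pos_sup \<rho> A"
proof -
  have "emeasure (positive_part \<rho>) A = (\<lambda>A. SUP B\<in>{B \<in> sets borel. B \<subseteq> A}. ennreal (\<rho> B)) A"
    unfolding positive_part_def
  proof (rule emeasure_measure_of_sigma)
    show "sigma_algebra UNIV (sets borel :: 'a set set)"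
      using sets.sigma_algebra_axioms[of borel] by simp
    show "positive (sets borel) (\<lambda>A. SUP B\<in>{B \<in> sets borel. B \<subseteq> A}. ennreal (\<rho> B))"
      unfolding positive_def using signed_borel_empty[OF \<rho>] by (auto simp: SUP_constant)
    show "countably_additive (sets borel) (\<lambda>A. SUP B\<in>{B \<in> sets borel. B \<subseteq> A}. ennreal (\<rho> B))"
      using pos_sup_countably_additive[OF \<rho>] unfolding pos_sup_def .
  qed fact
  then show ?thesis unfolding pos_sup_def .
qed

lemma finite_borel_positive_part: "signed_borel \<rho> \<Longrightarrow> finite_borel (positive_part \<rho>)"
  unfolding finite_borel_def
  using pos_sup_finite[of \<rho>] emeasure_positive_part[of \<rho> UNIV]
  by (auto intro!: finite_measureI simp: sets_positive_part sets_eq_imp_space_eq[OF sets_positive_part])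

lemma finite_borel_negative_part: "signed_borel \<rho> \<Longrightarrow> finite_borel (negative_part \<rho>)"
  unfolding negative_part_def by (intro finite_borel_positive_part signed_borel_uminus)

lemma finite_borelD:
  assumes "finite_borel M"
  shows "finite_measure M" "sets M = sets borel" "space M = UNIV"
  using assms sets_eq_imp_space_eq[of M borel] unfolding finite_borel_def by auto

lemma finite_borel_borel_measurable:
  "finite_borel M \<Longrightarrow> f \<in> borel_measurable borel \<Longrightarrow> f \<in> borel_measurable M"
  by (simp add: measurable_cong_sets[OF finite_borelD(2) refl])

lemma measure_positive_part:
  assumes \<rho>: "signed_borel \<rho>" and A: "A \<in> sets borel"
  shows "ennreal (measure (positive_part \<rho>) A) = pos_sup \<rho> A"
    and "ennreal (measure (negative_part \<rho>) A) = pos_sup (\<lambda>A. - \<rho> A) A"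
proof -
  note * = finite_measure.emeasure_eq_measure[OF finite_borelD(1)[OF finite_borel_positive_part], symmetric]
  show "ennreal (measure (positive_part \<rho>) A) = pos_sup \<rho> A"
    using *[OF \<rho>] emeasure_positive_part[OF \<rho> A] by simp
  show "ennreal (measure (negative_part \<rho>) A) = pos_sup (\<lambda>A. - \<rho> A) A"
    unfolding negative_part_def *[OF signed_borel_uminus[OF \<rho>]]
    by (rule emeasure_positive_part[OF signed_borel_uminus[OF \<rho>] A])
qed

text \<open>For \<open>B \<subseteq> A\<close>, \<rho> B = \<rho> A - \<rho> (A - B), and -\<rho> (A
  - B) is at most the negative part of \<open>A\<close>. Together with the same bound for -\<rho>
  this yields the Jordan decomposition.\<close>

lemma positive_part_le_negative_part:
  assumes \<rho>: "signed_borel \<rho>" and A: "A \<in> sets borel"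
  shows "measure (positive_part \<rho>) A \<le> measure (negative_part \<rho>) A + \<rho> A"
proof -
  have *: "- \<rho> B \<le> measure (negative_part \<rho>) A" if "B \<in> sets borel" "B \<subseteq> A" for B
    using pos_sup_upper[OF that, of "\<lambda>A. - \<rho> A"]
    unfolding measure_positive_part(2)[OF assms, symmetric] by (simp only: ennreal_le_iff measure_nonneg)
  have "\<rho> B \<le> measure (negative_part \<rho>) A + \<rho> A" if "B \<in> sets borel" "B \<subseteq> A" for B
    using signed_borel_Diff[OF \<rho> A that] *[of "A - B"] A that by auto
  then have "pos_sup \<rho> A \<le> ennreal (measure (negative_part \<rho>) A + \<rho> A)"
    unfolding pos_sup_def by (intro SUP_least ennreal_leI) auto
  moreover have "0 \<le> measure (negative_part \<rho>) A + \<rho> A"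
    using *[OF A] by auto
  ultimately show ?thesis
    unfolding measure_positive_part(1)[OF assms, symmetric] by (simp only: ennreal_le_iff)
qed

lemma Jordan_decomposition:
  assumes \<rho>: "signed_borel \<rho>" and A: "A \<in> sets borel"
  shows "\<rho> A = measure (positive_part \<rho>) A - measure (negative_part \<rho>) A"
  using positive_part_le_negative_part[OF \<rho> A]
    positive_part_le_negative_part[OF signed_borel_uminus[OF \<rho>] A]
  by (simp add: negative_part_def)

section \<open>From relations between set values to relations between integrals\<close>

lemma finite_borel_integrable_AE_bounded:
  fixes f :: "'a::topological_space \<Rightarrow> 'b::{banach, second_countable_topology}"
  assumes M: "finite_borel M" and f: "f \<in> borel_measurable borel" and "AE x in M. norm (f x) \<le> B"
  shows "integrable M f"
  using assms(3) finite_borel_borel_measurable[OF M f]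
  by (intro finite_measure.integrable_const_bound[OF finite_borelD(1)[OF M]])

text \<open>A linear relation between finitely many measures is carried as a family of real
  coefficients, so that signed combinations need no case distinction. For simple functions it is
  applied to the level sets.\<close>

lemma sum_integral_simple_function_eq_0:
  fixes f :: "'a::topological_space \<Rightarrow> 'b::{banach, second_countable_topology}" and c :: "'i \<Rightarrow> real"
  assumes "finite J" and M: "\<And>j. j \<in> J \<Longrightarrow> finite_borel (M j)"
    and 0: "\<And>A. A \<in> sets borel \<Longrightarrow> (\<Sum>j\<in>J. c j * measure (M j) A) = 0"
    and f: "simple_function borel f"
  shows "(\<Sum>j\<in>J. c j *\<^sub>R (LINT x|M j. f x)) = 0"
proof -
  have fin: "finite (range f)" and m: "\<And>y. f -` {y} \<in> sets borel"
    using f unfolding simple_function_def by (auto dest: bspec) (metis UNIV_I image_eqI inf_top.right_neutral rangeI sets.empty_sets vimage_empty vimage_singleton_eq ex_in_conv)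
  have feq: "f = (\<lambda>x. \<Sum>y\<in>range f. indicator (f -` {y}) x *\<^sub>R y)"
  proof
    fix x
    have "(\<Sum>y\<in>range f. indicator (f -` {y}) x *\<^sub>R y) = (\<Sum>y\<in>range f. if y = f x then y else 0)"
      by (intro sum.cong) (auto simp: indicator_def)
    then show "f x = (\<Sum>y\<in>range f. indicator (f -` {y}) x *\<^sub>R y)" using fin by (simp add: sum.delta)
  qed
  have "(LINT x|M j. f x) = (\<Sum>y\<in>range f. measure (M j) (f -` {y}) *\<^sub>R y)" if "j \<in> J" for j
  proof -
    interpret finite_measure "M j" using finite_borelD(1)[OF M[OF that]] .
    have [simp]: "f -` {y} \<in> sets (M j)" for y using m finite_borelD(2)[OF M[OF that]] by simp
    have "(LINT x|M j. f x) = (\<Sum>y\<in>range f. LINT x|M j. indicator (f -` {y}) x *\<^sub>R y)"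
      by (subst feq, rule Bochner_Integration.integral_sum)
         (auto intro!: integrable_scaleR_left simp: emeasure_finite less_top[symmetric])
    moreover have "(LINT x|M j. indicator (f -` {y}) x *\<^sub>R y) = measure (M j) (f -` {y}) *\<^sub>R y" for y
      by (subst integral_scaleR_left)
         (auto simp: emeasure_finite less_top[symmetric] finite_borelD(3)[OF M[OF that]])
    ultimately show ?thesis by simp
  qed
  then have "(\<Sum>j\<in>J. c j *\<^sub>R (LINT x|M j. f x)) =
      (\<Sum>j\<in>J. \<Sum>y\<in>range f. (c j * measure (M j) (f -` {y})) *\<^sub>R y)"
    by (simp add: scaleR_sum_right)
  also have "\<dots> = (\<Sum>y\<in>range f. (\<Sum>j\<in>J. c j * measure (M j) (f -` {y})) *\<^sub>R y)"
    by (subst sum.swap) (simp add: scaleR_sum_left)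
  also have "\<dots> = 0" using 0[OF m] by simp
  finally show ?thesis .
qed

text \<open>Bounds are asked almost everywhere under each measure, because some functions met later,
  such as the coordinates, are bounded on the support but not on the plane.\<close>

lemma sum_integral_eq_0:
  fixes f :: "'a::topological_space \<Rightarrow> 'b::{banach, second_countable_topology}" and c :: "'i \<Rightarrow> real"
  assumes J: "finite J" and M: "\<And>j. j \<in> J \<Longrightarrow> finite_borel (M j)"
    and 0: "\<And>A. A \<in> sets borel \<Longrightarrow> (\<Sum>j\<in>J. c j * measure (M j) A) = 0"
    and f[measurable]: "f \<in> borel_measurable borel" and bd: "\<And>j. j \<in> J \<Longrightarrow> AE x in M j. norm (f x) \<le> B"
  shows "(\<Sum>j\<in>J. c j *\<^sub>R (LINT x|M j. f x)) = 0"
proof -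
  \<comment> \<open>Cutting off where the bound fails changes no integral and makes the simple
    approximations uniformly bounded.\<close>
  define g where "g x = (if norm (f x) \<le> B then f x else 0)" for x
  have g[measurable]: "g \<in> borel_measurable borel" unfolding g_def by measurable
  have gb: "norm (g x) \<le> \<bar>B\<bar>" for x unfolding g_def by auto
  have fg: "(LINT x|M j. f x) = (LINT x|M j. g x)" if "j \<in> J" for j
    using bd[OF that]
    by (intro integral_cong_AE finite_borel_borel_measurable[OF M[OF that]] f g) (auto simp: g_def)
  obtain F where F: "\<And>i. simple_function borel (F i)" "\<And>x. (\<lambda>i. F i x) \<longlonglongrightarrow> g x"
    "\<And>i x. norm (F i x) \<le> 2 * norm (g x)"
    using borel_measurable_implies_sequence_metric[OF g, of 0] by (auto simp: dist_norm)
  have Fb: "norm (F i x) \<le> 2 * \<bar>B\<bar>" for i x using F(3)[of i x] gb[of x] by linarith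
  have lim: "(\<lambda>i. LINT x|M j. F i x) \<longlonglongrightarrow> (LINT x|M j. g x)" if "j \<in> J" for j
  proof (rule integral_dominated_convergence[where w="\<lambda>_. 2 * \<bar>B\<bar>"])
    interpret finite_measure "M j" using finite_borelD(1)[OF M[OF that]] .
    show "integrable (M j) (\<lambda>_. 2 * \<bar>B\<bar>)" by simp
    show "g \<in> borel_measurable (M j)" using finite_borel_borel_measurable[OF M[OF that] g] .
    show "F i \<in> borel_measurable (M j)" for i
      using finite_borel_borel_measurable[OF M[OF that] borel_measurable_simple_function[OF F(1)]] .
  qed (use F(2) Fb in auto)
  have "(\<lambda>i. \<Sum>j\<in>J. c j *\<^sub>R (LINT x|M j. F i x)) \<longlonglongrightarrow> (\<Sum>j\<in>J. c j *\<^sub>R (LINT x|M j. g x))"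
    by (intro tendsto_sum tendsto_scaleR tendsto_const lim)
  then have "(\<Sum>j\<in>J. c j *\<^sub>R (LINT x|M j. g x)) = 0"
    by (simp add: sum_integral_simple_function_eq_0[OF J M 0 F(1)] LIMSEQ_const_iff)
  then show ?thesis using fg by simp
qed

lemma signed_borel_diff_measure:
  assumes P: "finite_borel P" and Q: "finite_borel Q"
  shows "signed_borel (\<lambda>A. measure P A - measure Q A)"
proof -
  interpret P: finite_measure P using finite_borelD(1)[OF P] .
  interpret Q: finite_measure Q using finite_borelD(1)[OF Q] .
  show ?thesis
    unfolding signed_borel_def
    using P.finite_measure_UNION Q.finite_measure_UNION finite_borelD(2)[OF P] finite_borelD(2)[OF Q]
    by (auto simp: measure_notin_sets intro!: sums_diff)
qed

lemma AE_null_transfer: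
  assumes P: "finite_borel P" and Q: "finite_borel Q"
    and le: "\<And>A. A \<in> sets borel \<Longrightarrow> measure Q A \<le> measure P A"
    and AE: "AE x in P. Pr x" and m: "{x. \<not> Pr x} \<in> sets borel"
  shows "AE x in Q. Pr x"
proof -
  have "emeasure P {x. \<not> Pr x} = 0"
    using AE_iff_measurable[of "{x. \<not> Pr x}" P Pr] AE m finite_borelD[OF P] by auto
  then have "measure Q {x. \<not> Pr x} = 0"
    using le[OF m] by (simp add: measure_def order_antisym)
  then have "emeasure Q {x. \<not> Pr x} = 0"
    using finite_measure.emeasure_eq_measure[OF finite_borelD(1)[OF Q]] by simp
  then show ?thesis
    using AE_iff_measurable[of "{x. \<not> Pr x}" Q Pr] m finite_borelD[OF Q] by auto
qed

text \<open>Minimality of the Jordan decomposition. For \<rho> = P - Q it lets almost sure bounds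
  pass from P to the positive part and, applied to -\<rho>, from Q to the negative part.\<close>

lemma positive_part_minimal:
  assumes \<rho>: "signed_borel \<rho>" and P: "finite_borel P" 
    and le: "\<And>A. A \<in> sets borel \<Longrightarrow> \<rho> A \<le> measure P A" and A: "A \<in> sets borel"
  shows "measure (positive_part \<rho>) A \<le> measure P A"
proof -
  interpret P: finite_measure P using finite_borelD(1)[OF P] .
  have "pos_sup \<rho> A \<le> ennreal (measure P A)"
    unfolding pos_sup_def
  proof (intro SUP_least ennreal_leI)
    fix B assume "B \<in> {B \<in> sets borel. B \<subseteq> A}"
    then show "\<rho> B \<le> measure P A"
      using le[of B] P.finite_measure_mono[of B A] A finite_borelD(2)[OF P] by auto
  qed
  then show ?thesis
    unfolding measure_positive_part(1)[OF \<rho> A, symmetric] by (simp only: ennreal_le_iff measure_nonneg)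
qed

text \<open>P and Q may overlap and thus differ from the Jordan parts. But positive part plus Q
  equals negative part plus P on all Borel sets, and such a relation passes to integrals.\<close>

lemma signed_integral_diff_measure:
  fixes f :: "'a::topological_space \<Rightarrow> 'b::{banach, second_countable_topology}"
  assumes P: "finite_borel P" and Q: "finite_borel Q"
    and f[measurable]: "f \<in> borel_measurable borel"
    and bd: "AE x in P. norm (f x) \<le> B" "AE x in Q. norm (f x) \<le> B"
  shows "signed_integral (\<lambda>A. measure P A - measure Q A) f = (LINT x|P. f x) - (LINT x|Q. f x)"
proof -
  define \<rho> where "\<rho> A = measure P A - measure Q A" for A
  have \<rho>: "signed_borel \<rho>" unfolding \<rho>_def using signed_borel_diff_measure[OF P Q] .
  \<comment> \<open>The relation between the four measures with everything on one side, with signs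
    1, 1, -1, -1.\<close>
  let ?M = "\<lambda>j::nat. [positive_part \<rho>, Q, negative_part \<rho>, P] ! j"
  let ?c = "\<lambda>j::nat. [1, 1, - 1, - 1 :: real] ! j"
  have m: "{x. \<not> norm (f x) \<le> B} \<in> sets borel" by measurable
  have pos: "AE x in positive_part \<rho>. norm (f x) \<le> B"
    by (rule AE_null_transfer[OF P finite_borel_positive_part[OF \<rho>] _ bd(1) m])
       (intro positive_part_minimal[OF \<rho> P], auto simp: \<rho>_def)
  have neg: "AE x in negative_part \<rho>. norm (f x) \<le> B"
    by (rule AE_null_transfer[OF Q finite_borel_negative_part[OF \<rho>] _ bd(2) m])
       (unfold negative_part_def, intro positive_part_minimal[OF signed_borel_uminus[OF \<rho>] Q], auto simp: \<rho>_def)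
  have "(\<Sum>j<4. ?c j *\<^sub>R (LINT x|?M j. f x)) = 0"
  proof (rule sum_integral_eq_0)
    have j: "j = 0 \<or> j = 1 \<or> j = 2 \<or> j = 3" if "j \<in> {..<4}" for j :: nat using that by auto
    have Mj: "?M j \<in> {positive_part \<rho>, Q, negative_part \<rho>, P}" if "j \<in> {..<4}" for j
      using j[OF that] by auto
    show "finite_borel (?M j)" if "j \<in> {..<4}" for j
      using j[OF that] P Q finite_borel_positive_part[OF \<rho>] finite_borel_negative_part[OF \<rho>] by auto
    show "AE x in ?M j. norm (f x) \<le> B" if "j \<in> {..<4}" for j
    proof -
      define S where "S = {M. AE x in M. norm (f x) \<le> B}"
      have "{positive_part \<rho>, Q, negative_part \<rho>, P} \<subseteq> S"
        unfolding S_def using bd pos neg by blast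
      then show ?thesis using Mj[OF that] unfolding S_def by blast
    qed
    show "(\<Sum>j<4. ?c j * measure (?M j) A) = 0" if "A \<in> sets borel" for A
      using Jordan_decomposition[OF \<rho> that] by (simp add: eval_nat_numeral \<rho>_def)
  qed auto
  then show ?thesis
    unfolding signed_integral_def \<rho>_def[abs_def, symmetric] by (simp add: eval_nat_numeral algebra_simps)
qed

section \<open>Densities of variable sign\<close>

lemma finite_borel_density:
  assumes M: "finite_borel M" and f: "integrable M f"
  shows "finite_borel (density M (\<lambda>x. ennreal (f x)))"
proof -
  have "(\<integral>\<^sup>+x. ennreal (f x) \<partial>M) < \<infinity>"
    using f unfolding real_integrable_def by (auto simp: less_top[symmetric])
  moreover have "f \<in> borel_measurable M" using f by auto
  ultimately show ?thesis
    using finite_borelD[OF M] unfolding finite_borel_def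
    by (auto intro!: finite_measureI simp: emeasure_density cong: nn_integral_cong)
qed

text \<open>\<open>ennreal\<close> truncates at 0, so the two densities are those of the positive
  and the negative part of \<open>f\<close>, and \<open>f dM\<close> becomes a difference of finite
  measures.\<close>

lemma times_measure_eq_diff:
  assumes M: "finite_borel M" and f: "integrable M f"
  shows "times_measure f M =
    (\<lambda>A. measure (density M (\<lambda>x. ennreal (f x))) A - measure (density M (\<lambda>x. ennreal (- f x))) A)"
proof
  fix A
  show "times_measure f M A =
    measure (density M (\<lambda>x. ennreal (f x))) A - measure (density M (\<lambda>x. ennreal (- f x))) A"
  proof (cases "A \<in> sets borel")
    case False
    then show ?thesis using finite_borelD[OF M] by (simp add: times_measure_def measure_notin_sets)
  next
    case True
    then have A[measurable]: "A \<in> sets M" using finite_borelD[OF M] by simp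
    have [measurable]: "f \<in> borel_measurable M" using f by auto
    have *: "measure (density M (\<lambda>x. ennreal (g x))) A = enn2real (\<integral>\<^sup>+x. ennreal (indicator A x * g x) \<partial>M)"
      if [measurable]: "g \<in> borel_measurable M" for g
      unfolding measure_def
      by (subst emeasure_density) (auto intro!: arg_cong[of _ _ enn2real] nn_integral_cong simp: indicator_def)
    have "integrable M (\<lambda>x. indicator A x *\<^sub>R f x)"
      using f A by (rule integrable_mult_indicator[rotated])
    then show ?thesis
      using True unfolding times_measure_def set_lebesgue_integral_def
      by (simp add: real_lebesgue_integral_def *)
  qed
qed

lemma signed_integral_times_measure:
  assumes M: "finite_borel M" and f: "integrable M f" and g: "g \<in> borel_measurable borel"
    and bd: "\<And>x. \<bar>g x\<bar> \<le> (B::real)"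
  shows "signed_integral (times_measure f M) g = (LINT x|M. f x * g x)"
proof -
  have gM[measurable]: "g \<in> borel_measurable M" using finite_borel_borel_measurable[OF M g] .
  have fM[measurable]: "f \<in> borel_measurable M" using f by auto
  have dens: "(LINT x|density M (\<lambda>x. ennreal (h x)). g x) = (LINT x|M. max 0 (h x) * g x)"
    if [measurable]: "h \<in> borel_measurable M" for h
  proof -
    have eq: "(\<lambda>x. ennreal (h x)) = (\<lambda>x. ennreal (max 0 (h x)))"
      by (intro ext) (simp add: max_def ennreal_neg)
    have "(LINT x|density M (\<lambda>x. ennreal (max 0 (h x))). g x) = (LINT x|M. max 0 (h x) *\<^sub>R g x)"
    proof (rule integral_density[OF gM])
      show "(\<lambda>x. max 0 (h x)) \<in> borel_measurable M" using that by measurable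
    qed simp
    then show ?thesis unfolding eq[symmetric] by simp
  qed
  have i: "integrable M (\<lambda>x. h x * g x)" if "integrable M h" for h
  proof (rule Bochner_Integration.integrable_bound[where f="\<lambda>x. B * h x"])
    show "AE x in M. norm (h x * g x) \<le> norm (B * h x)"
    proof (rule AE_I2)
      fix x
      have "\<bar>g x\<bar> \<le> \<bar>B\<bar>" using bd[of x] by linarith
      then show "norm (h x * g x) \<le> norm (B * h x)"
        using mult_right_mono[of "\<bar>g x\<bar>" "\<bar>B\<bar>" "\<bar>h x\<bar>"] by (simp add: abs_mult mult.commute)
    qed
    show "(\<lambda>x. h x * g x) \<in> borel_measurable M" using borel_measurable_integrable[OF that] by measurable
  qed (use that in auto)
  have "signed_integral (times_measure f M) g =
      (LINT x|density M (\<lambda>x. ennreal (f x)). g x) - (LINT x|density M (\<lambda>x. ennreal (- f x)). g x)"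
    unfolding times_measure_eq_diff[OF M f]
    by (rule signed_integral_diff_measure[where B=B])
       (use f bd g in \<open>auto intro!: finite_borel_density M\<close>)
  also have "\<dots> = (LINT x|M. max 0 (f x) * g x) - (LINT x|M. max 0 (- f x) * g x)"
    by (simp add: dens)
  also have "\<dots> = (LINT x|M. max 0 (f x) * g x - max 0 (- f x) * g x)"
    using f by (intro Bochner_Integration.integral_diff[symmetric] i) auto
  also have "\<dots> = (LINT x|M. f x * g x)"
    by (intro Bochner_Integration.integral_cong refl) (auto simp: max_def)
  finally show ?thesis .
qed

section \<open>Measures determined by bounded continuous functions\<close>

lemma open_indicator_approximation:
  fixes U :: "'a::metric_space set"
  assumes "open U"
  obtains f :: "nat \<Rightarrow> 'a \<Rightarrow> real" where "\<And>k. continuous_on UNIV (f k)"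
    "\<And>k x. 0 \<le> f k x \<and> f k x \<le> 1" "\<And>x. (\<lambda>k. f k x) \<longlonglongrightarrow> indicator U x"
proof (cases "U = UNIV")
  case True
  \<comment> \<open>The distance to the empty set is 0 by convention, so the construction of the
    other case would give the zero function here.\<close>
  show ?thesis by (rule that[of "\<lambda>_ _. 1"]) (auto simp: True)
next
  case False
  \<comment> \<open>The distance to the closed complement is positive exactly on \<open>U\<close>,
    where its multiples eventually reach the cut-off 1.\<close>
  define f where "f k x = min 1 (real k * infdist x (- U))" for k x
  show ?thesis
  proof (rule that[of f])
    show "continuous_on UNIV (f k)" for k
      unfolding f_def by (intro continuous_intros)
    show "0 \<le> f k x \<and> f k x \<le> 1" for k x
      unfolding f_def by (auto simp: infdist_nonneg)
    show "(\<lambda>k. f k x) \<longlonglongrightarrow> indicator U x" for x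
    proof (cases "x \<in> U")
      case True
      have "infdist x (- U) \<noteq> 0"
        using in_closed_iff_infdist_zero[of "- U" x] assms False True by auto
      then have pos: "infdist x (- U) > 0" using infdist_nonneg[of x "- U"] by linarith
      obtain K where K: "real K * infdist x (- U) \<ge> 1"
        using ex_less_of_nat_mult[OF pos, of 1] by (auto intro: less_imp_le)
      have "f k x = 1" if "k \<ge> K" for k
      proof -
        have "real K * infdist x (- U) \<le> real k * infdist x (- U)"
          using that by (intro mult_right_mono) (auto simp: infdist_nonneg)
        then show ?thesis using K unfolding f_def by auto
      qed
      then have "\<forall>\<^sub>F k in sequentially. f k x = 1" unfolding eventually_sequentially by blast
      then show ?thesis using True by (auto intro: tendsto_eventually)
    next
      case False
      then show ?thesis by (simp add: f_def)
    qed
  qed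
qed

text \<open>Dynkin's argument, started from open sets, whose indicators are bounded limits of
  continuous functions. The densities \<open>c j\<close> are there for identities such as t d\<rho>1
  = s d\<rho>, in which each measure carries its own factor.\<close>

lemma sum_integral_determined:
  fixes c :: "'i \<Rightarrow> 'a::metric_space \<Rightarrow> real"
  assumes "finite J" and M: "\<And>j. j \<in> J \<Longrightarrow> finite_borel (M j)"
    and c: "\<And>j. j \<in> J \<Longrightarrow> integrable (M j) (c j)"
    and 0: "\<And>f :: 'a \<Rightarrow> real. continuous_on UNIV f \<Longrightarrow> bounded (range f) \<Longrightarrow>
      (\<Sum>j\<in>J. LINT x|M j. f x * c j x) = 0"
    and A: "A \<in> sets borel"
  shows "(\<Sum>j\<in>J. LINT x|M j. indicator A x * c j x) = 0"
proof -
  have lim: "(\<lambda>k. \<Sum>j\<in>J. LINT x|M j. f k x * c j x) \<longlonglongrightarrow> (\<Sum>j\<in>J. LINT x|M j. g x * c j x)"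
    if f: "\<And>k. f k \<in> borel_measurable borel" and g: "g \<in> borel_measurable borel"
      and b: "\<And>k x. \<bar>f k x\<bar> \<le> 1" and l: "\<And>x. (\<lambda>k. f k x) \<longlonglongrightarrow> g x"
    for f :: "nat \<Rightarrow> 'a \<Rightarrow> real" and g
  proof (intro tendsto_sum)
    fix j assume j: "j \<in> J"
    have [measurable]: "c j \<in> borel_measurable (M j)" "f k \<in> borel_measurable (M j)" "g \<in> borel_measurable (M j)" for k
      using c[OF j] finite_borel_borel_measurable[OF M[OF j]] f g by auto
    show "(\<lambda>k. LINT x|M j. f k x * c j x) \<longlonglongrightarrow> (LINT x|M j. g x * c j x)"
    proof (rule integral_dominated_convergence[where w="\<lambda>x. \<bar>c j x\<bar>"])
      show "AE x in M j. (\<lambda>k. f k x * c j x) \<longlonglongrightarrow> g x * c j x"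
        using l by (intro AE_I2 tendsto_mult tendsto_const)
      show "AE x in M j. norm (f k x * c j x) \<le> \<bar>c j x\<bar>" for k
      proof (rule AE_I2)
        fix x show "norm (f k x * c j x) \<le> \<bar>c j x\<bar>"
          using mult_right_mono[OF b[of k x], of "\<bar>c j x\<bar>"] by (simp add: abs_mult)
      qed
    qed (use c[OF j] in auto)
  qed
  have i: "integrable (M j) (\<lambda>x. indicator B x * c j x)" if "j \<in> J" "B \<in> sets borel" for B j
    using integrable_mult_indicator[OF _ c[OF that(1)], of B] finite_borelD(2)[OF M[OF that(1)]] that(2) by simp
  \<comment> \<open>The case of the constant function 1. Passing to complements requires the
    relation for the whole space.\<close>
  have 1: "(\<Sum>j\<in>J. LINT x|M j. c j x) = 0"
    using 0[of "\<lambda>_. 1"] by simp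
  have "A \<in> sigma_sets UNIV {S. open S}" using A by (simp add: borel_def)
  then show ?thesis
  proof (rule sigma_sets_induct_disjoint[of "{S. open S}" UNIV A, rotated 2])
    fix U :: "'a set" assume "U \<in> {S. open S}"
    then have U: "open U" by simp
    obtain f :: "nat \<Rightarrow> 'a \<Rightarrow> real" where f: "\<And>k. continuous_on UNIV (f k)"
      "\<And>k x. 0 \<le> f k x \<and> f k x \<le> 1" "\<And>x. (\<lambda>k. f k x) \<longlonglongrightarrow> indicator U x"
      using open_indicator_approximation[OF U] by blast
    have "bounded (range (f k))" for k
      using f(2) by (intro boundedI[of _ 1]) auto
    then have "(\<Sum>j\<in>J. LINT x|M j. f k x * c j x) = 0" for k using 0[OF f(1)] by blast
    moreover have "(\<lambda>k. \<Sum>j\<in>J. LINT x|M j. f k x * c j x) \<longlonglongrightarrow> (\<Sum>j\<in>J. LINT x|M j. indicator U x * c j x)"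
      using f U by (intro lim) (auto intro: borel_measurable_continuous_onI)
    ultimately show "(\<Sum>j\<in>J. LINT x|M j. indicator U x * c j x) = 0"
      by (simp add: LIMSEQ_const_iff)
  next
    fix B assume B: "B \<in> sigma_sets UNIV {S. open S}" "(\<Sum>j\<in>J. LINT x|M j. indicator B x * c j x) = 0"
    have Bb: "B \<in> sets borel" using B(1) by (simp add: borel_def)
    have "(LINT x|M j. indicator (UNIV - B) x * c j x) = (LINT x|M j. c j x) - (LINT x|M j. indicator B x * c j x)"
      if j: "j \<in> J" for j
      by (subst Bochner_Integration.integral_diff[OF c[OF j] i[OF j Bb], symmetric])
         (auto intro!: Bochner_Integration.integral_cong simp: indicator_def)
    then show "(\<Sum>j\<in>J. LINT x|M j. indicator (UNIV - B) x * c j x) = 0"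
      using B(2) 1 by (simp add: sum_subtractf)
  next
    fix F :: "nat \<Rightarrow> 'a set"
    assume F: "disjoint_family F" "range F \<subseteq> sigma_sets UNIV {S. open S}"
      "\<And>i. (\<Sum>j\<in>J. LINT x|M j. indicator (F i) x * c j x) = 0"
    have Fb: "F i \<in> sets borel" for i using F(2) by (auto simp: borel_def)
    have ind: "indicator (\<Union>i<n. F i) x = (\<Sum>i<n. indicator (F i) x :: real)" for n x
      using F(1) by (intro indicator_UN_disjoint) (auto simp: disjoint_family_on_def)
    have "(\<Sum>j\<in>J. LINT x|M j. indicator (\<Union>i<n. F i) x * c j x) =
      (\<Sum>j\<in>J. \<Sum>i<n. LINT x|M j. indicator (F i) x * c j x)" for n
      unfolding ind sum_distrib_right
      by (intro sum.cong refl Bochner_Integration.integral_sum i Fb)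
    also have "(\<Sum>j\<in>J. \<Sum>i<n. LINT x|M j. indicator (F i) x * c j x) = 0" for n
      by (subst sum.swap) (simp add: F(3))
    finally have "(\<Sum>j\<in>J. LINT x|M j. indicator (\<Union>i<n. F i) x * c j x) = 0" for n .
    moreover have "(\<lambda>n. \<Sum>j\<in>J. LINT x|M j. indicator (\<Union>i<n. F i) x * c j x)
      \<longlonglongrightarrow> (\<Sum>j\<in>J. LINT x|M j. indicator (\<Union>i. F i) x * c j x)"
    proof (intro lim)
      show "(\<lambda>n. indicator (\<Union>i<n. F i) x) \<longlonglongrightarrow> (indicator (\<Union>i. F i) x :: real)" for x
        by (rule LIMSEQ_indicator_UN)
    qed (use Fb in \<open>auto simp: indicator_def\<close>)
    ultimately show "(\<Sum>j\<in>J. LINT x|M j. indicator (\<Union>i. F i) x * c j x) = 0"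
      by (simp add: LIMSEQ_const_iff)
  qed (auto simp: Int_stable_def)
qed

lemma signed_measure_determined:
  fixes P Q P' Q' :: "'a::metric_space measure"
  assumes fb: "finite_borel P" "finite_borel Q" "finite_borel P'" "finite_borel Q'"
    and eq: "\<And>f :: 'a \<Rightarrow> real. continuous_on UNIV f \<Longrightarrow> bounded (range f) \<Longrightarrow>
      (LINT x|P. f x) - (LINT x|Q. f x) = (LINT x|P'. f x) - (LINT x|Q'. f x)"
    and A: "A \<in> sets borel"
  shows "measure P A - measure Q A = measure P' A - measure Q' A"
proof -
  let ?M = "\<lambda>j::nat. [P, Q, P', Q'] ! j"
  let ?c = "\<lambda>j::nat. [1, - 1, - 1, 1 :: real] ! j"
  have j: "j = 0 \<or> j = 1 \<or> j = 2 \<or> j = 3" if "j \<in> {..<4}" for j :: nat using that by auto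
  have Mfb: "finite_borel (?M j)" if "j \<in> {..<4}" for j using j[OF that] fb by auto
  have "(\<Sum>j<4. LINT x|?M j. indicator A x * ?c j) = 0"
  proof (rule sum_integral_determined[OF _ Mfb _ _ A])
    show "integrable (?M j) (\<lambda>x. ?c j)" if "j \<in> {..<4}" for j
      using finite_measure.integrable_const[OF finite_borelD(1)[OF Mfb[OF that]]] .
    show "(\<Sum>j<4. LINT x|?M j. f x * ?c j) = 0" if "continuous_on UNIV f" "bounded (range f)" for f :: "'a \<Rightarrow> real"
      using eq[OF that] by (simp add: eval_nat_numeral)
  qed auto
  then show ?thesis
    using A fb[THEN finite_borelD(2)] fb[THEN finite_borelD(3)] by (simp add: eval_nat_numeral)
qed

lemma finite_borel_eqI:
  fixes P Q :: "'a::metric_space measure"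
  assumes fb: "finite_borel P" "finite_borel Q"
    and eq: "\<And>f :: 'a \<Rightarrow> real. continuous_on UNIV f \<Longrightarrow> bounded (range f) \<Longrightarrow>
      (LINT x|P. f x) = (LINT x|Q. f x)"
  shows "P = Q"
proof (rule measure_eqI)
  show "sets P = sets Q" using fb[THEN finite_borelD(2)] by simp
  fix A assume "A \<in> sets P"
  then have A: "A \<in> sets borel" using fb[THEN finite_borelD(2)] by simp
  have "measure P A - measure Q A = measure Q A - measure Q A"
    using eq by (intro signed_measure_determined fb A) auto
  then show "emeasure P A = emeasure Q A"
    by (simp add: fb[THEN finite_borelD(1), THEN finite_measure.emeasure_eq_measure])
qed

lemma signed_borel_eqI:
  fixes \<rho> \<rho>' :: "'a::metric_space set \<Rightarrow> real"
  assumes \<rho>: "signed_borel \<rho>" "signed_borel \<rho>'"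
    and eq: "\<And>f :: 'a \<Rightarrow> real. continuous_on UNIV f \<Longrightarrow> bounded (range f) \<Longrightarrow>
      signed_integral \<rho> f = signed_integral \<rho>' f"
  shows "\<rho> = \<rho>'"
proof
  fix A
  show "\<rho> A = \<rho>' A"
  proof (cases "A \<in> sets borel")
    case True
    then show ?thesis
      using signed_measure_determined[OF finite_borel_positive_part[OF \<rho>(1)] finite_borel_negative_part[OF \<rho>(1)]
          finite_borel_positive_part[OF \<rho>(2)] finite_borel_negative_part[OF \<rho>(2)] _ True]
        eq unfolding signed_integral_def Jordan_decomposition[OF \<rho>(1) True] Jordan_decomposition[OF \<rho>(2) True]
      by blast
  qed (use \<rho> in \<open>auto simp: signed_borel_def\<close>)
qed

section \<open>Double power series\<close>

text \<open>\<open>has_sum\<close> over all index pairs is unconditional, hence absolute,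
  convergence. This is the source of the coefficient bounds and allows the double series to be
  summed in either order.\<close>

locale bidisc_series =
  fixes R :: "complex \<Rightarrow> complex \<Rightarrow> complex" and \<kappa> :: "nat \<Rightarrow> nat \<Rightarrow> real" and r :: real
  assumes r_pos: "r > 0"
    and series: "\<And>z w. norm z < r \<Longrightarrow> norm w < r \<Longrightarrow>
      ((\<lambda>(m, n). of_real (\<kappa> m n) * z ^ m * w ^ n) has_sum R z w) UNIV"
begin

lemma swap: "bidisc_series (\<lambda>z w. R w z) (\<lambda>m n. \<kappa> n m) r"
proof
  fix z w :: complex assume zw: "norm z < r" "norm w < r"
  have "((\<lambda>(m, n). of_real (\<kappa> m n) * w ^ m * z ^ n) \<circ> prod.swap has_sum R w z) UNIV"
    using has_sum_reindex[of prod.swap "UNIV :: (nat \<times> nat) set" "\<lambda>(m, n). of_real (\<kappa> m n) * w ^ m * z ^ n" "R w z"]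
      series[OF zw(2,1)] by (simp add: surj_swap)
  then show "((\<lambda>(m, n). of_real (\<kappa> n m) * z ^ m * w ^ n) has_sum R w z) UNIV"
    by (simp add: comp_def case_prod_unfold ac_simps)
qed (rule r_pos)

text \<open>At z = w = r / 2 the series converges absolutely, so each term is bounded by the total
  \<open>A\<close>.\<close>

lemma coefficient_bound: "\<exists>A\<ge>0. \<forall>m n. \<bar>\<kappa> m n\<bar> \<le> A * (2 / r) ^ (m + n)"
proof -
  let ?f = "\<lambda>(m, n). of_real (\<kappa> m n) * of_real (r / 2) ^ m * of_real (r / 2) ^ n :: complex"
  have "?f summable_on UNIV"
    using series[of "of_real (r / 2)" "of_real (r / 2)"] r_pos by (intro has_sum_imp_summable) auto
  then have s: "(\<lambda>p. norm (?f p)) summable_on UNIV" 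
    using summable_on_iff_abs_summable_on_complex by blast
  define A where "A = infsum (\<lambda>p. norm (?f p)) UNIV"
  have le: "norm (?f p) \<le> A" for p
  proof -
    have "sum (\<lambda>p. norm (?f p)) {p} \<le> A"
      unfolding A_def by (rule finite_sum_le_infsum[OF s]) auto
    then show ?thesis by simp
  qed
  have "\<bar>\<kappa> m n\<bar> \<le> A * (2 / r) ^ (m + n)" for m n
  proof -
    have "norm (?f (m, n)) = \<bar>\<kappa> m n\<bar> * (r / 2) ^ (m + n)"
      using r_pos by (simp add: norm_mult norm_power power_add)
    then have "\<bar>\<kappa> m n\<bar> * (r / 2) ^ (m + n) \<le> A" using le[of "(m, n)"] by simp
    then show ?thesis using r_pos by (simp add: field_simps)
  qed
  moreover have "A \<ge> 0" using le[of "(0, 0)"] norm_ge_zero order_trans by blast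
  ultimately show ?thesis by blast
qed

end

text \<open>With K |w| \<le> 1 / 2 the terms are dominated by D / 2 ^ n. The third bound keeps one
  factor K |w| of the tail and measures how far the sum is from its constant coefficient.\<close>

lemma geometric_bound_sums:
  fixes a :: "nat \<Rightarrow> 'a::{real_normed_field, banach}"
  assumes K: "K > 0" and a: "\<And>n. norm (a n) \<le> D * K ^ n" and w: "norm w \<le> 1 / (2 * K)"
  shows "summable (\<lambda>n. norm (a n * w ^ n))" "norm (\<Sum>n. a n * w ^ n) \<le> 2 * D"
    "norm ((\<Sum>n. a n * w ^ n) - a 0) \<le> 2 * D * K * norm w"
proof -
  have D: "D \<ge> 0" using order_trans[OF norm_ge_zero a[of 0]] by simp
  have Kw: "K * norm w \<le> 1 / 2" using w K by (simp add: field_simps)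
  have le: "norm (a n * w ^ n) \<le> D * (K * norm w) ^ n" for n
    using mult_right_mono[OF a[of n], of "norm w ^ n"] by (simp add: norm_mult norm_power power_mult_distrib mult.assoc)
  have le2: "norm (a n * w ^ n) \<le> D * (1 / 2) ^ n" for n
    using order_trans[OF le mult_left_mono[OF power_mono[OF Kw] D]] K by simp
  have s2: "summable (\<lambda>n. D * (1 / 2 :: real) ^ n)" by (intro summable_mult summable_geometric) auto
  show s: "summable (\<lambda>n. norm (a n * w ^ n))"
    by (rule summable_comparison_test'[OF s2, of 0]) (use le2 in auto)
  have "norm (\<Sum>n. a n * w ^ n) \<le> (\<Sum>n. norm (a n * w ^ n))" by (rule summable_norm[OF s])
  also have "\<dots> \<le> (\<Sum>n. D * (1 / 2) ^ n)" by (rule suminf_le[OF le2 s s2])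
  also have "\<dots> = 2 * D" by (subst suminf_mult) (auto simp: suminf_geometric)
  finally show "norm (\<Sum>n. a n * w ^ n) \<le> 2 * D" .
  have sa: "summable (\<lambda>n. a n * w ^ n)" using summable_norm_cancel[OF s] .
  have "(\<Sum>n. a n * w ^ n) - a 0 = (\<Sum>n. a (Suc n) * w ^ Suc n)"
    using suminf_split_head[OF sa] by simp
  also have "norm \<dots> \<le> (\<Sum>n. norm (a (Suc n) * w ^ Suc n))"
    using s by (intro summable_norm) (subst summable_Suc_iff)
  also have "\<dots> \<le> (\<Sum>n. D * K * norm w * (1 / 2) ^ n)"
  proof (rule suminf_le)
    show "summable (\<lambda>n. norm (a (Suc n) * w ^ Suc n))" using s by (subst summable_Suc_iff)
    show "summable (\<lambda>n. D * K * norm w * (1 / 2) ^ n)" by (intro summable_mult summable_geometric) auto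
    show "norm (a (Suc n) * w ^ Suc n) \<le> D * K * norm w * (1 / 2) ^ n" for n
    proof -
      have "norm (a (Suc n) * w ^ Suc n) \<le> D * (K * norm w) * (K * norm w) ^ n" using le[of "Suc n"] by (simp add: mult.assoc)
      also have "\<dots> \<le> D * (K * norm w) * (1 / 2) ^ n"
        using Kw K D by (intro mult_left_mono power_mono) auto
      finally show ?thesis by (simp add: mult.assoc)
    qed
  qed
  also have "\<dots> = 2 * D * K * norm w" by (subst suminf_mult) (auto simp: suminf_geometric)
  finally show "norm ((\<Sum>n. a n * w ^ n) - a 0) \<le> 2 * D * K * norm w" .
qed

context bidisc_series
begin

text \<open>The disc of radius r / 4 is the one of radius 1 / (2 K) for K = 2 / r. With
  \<open>w\<close> fixed, the inner sums are the coefficients of a power series in \<open>z\<close>;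
  each of the two geometric sums costs a factor 2.\<close>

lemma iterated_series:
  assumes A: "\<And>m n. \<bar>\<kappa> m n\<bar> \<le> A * (2 / r) ^ (m + n)" and z: "norm z \<le> r / 4" and w: "norm w \<le> r / 4"
  shows "(\<lambda>m. (\<Sum>n. of_real (\<kappa> m n) * w ^ n) * z ^ m) sums R z w"
    and "norm (\<Sum>n. of_real (\<kappa> m n) * w ^ n) \<le> 2 * A * (2 / r) ^ m"
    and "norm (R z w) \<le> 4 * A"
proof -
  have K: "2 / r > 0" and w': "norm w \<le> 1 / (2 * (2 / r))" and z': "norm z \<le> 1 / (2 * (2 / r))"
    using r_pos z w by auto
  have a: "norm (of_real (\<kappa> m n) :: complex) \<le> (A * (2 / r) ^ m) * (2 / r) ^ n" for m n
    using A[of m n] by (simp add: power_add mult.assoc)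
  note inner = geometric_bound_sums[OF K a w']
  show bd: "norm (\<Sum>n. of_real (\<kappa> m n) * w ^ n) \<le> 2 * A * (2 / r) ^ m" for m
    using inner(2)[of m] by (simp add: mult.assoc)
  have "((\<lambda>n. of_real (\<kappa> m n) * z ^ m * w ^ n) has_sum (\<Sum>n. of_real (\<kappa> m n) * w ^ n) * z ^ m) UNIV" for m
  proof -
    have "((\<lambda>n. of_real (\<kappa> m n) * w ^ n) has_sum (\<Sum>n. of_real (\<kappa> m n) * w ^ n)) UNIV"
      using norm_summable_imp_has_sum[OF inner(1)[of m] summable_sums[OF summable_norm_cancel[OF inner(1)[of m]]]] .
    from has_sum_cmult_left[OF this, of "z ^ m"] show ?thesis by (simp add: ac_simps)
  qed
  moreover
  have "((\<lambda>(m, n). of_real (\<kappa> m n) * z ^ m * w ^ n) has_sum R z w) (Sigma UNIV (\<lambda>_. UNIV))"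
    using series[of z w] r_pos z w by simp
  ultimately have "((\<lambda>m. (\<Sum>n. of_real (\<kappa> m n) * w ^ n) * z ^ m) has_sum R z w) UNIV"
    using has_sum_SigmaD[where f="\<lambda>(m, n). of_real (\<kappa> m n) * z ^ m * w ^ n" and A=UNIV and B="\<lambda>_. UNIV"
      and g="\<lambda>m. (\<Sum>n. of_real (\<kappa> m n) * w ^ n) * z ^ m" and S="R z w"] by simp
  then show s: "(\<lambda>m. (\<Sum>n. of_real (\<kappa> m n) * w ^ n) * z ^ m) sums R z w"
    by (rule has_sum_imp_sums)
  show "norm (R z w) \<le> 4 * A"
    using geometric_bound_sums(2)[OF K bd z'] sums_unique[OF s] by simp
qed

lemma holomorphic_left:
  assumes w: "norm w \<le> r / 4"
  shows "(\<lambda>z. R z w) holomorphic_on ball 0 (r / 4)"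
proof -
  obtain A where A: "\<And>m n. \<bar>\<kappa> m n\<bar> \<le> A * (2 / r) ^ (m + n)" using coefficient_bound by blast
  show ?thesis
    by (rule power_series_holomorphic[where a="\<lambda>m. \<Sum>n. of_real (\<kappa> m n) * w ^ n"])
       (use iterated_series(1)[OF A _ w] in auto)
qed

text \<open>Cauchy's estimate on discs of radius r / 8 about points of modulus below r / 8: they
  stay in the disc of radius r / 4, where |R| \<le> 4 A.\<close>

lemma Lipschitz_left:
  assumes A: "\<And>m n. \<bar>\<kappa> m n\<bar> \<le> A * (2 / r) ^ (m + n)"
    and w: "norm w \<le> r / 4" and z: "norm z < r / 8" "norm z' < r / 8"
  shows "norm (R z w - R z' w) \<le> 4 * A / (r / 8) * norm (z - z')"
proof (rule field_differentiable_bound[where S="ball 0 (r / 8)" and f="\<lambda>z. R z w" and f'="deriv (\<lambda>z. R z w)"])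
  fix x :: complex assume x: "x \<in> ball 0 (r / 8)"
  have sub: "cball x (r / 8) \<subseteq> ball 0 (r / 4)"
  proof
    fix y assume "y \<in> cball x (r / 8)"
    then have "norm (y - x) \<le> r / 8" by (simp add: dist_norm norm_minus_commute)
    moreover have "norm x < r / 8" using x by simp
    moreover have "norm y \<le> norm (y - x) + norm x" using norm_triangle_ineq[of "y - x" x] by simp
    ultimately have "norm y < r / 4" by linarith
    then show "y \<in> ball 0 (r / 4)" by simp
  qed
  show "((\<lambda>z. R z w) has_field_derivative deriv (\<lambda>z. R z w) x) (at x within ball 0 (r / 8))"
    using holomorphic_derivI[OF holomorphic_left[OF w], of x] x r_pos
    by (auto intro: has_field_derivative_at_within)
  have "norm ((deriv ^^ 1) (\<lambda>z. R z w) x) \<le> fact 1 * (4 * A) / (r / 8) ^ 1"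
  proof (rule Cauchy_inequality)
    show "(\<lambda>z. R z w) holomorphic_on ball x (r / 8)"
      using holomorphic_on_subset[OF holomorphic_left[OF w] subset_trans[OF ball_subset_cball sub]] .
    show "continuous_on (cball x (r / 8)) (\<lambda>z. R z w)"
      using holomorphic_on_imp_continuous_on[OF holomorphic_on_subset[OF holomorphic_left[OF w] sub]] .
    show "norm (R y w) \<le> 4 * A" if "norm (x - y) = r / 8" for y
    proof (rule iterated_series(3)[OF A _ w])
      have "y \<in> cball x (r / 8)" using that by (simp add: dist_norm)
      then have "y \<in> ball 0 (r / 4)" using sub by blast
      then show "norm y \<le> r / 4" by simp
    qed
  qed (use r_pos in auto)
  then show "norm (deriv (\<lambda>z. R z w) x) \<le> 4 * A / (r / 8)" by simp
qed (use z in auto)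

end

section \<open>Analytic continuation and Cauchy transforms\<close>

text \<open>Cauchy's estimate on discs of half the radius bounds the difference quotients uniformly,
  so dominated convergence applies. Holomorphy and the bound are asked almost everywhere, as the
  points \<open>x\<close> will lie in a box only almost surely.\<close>

lemma (in finite_measure) holomorphic_integral:
  fixes f :: "complex \<Rightarrow> 'a \<Rightarrow> complex"
  assumes S: "open S" and m: "\<And>z. z \<in> S \<Longrightarrow> f z \<in> borel_measurable M"
    and hol: "AE x in M. (\<lambda>z. f z x) holomorphic_on S"
    and bd: "AE x in M. \<forall>z\<in>S. norm (f z x) \<le> B"
  shows "(\<lambda>z. LINT x|M. f z x) holomorphic_on S"
proof -
  have int: "integrable M (f z)" if "z \<in> S" for z
    by (rule integrable_const_bound[where B=B]) (use bd m that in auto)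
  have "\<exists>D. ((\<lambda>z. LINT x|M. f z x) has_field_derivative D) (at z)" if z: "z \<in> S" for z
  proof -
    obtain e where e: "e > 0" "cball z e \<subseteq> S" using S z open_contains_cball by blast
    define d where "d = e / 2"
    have d: "d > 0" "d < e" using e by (auto simp: d_def)
    have dball: "y \<in> S" if "y \<in> ball z d" for y using that e d by auto
    define q where "q y x = (f y x - f z x) / (y - z)" for y x
    have qm: "q y \<in> borel_measurable M" if "y \<in> ball z d" for y
      unfolding q_def using m[OF dball[OF that]] m[OF z] by auto
    have qb: "AE x in M. \<forall>y\<in>ball z d - {z}. norm (q y x) \<le> B / d"
      using hol bd
    proof eventually_elim
      case (elim x)
      have "norm (f y x - f z x) \<le> B / d * norm (y - z)" if y: "y \<in> ball z d" for y
      proof (rule field_differentiable_bound[where S="ball z d" and f'="deriv (\<lambda>z. f z x)"])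
        fix u assume u: "u \<in> ball z d"
        show "((\<lambda>z. f z x) has_field_derivative deriv (\<lambda>z. f z x) u) (at u within ball z d)"
          using holomorphic_derivI[OF elim(1) S dball[OF u]] by (rule has_field_derivative_at_within)
        have sub: "cball u d \<subseteq> S"
        proof
          fix v assume "v \<in> cball u d"
          then have "dist z v \<le> e" using u dist_triangle[of z v u] unfolding d_def by auto
          then show "v \<in> S" using e by auto
        qed
        have "norm ((deriv ^^ 1) (\<lambda>z. f z x) u) \<le> fact 1 * B / d ^ 1"
        proof (rule Cauchy_inequality)
          show "(\<lambda>z. f z x) holomorphic_on ball u d"
            using holomorphic_on_subset[OF elim(1) subset_trans[OF ball_subset_cball sub]] .
          show "continuous_on (cball u d) (\<lambda>z. f z x)"
            using holomorphic_on_imp_continuous_on[OF holomorphic_on_subset[OF elim(1) sub]] .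
          show "norm (f v x) \<le> B" if "norm (u - v) = d" for v
            using elim(2) sub that by (auto simp: dist_norm)
        qed (use d in auto)
        then show "norm (deriv (\<lambda>z. f z x) u) \<le> B / d" by simp
      qed (use y d in auto)
      then show ?case
        by (auto simp: q_def norm_divide divide_le_eq)
    qed
    define t where "t n = d / (real n + 2)" for n :: nat
    have t: "0 < t n" "t n < d" for n
      using d by (auto simp: t_def field_simps add_pos_nonneg)
    \<comment> \<open>Taking the derivative as a limit along one fixed sequence makes it measurable
      in \<open>x\<close>; almost everywhere it is then identified with the true derivative.\<close>
    define D where "D x = lim (\<lambda>n. q (z + of_real (t n)) x)" for x
    have zn: "z + of_real (t n) \<in> ball z d" for n
      using t[of n] by (simp add: dist_norm)
    have Dm: "D \<in> borel_measurable M"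
      unfolding D_def using qm[OF zn] by (intro borel_measurable_lim_metric) auto
    have ql: "AE x in M. ((\<lambda>y. q y x) \<longlongrightarrow> D x) (at z)"
      using hol
    proof eventually_elim
      case (elim x)
      have l: "((\<lambda>y. q y x) \<longlongrightarrow> deriv (\<lambda>z. f z x) z) (at z)"
        using holomorphic_derivI[OF elim S z] unfolding has_field_derivative_iff q_def .
      have "filterlim (\<lambda>n. z + of_real (t n)) (at z) sequentially"
      proof (rule filterlim_atI)
        have "t \<longlonglongrightarrow> 0" unfolding t_def by real_asymp
        then have "(\<lambda>n. z + of_real (t n)) \<longlonglongrightarrow> z + of_real 0"
          by (intro tendsto_intros)
        then show "(\<lambda>n. z + of_real (t n)) \<longlonglongrightarrow> z" by simp
        show "\<forall>\<^sub>F n in sequentially. z + of_real (t n) \<noteq> z"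
          using t by (intro always_eventually) (auto simp: less_le)
      qed
      then have "(\<lambda>n. q (z + of_real (t n)) x) \<longlonglongrightarrow> deriv (\<lambda>z. f z x) z"
        using l by (rule filterlim_compose[rotated])
      then have "D x = deriv (\<lambda>z. f z x) z" unfolding D_def by (rule limI)
      then show ?case using l by simp
    qed
    have "((\<lambda>y. ((LINT x|M. f y x) - (LINT x|M. f z x)) / (y - z)) \<longlongrightarrow> (LINT x|M. D x)) (at z within ball z d)"
      unfolding tendsto_at_iff_sequentially comp_def
    proof safe
      fix X assume X: "\<forall>i. X i \<in> ball z d - {z}" "X \<longlonglongrightarrow> z"
      have fl: "filterlim X (at z) sequentially"
        using X by (intro filterlim_atI) auto
      have "(\<lambda>i. LINT x|M. q (X i) x) \<longlonglongrightarrow> (LINT x|M. D x)"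
      proof (rule integral_dominated_convergence[where w="\<lambda>_. B / d"])
        show "AE x in M. (\<lambda>i. q (X i) x) \<longlonglongrightarrow> D x"
          using ql by eventually_elim (rule filterlim_compose[OF _ fl])
        show "AE x in M. norm (q (X i) x) \<le> B / d" for i
          using qb X(1) by auto
      qed (use Dm qm X(1) in auto)
      moreover have "(LINT x|M. q (X i) x) = ((LINT x|M. f (X i) x) - (LINT x|M. f z x)) / (X i - z)" for i
        unfolding q_def using int[OF dball, of "X i"] int[OF z] X(1) by simp
      ultimately show "(\<lambda>i. ((LINT x|M. f (X i) x) - (LINT x|M. f z x)) / (X i - z)) \<longlonglongrightarrow> (LINT x|M. D x)"
        by simp
    qed
    then have "((\<lambda>z. LINT x|M. f z x) has_field_derivative (LINT x|M. D x)) (at z)"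
      unfolding has_field_derivative_iff using at_within_open[of z "ball z d"] d by simp
    then show ?thesis by blast
  qed
  then show ?thesis
    using S by (auto simp: holomorphic_on_open)
qed

text \<open>Inverts F z = z / (1 + L z). In the application L z = z R1 z, so that F z = 1 / (1 / z +
  R1 z), and the inverse \<open>g\<close> will be the Cauchy transform at 1 / \<zeta>. As |L| \<le>
  1 / 4, F is close enough to the identity to be injective, and Brouwer's theorem gives every point
  of the half-sized disc as a value.\<close>

lemma local_inverse:
  fixes L :: "complex \<Rightarrow> complex"
  assumes \<rho>: "\<rho> > 0" and hol: "L holomorphic_on ball 0 \<rho>"
    and Lip: "\<And>z z'. z \<in> ball 0 \<rho> \<Longrightarrow> z' \<in> ball 0 \<rho> \<Longrightarrow> norm (L z - L z') \<le> B * norm (z - z')"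
    and L0: "L 0 = 0" and B: "B \<ge> 0" "B * \<rho> \<le> 1 / 4"
  obtains g where "g holomorphic_on ball 0 (\<rho> / 2)"
    "\<And>\<zeta>. \<zeta> \<in> ball 0 (\<rho> / 2) \<Longrightarrow> g \<zeta> \<in> ball 0 \<rho>"
    "\<And>\<zeta>. \<zeta> \<in> ball 0 (\<rho> / 2) \<Longrightarrow> g \<zeta> = \<zeta> * (1 + L (g \<zeta>))"
    "\<And>z \<zeta>. z \<in> ball 0 \<rho> \<Longrightarrow> \<zeta> \<in> ball 0 (\<rho> / 2) \<Longrightarrow> z = \<zeta> * (1 + L z) \<Longrightarrow> z = g \<zeta>"
proof -
  have Lb: "norm (L z) \<le> 1 / 4" if "z \<in> ball 0 \<rho>" for z
  proof -
    have "norm (L z) \<le> B * norm z" using Lip[OF that, of 0] L0 \<rho> by simp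
    also have "\<dots> \<le> B * \<rho>" using that B by (intro mult_left_mono) auto
    finally show ?thesis using B by simp
  qed
  have den: "norm (1 + L z) \<ge> 3 / 4" if "z \<in> ball 0 \<rho>" for z
    using Lb[OF that] norm_triangle_ineq4[of "1 + L z" "L z"] by simp
  then have nz: "1 + L z \<noteq> 0" if "z \<in> ball 0 \<rho>" for z using that by force
  define F where "F z = z / (1 + L z)" for z
  have Fhol: "F holomorphic_on ball 0 \<rho>"
    unfolding F_def using nz by (intro holomorphic_intros hol) auto
  have inj: "inj_on F (ball 0 \<rho>)"
  proof (rule inj_onI)
    fix z z' assume z: "z \<in> ball 0 \<rho>" "z' \<in> ball 0 \<rho>" "F z = F z'"
    have F: "u = F u * (1 + L u)" if "u \<in> ball 0 \<rho>" for u
      using nz[OF that] by (simp add: F_def)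
    have "z = F z * (1 + L z)" "z' = F z * (1 + L z')"
      using F[OF z(1)] F[OF z(2)] unfolding z(3) .
    then have "z - z' = F z * (1 + L z) - F z * (1 + L z')" by (rule arg_cong2)
    also have "\<dots> = F z * (L z - L z')" by (simp add: algebra_simps)
    finally have "z - z' = F z * (L z - L z')" .
    then have "norm (z - z') = norm (F z) * norm (L z - L z')" by (simp add: norm_mult[symmetric])
    \<comment> \<open>|F z| is at most \<rho> / (3 / 4), and 4 / 3 times B \<rho> \<le> 1 / 4 is a
      contraction factor 1 / 3.\<close>
    also have "\<dots> \<le> (4 / 3 * \<rho>) * (B * norm (z - z'))"
    proof (intro mult_mono Lip z)
      have "norm (F z) \<le> norm z / (3 / 4)"
        unfolding F_def norm_divide using den[OF z(1)] by (intro divide_left_mono) auto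
      then show "norm (F z) \<le> 4 / 3 * \<rho>" using z(1) by simp
    qed (use \<rho> in auto)
    also have "\<dots> = 4 / 3 * (B * \<rho>) * norm (z - z')" by simp
    also have "\<dots> \<le> 4 / 3 * (1 / 4) * norm (z - z')" using B by (intro mult_right_mono mult_left_mono) auto
    finally show "z = z'" by simp
  qed
  obtain g where g: "g holomorphic_on F ` ball 0 \<rho>" "\<And>z. z \<in> ball 0 \<rho> \<Longrightarrow> g (F z) = z"
    using holomorphic_has_inverse[OF Fhol open_ball inj] by metis
  have surj: "\<exists>z\<in>ball 0 \<rho>. F z = \<zeta>" if \<zeta>: "\<zeta> \<in> ball 0 (\<rho> / 2)" for \<zeta>
  proof -
    have sub: "cball 0 (5 / 8 * \<rho>) \<subseteq> (ball 0 \<rho> :: complex set)" using \<rho> by auto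
    \<comment> \<open>The radius is \<rho> / 2 times the bound 5 / 4 for |1 + L|, so z -> \<zeta> (1
      + L z) maps this closed disc into itself; a fixed point solves F z = \<zeta>.\<close>
    obtain z where z: "z \<in> cball 0 (5 / 8 * \<rho>)" "\<zeta> * (1 + L z) = z"
    proof (rule brouwer_ball[of "5 / 8 * \<rho>" 0 "\<lambda>z. \<zeta> * (1 + L z)"])
      show "continuous_on (cball 0 (5 / 8 * \<rho>)) (\<lambda>z. \<zeta> * (1 + L z))"
        by (intro continuous_intros continuous_on_subset[OF holomorphic_on_imp_continuous_on[OF hol] sub])
      show "(\<lambda>z. \<zeta> * (1 + L z)) \<in> cball 0 (5 / 8 * \<rho>) \<rightarrow> cball 0 (5 / 8 * \<rho>)"
      proof
        fix z :: complex assume "z \<in> cball 0 (5 / 8 * \<rho>)"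
        then have "z \<in> ball 0 \<rho>" using sub by blast
        then have "norm (1 + L z) \<le> 5 / 4" using Lb norm_triangle_ineq[of 1 "L z"] by force
        then have "norm \<zeta> * norm (1 + L z) \<le> (\<rho> / 2) * (5 / 4)"
          using \<zeta> \<rho> by (intro mult_mono) auto
        then show "\<zeta> * (1 + L z) \<in> cball 0 (5 / 8 * \<rho>)" by (simp add: norm_mult)
      qed
    qed (use \<rho> in auto)
    then have zb: "z \<in> ball 0 \<rho>" using sub by blast
    have "F z = \<zeta> * (1 + L z) / (1 + L z)" unfolding F_def using z(2) by simp
    then show ?thesis using nz[OF zb] zb by auto
  qed
  have key: "g \<zeta> \<in> ball 0 \<rho> \<and> F (g \<zeta>) = \<zeta>" if "\<zeta> \<in> ball 0 (\<rho> / 2)" for \<zeta>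
    using surj[OF that] g(2) by auto
  show ?thesis
  proof (rule that[of g])
    have "ball 0 (\<rho> / 2) \<subseteq> F ` ball 0 \<rho>" using surj by blast
    then show "g holomorphic_on ball 0 (\<rho> / 2)" by (rule holomorphic_on_subset[OF g(1)])
    show "g \<zeta> \<in> ball 0 \<rho>" if "\<zeta> \<in> ball 0 (\<rho> / 2)" for \<zeta> using key[OF that] by blast
    show "g \<zeta> = \<zeta> * (1 + L (g \<zeta>))" if "\<zeta> \<in> ball 0 (\<rho> / 2)" for \<zeta>
      using key[OF that] nz[of "g \<zeta>"] unfolding F_def by (auto simp: divide_eq_eq)
    show "z = g \<zeta>" if "z \<in> ball 0 \<rho>" "\<zeta> \<in> ball 0 (\<rho> / 2)" "z = \<zeta> * (1 + L z)" for z \<zeta>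
    proof -
      have "F z = \<zeta>" unfolding F_def using that(3) nz[OF that(1)] by (metis nonzero_mult_div_cancel_right)
      then show ?thesis using g(2)[OF that(1)] by simp
    qed
  qed
qed

section \<open>The support of a law on the line, read off its Cauchy transform\<close>

lemma cauchy_transform_cnj: "cauchy_transform m (cnj z) = cnj (cauchy_transform m z)"
  unfolding cauchy_transform_def using Bochner_Integration.integral_cnj[of m "\<lambda>x. 1 / (z - of_real x)"] by simp

text \<open>-Im (1 / (x + i y - s)) = y / ((x - s)^2 + y^2) is the Poisson kernel up to a constant
  factor, and it is at least 1 / (2 y) for |x - s| \<le> y.\<close>

lemma (in real_distribution) measure_interval_le_cauchy_transform:
  assumes y: "y > 0"
  shows "measure M {x - y..x + y} \<le> 2 * y * \<bar>Im (cauchy_transform M (Complex x y))\<bar>"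
proof -
  have b: "norm (1 / (Complex x y - of_real s)) \<le> 1 / y" for s
    using abs_Im_le_cmod[of "Complex x y - of_real s"] y
    by (simp add: norm_divide divide_simps)
  have i: "integrable M (\<lambda>s. 1 / (Complex x y - of_real s))"
    by (rule integrable_const_bound[where B="1 / y"]) (use b in auto)
  have "measure M {x - y..x + y} = (LINT s|M. indicator {x - y..x + y} s)"
    by simp
  also have "\<dots> \<le> (LINT s|M. 2 * y * - Im (1 / (Complex x y - of_real s)))"
  proof (rule integral_mono)
    show "integrable M (\<lambda>s. 2 * y * - Im (1 / (Complex x y - of_real s)))"
      using i by (intro integrable_mult_right Bochner_Integration.integrable_minus integrable_Im)
    show "indicator {x - y..x + y} s \<le> 2 * y * - Im (1 / (Complex x y - of_real s))" for s
    proof -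
      have pos: "(x - s)\<^sup>2 + y\<^sup>2 > 0" using y by (simp add: sum_power2_gt_zero_iff)
      have im: "- Im (1 / (Complex x y - of_real s)) = y / ((x - s)\<^sup>2 + y\<^sup>2)"
        by (simp add: Im_divide)
      have "1 \<le> 2 * y * (y / ((x - s)\<^sup>2 + y\<^sup>2))" if "s \<in> {x - y..x + y}"
      proof -
        have "\<bar>x - s\<bar> \<le> \<bar>y\<bar>" using that y by auto
        then have "(x - s)\<^sup>2 \<le> y\<^sup>2" by (simp only: abs_le_square_iff)
        then show ?thesis using pos by (simp add: field_simps power2_eq_square)
      qed
      moreover have "0 \<le> 2 * y * (y / ((x - s)\<^sup>2 + y\<^sup>2))" using y pos by simp
      ultimately show ?thesis unfolding im by (auto simp: indicator_def)
    qed
  qed (simp add: emeasure_finite less_top[symmetric])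
  also have "\<dots> = 2 * y * - Im (cauchy_transform M (Complex x y))"
    unfolding cauchy_transform_def using i by simp
  also have "\<dots> \<le> 2 * y * \<bar>Im (cauchy_transform M (Complex x y))\<bar>"
    using y by (intro mult_left_mono) auto
  finally show ?thesis .
qed

text \<open>A pointwise form of Stieltjes inversion: with y = |t - x|, the increment of
  \<open>cdf M\<close> between x and t is at most the mass of the interval of radius y about x,
  hence at most 2 y |Im G (x + i y)|.\<close>

lemma (in real_distribution) cdf_has_derivative_0:
  assumes lim: "((\<lambda>y. Im (cauchy_transform M (Complex x y))) \<longlongrightarrow> 0) (at_right 0)"
  shows "(cdf M has_real_derivative 0) (at x)"
  unfolding has_field_derivative_iff
proof (rule Lim_null_comparison)
  let ?b = "\<lambda>t. 2 * \<bar>Im (cauchy_transform M (Complex x \<bar>t - x\<bar>))\<bar>"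
  have fl: "filterlim (\<lambda>t. \<bar>t - x\<bar>) (at_right 0) (at x)"
    unfolding filterlim_at
  proof
    show "((\<lambda>t. \<bar>t - x\<bar>) \<longlongrightarrow> 0) (at x)"
      by (intro tendsto_eq_intros) auto
    show "\<forall>\<^sub>F t in at x. \<bar>t - x\<bar> \<in> {0<..} \<and> \<bar>t - x\<bar> \<noteq> 0"
      by (auto simp: eventually_at_filter)
  qed
  have "(?b \<longlongrightarrow> 2 * \<bar>0\<bar>) (at x)"
    by (intro tendsto_intros filterlim_compose[OF lim fl])
  then show "(?b \<longlongrightarrow> 0) (at x)" by simp
  show "\<forall>\<^sub>F t in at x. norm ((cdf M t - cdf M x) / (t - x)) \<le> ?b t"
    unfolding eventually_at_filter
  proof (intro always_eventually allI impI)
    fix t assume t: "t \<noteq> x"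
    have "\<bar>cdf M t - cdf M x\<bar> \<le> measure M {x - \<bar>t - x\<bar>..x + \<bar>t - x\<bar>}"
    proof (cases "t < x")
      case True
      have "cdf M x - cdf M t = measure M {t<..x}" using cdf_diff_eq[OF True] .
      also have "\<dots> \<le> measure M {x - \<bar>t - x\<bar>..x + \<bar>t - x\<bar>}" using True by (intro finite_measure_mono) auto
      finally show ?thesis using cdf_nondecreasing[of t x] True by auto
    next
      case False
      then have xt: "x < t" using t by auto
      have "cdf M t - cdf M x = measure M {x<..t}" using cdf_diff_eq[OF xt] .
      also have "\<dots> \<le> measure M {x - \<bar>t - x\<bar>..x + \<bar>t - x\<bar>}" using xt by (intro finite_measure_mono) auto
      finally show ?thesis using cdf_nondecreasing[of x t] xt by auto
    qed
    also have "\<dots> \<le> 2 * \<bar>t - x\<bar> * \<bar>Im (cauchy_transform M (Complex x \<bar>t - x\<bar>))\<bar>"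
      using t by (intro measure_interval_le_cauchy_transform) auto
    finally show "norm ((cdf M t - cdf M x) / (t - x)) \<le> ?b t"
      using t by (simp add: divide_le_eq ac_simps)
  qed
qed

text \<open>Vanishing derivatives make \<open>cdf M\<close> constant on both outer half-lines, and
  its limits 1 and 0 at infinity leave no mass there.\<close>

lemma (in real_distribution) AE_bounded_of_cauchy_transform:
  assumes lim: "\<And>x. \<bar>x\<bar> > c \<Longrightarrow> ((\<lambda>y. Im (cauchy_transform M (Complex x y))) \<longlongrightarrow> 0) (at_right 0)"
    and c: "c \<ge> 0"
  shows "AE x in M. \<bar>x\<bar> \<le> c"
proof -
  have "\<exists>k. \<forall>x\<in>{c<..}. cdf M x = k"
    using cdf_has_derivative_0[OF lim] c
    by (intro has_field_derivative_zero_constant) (auto intro: has_field_derivative_at_within)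
  then obtain k where k: "\<And>x. x > c \<Longrightarrow> cdf M x = k" by auto
  have "(cdf M \<longlongrightarrow> k) at_top"
    by (rule tendsto_eventually) (use eventually_gt_at_top[of c] in eventually_elim, rule k)
  then have "k = 1" using cdf_lim_at_top_prob by (intro tendsto_unique[of at_top]) auto
  have "\<exists>k. \<forall>x\<in>{..<-c}. cdf M x = k"
    using cdf_has_derivative_0[OF lim] c
    by (intro has_field_derivative_zero_constant) (auto intro: has_field_derivative_at_within)
  then obtain k' where k': "\<And>x. x < - c \<Longrightarrow> cdf M x = k'" by auto
  have "(cdf M \<longlongrightarrow> k') at_bot"
    by (rule tendsto_eventually) (use eventually_gt_at_bot[of "- c"] in eventually_elim, rule k')
  then have "k' = 0" using cdf_lim_at_bot by (intro tendsto_unique[of at_bot]) auto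
  \<comment> \<open>Constancy is known on the open half-lines, so the closed interval is reached
    through a countable intersection.\<close>
  have 1: "AE x in M. x \<le> c + 1 / real (Suc n)" for n
  proof -
    have "prob {..c + 1 / real (Suc n)} = 1"
      using k[of "c + 1 / real (Suc n)"] \<open>k = 1\<close> by (simp add: cdf_def)
    then show ?thesis using prob_eq_1[of "{..c + 1 / real (Suc n)}"] by auto
  qed
  have 2: "AE x in M. x > - c - 1 / real (Suc n)" for n
  proof -
    have "prob {..- c - 1 / real (Suc n)} = 0"
      using k'[of "- c - 1 / real (Suc n)"] \<open>k' = 0\<close> by (simp add: cdf_def)
    then have "AE x in M. x \<notin> {..- c - 1 / real (Suc n)}"
      using prob_eq_0[of "{..- c - 1 / real (Suc n)}"] by auto
    then show ?thesis by eventually_elim auto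
  qed
  have "AE x in M. \<forall>n. x \<le> c + 1 / real (Suc n) \<and> x > - c - 1 / real (Suc n)"
    using 1 2 by (auto simp: AE_all_countable)
  then show ?thesis
  proof eventually_elim
    case (elim x)
    show ?case
    proof (rule ccontr)
      assume "\<not> \<bar>x\<bar> \<le> c"
      then have "\<bar>x\<bar> - c > 0" by simp
      then obtain n where "1 / real (Suc n) < \<bar>x\<bar> - c" using nat_approx_posE by blast
      then show False using elim[rule_format, of n] by (auto simp: abs_if split: if_splits)
    qed
  qed
qed

text \<open>\<open>g\<close> extends G (1 / \<zeta>) across the real axis. Since G commutes with
  conjugation, approaching a real point from both sides shows that \<open>g\<close> is real there;
  hence Im G tends to 0 at every real x with |x| > 1 / \<delta>.\<close>

lemma (in real_distribution) AE_bounded_of_extension: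
  assumes \<delta>: "\<delta> > 0" and g: "g holomorphic_on ball 0 \<delta>"
    and eq: "\<And>\<zeta>. \<zeta> \<in> ball 0 \<delta> \<Longrightarrow> Im \<zeta> \<noteq> 0 \<Longrightarrow> cauchy_transform M (1 / \<zeta>) = g \<zeta>"
  shows "AE x in M. \<bar>x\<bar> \<le> 1 / \<delta>"
proof (rule AE_bounded_of_cauchy_transform)
  fix x :: real assume x: "\<bar>x\<bar> > 1 / \<delta>"
  then have x0: "x \<noteq> 0" using \<delta> by auto
  have in_ball: "1 / Complex x y \<in> ball 0 \<delta>" for y
  proof -
    have "1 / \<delta> < norm (Complex x y)"
      using x abs_Re_le_cmod[of "Complex x y"] by simp
    then show ?thesis using \<delta> by (simp add: norm_divide divide_less_eq mult.commute pos_divide_less_eq)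
  qed
  have nz: "Complex x y \<noteq> 0" for y using x0 by (simp add: complex_eq_iff)
  have cont: "isCont g (1 / Complex x 0)"
    using continuous_on_interior[OF holomorphic_on_imp_continuous_on[OF g], of "1 / Complex x 0"] in_ball[of 0]
    by (simp add: interior_open)
  have "((\<lambda>y. Complex x y) \<longlongrightarrow> Complex x 0) (at_right 0)"
    by (intro tendsto_Complex tendsto_const tendsto_ident_at)
  then have "((\<lambda>y. 1 / Complex x y) \<longlongrightarrow> 1 / Complex x 0) (at_right 0)"
    using nz by (intro tendsto_divide tendsto_const)
  then have l: "((\<lambda>y. g (1 / Complex x y)) \<longlongrightarrow> g (1 / Complex x 0)) (at_right 0)"
    by (rule isCont_tendsto_compose[OF cont])
  have ct: "cauchy_transform M (Complex x y) = g (1 / Complex x y)" if "y \<noteq> 0" for y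
  proof -
    have "Im (1 / Complex x y) \<noteq> 0" using that nz[of y] by (simp add: Im_divide complex_eq_iff sum_power2_eq_zero_iff)
    from eq[OF in_ball this] show ?thesis by simp
  qed
  have "((\<lambda>y. 1 / Complex x (- y)) \<longlongrightarrow> 1 / Complex x (- 0)) (at_right 0)"
    using nz by (intro tendsto_divide tendsto_const tendsto_Complex tendsto_minus tendsto_ident_at) simp
  then have l': "((\<lambda>y. g (1 / Complex x (- y))) \<longlongrightarrow> g (1 / Complex x 0)) (at_right 0)"
    using isCont_tendsto_compose[OF cont, of "\<lambda>y. 1 / Complex x (- y)"] by simp
  have "((\<lambda>y. cnj (g (1 / Complex x y))) \<longlongrightarrow> g (1 / Complex x 0)) (at_right 0)"
  proof (rule Lim_transform_eventually[OF l'])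
    have "g (1 / Complex x (- y)) = cnj (g (1 / Complex x y))" if "y > 0" for y
      using ct[of y] ct[of "- y"] cauchy_transform_cnj[of M "Complex x y"] that by (simp add: complex_cnj)
    then show "\<forall>\<^sub>F y in at_right 0. g (1 / Complex x (- y)) = cnj (g (1 / Complex x y))"
      by (auto simp: eventually_at_filter)
  qed
  moreover have "((\<lambda>y. cnj (g (1 / Complex x y))) \<longlongrightarrow> cnj (g (1 / Complex x 0))) (at_right 0)"
    using l by (rule tendsto_cnj)
  ultimately have "g (1 / Complex x 0) = cnj (g (1 / Complex x 0))"
    by (intro tendsto_unique[of "at_right (0::real)"]) auto
  then have "Im (g (1 / Complex x 0)) = 0" by (simp add: complex_eq_iff)
  then have "((\<lambda>y. Im (g (1 / Complex x y))) \<longlongrightarrow> 0) (at_right 0)"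
    using tendsto_Im[OF l] by simp
  then show "((\<lambda>y. Im (cauchy_transform M (Complex x y))) \<longlongrightarrow> 0) (at_right 0)"
    by (rule Lim_transform_eventually) (auto simp: eventually_at_filter ct)
qed (use \<delta> in simp)

section \<open>Cauchy transforms in the plane and the functional equations\<close>

lemma borel_probD:
  assumes "borel_prob \<mu>"
  shows "prob_space \<mu>" "sets \<mu> = sets borel" "space \<mu> = UNIV" "finite_borel \<mu>"
  using assms sets_eq_imp_space_eq[of \<mu> borel]
  unfolding borel_prob_def finite_borel_def by (auto dest: prob_space.finite_measure)

lemma fst_borel_measurable [measurable]: "fst \<in> borel_measurable (borel :: ('a::topological_space \<times> 'b::topological_space) measure)"
  by (intro borel_measurable_continuous_onI continuous_intros)

lemma snd_borel_measurable [measurable]: "snd \<in> borel_measurable (borel :: ('a::topological_space \<times> 'b::topological_space) measure)"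
  by (intro borel_measurable_continuous_onI continuous_intros)

text \<open>Exchanging the coordinates turns a statement about the first marginal into one about the
  second, so only the first is treated directly.\<close>

definition swap_measure :: "(real \<times> real) measure \<Rightarrow> (real \<times> real) measure" where
  "swap_measure \<mu> = distr \<mu> borel prod.swap"

lemma swap_measurable: "borel_prob \<mu> \<Longrightarrow> prod.swap \<in> measurable \<mu> (borel :: (real \<times> real) measure)"
  by (rule finite_borel_borel_measurable[OF borel_probD(4)])
     (auto intro!: borel_measurable_continuous_onI continuous_intros simp: prod.swap_def)

lemma fst_measurable: "borel_prob \<mu> \<Longrightarrow> fst \<in> borel_measurable (\<mu> :: (real \<times> real) measure)"
  by (rule finite_borel_borel_measurable[OF borel_probD(4)]) auto

lemma snd_measurable: "borel_prob \<mu> \<Longrightarrow> snd \<in> borel_measurable (\<mu> :: (real \<times> real) measure)"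
  by (rule finite_borel_borel_measurable[OF borel_probD(4)]) auto

lemma borel_prob_swap: "borel_prob \<mu> \<Longrightarrow> borel_prob (swap_measure \<mu>)"
  unfolding swap_measure_def borel_prob_def[of "distr _ _ _"]
  using prob_space.prob_space_distr[OF borel_probD(1) swap_measurable] by simp

lemma marginal_swap:
  assumes "borel_prob \<mu>"
  shows "marginal1 (swap_measure \<mu>) = marginal2 \<mu>" "marginal2 (swap_measure \<mu>) = marginal1 \<mu>"
  unfolding marginal1_def marginal2_def swap_measure_def
  using distr_distr[OF fst_borel_measurable swap_measurable[OF assms]]
    distr_distr[OF snd_borel_measurable swap_measurable[OF assms]]
  by (simp_all add: comp_def)

lemma integral_swap:
  fixes f :: "real \<times> real \<Rightarrow> 'b::{banach, second_countable_topology}"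
  assumes "borel_prob \<mu>" "f \<in> borel_measurable borel"
  shows "(LINT p|swap_measure \<mu>. f p) = (LINT p|\<mu>. f (prod.swap p))"
  unfolding swap_measure_def by (rule integral_distr) (use swap_measurable assms in auto)

lemma AE_swap:
  assumes "borel_prob \<mu>" "{p. Pr p} \<in> sets borel"
  shows "(AE p in swap_measure \<mu>. Pr p) \<longleftrightarrow> (AE p in \<mu>. Pr (prod.swap p))"
  unfolding swap_measure_def using assms by (intro AE_distr_iff swap_measurable) auto

lemma real_distribution_marginal1:
  assumes "borel_prob \<mu>" shows "real_distribution (marginal1 \<mu>)"
proof -
  interpret prob_space \<mu> using borel_probD(1)[OF assms] .
  show ?thesis unfolding marginal1_def using fst_measurable[OF assms] by (rule real_distribution_distr)
qed

lemma AE_marginal1: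
  assumes "borel_prob \<mu>"
  shows "(AE x in marginal1 \<mu>. \<bar>x\<bar> \<le> c) \<longleftrightarrow> (AE p in \<mu>. \<bar>fst p\<bar> \<le> c)"
  unfolding marginal1_def by (rule AE_distr_iff[OF fst_measurable[OF assms]]) auto

lemma cauchy_transform_marginal1:
  assumes "borel_prob \<mu>"
  shows "cauchy_transform (marginal1 \<mu>) z = (LINT p|\<mu>. 1 / (z - of_real (fst p)))"
  unfolding cauchy_transform_def marginal1_def by (rule integral_distr[OF fst_measurable[OF assms]]) simp

text \<open>Off the axes this is G (1 / u, 1 / v) / (u v). In this form it also makes sense at u = 0
  or v = 0, where it sees a single marginal.\<close>

definition biresolvent :: "(real \<times> real) measure \<Rightarrow> complex \<Rightarrow> complex \<Rightarrow> complex" where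
  "biresolvent \<mu> u v = (LINT p|\<mu>. 1 / ((1 - u * of_real (fst p)) * (1 - v * of_real (snd p))))"

lemma biresolvent_swap:
  assumes "borel_prob \<mu>"
  shows "biresolvent (swap_measure \<mu>) u v = biresolvent \<mu> v u"
  unfolding biresolvent_def by (subst integral_swap[OF assms]) (auto simp: mult.commute)

lemma cauchy_transform2_swap:
  assumes "borel_prob \<mu>"
  shows "cauchy_transform2 (swap_measure \<mu>) z w = cauchy_transform2 \<mu> w z"
  unfolding cauchy_transform2_def
  by (subst integral_swap[OF assms]) (auto simp: mult.commute case_prod_unfold)

section \<open>Stolz angles and the defining relation of the bi-free R-transform\<close>

lemma stolz_pair_alt:
  "stolz_pair \<alpha> \<beta> = {z. Im z \<noteq> 0 \<and> \<bar>Re z\<bar> < \<alpha> * \<bar>Im z\<bar> \<and> \<bar>Im z\<bar> < \<beta>}"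
proof -
  have "z \<in> cnj ` stolz \<alpha> \<beta> \<longleftrightarrow> cnj z \<in> stolz \<alpha> \<beta>" for z
    by (metis complex_cnj_cnj image_iff)
  then have "z \<in> stolz_pair \<alpha> \<beta> \<longleftrightarrow> z \<in> stolz \<alpha> \<beta> \<or> cnj z \<in> stolz \<alpha> \<beta>" for z
    unfolding stolz_pair_def by simp
  moreover have "z \<in> stolz \<alpha> \<beta> \<or> cnj z \<in> stolz \<alpha> \<beta> \<longleftrightarrow>
      Im z \<noteq> 0 \<and> \<bar>Re z\<bar> < \<alpha> * \<bar>Im z\<bar> \<and> \<bar>Im z\<bar> < \<beta>" for z
    by (cases "Im z < 0"; cases "Im z = 0") (auto simp: stolz_def)
  ultimately show ?thesis by blast
qed

lemma stolz_pair_mono: "\<alpha>' \<le> \<alpha> \<Longrightarrow> \<beta>' \<le> \<beta> \<Longrightarrow> stolz_pair \<alpha>' \<beta>' \<subseteq> stolz_pair \<alpha> \<beta>"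
  unfolding stolz_pair_alt by (auto intro: less_le_trans mult_right_mono)

lemma norm_stolz_pair: "z \<in> stolz_pair \<alpha> \<beta> \<Longrightarrow> norm z \<le> (\<alpha> + 1) * \<beta>" if "\<alpha> > 0"
proof -
  assume z: "z \<in> stolz_pair \<alpha> \<beta>"
  have "norm z \<le> \<bar>Re z\<bar> + \<bar>Im z\<bar>" by (rule cmod_le)
  also have "\<dots> \<le> \<alpha> * \<bar>Im z\<bar> + \<bar>Im z\<bar>" using z unfolding stolz_pair_alt by auto
  also have "\<dots> = (\<alpha> + 1) * \<bar>Im z\<bar>" by (simp add: algebra_simps)
  also have "\<dots> \<le> (\<alpha> + 1) * \<beta>" using z that unfolding stolz_pair_alt by (intro mult_left_mono) auto
  finally show ?thesis .
qed

lemma open_stolz_pair: "open (stolz_pair \<alpha> \<beta>)"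
  unfolding stolz_pair_alt
  by (intro open_Collect_conj open_Collect_less open_Collect_neq continuous_intros)

lemma stolz_pair_imaginary: "\<alpha> > 0 \<Longrightarrow> y \<noteq> 0 \<Longrightarrow> \<bar>y\<bar> < \<beta> \<Longrightarrow> Complex 0 y \<in> stolz_pair \<alpha> \<beta>"
  unfolding stolz_pair_alt by auto

lemma stolz_pair_nonzero: "z \<in> stolz_pair \<alpha> \<beta> \<Longrightarrow> z \<noteq> 0"
  unfolding stolz_pair_alt by auto

text \<open>The relation 1 - 1 / h = R - z R1 - w R2 multiplied out: no quotient remains, and the
  one-variable transforms, hidden by a quantifier in \<open>is_bifree_R\<close>, are named.\<close>

definition bifree_pair ::
  "(real \<times> real) measure \<Rightarrow> real \<Rightarrow> real \<Rightarrow> (complex \<Rightarrow> complex \<Rightarrow> complex) \<Rightarrow>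
    (complex \<Rightarrow> complex) \<Rightarrow> (complex \<Rightarrow> complex) \<Rightarrow> bool" where
  "bifree_pair \<mu> \<alpha> \<beta> R R1 R2 \<longleftrightarrow> borel_prob \<mu> \<and> \<alpha> > 0 \<and> \<beta> > 0 \<and>
     is_R_transform (marginal1 \<mu>) \<alpha> \<beta> R1 \<and> is_R_transform (marginal2 \<mu>) \<alpha> \<beta> R2 \<and>
     (\<forall>z\<in>stolz_pair \<alpha> \<beta>. \<forall>w\<in>stolz_pair \<alpha> \<beta>.
        cauchy_transform2 \<mu> (1 / z + R1 z) (1 / w + R2 w) * (1 - (R z w - z * R1 z - w * R2 w)) = z * w)"

lemma bifree_R_pair:
  assumes "borel_prob \<mu>" "is_bifree_R \<mu> \<alpha> \<beta> R"
  obtains R1 R2 where "bifree_pair \<mu> \<alpha> \<beta> R R1 R2"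
proof -
  obtain R1 R2 where R: "is_R_transform (marginal1 \<mu>) \<alpha> \<beta> R1" "is_R_transform (marginal2 \<mu>) \<alpha> \<beta> R2"
    "\<And>z w. z \<in> stolz_pair \<alpha> \<beta> \<Longrightarrow> w \<in> stolz_pair \<alpha> \<beta> \<Longrightarrow>
       let h = cauchy_transform2 \<mu> (1 / z + R1 z) (1 / w + R2 w) / (z * w)
       in h \<noteq> 0 \<and> R z w = z * R1 z + w * R2 w + (1 - 1 / h)"
    and ab: "\<alpha> > 0" "\<beta> > 0"
    using assms(2) unfolding is_bifree_R_def by blast
  have "cauchy_transform2 \<mu> (1 / z + R1 z) (1 / w + R2 w) * (1 - (R z w - z * R1 z - w * R2 w)) = z * w"
    if zw: "z \<in> stolz_pair \<alpha> \<beta>" "w \<in> stolz_pair \<alpha> \<beta>" for z w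
  proof -
    define G where "G = cauchy_transform2 \<mu> (1 / z + R1 z) (1 / w + R2 w)"
    have h: "G / (z * w) \<noteq> 0" "R z w = z * R1 z + w * R2 w + (1 - 1 / (G / (z * w)))"
      using R(3)[OF zw] unfolding G_def Let_def by auto
    have "1 - (R z w - z * R1 z - w * R2 w) = z * w / G" unfolding h(2) by simp
    then show ?thesis using h(1) unfolding G_def[symmetric] by simp
  qed
  then show ?thesis using R(1,2) assms(1) ab by (intro that[of R1 R2]) (auto simp: bifree_pair_def)
qed

lemma bifree_pair_equation:
  assumes "bifree_pair \<mu> \<alpha> \<beta> R R1 R2" "z \<in> stolz_pair \<alpha> \<beta>" "w \<in> stolz_pair \<alpha> \<beta>"
  shows "cauchy_transform2 \<mu> (1 / z + R1 z) (1 / w + R2 w) * (1 - (R z w - z * R1 z - w * R2 w)) = z * w"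
  using assms unfolding bifree_pair_def by blast

lemma bifree_pair_swap:
  assumes "bifree_pair \<mu> \<alpha> \<beta> R R1 R2"
  shows "bifree_pair (swap_measure \<mu>) \<alpha> \<beta> (\<lambda>z w. R w z) R2 R1"
proof -
  have \<mu>: "borel_prob \<mu>" using assms unfolding bifree_pair_def by blast
  have "cauchy_transform2 \<mu> (1 / w + R1 w) (1 / z + R2 z) * (1 - (R w z - z * R2 z - w * R1 w)) = z * w"
    if "z \<in> stolz_pair \<alpha> \<beta>" "w \<in> stolz_pair \<alpha> \<beta>" for z w
  proof -
    have "R w z - z * R2 z - w * R1 w = R w z - w * R1 w - z * R2 z" by simp
    then show ?thesis using bifree_pair_equation[OF assms that(2,1)] by (simp only: mult.commute[of w z])
  qed
  then show ?thesis
    using assms borel_prob_swap[OF \<mu>]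
    unfolding bifree_pair_def marginal_swap[OF \<mu>] cauchy_transform2_swap[OF \<mu>]
    by blast
qed

lemma is_R_transformD:
  assumes "is_R_transform m \<alpha> \<beta> f"
  shows "f holomorphic_on stolz_pair \<alpha> \<beta>"
    and "z \<in> stolz_pair \<alpha> \<beta> \<Longrightarrow> 1 / z + f z \<notin> \<real>"
    and "z \<in> stolz_pair \<alpha> \<beta> \<Longrightarrow> cauchy_transform m (1 / z + f z) = z"
    and "((\<lambda>z. z * f z) \<longlongrightarrow> 0) (at 0 within stolz_pair \<alpha> \<beta>)"
  using assms unfolding is_R_transform_def by blast+

text \<open>For w on the imaginary axis and t real, w t is imaginary, which keeps 1 - w t away from
  0 without any bound on t.\<close>

lemma imaginary_sequence:
  assumes "\<alpha> > 0" "\<beta> > 0"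
  obtains \<tau> :: "nat \<Rightarrow> real" where "\<And>n. 0 < \<tau> n" "\<And>n. Complex 0 (- \<tau> n) \<in> stolz_pair \<alpha> \<beta>" "\<tau> \<longlonglongrightarrow> 0"
    "filterlim (\<lambda>n. Complex 0 (- \<tau> n)) (at 0 within stolz_pair \<alpha> \<beta>) sequentially"
proof -
  define \<tau> where "\<tau> n = \<beta> / (real n + 2)" for n
  have \<tau>: "0 < \<tau> n" "\<tau> n < \<beta>" for n
    using assms by (auto simp: \<tau>_def field_simps add_pos_nonneg)
  have lim: "\<tau> \<longlonglongrightarrow> 0" unfolding \<tau>_def by real_asymp
  have S: "Complex 0 (- \<tau> n) \<in> stolz_pair \<alpha> \<beta>" for n
    using \<tau>[of n] assms by (intro stolz_pair_imaginary) auto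
  have "(\<lambda>n. Complex 0 (- \<tau> n)) \<longlonglongrightarrow> Complex 0 (- 0)"
    by (intro tendsto_Complex tendsto_minus lim tendsto_const)
  then have "filterlim (\<lambda>n. Complex 0 (- \<tau> n)) (at 0 within stolz_pair \<alpha> \<beta>) sequentially"
    using S stolz_pair_nonzero[OF S] by (intro filterlim_at_withinI) (auto simp: zero_complex.code[symmetric])
  then show ?thesis using that \<tau>(1) S lim by blast
qed

text \<open>Letting w tend to 0 removes the second variable: h tends to G of the first marginal at 1
  / z + R1 z, divided by z, which is 1. Thus 1 - 1 / h and w R2 w both vanish in the limit and z R1
  z is left.\<close>

lemma bifree_pair_limit:
  assumes bp: "bifree_pair \<mu> \<alpha> \<beta> R R1 R2" and z: "z \<in> stolz_pair \<alpha> \<beta>"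
    and \<tau>: "\<And>n. 0 < \<tau> n" "\<And>n. Complex 0 (- \<tau> n) \<in> stolz_pair \<alpha> \<beta>" "\<tau> \<longlonglongrightarrow> 0"
    "filterlim (\<lambda>n. Complex 0 (- \<tau> n)) (at 0 within stolz_pair \<alpha> \<beta>) sequentially"
  shows "(\<lambda>n. R z (Complex 0 (- \<tau> n))) \<longlonglongrightarrow> z * R1 z"
proof -
  have \<mu>: "borel_prob \<mu>" and R1: "is_R_transform (marginal1 \<mu>) \<alpha> \<beta> R1" and R2: "is_R_transform (marginal2 \<mu>) \<alpha> \<beta> R2"
    using bp unfolding bifree_pair_def by auto
  interpret prob_space \<mu> using borel_probD(1)[OF \<mu>] .
  define w where "w n = Complex 0 (- \<tau> n)" for n
  define a where "a n = w n * R2 (w n)" for n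
  define Z where "Z = 1 / z + R1 z"
  have ZR: "Im Z \<noteq> 0" using is_R_transformD(2)[OF R1 z] unfolding Z_def complex_is_Real_iff .
  have w: "w n \<in> stolz_pair \<alpha> \<beta>" "w n \<noteq> 0" for n
    using \<tau>(2) stolz_pair_nonzero by (auto simp: w_def)
  have a: "a \<longlonglongrightarrow> 0"
    using filterlim_compose[OF is_R_transformD(4)[OF R2] \<tau>(4)] unfolding a_def w_def .
  then have "\<forall>\<^sub>F n in sequentially. norm (a n) < 1 / 2"
    using order_tendstoD(2)[OF tendsto_norm_zero, of a sequentially "1/2"] by simp
  then obtain N where N: "\<And>n. n \<ge> N \<Longrightarrow> norm (a n) < 1 / 2" unfolding eventually_sequentially by blast
  have wl: "w \<longlonglongrightarrow> 0"
    using filterlim_mono[OF \<tau>(4) _ order_refl, of "nhds 0"] unfolding w_def by (simp add: at_within_def)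
  define h where "h n = cauchy_transform2 \<mu> Z (1 / w n + R2 (w n)) / (z * w n)" for n
  have heq: "h n * (1 - (R z (w n) - z * R1 z - a n)) = 1" for n
    using bifree_pair_equation[OF bp z w(1)[of n]] w(2)[of n] stolz_pair_nonzero[OF z]
    unfolding h_def Z_def a_def times_divide_eq_left by simp
  have hint: "h n = (LINT p|\<mu>. 1 / ((Z - of_real (fst p)) * (1 + a n - w n * of_real (snd p)))) / z" for n
  proof -
    have "cauchy_transform2 \<mu> Z (1 / w n + R2 (w n)) =
      (LINT p|\<mu>. w n * (1 / ((Z - of_real (fst p)) * (1 + a n - w n * of_real (snd p)))))"
      unfolding cauchy_transform2_def case_prod_unfold
    proof (rule Bochner_Integration.integral_cong[OF refl])
      fix p :: "real \<times> real"
      have "1 / w n + R2 (w n) - of_real (snd p) = (1 + a n - w n * of_real (snd p)) / w n"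
        using w(2)[of n] by (simp add: a_def field_simps)
      then show "1 / ((Z - of_real (fst p)) * (1 / w n + R2 (w n) - of_real (snd p))) =
        w n * (1 / ((Z - of_real (fst p)) * (1 + a n - w n * of_real (snd p))))" by simp
    qed
    also have "\<dots> = w n * (LINT p|\<mu>. 1 / ((Z - of_real (fst p)) * (1 + a n - w n * of_real (snd p))))"
      by (rule Bochner_Integration.integral_mult_right_zero)
    finally show ?thesis unfolding h_def using w(2)[of n] by simp
  qed
  \<comment> \<open>The index shift by \<open>N\<close> puts every |a| below 1 / 2, as the
    dominating constant requires.\<close>
  have "(\<lambda>n. LINT p|\<mu>. 1 / ((Z - of_real (fst p)) * (1 + a (n + N) - w (n + N) * of_real (snd p))))
    \<longlonglongrightarrow> (LINT p|\<mu>. 1 / (Z - of_real (fst p)))"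
  proof (rule integral_dominated_convergence[where w="\<lambda>_. 2 / \<bar>Im Z\<bar>"])
    note [measurable] = fst_measurable[OF \<mu>] snd_measurable[OF \<mu>]
    show "(\<lambda>p. 1 / (Z - of_real (fst p))) \<in> borel_measurable \<mu>" by measurable
    show "(\<lambda>p. 1 / ((Z - of_real (fst p)) * (1 + a (n + N) - w (n + N) * of_real (snd p)))) \<in> borel_measurable \<mu>" for n
      by measurable
    show "AE p in \<mu>. (\<lambda>n. 1 / ((Z - of_real (fst p)) * (1 + a (n + N) - w (n + N) * of_real (snd p))))
        \<longlonglongrightarrow> 1 / (Z - of_real (fst p))"
    proof (rule AE_I2)
      fix p :: "real \<times> real"
      have "Z - of_real (fst p) \<noteq> 0" using ZR by (auto simp: complex_eq_iff)
      then have "(\<lambda>n. 1 / ((Z - of_real (fst p)) * (1 + a (n + N) - w (n + N) * of_real (snd p))))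
        \<longlonglongrightarrow> 1 / ((Z - of_real (fst p)) * (1 + 0 - 0 * of_real (snd p)))"
        by (intro tendsto_intros LIMSEQ_ignore_initial_segment a wl) auto
      then show "(\<lambda>n. 1 / ((Z - of_real (fst p)) * (1 + a (n + N) - w (n + N) * of_real (snd p))))
        \<longlonglongrightarrow> 1 / (Z - of_real (fst p))" by simp
    qed
    show "AE p in \<mu>. norm (1 / ((Z - of_real (fst p)) * (1 + a (n + N) - w (n + N) * of_real (snd p)))) \<le> 2 / \<bar>Im Z\<bar>" for n
    proof (rule AE_I2)
      fix p :: "real \<times> real"
      have 1: "\<bar>Im Z\<bar> \<le> norm (Z - of_real (fst p))" using abs_Im_le_cmod[of "Z - of_real (fst p)"] by simp
      have "\<bar>Re (a (n + N))\<bar> < 1 / 2" using N[of "n + N"] abs_Re_le_cmod[of "a (n + N)"] by simp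
      \<comment> \<open>\<open>w\<close> is purely imaginary, so the term with \<open>snd p\<close>
        does not enter the real part, which is at least 1 - 1 / 2 however large \<open>snd p\<close>
        is.\<close>
      then have "1 / 2 \<le> Re (1 + a (n + N) - w (n + N) * of_real (snd p))" by (simp add: w_def abs_if split: if_splits)
      then have 2: "1 / 2 \<le> norm (1 + a (n + N) - w (n + N) * of_real (snd p))"
        using complex_Re_le_cmod order_trans by blast
      have "\<bar>Im Z\<bar> * (1 / 2) \<le> norm ((Z - of_real (fst p)) * (1 + a (n + N) - w (n + N) * of_real (snd p)))"
        unfolding norm_mult by (intro mult_mono 1 2) auto
      then have "1 / norm ((Z - of_real (fst p)) * (1 + a (n + N) - w (n + N) * of_real (snd p))) \<le> 1 / (\<bar>Im Z\<bar> * (1 / 2))"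
        using ZR by (intro divide_left_mono) (auto intro!: mult_pos_pos simp: norm_mult)
      then show "norm (1 / ((Z - of_real (fst p)) * (1 + a (n + N) - w (n + N) * of_real (snd p)))) \<le> 2 / \<bar>Im Z\<bar>"
        by (simp add: norm_divide)
    qed
  qed simp
  then have "(\<lambda>n. h (n + N)) \<longlonglongrightarrow> (LINT p|\<mu>. 1 / (Z - of_real (fst p))) / z"
    unfolding hint using stolz_pair_nonzero[OF z] by (intro tendsto_divide tendsto_const)
  also have "(LINT p|\<mu>. 1 / (Z - of_real (fst p))) = z"
    using is_R_transformD(3)[OF R1 z] unfolding cauchy_transform_marginal1[OF \<mu>] Z_def .
  finally have h: "h \<longlonglongrightarrow> 1" using stolz_pair_nonzero[OF z] by (simp add: LIMSEQ_offset)
  have "1 - 1 / h n + z * R1 z + a n = R z (w n)" for n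
    using heq[of n] by (cases "h n = 0") (auto simp: field_simps)
  moreover have "(\<lambda>n. 1 - 1 / h n + z * R1 z + a n) \<longlonglongrightarrow> 1 - 1 / 1 + z * R1 z + 0"
    by (intro tendsto_intros h a) auto
  ultimately show ?thesis by (simp add: w_def)
qed

text \<open>The integrand is bounded by 1 / c where |Im z| > c, and these open sets exhaust the
  domain.\<close>

lemma cauchy_transform_holomorphic:
  assumes "real_distribution m"
  shows "cauchy_transform m holomorphic_on {z. Im z \<noteq> 0}"
proof -
  interpret real_distribution m by fact
  have o: "open {z. c < \<bar>Im z\<bar>}" for c by (intro open_Collect_less continuous_intros)
  have *: "cauchy_transform m holomorphic_on {z. c < \<bar>Im z\<bar>}" if c: "c > 0" for c
    unfolding cauchy_transform_def[abs_def]
  proof (rule holomorphic_integral[OF o, where B="1 / c"])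
    show "AE x in m. (\<lambda>z. 1 / (z - of_real x)) holomorphic_on {z. c < \<bar>Im z\<bar>}"
      using c by (intro AE_I2 holomorphic_intros) auto
    have "norm (1 / (z - of_real x)) \<le> 1 / c" if "c < \<bar>Im z\<bar>" for x :: real and z
    proof -
      have "c \<le> norm (z - of_real x)" using that abs_Im_le_cmod[of "z - of_real x"] by simp
      then show ?thesis using c by (simp add: norm_divide frac_le)
    qed
    then show "AE x in m. \<forall>z\<in>{z. c < \<bar>Im z\<bar>}. norm (1 / (z - of_real x)) \<le> 1 / c" by auto
  qed simp
  have "cauchy_transform m field_differentiable at z" if "Im z \<noteq> 0" for z
    using holomorphic_on_imp_differentiable_at[OF * o, of "\<bar>Im z\<bar> / 2" z] that by simp
  then show ?thesis
    by (auto simp: holomorphic_on_def intro: field_differentiable_at_within)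
qed

text \<open>The radii are matched: the support bound 2 / \<rho> times the disc radius \<rho> / 4 is
  1 / 2.\<close>

lemma norm_resolvent_le:
  fixes u :: complex
  assumes "\<rho> > 0" "u \<in> ball 0 (\<rho> / 4)" "\<bar>s\<bar> \<le> 2 / \<rho>"
  shows "norm (1 / (1 - u * of_real s)) \<le> 2" "1 - u * of_real s \<noteq> 0" "norm (u * of_real s) \<le> 1 / 2"
proof -
  have "norm (u * of_real s) \<le> (\<rho> / 4) * (2 / \<rho>)"
    unfolding norm_mult using assms by (intro mult_mono) auto
  then show us: "norm (u * of_real s) \<le> 1 / 2" using assms(1) by simp
  then have "norm (1 - u * of_real s) \<ge> 1 / 2"
    using norm_triangle_ineq2[of 1 "u * of_real s"] by simp
  then show "1 - u * of_real s \<noteq> 0" "norm (1 / (1 - u * of_real s)) \<le> 2"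
    by (auto simp: norm_divide divide_le_eq)
qed

text \<open>The alternative v = 0 serves the one-variable case, where the first coordinate is known
  to be bounded before anything is known about the second.\<close>

lemma holomorphic_biresolvent_aux:
  assumes \<mu>: "borel_prob \<mu>" and \<rho>: "\<rho> > 0"
    and AE: "AE p in \<mu>. \<bar>fst p\<bar> \<le> 2 / \<rho>" "v = 0 \<or> (AE p in \<mu>. \<bar>snd p\<bar> \<le> 2 / \<rho>)" and v: "v \<in> ball 0 (\<rho> / 4)"
  shows "(\<lambda>u. LINT p|\<mu>. 1 / ((1 - u * of_real (fst p)) * (1 - v * of_real (snd p)))) holomorphic_on ball 0 (\<rho> / 4)"
proof -
  interpret prob_space \<mu> using borel_probD(1)[OF \<mu>] .
  note [measurable] = fst_measurable[OF \<mu>] snd_measurable[OF \<mu>]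
  have v2: "AE p in \<mu>. norm (1 / (1 - v * of_real (snd p))) \<le> 2 \<and> 1 - v * of_real (snd p) \<noteq> 0"
    using AE(2)
  proof
    assume "AE p in \<mu>. \<bar>snd p\<bar> \<le> 2 / \<rho>"
    then show ?thesis by eventually_elim (use norm_resolvent_le[OF \<rho> v] in blast)
  qed simp
  show ?thesis
  proof (rule holomorphic_integral[OF open_ball, where B=4])
    show "AE p in \<mu>. (\<lambda>u. 1 / ((1 - u * of_real (fst p)) * (1 - v * of_real (snd p)))) holomorphic_on ball 0 (\<rho> / 4)"
      using AE(1) v2
    proof eventually_elim
      case (elim p)
      then show ?case
        using norm_resolvent_le(2)[OF \<rho> _ elim(1)] by (intro holomorphic_intros) auto
    qed
    show "AE p in \<mu>. \<forall>u\<in>ball 0 (\<rho> / 4). norm (1 / ((1 - u * of_real (fst p)) * (1 - v * of_real (snd p)))) \<le> 4"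
      using AE(1) v2
    proof eventually_elim
      case (elim p)
      show ?case
      proof
        fix u :: complex assume "u \<in> ball 0 (\<rho> / 4)"
        then have "norm (1 / (1 - u * of_real (fst p))) * norm (1 / (1 - v * of_real (snd p))) \<le> 2 * 2"
          using norm_resolvent_le(1)[OF \<rho> _ elim(1)] elim(2) by (intro mult_mono) auto
        then show "norm (1 / ((1 - u * of_real (fst p)) * (1 - v * of_real (snd p)))) \<le> 4"
          by (simp add: norm_mult norm_divide)
      qed
    qed
  qed measurable
qed

text \<open>The properties of \<open>R\<close> near the origin on which the inversion rests,
  symmetric under exchange of the variables. Separate holomorphy is enough since continuation is
  done in one variable at a time; the Lipschitz bound supplies joint continuity.\<close>

locale lipschitz_bidisc =
  fixes R :: "complex \<Rightarrow> complex \<Rightarrow> complex" and \<rho> B :: real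
  assumes \<rho>: "\<rho> > 0" and B: "B \<ge> 0"
    and hol1: "\<And>w. w \<in> ball 0 \<rho> \<Longrightarrow> (\<lambda>z. R z w) holomorphic_on ball 0 \<rho>"
    and hol2: "\<And>z. z \<in> ball 0 \<rho> \<Longrightarrow> (\<lambda>w. R z w) holomorphic_on ball 0 \<rho>"
    and Lip: "\<And>z z' w w'. z \<in> ball 0 \<rho> \<Longrightarrow> z' \<in> ball 0 \<rho> \<Longrightarrow> w \<in> ball 0 \<rho> \<Longrightarrow> w' \<in> ball 0 \<rho> \<Longrightarrow>
      norm (R z w - R z' w') \<le> B * (norm (z - z') + norm (w - w'))"
begin

lemma swap: "lipschitz_bidisc (\<lambda>z w. R w z) \<rho> B"
proof (unfold_locales, rule \<rho>, rule B, rule hol2, assumption, rule hol1, assumption)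
  fix z z' w w' :: complex
  assume "z \<in> ball 0 \<rho>" "z' \<in> ball 0 \<rho>" "w \<in> ball 0 \<rho>" "w' \<in> ball 0 \<rho>"
  then show "norm (R w z - R w' z') \<le> B * (norm (z - z') + norm (w - w'))"
    using Lip[of w w' z z'] by (simp add: add.commute)
qed

lemma continuous:
  assumes "z \<in> ball 0 \<rho>" "w \<in> ball 0 \<rho>" "(f \<longlongrightarrow> z) F" "(g \<longlongrightarrow> w) F"
  shows "((\<lambda>x. R (f x) (g x)) \<longlongrightarrow> R z w) F"
proof (rule Lim_null[THEN iffD2], rule Lim_null_comparison)
  have "\<forall>\<^sub>F x in F. f x \<in> ball 0 \<rho>" "\<forall>\<^sub>F x in F. g x \<in> ball 0 \<rho>"
    using topological_tendstoD[OF assms(3) open_ball assms(1)] topological_tendstoD[OF assms(4) open_ball assms(2)] .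
  then show "\<forall>\<^sub>F x in F. norm (R (f x) (g x) - R z w) \<le> B * (norm (f x - z) + norm (g x - w))"
    by eventually_elim (intro Lip assms)
  have "((\<lambda>x. B * (norm (f x - z) + norm (g x - w))) \<longlongrightarrow> B * (norm (z - z) + norm (w - w))) F"
    by (intro tendsto_intros assms)
  then show "((\<lambda>x. B * (norm (f x - z) + norm (g x - w))) \<longlongrightarrow> 0) F" by simp
qed

section \<open>One law of the family: inverting the R-transform of its first marginal\<close>

context
  fixes \<mu> :: "(real \<times> real) measure" and \<alpha> \<beta> \<epsilon> :: real and R1 R2 :: "complex \<Rightarrow> complex"
  assumes \<epsilon>: "\<epsilon> > 0" and small: "\<epsilon> * B * \<rho> \<le> 1 / 4"
    and pair: "bifree_pair \<mu> \<alpha> \<beta> (\<lambda>z w. of_real \<epsilon> * R z w) R1 R2"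
begin

lemma pair_prob: "borel_prob \<mu>" and pair_alpha: "\<alpha> > 0" and pair_beta: "\<beta> > 0"
  and pair_R_transform: "is_R_transform (marginal1 \<mu>) \<alpha> \<beta> R1"
  using pair unfolding bifree_pair_def by auto

text \<open>Both sides are the limit of \<epsilon> R z w as w tends to 0 along the imaginary axis,
  once by the bi-free relation and once by continuity of \<open>R\<close>.\<close>

lemma R1_eq:
  assumes z: "z \<in> stolz_pair \<alpha> \<beta>" "z \<in> ball 0 \<rho>"
  shows "z * R1 z = of_real \<epsilon> * R z 0"
proof -
  obtain \<tau> where \<tau>: "\<And>n. 0 < \<tau> n" "\<And>n. Complex 0 (- \<tau> n) \<in> stolz_pair \<alpha> \<beta>" "\<tau> \<longlonglongrightarrow> 0"
    "filterlim (\<lambda>n. Complex 0 (- \<tau> n)) (at 0 within stolz_pair \<alpha> \<beta>) sequentially"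
    using imaginary_sequence[OF pair_alpha pair_beta] by blast
  have "(\<lambda>n. Complex 0 (- \<tau> n)) \<longlonglongrightarrow> 0"
    using filterlim_mono[OF \<tau>(4) _ order_refl, of "nhds 0"] by (simp add: at_within_def)
  then have "(\<lambda>n. of_real \<epsilon> * R z (Complex 0 (- \<tau> n))) \<longlonglongrightarrow> of_real \<epsilon> * R z 0"
    using z \<rho> by (intro tendsto_mult tendsto_const continuous) auto
  then show ?thesis
    using bifree_pair_limit[OF pair z(1) \<tau>] LIMSEQ_unique by blast
qed

text \<open>z R1 z tends to 0 inside the Stolz angles by definition of the R-transform, and near 0
  it equals \<epsilon> R z 0 there.\<close>

lemma R_0_0: "R 0 0 = 0"
proof -
  obtain \<tau> where \<tau>: "\<And>n. 0 < \<tau> n" "\<And>n. Complex 0 (- \<tau> n) \<in> stolz_pair \<alpha> \<beta>" "\<tau> \<longlonglongrightarrow> 0"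
    "filterlim (\<lambda>n. Complex 0 (- \<tau> n)) (at 0 within stolz_pair \<alpha> \<beta>) sequentially"
    using imaginary_sequence[OF pair_alpha pair_beta] by blast
  have l: "(\<lambda>n. Complex 0 (- \<tau> n)) \<longlonglongrightarrow> 0"
    using filterlim_mono[OF \<tau>(4) _ order_refl, of "nhds 0"] by (simp add: at_within_def)
  then have "(\<lambda>n. of_real \<epsilon> * R (Complex 0 (- \<tau> n)) 0) \<longlonglongrightarrow> of_real \<epsilon> * R 0 0"
    using \<rho> by (intro tendsto_mult tendsto_const continuous) auto
  moreover have "(\<lambda>n. of_real \<epsilon> * R (Complex 0 (- \<tau> n)) 0) \<longlonglongrightarrow> 0"
  proof (rule Lim_transform_eventually)
    show "(\<lambda>n. Complex 0 (- \<tau> n) * R1 (Complex 0 (- \<tau> n))) \<longlonglongrightarrow> 0"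
      using filterlim_compose[OF is_R_transformD(4)[OF pair_R_transform] \<tau>(4)] .
    have "\<forall>\<^sub>F n in sequentially. Complex 0 (- \<tau> n) \<in> ball 0 \<rho>"
      using topological_tendstoD[OF l open_ball, of 0 \<rho>] \<rho> by simp
    then show "\<forall>\<^sub>F n in sequentially. Complex 0 (- \<tau> n) * R1 (Complex 0 (- \<tau> n)) = of_real \<epsilon> * R (Complex 0 (- \<tau> n)) 0"
      by eventually_elim (rule R1_eq[OF \<tau>(2)])
  qed
  ultimately have "of_real \<epsilon> * R 0 0 = 0" using LIMSEQ_unique by blast
  then show ?thesis using \<epsilon> by simp
qed

text \<open>With L z = \<epsilon> R z 0, the local inverse \<open>g\<close> of z / (1 + L z)
  satisfies 1 / g \<zeta> + R1 (g \<zeta>) = 1 / \<zeta> wherever \<open>g \<zeta>\<close> lies in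
  the Stolz angles, so G (1 / \<zeta>) = g \<zeta> there. Continuation spreads this over each
  half-disc. The open set of the last conclusion is kept for the two-variable identity.\<close>

lemma half_plane_inverse:
  obtains g where "g holomorphic_on ball 0 (\<rho> / 2)"
    "\<And>\<zeta>. \<zeta> \<in> ball 0 (\<rho> / 2) \<Longrightarrow> g \<zeta> \<in> ball 0 \<rho>"
    "\<And>\<zeta>. \<zeta> \<in> ball 0 (\<rho> / 2) \<Longrightarrow> g \<zeta> = \<zeta> * (1 + of_real \<epsilon> * R (g \<zeta>) 0)"
    "\<And>\<zeta>. \<zeta> \<in> ball 0 (\<rho> / 2) \<Longrightarrow> Im \<zeta> \<noteq> 0 \<Longrightarrow> cauchy_transform (marginal1 \<mu>) (1 / \<zeta>) = g \<zeta>"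
    "\<exists>U. open U \<and> U \<noteq> {} \<and> U \<subseteq> ball 0 (\<rho> / 4) \<and>
      (\<forall>\<zeta>\<in>U. g \<zeta> \<in> stolz_pair \<alpha> \<beta> \<and> 1 / g \<zeta> + R1 (g \<zeta>) = 1 / \<zeta>)"
proof -
  define L where "L z = of_real \<epsilon> * R z 0" for z
  have LLip: "norm (L z - L z') \<le> (\<epsilon> * B) * norm (z - z')" if "z \<in> ball 0 \<rho>" "z' \<in> ball 0 \<rho>" for z z'
  proof -
    have "norm (L z - L z') = \<epsilon> * norm (R z 0 - R z' 0)"
      unfolding L_def right_diff_distrib[symmetric] norm_mult using \<epsilon> by simp
    also have "\<dots> \<le> \<epsilon> * (B * (norm (z - z') + norm (0 - 0 :: complex)))"
      using \<epsilon> \<rho> that by (intro mult_left_mono Lip) auto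
    finally show ?thesis by simp
  qed
  have Lhol: "L holomorphic_on ball 0 \<rho>" unfolding L_def using \<rho> by (intro holomorphic_intros hol1) auto
  have L0: "L 0 = 0" using R_0_0 by (simp add: L_def)
  obtain g where g: "g holomorphic_on ball 0 (\<rho> / 2)"
    "\<And>\<zeta>. \<zeta> \<in> ball 0 (\<rho> / 2) \<Longrightarrow> g \<zeta> \<in> ball 0 \<rho>"
    "\<And>\<zeta>. \<zeta> \<in> ball 0 (\<rho> / 2) \<Longrightarrow> g \<zeta> = \<zeta> * (1 + L (g \<zeta>))"
    "\<And>z \<zeta>. z \<in> ball 0 \<rho> \<Longrightarrow> \<zeta> \<in> ball 0 (\<rho> / 2) \<Longrightarrow> z = \<zeta> * (1 + L z) \<Longrightarrow> z = g \<zeta>"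
  proof (rule local_inverse[OF \<rho> Lhol LLip L0])
    show "0 \<le> \<epsilon> * B" using \<epsilon> B by simp
    show "\<epsilon> * B * \<rho> \<le> 1 / 4" by (rule small)
  qed blast+
  interpret m: real_distribution "marginal1 \<mu>" using real_distribution_marginal1[OF pair_prob] .
  have inv: "1 / g \<zeta> + R1 (g \<zeta>) = 1 / \<zeta>" if "\<zeta> \<in> ball 0 (\<rho> / 2)" "g \<zeta> \<in> stolz_pair \<alpha> \<beta>" for \<zeta>
  proof -
    have gz: "g \<zeta> \<noteq> 0" using that stolz_pair_nonzero by blast
    have "R1 (g \<zeta>) = L (g \<zeta>) / g \<zeta>"
      using R1_eq[OF that(2) g(2)[OF that(1)]] gz unfolding L_def by (simp add: field_simps)
    then have "1 / g \<zeta> + R1 (g \<zeta>) = (1 + L (g \<zeta>)) / g \<zeta>" by (simp add: add_divide_distrib)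
    also have "\<dots> = (1 + L (g \<zeta>)) / (\<zeta> * (1 + L (g \<zeta>)))" using g(3)[OF that(1)] by simp
    also have "\<dots> = 1 / \<zeta>"
    proof -
      have "1 + L (g \<zeta>) \<noteq> 0" using g(3)[OF that(1)] gz by (metis mult_zero_right)
      then show ?thesis by simp
    qed
    finally show ?thesis .
  qed
  \<comment> \<open>\<open>\<sigma>\<close> selects the half-plane; each half-disc needs its own
    open set on which the continuation starts.\<close>
  have U: "\<exists>U. open U \<and> U \<noteq> {} \<and> U \<subseteq> ball 0 (\<rho> / 4) \<inter> {\<zeta>. \<sigma> * Im \<zeta> > 0} \<and> (\<forall>\<zeta>\<in>U. g \<zeta> \<in> stolz_pair \<alpha> \<beta>)"
    if \<sigma>: "\<sigma> \<in> {-1, 1}" for \<sigma> :: real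
  proof -
    \<comment> \<open>A point z = i \<sigma> \<tau> of the imaginary axis is prescribed as a value
      of \<open>g\<close>, and \<zeta> = z / (1 + L z) is its preimage. With \<tau> \<le> \<rho> / 8
      the factor 4 / 3 still leaves |\<zeta>| below \<rho> / 4, and Re (1 + L z) > 0 keeps \<zeta>
      in the half-plane of z.\<close>
    define \<tau> where "\<tau> = min (\<rho> / 8) (\<beta> / 2)"
    have \<tau>: "0 < \<tau>" "\<tau> \<le> \<rho> / 8" "\<tau> < \<beta>" using \<rho> pair_beta by (auto simp: \<tau>_def)
    define z where "z = Complex 0 (\<sigma> * \<tau>)"
    have nz: "norm z = \<tau>" using \<sigma> \<tau> by (auto simp: z_def cmod_def)
    have zS: "z \<in> stolz_pair \<alpha> \<beta>" unfolding z_def using \<sigma> \<tau> pair_alpha by (intro stolz_pair_imaginary) auto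
    have zb: "z \<in> ball 0 \<rho>" using nz \<tau> \<rho> by simp
    have "norm (L z) \<le> (\<epsilon> * B) * norm z" using LLip[OF zb, of 0] L0 \<rho> by simp
    also have "\<dots> \<le> (\<epsilon> * B) * \<rho>" using zb \<epsilon> B by (intro mult_left_mono) auto
    finally have Lz: "norm (L z) \<le> 1 / 4" using small by simp
    then have Re: "Re (1 + L z) \<ge> 3 / 4" using abs_Re_le_cmod[of "L z"] by (simp add: abs_le_iff)
    then have n34: "norm (1 + L z) \<ge> 3 / 4" using complex_Re_le_cmod order_trans by blast
    have ne: "1 + L z \<noteq> 0"
    proof
      assume "1 + L z = 0"
      with n34 have "3 / 4 \<le> norm (0 :: complex)" by simp
      then show False by simp
    qed
    define \<zeta> where "\<zeta> = z / (1 + L z)"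
    have "norm \<zeta> \<le> \<tau> / (3 / 4)"
      unfolding \<zeta>_def norm_divide nz using n34 \<tau> by (intro divide_left_mono) auto
    also have "\<dots> < \<rho> / 4" using \<tau> \<rho> by simp
    finally have \<zeta>b: "\<zeta> \<in> ball 0 (\<rho> / 4)" by simp
    have g\<zeta>: "g \<zeta> = z" using g(4)[OF zb, of \<zeta>] \<zeta>b ne \<rho> by (auto simp: \<zeta>_def)
    have "Im \<zeta> = \<sigma> * \<tau> * Re (1 + L z) / (norm (1 + L z))\<^sup>2"
      unfolding \<zeta>_def z_def by (simp add: Im_divide cmod_power2)
    then have "\<sigma> * Im \<zeta> = \<tau> * Re (1 + L z) / (norm (1 + L z))\<^sup>2" using \<sigma> by auto
    then have Im\<zeta>: "\<sigma> * Im \<zeta> > 0" using \<tau> Re ne by simp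
    define U where "U = ball 0 (\<rho> / 4) \<inter> {\<zeta>. \<sigma> * Im \<zeta> > 0} \<inter> (ball 0 (\<rho> / 2) \<inter> g -` stolz_pair \<alpha> \<beta>)"
    have "open U" unfolding U_def
      by (intro open_Int open_ball continuous_open_preimage[OF holomorphic_on_imp_continuous_on[OF g(1)]]
          open_stolz_pair open_Collect_less continuous_intros)
    moreover have "\<zeta> \<in> U" unfolding U_def using \<zeta>b Im\<zeta> g\<zeta> zS \<rho> by auto
    ultimately show ?thesis by (intro exI[of _ U]) (auto simp: U_def)
  qed
  have Geq: "cauchy_transform (marginal1 \<mu>) (1 / \<zeta>) = g \<zeta>"
    if \<zeta>: "\<zeta> \<in> ball 0 (\<rho> / 2)" "Im \<zeta> \<noteq> 0" for \<zeta>
  proof -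
    define \<sigma> :: real where "\<sigma> = sgn (Im \<zeta>)"
    have \<sigma>: "\<sigma> \<in> {-1, 1}" and s\<zeta>: "\<sigma> * Im \<zeta> > 0" using \<zeta>(2) unfolding \<sigma>_def by (auto simp: sgn_if)
    obtain U where U: "open U" "U \<noteq> {}" "U \<subseteq> ball 0 (\<rho> / 4) \<inter> {\<zeta>. \<sigma> * Im \<zeta> > 0}"
      "\<And>\<zeta>. \<zeta> \<in> U \<Longrightarrow> g \<zeta> \<in> stolz_pair \<alpha> \<beta>" using U[OF \<sigma>] by metis
    let ?S = "ball 0 (\<rho> / 2) \<inter> {\<zeta>. \<sigma> * Im \<zeta> > 0}"
    have "{\<zeta>. \<sigma> * Im \<zeta> > 0} = {\<zeta>. Im \<zeta> > 0} \<or> {\<zeta>. \<sigma> * Im \<zeta> > 0} = {\<zeta>. Im \<zeta> < 0}" using \<sigma> by auto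
    then have "convex {\<zeta>. \<sigma> * Im \<zeta> > 0}" using convex_halfspace_Im_gt[of 0] convex_halfspace_Im_lt[of 0] by auto
    then have conn: "connected ?S" by (intro convex_connected convex_Int convex_ball)
    have op: "open ?S" by (intro open_Int open_ball open_Collect_less continuous_intros)
    have sub: "U \<subseteq> ?S" using U(3) \<rho> by auto
    have ch: "(\<lambda>\<zeta>. cauchy_transform (marginal1 \<mu>) (1 / \<zeta>)) holomorphic_on ?S"
    proof (rule holomorphic_on_compose_gen[unfolded comp_def, OF _ cauchy_transform_holomorphic[OF m.real_distribution_axioms]])
      show "(\<lambda>\<zeta>. 1 / \<zeta>) holomorphic_on ?S" by (intro holomorphic_intros) auto
      show "(\<lambda>\<zeta>. 1 / \<zeta>) ` ?S \<subseteq> {z. Im z \<noteq> 0}" by (auto simp: Im_divide complex_eq_iff sum_power2_eq_zero_iff)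
    qed
    have gh: "g holomorphic_on ?S" by (rule holomorphic_on_subset[OF g(1) Int_lower1])
    show ?thesis
    proof (rule analytic_continuation_open[OF U(1) op U(2) conn sub ch gh])
      fix \<zeta> assume \<zeta>: "\<zeta> \<in> U"
      have "\<zeta> \<in> ball 0 (\<rho> / 2)" using sub \<zeta> by blast
      then show "cauchy_transform (marginal1 \<mu>) (1 / \<zeta>) = g \<zeta>"
        using is_R_transformD(3)[OF pair_R_transform U(4)[OF \<zeta>]] inv[OF _ U(4)[OF \<zeta>]] by metis
    qed (use \<zeta> s\<zeta> in auto)
  qed
  obtain U where U: "open U" "U \<noteq> {}" "U \<subseteq> ball 0 (\<rho> / 4)" "\<And>\<zeta>. \<zeta> \<in> U \<Longrightarrow> g \<zeta> \<in> stolz_pair \<alpha> \<beta>"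
    using U[of 1] by auto
  have "\<zeta> \<in> ball 0 (\<rho> / 2)" if "\<zeta> \<in> U" for \<zeta> using U(3) that \<rho> by auto
  then show ?thesis
    using U inv by (intro that[OF g(1,2) g(3)[unfolded L_def] Geq]) (auto intro!: exI[of _ U])
qed

text \<open>G (1 / \<zeta>) is \<zeta> times \<open>biresolvent \<mu> \<zeta> 0\<close>, so
  \<open>g\<close> is this product on a half-disc and by continuation on the whole disc. Cancelling
  \<zeta> in g = \<zeta> (1 + \<epsilon> R g 0) gives the equation for the resolvent. The bound 2 /
  \<rho> is the reciprocal of the radius \<rho> / 2 on which \<open>g\<close> extends the Cauchy
  transform.\<close>

lemma inverse_resolvent:
  obtains g where "AE p in \<mu>. \<bar>fst p\<bar> \<le> 2 / \<rho>"
    "g holomorphic_on ball 0 (\<rho> / 4)"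
    "\<And>\<zeta>. \<zeta> \<in> ball 0 (\<rho> / 4) \<Longrightarrow> g \<zeta> \<in> ball 0 \<rho>"
    "\<And>\<zeta>. \<zeta> \<in> ball 0 (\<rho> / 4) \<Longrightarrow> g \<zeta> = \<zeta> * biresolvent \<mu> \<zeta> 0"
    "\<And>\<zeta>. \<zeta> \<in> ball 0 (\<rho> / 4) \<Longrightarrow> biresolvent \<mu> \<zeta> 0 = 1 + of_real \<epsilon> * R (g \<zeta>) 0"
    "\<exists>U. open U \<and> U \<noteq> {} \<and> U \<subseteq> ball 0 (\<rho> / 4) \<and>
      (\<forall>\<zeta>\<in>U. g \<zeta> \<in> stolz_pair \<alpha> \<beta> \<and> 1 / g \<zeta> + R1 (g \<zeta>) = 1 / \<zeta>)"
proof -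
  interpret \<mu>: prob_space \<mu> using borel_probD(1)[OF pair_prob] .
  interpret m: real_distribution "marginal1 \<mu>" using real_distribution_marginal1[OF pair_prob] .
  obtain g where g: "g holomorphic_on ball 0 (\<rho> / 2)"
    "\<And>\<zeta>. \<zeta> \<in> ball 0 (\<rho> / 2) \<Longrightarrow> g \<zeta> \<in> ball 0 \<rho>"
    "\<And>\<zeta>. \<zeta> \<in> ball 0 (\<rho> / 2) \<Longrightarrow> g \<zeta> = \<zeta> * (1 + of_real \<epsilon> * R (g \<zeta>) 0)"
    "\<And>\<zeta>. \<zeta> \<in> ball 0 (\<rho> / 2) \<Longrightarrow> Im \<zeta> \<noteq> 0 \<Longrightarrow> cauchy_transform (marginal1 \<mu>) (1 / \<zeta>) = g \<zeta>"
    "\<exists>U. open U \<and> U \<noteq> {} \<and> U \<subseteq> ball 0 (\<rho> / 4) \<and>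
      (\<forall>\<zeta>\<in>U. g \<zeta> \<in> stolz_pair \<alpha> \<beta> \<and> 1 / g \<zeta> + R1 (g \<zeta>) = 1 / \<zeta>)"
    using half_plane_inverse by blast
  have AE: "AE p in \<mu>. \<bar>fst p\<bar> \<le> 2 / \<rho>"
    using m.AE_bounded_of_extension[OF _ g(1,4)] \<rho> unfolding AE_marginal1[OF pair_prob] by simp
  have sub: "ball 0 (\<rho> / 4) \<subseteq> (ball 0 (\<rho> / 2) :: complex set)" using \<rho> by auto
  have hol: "(\<lambda>\<zeta>. \<zeta> * biresolvent \<mu> \<zeta> 0) holomorphic_on ball 0 (\<rho> / 4)"
    unfolding biresolvent_def using AE by (intro holomorphic_intros holomorphic_biresolvent_aux[OF pair_prob \<rho>]) (auto simp: \<rho>)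
  have gb: "g \<zeta> = \<zeta> * biresolvent \<mu> \<zeta> 0" if \<zeta>: "\<zeta> \<in> ball 0 (\<rho> / 4)" for \<zeta>
  proof (rule analytic_continuation_open[of "ball 0 (\<rho> / 4) \<inter> {\<zeta>. Im \<zeta> > 0}" "ball 0 (\<rho> / 4)" g])
    show "ball 0 (\<rho> / 4) \<inter> {\<zeta>. Im \<zeta> > 0} \<noteq> {}"
    proof -
      have "Complex 0 (\<rho> / 8) \<in> ball 0 (\<rho> / 4) \<inter> {\<zeta>. Im \<zeta> > 0}" using \<rho> by (auto simp: cmod_def)
      then show ?thesis by blast
    qed
    show "g \<zeta> = \<zeta> * biresolvent \<mu> \<zeta> 0" if z: "\<zeta> \<in> ball 0 (\<rho> / 4) \<inter> {\<zeta>. Im \<zeta> > 0}" for \<zeta>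
    proof -
      have z0: "\<zeta> \<noteq> 0" "Im \<zeta> \<noteq> 0" "\<zeta> \<in> ball 0 (\<rho> / 2)" using z sub by auto
      have "g \<zeta> = (LINT p|\<mu>. 1 / (1 / \<zeta> - of_real (fst p)))"
        using g(4)[OF z0(3,2)] unfolding cauchy_transform_marginal1[OF pair_prob] by simp
      also have "\<dots> = (LINT p|\<mu>. \<zeta> * (1 / ((1 - \<zeta> * of_real (fst p)) * (1 - 0 * of_real (snd p)))))"
      proof (rule Bochner_Integration.integral_cong[OF refl])
        fix p :: "real \<times> real"
        have "1 / \<zeta> - of_real (fst p) = (1 - \<zeta> * of_real (fst p)) / \<zeta>" using z0 by (simp add: field_simps)
        then show "1 / (1 / \<zeta> - of_real (fst p)) =
          \<zeta> * (1 / ((1 - \<zeta> * of_real (fst p)) * (1 - 0 * of_real (snd p))))" by simp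
      qed
      also have "\<dots> = \<zeta> * biresolvent \<mu> \<zeta> 0"
        unfolding biresolvent_def by (rule Bochner_Integration.integral_mult_right_zero)
      finally show ?thesis .
    qed
  qed (use \<zeta> hol holomorphic_on_subset[OF g(1) sub] in
      \<open>auto intro!: open_Int open_Collect_less continuous_intros\<close>)
  have eq: "biresolvent \<mu> \<zeta> 0 = 1 + of_real \<epsilon> * R (g \<zeta>) 0" if \<zeta>: "\<zeta> \<in> ball 0 (\<rho> / 4)" for \<zeta>
  proof (cases "\<zeta> = 0")
    case True
    then show ?thesis using gb[OF \<zeta>] R_0_0 by (simp add: biresolvent_def \<mu>.prob_space)
  next
    case False
    then show ?thesis using gb[OF \<zeta>] g(3)[of \<zeta>] \<zeta> sub by auto
  qed
  have g2: "g \<zeta> \<in> ball 0 \<rho>" if "\<zeta> \<in> ball 0 (\<rho> / 4)" for \<zeta> using g(2) sub that by blast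
  show ?thesis using that[OF AE holomorphic_on_subset[OF g(1) sub] g2 gb eq g(5)] by blast
qed

end

text \<open>The one-variable identity theorem used twice: in u for each v in \<open>V\<close>, then
  in v for each u of the disc.\<close>

lemma identity_theorem_bidisc:
  assumes "open U" "U \<noteq> {}" "U \<subseteq> ball 0 d" "open V" "V \<noteq> {}" "V \<subseteq> ball (0::complex) d"
    and h1: "\<And>v. v \<in> ball 0 d \<Longrightarrow> (\<lambda>u. H u v) holomorphic_on ball 0 d"
    and h2: "\<And>u. u \<in> ball 0 d \<Longrightarrow> (\<lambda>v. H u v) holomorphic_on ball 0 d"
    and 0: "\<And>u v. u \<in> U \<Longrightarrow> v \<in> V \<Longrightarrow> H u v = 0"
    and u: "u \<in> ball 0 d" and v: "v \<in> ball 0 d"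
  shows "H u v = (0::complex)"
proof -
  have 1: "H u v = 0" if v: "v \<in> V" for v
    using analytic_continuation_open[OF assms(1) open_ball assms(2) convex_connected[OF convex_ball] assms(3) h1[of v] holomorphic_on_const[of 0] _ u]
      0[OF _ v] v assms(6) by blast
  show ?thesis
    using analytic_continuation_open[OF assms(4) open_ball assms(5) convex_connected[OF convex_ball] assms(6) h2[OF u] holomorphic_on_const[of 0] _ v]
      1 by blast
qed

context
  fixes \<mu> :: "(real \<times> real) measure" and \<alpha> \<beta> \<epsilon> :: real
  assumes \<epsilon>: "\<epsilon> > 0" and small: "\<epsilon> * B * \<rho> \<le> 1 / 4"
    and prob: "borel_prob \<mu>" and bfR: "is_bifree_R \<mu> \<alpha> \<beta> (\<lambda>z w. of_real \<epsilon> * R z w)"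
begin

text \<open>The inverse functions of both marginals appear as u times
  \<open>biresolvent \<mu> u 0\<close> and v times \<open>biresolvent \<mu> 0 v\<close>. Stolz
  angles only provide the open sets on which the two-variable identity is verified, before it
  spreads over the bidisc.\<close>

theorem bifree_identities:
  shows "R 0 0 = 0" and "AE p in \<mu>. \<bar>fst p\<bar> \<le> 2 / \<rho> \<and> \<bar>snd p\<bar> \<le> 2 / \<rho>"
    and "u \<in> ball 0 (\<rho> / 4) \<Longrightarrow> u * biresolvent \<mu> u 0 \<in> ball 0 \<rho>"
    and "u \<in> ball 0 (\<rho> / 4) \<Longrightarrow> biresolvent \<mu> u 0 = 1 + of_real \<epsilon> * R (u * biresolvent \<mu> u 0) 0"
    and "v \<in> ball 0 (\<rho> / 4) \<Longrightarrow> v * biresolvent \<mu> 0 v \<in> ball 0 \<rho>"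
    and "v \<in> ball 0 (\<rho> / 4) \<Longrightarrow> biresolvent \<mu> 0 v = 1 + of_real \<epsilon> * R 0 (v * biresolvent \<mu> 0 v)"
    and "u \<in> ball 0 (\<rho> / 4) \<Longrightarrow> v \<in> ball 0 (\<rho> / 4) \<Longrightarrow>
      biresolvent \<mu> u v * (1 - of_real \<epsilon> * (R (u * biresolvent \<mu> u 0) (v * biresolvent \<mu> 0 v)
        - R (u * biresolvent \<mu> u 0) 0 - R 0 (v * biresolvent \<mu> 0 v))) =
      biresolvent \<mu> u 0 * biresolvent \<mu> 0 v"
proof -
  obtain R1 R2 where pair: "bifree_pair \<mu> \<alpha> \<beta> (\<lambda>z w. of_real \<epsilon> * R z w) R1 R2"
    using bifree_R_pair[OF prob bfR] by blast
  interpret \<mu>: prob_space \<mu> using borel_probD(1)[OF prob] .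
  interpret sw: lipschitz_bidisc "\<lambda>z w. R w z" \<rho> B by (rule swap)
  let ?\<nu> = "swap_measure \<mu>"
  have pairsw: "bifree_pair ?\<nu> \<alpha> \<beta> (\<lambda>z w. of_real \<epsilon> * R w z) R2 R1"
    using bifree_pair_swap[OF pair] .
  show R00: "R 0 0 = 0" by (rule R_0_0[OF \<epsilon> small pair])
  obtain g where g: "AE p in \<mu>. \<bar>fst p\<bar> \<le> 2 / \<rho>"
    "g holomorphic_on ball 0 (\<rho> / 4)"
    "\<And>\<zeta>. \<zeta> \<in> ball 0 (\<rho> / 4) \<Longrightarrow> g \<zeta> \<in> ball 0 \<rho>"
    "\<And>\<zeta>. \<zeta> \<in> ball 0 (\<rho> / 4) \<Longrightarrow> g \<zeta> = \<zeta> * biresolvent \<mu> \<zeta> 0"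
    "\<And>\<zeta>. \<zeta> \<in> ball 0 (\<rho> / 4) \<Longrightarrow> biresolvent \<mu> \<zeta> 0 = 1 + of_real \<epsilon> * R (g \<zeta>) 0"
    "\<exists>U. open U \<and> U \<noteq> {} \<and> U \<subseteq> ball 0 (\<rho> / 4) \<and>
      (\<forall>\<zeta>\<in>U. g \<zeta> \<in> stolz_pair \<alpha> \<beta> \<and> 1 / g \<zeta> + R1 (g \<zeta>) = 1 / \<zeta>)"
    by (rule inverse_resolvent[OF \<epsilon> small pair]) blast
  obtain k where k: "AE p in ?\<nu>. \<bar>fst p\<bar> \<le> 2 / \<rho>"
    "k holomorphic_on ball 0 (\<rho> / 4)"
    "\<And>\<zeta>. \<zeta> \<in> ball 0 (\<rho> / 4) \<Longrightarrow> k \<zeta> \<in> ball 0 \<rho>"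
    "\<And>\<zeta>. \<zeta> \<in> ball 0 (\<rho> / 4) \<Longrightarrow> k \<zeta> = \<zeta> * biresolvent ?\<nu> \<zeta> 0"
    "\<And>\<zeta>. \<zeta> \<in> ball 0 (\<rho> / 4) \<Longrightarrow> biresolvent ?\<nu> \<zeta> 0 = 1 + of_real \<epsilon> * R 0 (k \<zeta>)"
    "\<exists>U. open U \<and> U \<noteq> {} \<and> U \<subseteq> ball 0 (\<rho> / 4) \<and>
      (\<forall>\<zeta>\<in>U. k \<zeta> \<in> stolz_pair \<alpha> \<beta> \<and> 1 / k \<zeta> + R2 (k \<zeta>) = 1 / \<zeta>)"
    by (rule sw.inverse_resolvent[OF \<epsilon> small pairsw]) blast
  note k' = k(4,5)[unfolded biresolvent_swap[OF prob]]
  have AEsnd: "AE p in \<mu>. \<bar>snd p\<bar> \<le> 2 / \<rho>"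
    using k(1) by (subst (asm) AE_swap[OF prob]) auto
  show AE: "AE p in \<mu>. \<bar>fst p\<bar> \<le> 2 / \<rho> \<and> \<bar>snd p\<bar> \<le> 2 / \<rho>"
    using g(1) AEsnd by eventually_elim auto
  show "u * biresolvent \<mu> u 0 \<in> ball 0 \<rho>"
    "biresolvent \<mu> u 0 = 1 + of_real \<epsilon> * R (u * biresolvent \<mu> u 0) 0" if "u \<in> ball 0 (\<rho> / 4)"
    by (rule g(3)[OF that, unfolded g(4)[OF that]], rule g(5)[OF that, unfolded g(4)[OF that]])
  show "v * biresolvent \<mu> 0 v \<in> ball 0 \<rho>"
    "biresolvent \<mu> 0 v = 1 + of_real \<epsilon> * R 0 (v * biresolvent \<mu> 0 v)" if "v \<in> ball 0 (\<rho> / 4)"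
    by (rule k(3)[OF that, unfolded k'(1)[OF that]], rule k'(2)[OF that, unfolded k'(1)[OF that]])
  have hol_u: "(\<lambda>u. biresolvent \<mu> u v) holomorphic_on ball 0 (\<rho> / 4)" if "v \<in> ball 0 (\<rho> / 4)" for v
    unfolding biresolvent_def using that by (intro holomorphic_biresolvent_aux[OF prob \<rho> g(1)] disjI2 AEsnd)
  have AEsnd': "AE p in ?\<nu>. \<bar>snd p\<bar> \<le> 2 / \<rho>"
    using g(1) by (subst AE_swap[OF prob]) auto
  have hol_v: "(\<lambda>v. biresolvent \<mu> u v) holomorphic_on ball 0 (\<rho> / 4)" if "u \<in> ball 0 (\<rho> / 4)" for u
    unfolding biresolvent_swap[OF prob, symmetric] unfolding biresolvent_def
    using that by (intro holomorphic_biresolvent_aux[OF borel_prob_swap[OF prob] \<rho> k(1)] disjI2 AEsnd')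
  \<comment> \<open>The relation of \<open>bifree_pair\<close> at the points g u and k v. As 1 / g u
    + R1 (g u) = 1 / u and likewise for v on the open sets, the Cauchy transform there becomes u v
    times the biresolvent.\<close>
  define H where "H u v = u * v * biresolvent \<mu> u v * (1 - of_real \<epsilon> * (R (g u) (k v) - R (g u) 0 - R 0 (k v))) - g u * k v" for u v
  have zero: "(0::complex) \<in> ball 0 \<rho>" using \<rho> by simp
  have H0: "H u v = 0" if u: "u \<in> ball 0 (\<rho> / 4)" and v: "v \<in> ball 0 (\<rho> / 4)" for u v
  proof -
    obtain U where U: "open U" "U \<noteq> {}" "U \<subseteq> ball 0 (\<rho> / 4)"
      "\<And>\<zeta>. \<zeta> \<in> U \<Longrightarrow> g \<zeta> \<in> stolz_pair \<alpha> \<beta> \<and> 1 / g \<zeta> + R1 (g \<zeta>) = 1 / \<zeta>" using g(6) by blast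
    obtain V where V: "open V" "V \<noteq> {}" "V \<subseteq> ball 0 (\<rho> / 4)"
      "\<And>\<zeta>. \<zeta> \<in> V \<Longrightarrow> k \<zeta> \<in> stolz_pair \<alpha> \<beta> \<and> 1 / k \<zeta> + R2 (k \<zeta>) = 1 / \<zeta>" using k(6) by blast
    show ?thesis
    proof (rule identity_theorem_bidisc[OF U(1-3) V(1-3) _ _ _ u v])
      fix v :: complex assume v: "v \<in> ball 0 (\<rho> / 4)"
      have c: "(\<lambda>u. R (g u) w) holomorphic_on ball 0 (\<rho> / 4)" if "w \<in> ball 0 \<rho>" for w
        by (rule holomorphic_on_compose_gen[OF g(2) hol1[OF that], unfolded comp_def]) (use g(3) in blast)
      show "(\<lambda>u. H u v) holomorphic_on ball 0 (\<rho> / 4)"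
        unfolding H_def by (intro holomorphic_intros hol_u c g(2) k(3) v zero)
    next
      fix u :: complex assume u: "u \<in> ball 0 (\<rho> / 4)"
      have c: "(\<lambda>v. R w (k v)) holomorphic_on ball 0 (\<rho> / 4)" if "w \<in> ball 0 \<rho>" for w
        by (rule holomorphic_on_compose_gen[OF k(2) hol2[OF that], unfolded comp_def]) (use k(3) in blast)
      show "(\<lambda>v. H u v) holomorphic_on ball 0 (\<rho> / 4)"
        unfolding H_def by (intro holomorphic_intros hol_v c k(2) g(3) u zero)
    next
      fix u v assume u: "u \<in> U" and v: "v \<in> V"
      have ub: "u \<in> ball 0 (\<rho> / 4)" and vb: "v \<in> ball 0 (\<rho> / 4)" using u v U V by auto
      have gu: "g u \<in> stolz_pair \<alpha> \<beta>" "1 / g u + R1 (g u) = 1 / u" using U(4)[OF u] by auto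
      have kv: "k v \<in> stolz_pair \<alpha> \<beta>" "1 / k v + R2 (k v) = 1 / v" using V(4)[OF v] by auto
      have u0: "u \<noteq> 0" and v0: "v \<noteq> 0"
        using stolz_pair_nonzero[OF gu(1)] stolz_pair_nonzero[OF kv(1)] g(4)[OF ub] k(4)[OF vb] by auto
      have R1: "g u * R1 (g u) = of_real \<epsilon> * R (g u) 0" by (rule R1_eq[OF \<epsilon> small pair gu(1) g(3)[OF ub]])
      have R2: "k v * R2 (k v) = of_real \<epsilon> * R 0 (k v)" by (rule sw.R1_eq[OF \<epsilon> small pairsw kv(1) k(3)[OF vb]])
      have "cauchy_transform2 \<mu> (1 / u) (1 / v) = (LINT p|\<mu>. (u * v) * (1 / ((1 - u * of_real (fst p)) * (1 - v * of_real (snd p)))))"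
        unfolding cauchy_transform2_def case_prod_unfold
      proof (rule Bochner_Integration.integral_cong[OF refl])
        fix p :: "real \<times> real"
        have "1 / u - of_real (fst p) = (1 - u * of_real (fst p)) / u" "1 / v - of_real (snd p) = (1 - v * of_real (snd p)) / v"
          using u0 v0 by (auto simp: field_simps)
        then show "1 / ((1 / u - of_real (fst p)) * (1 / v - of_real (snd p))) =
          (u * v) * (1 / ((1 - u * of_real (fst p)) * (1 - v * of_real (snd p))))" by simp
      qed
      also have "\<dots> = u * v * biresolvent \<mu> u v"
        unfolding biresolvent_def by (rule Bochner_Integration.integral_mult_right_zero)
      finally have "u * v * biresolvent \<mu> u v * (1 - (of_real \<epsilon> * R (g u) (k v) - of_real \<epsilon> * R (g u) 0 - of_real \<epsilon> * R 0 (k v))) = g u * k v"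
        using bifree_pair_equation[OF pair gu(1) kv(1)] unfolding gu(2) kv(2) R1 R2 by simp
      then show "H u v = 0" unfolding H_def by (simp only: right_diff_distrib) simp
    qed
  qed
  show "biresolvent \<mu> u v * (1 - of_real \<epsilon> * (R (u * biresolvent \<mu> u 0) (v * biresolvent \<mu> 0 v)
        - R (u * biresolvent \<mu> u 0) 0 - R 0 (v * biresolvent \<mu> 0 v))) =
      biresolvent \<mu> u 0 * biresolvent \<mu> 0 v"
    if u: "u \<in> ball 0 (\<rho> / 4)" and v: "v \<in> ball 0 (\<rho> / 4)"
  proof -
    have 1: "biresolvent \<mu> 0 0 = 1" by (simp add: biresolvent_def \<mu>.prob_space)
    \<comment> \<open>Off the axes the factor u v cancels. On them the identity degenerates, since
      \<open>R 0 0 = 0\<close> and the biresolvent at the origin is 1.\<close>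
    consider "u = 0" | "v = 0" | "u \<noteq> 0" "v \<noteq> 0" by blast
    then show ?thesis
    proof cases
      case 3
      have "u * v * (biresolvent \<mu> u v * (1 - of_real \<epsilon> * (R (g u) (k v) - R (g u) 0 - R 0 (k v)))) =
          u * v * (biresolvent \<mu> u 0 * biresolvent \<mu> 0 v)"
        using H0[OF u v] g(4)[OF u] k'(1)[OF v] unfolding H_def by (simp add: ac_simps)
      then have "biresolvent \<mu> u v * (1 - of_real \<epsilon> * (R (g u) (k v) - R (g u) 0 - R 0 (k v))) =
          biresolvent \<mu> u 0 * biresolvent \<mu> 0 v"
        using 3 by (simp only: mult_cancel_left) auto
      then show ?thesis unfolding g(4)[OF u] k'(1)[OF v] .
    qed (auto simp: R00 1)
  qed
qed

end

end

section \<open>Moments along the semigroup\<close>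

text \<open>The uniform geometric bound makes each sum differ from its constant term by at most 2 D
  K |w|, so convergence at one small w determines the constant terms up to e. The point w = 0 is
  left out because higher coefficients are reached by dividing by powers of w.\<close>

lemma constant_coefficient_tendsto:
  fixes a :: "'i \<Rightarrow> nat \<Rightarrow> 'a::{real_normed_field, banach}"
  assumes K: "K > 0" and \<eta>: "\<eta> > 0"
    and a: "\<forall>\<^sub>F i in F. \<forall>n. norm (a i n) \<le> D * K ^ n" and b: "\<And>n. norm (b n) \<le> D * K ^ n"
    and lim: "\<And>w. w \<noteq> 0 \<Longrightarrow> norm w < \<eta> \<Longrightarrow> ((\<lambda>i. \<Sum>n. a i n * w ^ n) \<longlongrightarrow> (\<Sum>n. b n * w ^ n)) F"
  shows "((\<lambda>i. a i 0) \<longlongrightarrow> b 0) F"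
proof (rule tendstoI)
  fix e :: real assume e: "e > 0"
  have D: "D \<ge> 0" using order_trans[OF norm_ge_zero b[of 0]] by simp
  \<comment> \<open>\<open>D + 1\<close> in place of \<open>D\<close> keeps \<open>q\<close>
    positive when D = 0.\<close>
  define q where "q = (D + 1) * K"
  have q: "q > 0" using D K by (simp add: q_def)
  define x where "x = min (\<eta> / 2) (min (1 / (2 * K)) (e / (8 * q)))"
  have "x \<le> \<eta> / 2" unfolding x_def by (rule min.cobounded1)
  moreover have "x \<le> 1 / (2 * K)" "x \<le> e / (8 * q)" "x > 0"
    unfolding x_def using K \<eta> e q by (simp_all add: min.coboundedI2)
  ultimately have x: "x > 0" "x < \<eta>" "x \<le> 1 / (2 * K)" "x \<le> e / (8 * q)"
    using \<eta> by auto
  have "2 * D * K * x \<le> 2 * q * x"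
    using x K D by (intro mult_right_mono) (auto simp: q_def)
  also have "\<dots> \<le> 2 * q * (e / (8 * q))" using x q by (intro mult_left_mono) auto
  also have "\<dots> = e / 4" using q by simp
  finally have small: "2 * D * K * x \<le> e / 4" .
  define w where "w = (of_real x :: 'a)"
  have w: "w \<noteq> 0" "norm w < \<eta>" "norm w \<le> 1 / (2 * K)" "norm w = x" using x by (auto simp: w_def)
  have "\<forall>\<^sub>F i in F. dist (\<Sum>n. a i n * w ^ n) (\<Sum>n. b n * w ^ n) < e / 2"
    using tendstoD[OF lim[OF w(1,2)], of "e / 2"] e by simp
  with a show "\<forall>\<^sub>F i in F. dist (a i 0) (b 0) < e"
  proof eventually_elim
    case (elim i)
    have 1: "norm ((\<Sum>n. a i n * w ^ n) - a i 0) \<le> e / 4"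
      using geometric_bound_sums(3)[OF K elim(1)[rule_format] w(3)] small w(4) by simp
    have 2: "norm ((\<Sum>n. b n * w ^ n) - b 0) \<le> e / 4"
      using geometric_bound_sums(3)[OF K b w(3)] small w(4) by simp
    have "norm (x - y) \<le> norm (x' - y') + norm (x' - x) + norm (y' - y)" for x x' y y' :: 'a
    proof -
      have "norm (x - y) = norm ((x' - y') - (x' - x) + (y' - y))" by simp
      also have "\<dots> \<le> norm ((x' - y') - (x' - x)) + norm (y' - y)" by (rule norm_triangle_ineq)
      also have "norm ((x' - y') - (x' - x)) \<le> norm (x' - y') + norm (x' - x)" by (rule norm_triangle_ineq4)
      finally show ?thesis by simp
    qed
    from this[of "a i 0" "b 0" "\<Sum>n. a i n * w ^ n" "\<Sum>n. b n * w ^ n"]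
    show ?case using 1 2 elim(2) unfolding dist_norm by linarith
  qed
qed

text \<open>Once all coefficients below n converge, subtracting their terms and dividing by w ^ n
  makes the coefficient of index n the constant one.\<close>

lemma coefficient_tendsto:
  fixes a :: "'i \<Rightarrow> nat \<Rightarrow> 'a::{real_normed_field, banach}"
  assumes K: "K > 0" and \<eta>: "\<eta> > 0"
    and a: "\<forall>\<^sub>F i in F. \<forall>n. norm (a i n) \<le> D * K ^ n" and b: "\<And>n. norm (b n) \<le> D * K ^ n"
    and lim: "\<And>w. w \<noteq> 0 \<Longrightarrow> norm w < \<eta> \<Longrightarrow> ((\<lambda>i. \<Sum>n. a i n * w ^ n) \<longlongrightarrow> (\<Sum>n. b n * w ^ n)) F"
  shows "((\<lambda>i. a i n) \<longlongrightarrow> b n) F"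
proof (induction n rule: less_induct)
  case (less n)
  have shift: "(\<Sum>k. c (n + k) * w ^ k) = ((\<Sum>k. c k * w ^ k) - (\<Sum>k<n. c k * w ^ k)) / w ^ n"
    if c: "\<And>k. norm (c k) \<le> D * K ^ k" and w: "w \<noteq> 0" "norm w \<le> 1 / (2 * K)" for c :: "nat \<Rightarrow> 'a" and w
  proof -
    have s: "summable (\<lambda>k. c k * w ^ k)"
      using summable_norm_cancel[OF geometric_bound_sums(1)[OF K c w(2)]] .
    have s': "summable (\<lambda>k. c (k + n) * w ^ k)"
    proof (rule summable_norm_cancel, rule geometric_bound_sums(1)[OF K _ w(2)])
      show "norm (c (k + n)) \<le> (D * K ^ n) * K ^ k" for k
        using c[of "k + n"] by (simp add: power_add ac_simps)
    qed
    have "(\<Sum>k. c k * w ^ k) - (\<Sum>k<n. c k * w ^ k) = (\<Sum>k. c (k + n) * w ^ (k + n))"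
      using suminf_split_initial_segment[OF s, of n] by simp
    also have "\<dots> = (\<Sum>k. c (k + n) * w ^ k) * w ^ n"
      by (subst suminf_mult2[OF s']) (simp add: power_add ac_simps)
    finally show ?thesis using w by (simp add: add.commute)
  qed
  have "((\<lambda>i. a i (n + 0)) \<longlongrightarrow> b (n + 0)) F"
  proof (rule constant_coefficient_tendsto[OF K, where a="\<lambda>i k. a i (n + k)" and b="\<lambda>k. b (n + k)"])
    show "min \<eta> (1 / (2 * K)) > 0" using K \<eta> by simp
    show "\<forall>\<^sub>F i in F. \<forall>k. norm (a i (n + k)) \<le> (D * K ^ n) * K ^ k"
      using a by eventually_elim (simp add: power_add[symmetric] mult.assoc)
    show "norm (b (n + k)) \<le> (D * K ^ n) * K ^ k" for k
      using b[of "n + k"] by (simp add: power_add ac_simps)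
    fix w :: 'a assume w: "w \<noteq> 0" "norm w < min \<eta> (1 / (2 * K))"
    have "((\<lambda>i. ((\<Sum>k. a i k * w ^ k) - (\<Sum>k<n. a i k * w ^ k)) / w ^ n)
      \<longlongrightarrow> ((\<Sum>k. b k * w ^ k) - (\<Sum>k<n. b k * w ^ k)) / w ^ n) F"
      using w less by (intro tendsto_intros lim) auto
    then have "((\<lambda>i. \<Sum>k. a i (n + k) * w ^ k) \<longlongrightarrow> ((\<Sum>k. b k * w ^ k) - (\<Sum>k<n. b k * w ^ k)) / w ^ n) F"
    proof (rule Lim_transform_eventually)
      show "\<forall>\<^sub>F i in F. ((\<Sum>k. a i k * w ^ k) - (\<Sum>k<n. a i k * w ^ k)) / w ^ n = (\<Sum>k. a i (n + k) * w ^ k)"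
        using a by eventually_elim (rule shift[symmetric], use w in auto)
    qed
    then show "((\<lambda>i. \<Sum>k. a i (n + k) * w ^ k) \<longlongrightarrow> (\<Sum>k. b (n + k) * w ^ k)) F"
      using shift[OF b, of w] w by simp
  qed
  then show ?case by simp
qed

text \<open>With v fixed, the inner sums are coefficients in u and converge by the one-variable
  result; applied once more, in v, it reaches the entries.\<close>

lemma coefficient_tendsto2:
  fixes a :: "'i \<Rightarrow> nat \<Rightarrow> nat \<Rightarrow> 'a::{real_normed_field, banach}"
  assumes K: "K > 0" and \<eta>: "\<eta> > 0" "\<eta> \<le> 1 / (2 * K)"
    and a: "\<forall>\<^sub>F i in F. \<forall>p q. norm (a i p q) \<le> D * K ^ (p + q)" and b: "\<And>p q. norm (b p q) \<le> D * K ^ (p + q)"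
    and lim: "\<And>u v. norm u < \<eta> \<Longrightarrow> norm v < \<eta> \<Longrightarrow>
      ((\<lambda>i. \<Sum>p. (\<Sum>q. a i p q * v ^ q) * u ^ p) \<longlongrightarrow> (\<Sum>p. (\<Sum>q. b p q * v ^ q) * u ^ p)) F"
  shows "((\<lambda>i. a i p q) \<longlongrightarrow> b p q) F"
proof (rule coefficient_tendsto[OF K \<eta>(1), where a="\<lambda>i q. a i p q" and b="\<lambda>q. b p q"])
  show "\<forall>\<^sub>F i in F. \<forall>q. norm (a i p q) \<le> (D * K ^ p) * K ^ q"
    using a by eventually_elim (simp add: power_add mult.assoc)
  show "norm (b p q) \<le> (D * K ^ p) * K ^ q" for q
    using b[of p q] by (simp add: power_add mult.assoc)
  fix v :: 'a assume v: "v \<noteq> 0" "norm v < \<eta>"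
  then have v': "norm v \<le> 1 / (2 * K)" using \<eta> by simp
  show "((\<lambda>i. \<Sum>q. a i p q * v ^ q) \<longlongrightarrow> (\<Sum>q. b p q * v ^ q)) F"
  proof (rule coefficient_tendsto[OF K \<eta>(1), where a="\<lambda>i p. \<Sum>q. a i p q * v ^ q" and b="\<lambda>p. \<Sum>q. b p q * v ^ q"])
    have bd: "norm (\<Sum>q. c p q * v ^ q) \<le> (2 * D) * K ^ p"
      if "\<And>p q. norm (c p q) \<le> D * K ^ (p + q)" for c :: "nat \<Rightarrow> nat \<Rightarrow> 'a" and p
    proof -
      have "norm (c p q) \<le> (D * K ^ p) * K ^ q" for q
        using that[of p q] by (simp add: power_add mult.assoc)
      from geometric_bound_sums(2)[OF K this v'] show ?thesis by simp
    qed
    show "\<forall>\<^sub>F i in F. \<forall>p. norm (\<Sum>q. a i p q * v ^ q) \<le> (2 * D) * K ^ p"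
      using a by eventually_elim (use bd in blast)
    show "norm (\<Sum>q. b p q * v ^ q) \<le> (2 * D) * K ^ p" for p using bd b by blast
  qed (use lim v in auto)
qed

text \<open>Termwise integration of a geometric series dominated by D / 2 ^ n. The factor
  \<open>k\<close> allows two uses: with the resolvent of the other coordinate, and with a power of
  the other coordinate.\<close>

lemma moment_expansion:
  fixes k :: "'a \<Rightarrow> complex" and x :: "'a \<Rightarrow> real"
  assumes "finite_measure M" and k: "k \<in> borel_measurable M" and x: "x \<in> borel_measurable M"
    and K: "K > 0" and xK: "AE p in M. \<bar>x p\<bar> \<le> K" and kb: "AE p in M. norm (k p) \<le> D"
    and u: "norm u \<le> 1 / (2 * K)"
  shows "(\<lambda>n. (LINT p|M. of_real (x p) ^ n * k p) * u ^ n) sums (LINT p|M. k p / (1 - u * of_real (x p)))"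
proof -
  interpret finite_measure M by fact
  note [measurable] = k x
  define f where "f n p = of_real (x p) ^ n * k p * u ^ n" for n p
  have ux: "AE p in M. norm (of_real (x p) * u) \<le> 1 / 2 \<and> norm (k p) \<le> D"
    using xK kb
  proof eventually_elim
    case (elim p)
    have "norm (of_real (x p) * u) \<le> K * (1 / (2 * K))"
      unfolding norm_mult using elim u K by (intro mult_mono) auto
    then show ?case using K elim by simp
  qed
  have fb: "AE p in M. \<forall>n. norm (f n p) \<le> (1 / 2) ^ n * D"
    using ux
  proof eventually_elim
    case (elim p)
    show ?case
    proof
      fix n
      have "norm (f n p) = norm (of_real (x p) * u) ^ n * norm (k p)"
        by (simp add: f_def norm_mult norm_power power_mult_distrib)
      also have "\<dots> \<le> (1 / 2) ^ n * D" using elim by (intro mult_mono power_mono) auto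
      finally show "norm (f n p) \<le> (1 / 2) ^ n * D" .
    qed
  qed
  have fi: "integrable M (f n)" for n
  proof (rule integrable_const_bound)
    show "AE p in M. norm (f n p) \<le> (1 / 2) ^ n * D" using fb by eventually_elim blast
    show "f n \<in> borel_measurable M" unfolding f_def by measurable
  qed
  have s2: "summable (\<lambda>n. (1 / 2) ^ n * D)" by (intro summable_mult2 summable_geometric) auto
  have "(\<lambda>n. LINT p|M. f n p) sums (LINT p|M. (\<Sum>n. f n p))"
  proof (rule sums_integral[OF fi])
    show "AE p in M. summable (\<lambda>n. norm (f n p))"
      using fb
    proof eventually_elim
      case (elim p)
      then show ?case using s2 by (intro summable_comparison_test'[OF s2, of 0]) auto
    qed
    show "summable (\<lambda>n. LINT p|M. norm (f n p))"
    proof (rule summable_comparison_test'[of "\<lambda>n. (1 / 2) ^ n * D * measure M (space M)" 0])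
      show "summable (\<lambda>n. (1 / 2) ^ n * D * measure M (space M))" using s2 by (rule summable_mult2)
      fix n
      have "(LINT p|M. norm (f n p)) \<le> (LINT p|M. (1 / 2) ^ n * D)"
        using fb fi by (intro integral_mono_AE) (auto intro: integrable_norm)
      then show "norm (LINT p|M. norm (f n p)) \<le> (1 / 2) ^ n * D * measure M (space M)"
        by (simp add: ac_simps)
    qed
  qed
  also have "(LINT p|M. (\<Sum>n. f n p)) = (LINT p|M. k p / (1 - u * of_real (x p)))"
  proof (rule integral_cong_AE)
    show "AE p in M. (\<Sum>n. f n p) = k p / (1 - u * of_real (x p))"
      using ux
    proof eventually_elim
      case (elim p)
      have "(\<lambda>n. (of_real (x p) * u) ^ n * k p) sums (1 / (1 - of_real (x p) * u) * k p)"
        using elim by (intro sums_mult2 geometric_sums) auto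
      then have "(\<lambda>n. f n p) sums (k p / (1 - u * of_real (x p)))"
        by (simp add: f_def power_mult_distrib ac_simps)
      then show ?case by (rule sums_unique[symmetric])
    qed
  qed (auto simp: f_def)
  also have "(\<lambda>n. LINT p|M. f n p) = (\<lambda>n. (LINT p|M. of_real (x p) ^ n * k p) * u ^ n)"
    unfolding f_def by (simp add: Bochner_Integration.integral_mult_left_zero)
  finally show ?thesis .
qed

lemma biresolvent_expansion:
  assumes \<mu>: "borel_prob \<mu>" and K: "K > 0"
    and AE: "AE p in \<mu>. \<bar>fst p\<bar> \<le> K \<and> \<bar>snd p\<bar> \<le> K"
    and u: "norm u \<le> 1 / (2 * K)" and v: "norm v \<le> 1 / (2 * K)"
  shows "(\<lambda>p. (\<Sum>q. of_real (LINT x|\<mu>. fst x ^ p * snd x ^ q) * v ^ q) * u ^ p) sums biresolvent \<mu> u v"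
proof -
  interpret prob_space \<mu> using borel_probD(1)[OF \<mu>] .
  note [measurable] = fst_measurable[OF \<mu>] snd_measurable[OF \<mu>]
  have A1: "AE p in \<mu>. \<bar>fst p\<bar> \<le> K" and A2: "AE p in \<mu>. \<bar>snd p\<bar> \<le> K" using AE by auto
  have rb: "AE p in \<mu>. norm (1 / (1 - v * of_real (snd p))) \<le> 2"
    using A2
  proof eventually_elim
    case (elim p)
    have "norm (v * of_real (snd p)) \<le> (1 / (2 * K)) * K"
      unfolding norm_mult using elim v K by (intro mult_mono) auto
    then have "norm (1 - v * of_real (snd p)) \<ge> 1 / 2"
      using norm_triangle_ineq2[of 1 "v * of_real (snd p)"] K by simp
    then show ?case by (simp add: norm_divide divide_le_eq)
  qed
  have inner: "(LINT x|\<mu>. of_real (fst x) ^ p * (1 / (1 - v * of_real (snd x)))) =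
      (\<Sum>q. of_real (LINT x|\<mu>. fst x ^ p * snd x ^ q) * v ^ q)" for p
  proof -
    have "AE x in \<mu>. norm (of_real (fst x) ^ p :: complex) \<le> K ^ p"
      using A1 by eventually_elim (auto simp: norm_power intro: power_mono)
    from sums_unique[OF moment_expansion[OF finite_measure_axioms _ _ K A2 this v]]
    have "(LINT x|\<mu>. of_real (fst x) ^ p / (1 - v * of_real (snd x))) =
      (\<Sum>q. (LINT x|\<mu>. of_real (snd x) ^ q * of_real (fst x) ^ p) * v ^ q)" by simp
    also have "(\<lambda>q. LINT x|\<mu>. of_real (snd x) ^ q * of_real (fst x) ^ p :: complex) =
      (\<lambda>q. of_real (LINT x|\<mu>. fst x ^ p * snd x ^ q))"
      by (simp add: integral_complex_of_real[symmetric] mult.commute)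
    finally show ?thesis by simp
  qed
  show ?thesis
    using moment_expansion[OF finite_measure_axioms _ _ K A1 rb u]
    unfolding inner by (simp add: biresolvent_def mult.commute divide_divide_eq_left)
qed

section \<open>A space-filling curve\<close>

text \<open>For digits e k in {0, 1}, the point of the Cantor set with ternary digits 2 e k.\<close>

definition ternary :: "(nat \<Rightarrow> real) \<Rightarrow> real" where
  "ternary e = (\<Sum>k. 2 * e k / 3 ^ Suc k)"

lemma ternary_summable:
  assumes "\<And>k. e k \<in> {0, 1 :: real}"
  shows "summable (\<lambda>k. 2 * e k / 3 ^ Suc k)"
proof (rule summable_comparison_test'[of "\<lambda>k. (2 / 3) * (1 / 3) ^ k" 0])
  show "summable (\<lambda>k. (2 / 3) * (1 / 3 :: real) ^ k)" by (intro summable_mult summable_geometric) auto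
  show "norm (2 * e k / 3 ^ Suc k) \<le> (2 / 3) * (1 / 3) ^ k" for k
    using assms[of k] by (auto simp: power_divide)
qed

lemma ternary_bounds:
  assumes e: "\<And>k. e k \<in> {0, 1 :: real}"
  shows "0 \<le> ternary e" "ternary e \<le> 1"
proof -
  have e01: "0 \<le> e k" "e k \<le> 1" for k using e[of k] by auto
  show "0 \<le> ternary e"
    unfolding ternary_def using e01 by (intro suminf_nonneg ternary_summable e) auto
  have s: "(\<lambda>k. (2 / 3) * (1 / 3 :: real) ^ k) sums ((2 / 3) * (1 / (1 - 1 / 3)))"
    by (intro sums_mult geometric_sums) auto
  have "ternary e \<le> (\<Sum>k. (2 / 3) * (1 / 3 :: real) ^ k)"
    unfolding ternary_def using e01 s
    by (intro suminf_le ternary_summable e) (auto simp: sums_iff power_divide divide_right_mono)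
  also have "\<dots> = 1" using s by (simp add: sums_iff)
  finally show "ternary e \<le> 1" .
qed

lemma ternary_Suc:
  assumes e: "\<And>k. e k \<in> {0, 1 :: real}"
  shows "3 * ternary e = 2 * e 0 + ternary (\<lambda>k. e (Suc k))"
proof -
  have "ternary e = 2 * e 0 / 3 + (\<Sum>k. 2 * e (Suc k) / 3 ^ Suc (Suc k))"
    unfolding ternary_def using suminf_split_head[OF ternary_summable[of e, OF e]] by simp
  also have "(\<Sum>k. 2 * e (Suc k) / 3 ^ Suc (Suc k)) = ternary (\<lambda>k. e (Suc k)) / 3"
    unfolding ternary_def using suminf_divide[OF ternary_summable[of "\<lambda>k. e (Suc k)"], of 3] e by simp
  finally show ?thesis by simp
qed

text \<open>All ternary digits are 0 or 2, so moving the point by n places splits off an even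
  integer, which functions of period 2 do not see.\<close>

lemma ternary_shift:
  assumes e: "\<And>k. e k \<in> {0, 1 :: real}"
  shows "\<exists>m :: int. 3 ^ n * ternary e = 2 * of_int m + ternary (\<lambda>k. e (n + k))"
proof (induction n)
  case (Suc n)
  then obtain m :: int where m: "3 ^ n * ternary e = 2 * of_int m + ternary (\<lambda>k. e (n + k))" by blast
  obtain b :: int where b: "e n = of_int b" using e[of n] by (metis insertE of_int_0 of_int_1 singletonD)
  have "3 ^ Suc n * ternary e = 3 * (2 * of_int m + ternary (\<lambda>k. e (n + k)))" using m by simp
  also have "\<dots> = 2 * of_int (3 * m + b) + ternary (\<lambda>k. e (Suc n + k))"
    using ternary_Suc[of "\<lambda>k. e (n + k)"] e b by (simp add: algebra_simps)
  finally show ?case by blast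
qed (auto intro!: exI[of _ 0])

text \<open>Schoenberg's auxiliary function: even, of period 2, equal to 0 on [0, 1/3] and to 1 on
  [2/3, 1]. Clipping a cosine gives continuity and periodicity without a piecewise definition; the
  values 1/2 and -1/2 of the cosine at pi/3 and 2 pi/3 explain the shift by 1/2.\<close>

definition hat :: "real \<Rightarrow> real" where
  "hat x = max 0 (min 1 (1 / 2 - cos (pi * x)))"

lemma hat_bounds: "0 \<le> hat x" "hat x \<le> 1"
  unfolding hat_def by auto

lemma continuous_hat: "continuous_on A (\<lambda>x. hat (c * x))"
  unfolding hat_def by (intro continuous_intros)

lemma hat_periodic: "hat (2 * of_int m + x) = hat x"
proof -
  have "pi * (2 * of_int m + x) = pi * x + of_int m * (2 * pi)" by (simp add: algebra_simps)
  then have "cos (pi * (2 * of_int m + x)) = cos (pi * x)"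
    by (simp only: cos_add) (simp add: mult.commute[of "of_int m"])
  then show ?thesis by (simp add: hat_def)
qed

text \<open>The tail after n places lies in [0, 1/3] or in [2/3, 1] according to its leading digit,
  and \<open>hat\<close> is constant on each of these intervals.\<close>

lemma hat_ternary:
  assumes e: "\<And>k. e k \<in> {0, 1 :: real}"
  shows "hat (3 ^ n * ternary e) = e n"
proof -
  let ?T = "ternary (\<lambda>k. e (n + k))"
  have S: "3 * ?T = 2 * e n + ternary (\<lambda>k. e (n + Suc k))"
    using ternary_Suc[of "\<lambda>k. e (n + k)"] e by simp
  have b: "0 \<le> ternary (\<lambda>k. e (n + Suc k))" "ternary (\<lambda>k. e (n + Suc k)) \<le> 1"
    using ternary_bounds[of "\<lambda>k. e (n + Suc k)"] e by auto
  have "hat (3 ^ n * ternary e) = hat ?T"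
    using ternary_shift[of e n, OF e] hat_periodic by auto
  also have "hat ?T = e n"
  proof (cases "e n = 0")
    case True
    have T: "0 \<le> ?T" "?T \<le> 1 / 3" using S b True by auto
    have "cos (pi / 3) \<le> cos (pi * ?T)" using T by (intro cos_monotone_0_pi_le) auto
    then show ?thesis using True by (simp add: hat_def cos_60)
  next
    case False
    then have en: "e n = 1" using e[of n] by auto
    have T: "2 / 3 \<le> ?T" "?T \<le> 1" using S b en by auto
    have "pi * (2 / 3) \<le> pi * ?T" using T by (intro mult_left_mono) auto
    then have "cos (pi * ?T) \<le> cos (2 * pi / 3)" using T by (intro cos_monotone_0_pi_le) (auto simp: mult.commute)
    then show ?thesis using en by (simp add: hat_def cos_120)
  qed
  finally show ?thesis .
qed

text \<open>The binary digit of a that carries the weight 1 / 2 ^ (k + 1).\<close>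

definition bit :: "real \<Rightarrow> nat \<Rightarrow> real" where
  "bit a k = of_int (\<lfloor>2 ^ Suc k * a\<rfloor> - 2 * \<lfloor>2 ^ k * a\<rfloor>)"

lemma bit_01: "bit a k \<in> {0, 1}"
proof -
  have "2 * \<lfloor>2 ^ k * a\<rfloor> \<le> \<lfloor>2 ^ Suc k * a\<rfloor>" "\<lfloor>2 ^ Suc k * a\<rfloor> < 2 * \<lfloor>2 ^ k * a\<rfloor> + 2"
    by (simp_all add: le_floor_iff floor_less_iff mult.assoc) linarith+
  then have "\<lfloor>2 ^ Suc k * a\<rfloor> - 2 * \<lfloor>2 ^ k * a\<rfloor> = 0 \<or> \<lfloor>2 ^ Suc k * a\<rfloor> - 2 * \<lfloor>2 ^ k * a\<rfloor> = 1" by linarith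
  then show ?thesis unfolding bit_def by auto
qed

text \<open>The partial sums telescope to the binary truncations of a. For 0 \<le> a < 1 the integer
  part, at which the telescope starts, is 0.\<close>

lemma bit_sums:
  assumes "0 \<le> a" "a < 1"
  shows "(\<lambda>k. bit a k / 2 ^ Suc k) sums a"
proof -
  have partial: "(\<Sum>k<n. bit a k / 2 ^ Suc k) = of_int \<lfloor>2 ^ n * a\<rfloor> / 2 ^ n" for n
  proof (induction n)
    case 0
    have "\<lfloor>a\<rfloor> = 0" using assms by (simp add: floor_eq_iff)
    then show ?case by simp
  next
    case (Suc n)
    then show ?case by (simp add: bit_def field_simps)
  qed
  have "(\<lambda>n. of_int \<lfloor>2 ^ n * a\<rfloor> / 2 ^ n) \<longlonglongrightarrow> a"
  proof (rule tendsto_sandwich)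
    show "\<forall>\<^sub>F n in sequentially. a - (1 / 2) ^ n \<le> of_int \<lfloor>2 ^ n * a\<rfloor> / 2 ^ n"
    proof (intro always_eventually allI)
      fix n
      have "2 ^ n * a - 1 \<le> of_int \<lfloor>2 ^ n * a\<rfloor>" by linarith
      then have "(2 ^ n * a - 1) / 2 ^ n \<le> of_int \<lfloor>2 ^ n * a\<rfloor> / 2 ^ n" by (intro divide_right_mono) auto
      then show "a - (1 / 2) ^ n \<le> of_int \<lfloor>2 ^ n * a\<rfloor> / 2 ^ n" by (simp add: diff_divide_distrib power_divide)
    qed
    show "\<forall>\<^sub>F n in sequentially. of_int \<lfloor>2 ^ n * a\<rfloor> / 2 ^ n \<le> a"
    proof (intro always_eventually allI)
      fix n
      have "of_int \<lfloor>2 ^ n * a\<rfloor> \<le> 2 ^ n * a" by linarith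
      then have "of_int \<lfloor>2 ^ n * a\<rfloor> / 2 ^ n \<le> (2 ^ n * a) / 2 ^ n" by (intro divide_right_mono) auto
      then show "of_int \<lfloor>2 ^ n * a\<rfloor> / 2 ^ n \<le> a" by simp
    qed
    have "(\<lambda>n. a - (1 / 2) ^ n) \<longlonglongrightarrow> a - 0" by (intro tendsto_intros LIMSEQ_realpow_zero) auto
    then show "(\<lambda>n. a - (1 / 2) ^ n) \<longlonglongrightarrow> a" by simp
  qed simp
  then show ?thesis unfolding sums_def partial .
qed

text \<open>Schoenberg's space-filling curve. Its coordinates read off the even and the odd ternary
  digits, so that it maps onto the square, with a Borel right inverse.\<close>

definition curve :: "real \<Rightarrow> real \<Rightarrow> real" where
  "curve c t = (\<Sum>k. hat (c * 9 ^ k * t) / 2 ^ Suc k)"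

lemma curve_summand_bound: "norm (hat (c * 9 ^ k * t) / 2 ^ Suc k) \<le> (1 / 2) * (1 / 2) ^ k"
  using hat_bounds[of "c * 9 ^ k * t"] by (simp add: power_divide divide_right_mono)

lemma curve_summable_bound: "summable (\<lambda>k. (1 / 2) * (1 / 2 :: real) ^ k)"
  by (intro summable_mult summable_geometric) auto

lemma curve_continuous: "continuous_on UNIV (curve c)"
proof (rule uniform_limit_theorem)
  show "uniform_limit UNIV (\<lambda>n t. \<Sum>k<n. hat (c * 9 ^ k * t) / 2 ^ Suc k) (curve c) sequentially"
    unfolding curve_def[abs_def]
    by (rule Weierstrass_m_test[OF curve_summand_bound curve_summable_bound])
  show "\<forall>\<^sub>F n in sequentially. continuous_on UNIV (\<lambda>t. \<Sum>k<n. hat (c * 9 ^ k * t) / 2 ^ Suc k)"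
    by (intro always_eventually allI continuous_intros continuous_hat) auto
qed simp

lemma curve_bounds: "0 \<le> curve c t" "curve c t \<le> 1"
proof -
  have s: "summable (\<lambda>k. hat (c * 9 ^ k * t) / 2 ^ Suc k)"
    by (rule summable_comparison_test'[OF curve_summable_bound, of 0]) (rule curve_summand_bound)
  show "0 \<le> curve c t" unfolding curve_def using s hat_bounds by (intro suminf_nonneg) auto
  have "curve c t \<le> (\<Sum>k. (1 / 2) * (1 / 2 :: real) ^ k)"
    unfolding curve_def 
    by (intro suminf_le s curve_summable_bound order_trans[OF abs_ge_self curve_summand_bound[unfolded real_norm_def]])
  also have "\<dots> = 1" by (subst suminf_mult) (auto simp: suminf_geometric)
  finally show "curve c t \<le> 1" .
qed

text \<open>Interleaving lets one real number store both coordinates of a point of the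
  square.\<close>

definition digits :: "real \<times> real \<Rightarrow> nat \<Rightarrow> real" where
  "digits x k = (if even k then bit (fst x) (k div 2) else bit (snd x) (k div 2))"

lemma digits_01: "digits x k \<in> {0, 1}"
  unfolding digits_def using bit_01 by auto

text \<open>Multiplication by 9 ^ k or by 3 * 9 ^ k brings digit 2 k or digit 2 k + 1 to the front;
  hence the parameters 1 and 3 of \<open>curve\<close>.\<close>

lemma curve_ternary:
  assumes "0 \<le> fst x" "fst x < 1" "0 \<le> snd x" "snd x < 1"
  shows "curve 1 (ternary (digits x)) = fst x" "curve 3 (ternary (digits x)) = snd x"
proof -
  have "hat (1 * 9 ^ k * ternary (digits x)) = bit (fst x) k" for k
    using hat_ternary[of "digits x" "2 * k"] digits_01 by (simp add: power_mult digits_def)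
  then show "curve 1 (ternary (digits x)) = fst x"
    using bit_sums[OF assms(1,2)] by (simp add: curve_def sums_iff)
  have "hat (3 * 9 ^ k * ternary (digits x)) = bit (snd x) k" for k
    using hat_ternary[of "digits x" "Suc (2 * k)"] digits_01 by (simp add: power_mult digits_def)
  then show "curve 3 (ternary (digits x)) = snd x"
    using bit_sums[OF assms(3,4)] by (simp add: curve_def sums_iff)
qed

lemma digits_measurable: "(\<lambda>x. ternary (digits x)) \<in> borel_measurable borel"
proof -
  have "(\<lambda>x. digits x k) \<in> borel_measurable borel" for k
    unfolding digits_def bit_def by (cases "even k") (simp_all, measurable)
  then show ?thesis unfolding ternary_def by measurable
qed

lemma space_filling_curve:
  fixes c :: real
  assumes c: "c > 0"
  obtains \<Phi> :: "real \<Rightarrow> real \<times> real" and \<Psi> :: "real \<times> real \<Rightarrow> real"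
  where "continuous_on UNIV \<Phi>" "\<Psi> \<in> borel_measurable borel"
    "\<And>x. \<bar>fst x\<bar> \<le> c \<Longrightarrow> \<bar>snd x\<bar> \<le> c \<Longrightarrow> \<Phi> (\<Psi> x) = x" "\<And>x. 0 \<le> \<Psi> x \<and> \<Psi> x \<le> 1"
    "\<And>t. \<bar>fst (\<Phi> t)\<bar> \<le> 2 * c \<and> \<bar>snd (\<Phi> t)\<bar> \<le> 2 * c"
proof -
  \<comment> \<open>Maps the box of half-width c into [1/4, 3/4] in each coordinate, safely inside
    the half-open square where binary expansions are used. The price is that the curve only stays in
    the box of half-width 2 c.\<close>
  define sc where "sc x = ((fst x + 2 * c) / (4 * c), (snd x + 2 * c) / (4 * c))" for x :: "real \<times> real"
  define \<Phi> where "\<Phi> t = (4 * c * curve 1 t - 2 * c, 4 * c * curve 3 t - 2 * c)" for t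
  define \<Psi> where "\<Psi> x = ternary (digits (sc x))" for x
  show ?thesis
  proof (rule that[of \<Phi> \<Psi>])
    show "continuous_on UNIV \<Phi>" unfolding \<Phi>_def by (intro continuous_intros curve_continuous)
    have "sc \<in> borel_measurable borel" unfolding sc_def using c by (intro borel_measurable_continuous_onI continuous_intros) auto
    then show "\<Psi> \<in> borel_measurable borel" unfolding \<Psi>_def using digits_measurable by (rule measurable_compose)
    show "0 \<le> \<Psi> x \<and> \<Psi> x \<le> 1" for x unfolding \<Psi>_def using ternary_bounds[of "digits (sc x)"] digits_01 by blast
    show "\<Phi> (\<Psi> x) = x" if "\<bar>fst x\<bar> \<le> c" "\<bar>snd x\<bar> \<le> c" for x
    proof -
      have "0 \<le> fst (sc x)" "fst (sc x) < 1" "0 \<le> snd (sc x)" "snd (sc x) < 1"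
        using that c by (auto simp: sc_def field_simps abs_le_iff)
      from curve_ternary[OF this] show ?thesis
        using c by (auto simp: \<Phi>_def \<Psi>_def sc_def prod_eq_iff)
    qed
    have "\<bar>4 * c * y - 2 * c\<bar> \<le> 2 * c" if "0 \<le> y" "y \<le> 1" for y
      using mult_left_mono[OF that(2), of "4 * c"] mult_nonneg_nonneg[of "4 * c" y] that c by (auto simp: abs_le_iff)
    then show "\<bar>fst (\<Phi> t)\<bar> \<le> 2 * c \<and> \<bar>snd (\<Phi> t)\<bar> \<le> 2 * c" for t
      unfolding \<Phi>_def using curve_bounds by simp
  qed
qed

section \<open>Choice of radii and the family of laws\<close>

lemma (in bidisc_series) lipschitz_bidisc:
  assumes A: "A \<ge> 0" "\<And>m n. \<bar>\<kappa> m n\<bar> \<le> A * (2 / r) ^ (m + n)" and \<rho>: "0 < \<rho>" "\<rho> \<le> r / 8"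
  shows "lipschitz_bidisc R \<rho> (4 * A / (r / 8))"
proof
  interpret sw: bidisc_series "\<lambda>z w. R w z" "\<lambda>m n. \<kappa> n m" r by (rule swap)
  show "\<rho> > 0" by fact
  show "4 * A / (r / 8) \<ge> 0" using A r_pos by simp
  have sub: "ball 0 \<rho> \<subseteq> (ball 0 (r / 4) :: complex set)" using \<rho> r_pos by (intro subset_ball) linarith
  show "(\<lambda>z. R z w) holomorphic_on ball 0 \<rho>" if "w \<in> ball 0 \<rho>" for w
    using sub that by (intro holomorphic_on_subset[OF holomorphic_left sub]) auto
  show "(\<lambda>w. R z w) holomorphic_on ball 0 \<rho>" if "z \<in> ball 0 \<rho>" for z
    using sub that by (intro holomorphic_on_subset[OF sw.holomorphic_left sub]) auto
  fix z z' w w' :: complex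
  assume zw: "z \<in> ball 0 \<rho>" "z' \<in> ball 0 \<rho>" "w \<in> ball 0 \<rho>" "w' \<in> ball 0 \<rho>"
  have A': "\<bar>\<kappa> n m\<bar> \<le> A * (2 / r) ^ (m + n)" for m n using A(2)[of n m] by (simp add: add.commute)
  have "norm (R z w - R z' w') \<le> norm (R z w - R z' w) + norm (R z' w - R z' w')"
    using norm_triangle_ineq[of "R z w - R z' w" "R z' w - R z' w'"] by simp
  also have "\<dots> \<le> 4 * A / (r / 8) * norm (z - z') + 4 * A / (r / 8) * norm (w - w')"
    using zw \<rho> r_pos by (intro add_mono Lipschitz_left[OF A(2)] sw.Lipschitz_left[OF A']) auto
  finally show "norm (R z w - R z' w') \<le> 4 * A / (r / 8) * (norm (z - z') + norm (w - w'))"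
    by (simp add: distrib_left)
qed

text \<open>The Lipschitz constant comes from the coefficient bound alone, so the radius can be
  shrunk afterwards to meet E B \<rho> \<le> 1 / 4. \<open>B + 1\<close> avoids a division by
  0.\<close>

lemma (in bidisc_series) choose_radius:
  assumes E: "E > 0"
  shows "\<exists>\<rho> B. \<rho> \<le> r / 8 \<and> E * B * \<rho> \<le> 1 / 4 \<and> lipschitz_bidisc R \<rho> B"
proof -
  obtain A where A: "A \<ge> 0" "\<And>m n. \<bar>\<kappa> m n\<bar> \<le> A * (2 / r) ^ (m + n)" using coefficient_bound by blast
  define B where "B = 4 * A / (r / 8)"
  define q where "q = E * (B + 1)"
  define \<rho> where "\<rho> = min (r / 8) (1 / (4 * q))"
  have B: "B \<ge> 0" using A r_pos by (simp add: B_def)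
  have q: "q > 0" using B E by (simp add: q_def)
  have \<rho>: "\<rho> > 0" "\<rho> \<le> r / 8" "\<rho> \<le> 1 / (4 * q)"
    unfolding \<rho>_def using q r_pos by simp_all
  have "E * B * \<rho> \<le> q * \<rho>" using \<rho> B E by (intro mult_right_mono) (auto simp: q_def)
  also have "\<dots> \<le> q * (1 / (4 * q))" using \<rho> q by (intro mult_left_mono) auto
  also have "\<dots> = 1 / 4" using q by simp
  finally show ?thesis using lipschitz_bidisc[OF A \<rho>(1,2)] \<rho>(2) unfolding B_def by blast
qed

text \<open>The semigroup tied to one fixed \<open>R\<close>, on Stolz angles that may vary with
  \<epsilon>.\<close>

locale bifree_family = bidisc_series +
  fixes N :: "real \<Rightarrow> (real \<times> real) measure"
  assumes N: "\<And>\<epsilon>. \<epsilon> > 0 \<Longrightarrow> borel_prob (N \<epsilon>)"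
    and NR: "\<And>\<epsilon>. \<epsilon> > 0 \<Longrightarrow> \<exists>\<alpha> \<beta>. is_bifree_R (N \<epsilon>) \<alpha> \<beta> (\<lambda>z w. of_real \<epsilon> * R z w)"
begin

text \<open>The radius is chosen for this \<epsilon> alone, so the box may grow with \<epsilon>.
  This also covers \<epsilon> > 1, whereas the common radius introduced next is adapted to
  \<epsilon> \<le> 1.\<close>

lemma AE_bounded:
  assumes "\<epsilon> > 0"
  shows "\<exists>c. AE p in N \<epsilon>. \<bar>fst p\<bar> \<le> c \<and> \<bar>snd p\<bar> \<le> c"
proof -
  obtain \<rho> B where "\<epsilon> * B * \<rho> \<le> 1 / 4" and l: "lipschitz_bidisc R \<rho> B"
    using choose_radius[OF assms] by blast
  then interpret lipschitz_bidisc R \<rho> B by simp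
  show ?thesis
    using bifree_identities(2)[OF assms \<open>\<epsilon> * B * \<rho> \<le> 1 / 4\<close> N[OF assms]] NR[OF assms] by blast
qed

end

text \<open>One radius for all \<epsilon> \<le> 1, since the condition \<epsilon> B \<rho> \<le> 1 /
  4 is strongest at \<epsilon> = 1.\<close>

locale bifree_family_radius = bifree_family + lipschitz_bidisc R \<rho> B for \<rho> B +
  assumes \<rho>_le: "\<rho> \<le> r / 8" and B\<rho>: "B * \<rho> \<le> 1 / 4"
begin

lemma family_identities:
  assumes \<epsilon>: "0 < \<epsilon>" "\<epsilon> \<le> 1"
  shows "AE p in N \<epsilon>. \<bar>fst p\<bar> \<le> 2 / \<rho> \<and> \<bar>snd p\<bar> \<le> 2 / \<rho>"
    and "u \<in> ball 0 (\<rho> / 4) \<Longrightarrow> u * biresolvent (N \<epsilon>) u 0 \<in> ball 0 \<rho>"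
    and "u \<in> ball 0 (\<rho> / 4) \<Longrightarrow> biresolvent (N \<epsilon>) u 0 = 1 + of_real \<epsilon> * R (u * biresolvent (N \<epsilon>) u 0) 0"
    and "v \<in> ball 0 (\<rho> / 4) \<Longrightarrow> v * biresolvent (N \<epsilon>) 0 v \<in> ball 0 \<rho>"
    and "v \<in> ball 0 (\<rho> / 4) \<Longrightarrow> biresolvent (N \<epsilon>) 0 v = 1 + of_real \<epsilon> * R 0 (v * biresolvent (N \<epsilon>) 0 v)"
    and "u \<in> ball 0 (\<rho> / 4) \<Longrightarrow> v \<in> ball 0 (\<rho> / 4) \<Longrightarrow>
      biresolvent (N \<epsilon>) u v * (1 - of_real \<epsilon> * (R (u * biresolvent (N \<epsilon>) u 0) (v * biresolvent (N \<epsilon>) 0 v)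
        - R (u * biresolvent (N \<epsilon>) u 0) 0 - R 0 (v * biresolvent (N \<epsilon>) 0 v))) =
      biresolvent (N \<epsilon>) u 0 * biresolvent (N \<epsilon>) 0 v"
proof -
  obtain \<alpha> \<beta> where R: "is_bifree_R (N \<epsilon>) \<alpha> \<beta> (\<lambda>z w. of_real \<epsilon> * R z w)" using NR[OF \<epsilon>(1)] by blast
  have "\<epsilon> * (B * \<rho>) \<le> 1 * (B * \<rho>)" using \<epsilon> B \<rho> by (intro mult_right_mono) auto
  then have s: "\<epsilon> * B * \<rho> \<le> 1 / 4" using B\<rho> by (simp add: mult.assoc)
  note * = bifree_identities[OF \<epsilon>(1) s N[OF \<epsilon>(1)] R]
  show "AE p in N \<epsilon>. \<bar>fst p\<bar> \<le> 2 / \<rho> \<and> \<bar>snd p\<bar> \<le> 2 / \<rho>" by (rule *)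
  show "u \<in> ball 0 (\<rho> / 4) \<Longrightarrow> u * biresolvent (N \<epsilon>) u 0 \<in> ball 0 \<rho>" by (rule *)
  show "u \<in> ball 0 (\<rho> / 4) \<Longrightarrow> biresolvent (N \<epsilon>) u 0 = 1 + of_real \<epsilon> * R (u * biresolvent (N \<epsilon>) u 0) 0" by (rule *)
  show "v \<in> ball 0 (\<rho> / 4) \<Longrightarrow> v * biresolvent (N \<epsilon>) 0 v \<in> ball 0 \<rho>" by (rule *)
  show "v \<in> ball 0 (\<rho> / 4) \<Longrightarrow> biresolvent (N \<epsilon>) 0 v = 1 + of_real \<epsilon> * R 0 (v * biresolvent (N \<epsilon>) 0 v)" by (rule *)
  show "u \<in> ball 0 (\<rho> / 4) \<Longrightarrow> v \<in> ball 0 (\<rho> / 4) \<Longrightarrow>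
      biresolvent (N \<epsilon>) u v * (1 - of_real \<epsilon> * (R (u * biresolvent (N \<epsilon>) u 0) (v * biresolvent (N \<epsilon>) 0 v)
        - R (u * biresolvent (N \<epsilon>) u 0) 0 - R 0 (v * biresolvent (N \<epsilon>) 0 v))) =
      biresolvent (N \<epsilon>) u 0 * biresolvent (N \<epsilon>) 0 v" by (rule *)
qed

lemma R_0_0': "R 0 0 = 0"
proof -
  obtain \<alpha> \<beta> where "is_bifree_R (N 1) \<alpha> \<beta> (\<lambda>z w. of_real 1 * R z w)" using NR[of 1] by auto
  then show ?thesis using bifree_identities(1)[of 1 "N 1"] B\<rho> N[of 1] by simp
qed

lemma norm_R_le: "z \<in> ball 0 \<rho> \<Longrightarrow> w \<in> ball 0 \<rho> \<Longrightarrow> norm (R z w) \<le> B * (norm z + norm w)"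
  using Lip[of z 0 w 0] R_0_0' \<rho> by simp

text \<open>The deviation from 1 is \<epsilon> times a value of \<open>R\<close> on an axis at
  distance less than \<rho> from the origin, where |R| \<le> B \<rho> \<le> 1 / 4.\<close>

lemma biresolvent_1_bound:
  assumes \<epsilon>: "0 < \<epsilon>" "\<epsilon> \<le> 1" and u: "u \<in> ball 0 (\<rho> / 4)"
  shows "norm (biresolvent (N \<epsilon>) u 0 - 1) \<le> \<epsilon> / 4" "norm (biresolvent (N \<epsilon>) 0 u - 1) \<le> \<epsilon> / 4"
proof -
  have *: "norm (of_real \<epsilon> * x) \<le> \<epsilon> / 4" if "norm x \<le> B * norm z" "z \<in> ball 0 \<rho>" for x z :: complex
  proof -
    have "norm x \<le> B * \<rho>" using that B by (intro order_trans[OF that(1)] mult_left_mono) auto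
    then have "\<epsilon> * norm x \<le> \<epsilon> * (1 / 4)" using B\<rho> \<epsilon> by (intro mult_left_mono) auto
    then show ?thesis using \<epsilon> by (simp add: norm_mult)
  qed
  have "biresolvent (N \<epsilon>) u 0 - 1 = of_real \<epsilon> * R (u * biresolvent (N \<epsilon>) u 0) 0"
    using family_identities(3)[OF \<epsilon> u] by (metis add_diff_cancel_left')
  also have "norm \<dots> \<le> \<epsilon> / 4"
    by (rule *[OF _ family_identities(2)[OF \<epsilon> u]])
       (use norm_R_le[OF family_identities(2)[OF \<epsilon> u], of 0] \<rho> in simp)
  finally show "norm (biresolvent (N \<epsilon>) u 0 - 1) \<le> \<epsilon> / 4" .
  have "biresolvent (N \<epsilon>) 0 u - 1 = of_real \<epsilon> * R 0 (u * biresolvent (N \<epsilon>) 0 u)"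
    using family_identities(5)[OF \<epsilon> u] by (metis add_diff_cancel_left')
  also have "norm \<dots> \<le> \<epsilon> / 4"
    by (rule *[OF _ family_identities(4)[OF \<epsilon> u]])
       (use norm_R_le[OF _ family_identities(4)[OF \<epsilon> u], of 0] \<rho> in simp)
  finally show "norm (biresolvent (N \<epsilon>) 0 u - 1) \<le> \<epsilon> / 4" .
qed

lemma eventually_small: "\<forall>\<^sub>F \<epsilon> in at_right 0. 0 < \<epsilon> \<and> \<epsilon> \<le> (1::real)"
  using eventually_at_right_less[of 0] eventually_at_right_real[of 0 1]
  by (auto elim: eventually_mono)

lemma tendsto_1_of_bound:
  fixes f :: "real \<Rightarrow> complex"
  assumes "\<And>\<epsilon>. 0 < \<epsilon> \<Longrightarrow> \<epsilon> \<le> 1 \<Longrightarrow> norm (f \<epsilon> - 1) \<le> c * \<epsilon>"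
  shows "(f \<longlongrightarrow> 1) (at_right 0)"
proof (rule Lim_null[THEN iffD2], rule Lim_null_comparison)
  show "\<forall>\<^sub>F \<epsilon> in at_right 0. norm (f \<epsilon> - 1) \<le> c * \<epsilon>"
    using eventually_small by eventually_elim (use assms in blast)
  have "((\<lambda>\<epsilon>. c * \<epsilon>) \<longlongrightarrow> c * 0) (at_right 0)" by (intro tendsto_intros)
  then show "((\<lambda>\<epsilon>. c * \<epsilon>) \<longlongrightarrow> 0) (at_right 0)" by simp
qed

text \<open>With a = 1 + \<epsilon> X and b = 1 + \<epsilon> Y, the functional equation \<Psi> (1 -
  \<epsilon> C) = a b gives (\<Psi> - 1) / \<epsilon> = (X b + Y + C) / (1 - \<epsilon> C). As
  \<epsilon> tends to 0, a and b tend to 1 and X + Y + C tends to R u v.\<close>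

lemma biresolvent_derivative:
  assumes u: "u \<in> ball 0 (\<rho> / 4)" and v: "v \<in> ball 0 (\<rho> / 4)"
  shows "((\<lambda>\<epsilon>. (biresolvent (N \<epsilon>) u v - 1) / of_real \<epsilon>) \<longlongrightarrow> R u v) (at_right 0)"
proof -
  define a where "a \<epsilon> = biresolvent (N \<epsilon>) u 0" for \<epsilon>
  define b where "b \<epsilon> = biresolvent (N \<epsilon>) 0 v" for \<epsilon>
  define C where "C \<epsilon> = R (u * a \<epsilon>) (v * b \<epsilon>) - R (u * a \<epsilon>) 0 - R 0 (v * b \<epsilon>)" for \<epsilon>
  have ub: "u \<in> ball 0 \<rho>" and vb: "v \<in> ball 0 \<rho>" and zb: "(0::complex) \<in> ball 0 \<rho>" using u v \<rho> by auto
  have a1: "(a \<longlongrightarrow> 1) (at_right 0)" and b1: "(b \<longlongrightarrow> 1) (at_right 0)"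
    unfolding a_def b_def
    using biresolvent_1_bound(1)[OF _ _ u] biresolvent_1_bound(2)[OF _ _ v]
    by (auto intro!: tendsto_1_of_bound[where c="1 / 4"])
  have ua: "((\<lambda>\<epsilon>. u * a \<epsilon>) \<longlongrightarrow> u) (at_right 0)" and vb': "((\<lambda>\<epsilon>. v * b \<epsilon>) \<longlongrightarrow> v) (at_right 0)"
    using tendsto_mult[OF tendsto_const a1, of u] tendsto_mult[OF tendsto_const b1, of v] by auto
  have Cl: "(C \<longlongrightarrow> R u v - R u 0 - R 0 v) (at_right 0)"
    unfolding C_def
    by (intro tendsto_diff continuous[OF ub vb] continuous[OF ub zb] continuous[OF zb vb] ua vb' tendsto_const)
  have el: "\<forall>\<^sub>F \<epsilon> in at_right 0. 1 - of_real \<epsilon> * C \<epsilon> \<noteq> 0"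
  proof -
    have "((\<lambda>\<epsilon>. 1 - of_real \<epsilon> * C \<epsilon>) \<longlongrightarrow> 1 - of_real 0 * (R u v - R u 0 - R 0 v)) (at_right 0)"
      by (intro tendsto_intros Cl)
    then show ?thesis by (intro tendsto_imp_eventually_ne) auto
  qed
  have "((\<lambda>\<epsilon>. (R (u * a \<epsilon>) 0 * b \<epsilon> + R 0 (v * b \<epsilon>) + C \<epsilon>) / (1 - of_real \<epsilon> * C \<epsilon>))
      \<longlongrightarrow> (R u 0 * 1 + R 0 v + (R u v - R u 0 - R 0 v)) / (1 - of_real 0 * (R u v - R u 0 - R 0 v))) (at_right 0)"
    by (intro tendsto_intros Cl b1 continuous[OF ub zb] continuous[OF zb vb] ua vb') auto
  then have "((\<lambda>\<epsilon>. (R (u * a \<epsilon>) 0 * b \<epsilon> + R 0 (v * b \<epsilon>) + C \<epsilon>) / (1 - of_real \<epsilon> * C \<epsilon>)) \<longlongrightarrow> R u v) (at_right 0)"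
    by simp
  then show ?thesis
  proof (rule Lim_transform_eventually)
    show "\<forall>\<^sub>F \<epsilon> in at_right 0. (R (u * a \<epsilon>) 0 * b \<epsilon> + R 0 (v * b \<epsilon>) + C \<epsilon>) / (1 - of_real \<epsilon> * C \<epsilon>) =
      (biresolvent (N \<epsilon>) u v - 1) / of_real \<epsilon>"
      using eventually_small el
    proof eventually_elim
      case (elim \<epsilon>)
      then have \<epsilon>: "0 < \<epsilon>" "\<epsilon> \<le> 1" by auto
      define \<Psi> where "\<Psi> = biresolvent (N \<epsilon>) u v"
      define X where "X = R (u * a \<epsilon>) 0"
      define Y where "Y = R 0 (v * b \<epsilon>)"
      have 1: "a \<epsilon> = 1 + of_real \<epsilon> * X" unfolding a_def X_def by (rule family_identities(3)[OF \<epsilon> u])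
      have 2: "b \<epsilon> = 1 + of_real \<epsilon> * Y" unfolding b_def Y_def by (rule family_identities(5)[OF \<epsilon> v])
      have 3: "\<Psi> * (1 - of_real \<epsilon> * C \<epsilon>) = a \<epsilon> * b \<epsilon>"
        unfolding C_def a_def b_def \<Psi>_def by (rule family_identities(6)[OF \<epsilon> u v])
      have "(\<Psi> - 1) * (1 - of_real \<epsilon> * C \<epsilon>) = a \<epsilon> * b \<epsilon> - 1 + of_real \<epsilon> * C \<epsilon>"
        unfolding left_diff_distrib 3 by simp
      also have "\<dots> = of_real \<epsilon> * (X * b \<epsilon> + Y + C \<epsilon>)"
        unfolding 1 2 by (simp add: algebra_simps)
      finally show ?case
        using elim(2) \<epsilon> unfolding X_def[symmetric] Y_def[symmetric] \<Psi>_def[symmetric] by (simp add: frac_eq_eq mult.commute)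
    qed
  qed
qed

end

text \<open>Adding the resolvents at x and -x cancels the odd part: 1 / (1 - y) + 1 / (1 + y) - 2
  \<ge> 2 y^2. This bounds the second moment without knowledge of the first, which then follows from
  |1 / (1 - y) - 1 - y| \<le> 2 y^2. The choice x = 1 / (4 K) keeps |y| \<le> 1 / 4 for y = x
  X.\<close>

lemma (in prob_space) moment_bounds_of_resolvent:
  fixes X :: "'a \<Rightarrow> real"
  assumes X[measurable]: "X \<in> borel_measurable M" and K: "K > 0" and AE: "AE p in M. \<bar>X p\<bar> \<le> K"
    and x: "x = 1 / (4 * K)"
    and r1: "\<bar>(LINT p|M. 1 / (1 - x * X p)) - 1\<bar> \<le> \<epsilon> / 4"
    and r2: "\<bar>(LINT p|M. 1 / (1 + x * X p)) - 1\<bar> \<le> \<epsilon> / 4"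
  shows "(LINT p|M. (X p)\<^sup>2) \<le> 4 * K\<^sup>2 * \<epsilon>" and "\<bar>LINT p|M. X p\<bar> \<le> 4 * K * \<epsilon>"
proof -
  have x0: "x > 0" using K x by simp
  have xX: "AE p in M. \<bar>x * X p\<bar> \<le> 1 / 4"
    using AE
  proof eventually_elim
    case (elim p)
    have "\<bar>x * X p\<bar> \<le> x * K" unfolding abs_mult using elim x0 by (simp add: mult_left_mono)
    then show ?case using x K by simp
  qed
  have i1: "integrable M (\<lambda>p. 1 / (1 - x * X p))"
  proof (rule integrable_const_bound[where B="4 / 3"])
    show "AE p in M. norm (1 / (1 - x * X p)) \<le> 4 / 3"
      using xX by eventually_elim (auto simp: divide_simps abs_if split: if_splits)
  qed measurable
  have i2: "integrable M (\<lambda>p. 1 / (1 + x * X p))"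
  proof (rule integrable_const_bound[where B="4 / 3"])
    show "AE p in M. norm (1 / (1 + x * X p)) \<le> 4 / 3"
      using xX by eventually_elim (auto simp: divide_simps abs_if split: if_splits)
  qed measurable
  have iX: "integrable M X" by (rule integrable_const_bound[where B=K]) (use AE in auto)
  have iX2: "integrable M (\<lambda>p. (X p)\<^sup>2)"
  proof (rule integrable_const_bound[where B="K\<^sup>2"])
    show "AE p in M. norm ((X p)\<^sup>2) \<le> K\<^sup>2"
      using AE by eventually_elim (use K in \<open>simp add: abs_le_square_iff[symmetric]\<close>)
  qed measurable
  have "(LINT p|M. 2 * x\<^sup>2 * (X p)\<^sup>2) \<le> (LINT p|M. 1 / (1 - x * X p) + 1 / (1 + x * X p) - 2)"
  proof (rule integral_mono_AE)
    show "AE p in M. 2 * x\<^sup>2 * (X p)\<^sup>2 \<le> 1 / (1 - x * X p) + 1 / (1 + x * X p) - 2"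
      using xX
    proof eventually_elim
      case (elim p)
      define y where "y = x * X p"
      have y: "\<bar>y\<bar> \<le> 1 / 4" using elim by (simp add: y_def)
      then have pos: "1 - y > 0" "1 + y > 0" by auto
      have "1 / (1 - y) + 1 / (1 + y) = 2 / ((1 - y) * (1 + y))"
        using pos by (simp add: add_divide_eq_if_simps divide_simps)
      also have "(1 - y) * (1 + y) = 1 - y\<^sup>2" by (simp add: power2_eq_square algebra_simps)
      finally have "1 / (1 - y) + 1 / (1 + y) = 2 * (1 / (1 - y\<^sup>2))" by simp
      moreover have "1 + y\<^sup>2 \<le> 1 / (1 - y\<^sup>2)"
      proof -
        have "1 - y\<^sup>2 > 0" using pos mult_pos_pos[OF pos] by (simp add: power2_eq_square algebra_simps)
        moreover have "(1 + y\<^sup>2) * (1 - y\<^sup>2) = 1 - (y\<^sup>2)\<^sup>2" by (simp add: power2_eq_square algebra_simps)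
        then have "(1 + y\<^sup>2) * (1 - y\<^sup>2) \<le> 1" by simp
        ultimately show ?thesis by (simp add: pos_le_divide_eq)
      qed
      ultimately have "2 * y\<^sup>2 \<le> 1 / (1 - y) + 1 / (1 + y) - 2" by linarith
      then show ?case by (simp add: y_def power_mult_distrib)
    qed
  qed (use i1 i2 iX2 in auto)
  also have "\<dots> = (LINT p|M. 1 / (1 - x * X p)) + (LINT p|M. 1 / (1 + x * X p)) - 2"
    using i1 i2 by (simp add: prob_space)
  also have "\<dots> \<le> \<epsilon> / 2" using r1 r2 by linarith
  finally have *: "2 * x\<^sup>2 * (LINT p|M. (X p)\<^sup>2) \<le> \<epsilon> / 2" by simp
  \<comment> \<open>Undoes the scaling, as \<open>16 * K\<^sup>2 * x\<^sup>2\<close> is 1.\<close>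
  have "(LINT p|M. (X p)\<^sup>2) = 4 * K\<^sup>2 * 2 * (2 * x\<^sup>2 * (LINT p|M. (X p)\<^sup>2))"
    using K by (simp add: x power_divide power_mult_distrib)
  also have "\<dots> \<le> 4 * K\<^sup>2 * 2 * (\<epsilon> / 2)" by (intro mult_left_mono *) auto
  finally show "(LINT p|M. (X p)\<^sup>2) \<le> 4 * K\<^sup>2 * \<epsilon>" by (simp add: mult.assoc mult.commute)
  have "\<bar>(LINT p|M. 1 / (1 - x * X p) - 1 - x * X p)\<bar> \<le> (LINT p|M. 2 * x\<^sup>2 * (X p)\<^sup>2)"
    unfolding real_norm_def[symmetric]
  proof (rule order_trans[OF integral_norm_bound], rule integral_mono_AE)
    show "AE p in M. norm (1 / (1 - x * X p) - 1 - x * X p) \<le> 2 * x\<^sup>2 * (X p)\<^sup>2"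
      using xX
    proof eventually_elim
      case (elim p)
      define y where "y = x * X p"
      have y: "\<bar>y\<bar> \<le> 1 / 4" using elim by (simp add: y_def)
      then have pos: "1 - y \<ge> 3 / 4" by auto
      then have "1 / (1 - y) - 1 - y = y\<^sup>2 / (1 - y)"
        by (simp add: field_simps power2_eq_square)
      moreover have "y\<^sup>2 / (1 - y) \<le> y\<^sup>2 / (1 / 2)" using pos by (intro divide_left_mono) auto
      moreover have "y\<^sup>2 / (1 - y) \<ge> 0" using pos by simp
      ultimately have "\<bar>1 / (1 - y) - 1 - y\<bar> \<le> 2 * y\<^sup>2" using pos by (simp add: abs_of_pos)
      then show ?case by (simp add: y_def power_mult_distrib)
    qed
  qed (use i1 iX iX2 in auto)
  also have "\<dots> \<le> \<epsilon> / 2" using * by simp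
  also have "(LINT p|M. 1 / (1 - x * X p) - 1 - x * X p) = (LINT p|M. 1 / (1 - x * X p)) - 1 - x * (LINT p|M. X p)"
    using i1 iX by (simp add: prob_space)
  \<comment> \<open>\<epsilon> / 4 comes from the resolvent and \<epsilon> / 2 from the quadratic
    remainder.\<close>
  finally have "\<bar>x * (LINT p|M. X p)\<bar> \<le> 3 / 4 * \<epsilon>" using r1 by linarith
  then have "4 * K * (x * \<bar>LINT p|M. X p\<bar>) \<le> 4 * K * (3 / 4 * \<epsilon>)"
    using x0 K by (intro mult_left_mono) (auto simp: abs_mult)
  moreover have "4 * K * (x * \<bar>LINT p|M. X p\<bar>) = \<bar>LINT p|M. X p\<bar>" using K by (simp add: x)
  moreover have "\<epsilon> \<ge> 0" using r1 by linarith
  then have "4 * K * (3 / 4 * \<epsilon>) \<le> 4 * K * \<epsilon>" using K by simp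
  ultimately show "\<bar>LINT p|M. X p\<bar> \<le> 4 * K * \<epsilon>" by linarith
qed

text \<open>Two factors of size max(|s|, |t|) are kept and the remaining ones are bounded by K, so
  the squares of the coordinates control every monomial of degree at least 2.\<close>

lemma monomial_bound:
  fixes s t K :: real
  assumes "\<bar>s\<bar> \<le> K" "\<bar>t\<bar> \<le> K" "p + q \<ge> 2"
  shows "\<bar>s ^ p * t ^ q\<bar> * K\<^sup>2 \<le> max (s\<^sup>2) (t\<^sup>2) * K ^ (p + q)"
proof -
  have K: "K \<ge> 0" using assms(1) by linarith
  define m where "m = max \<bar>s\<bar> \<bar>t\<bar>"
  have m: "m \<ge> 0" "m \<le> K" "\<bar>s\<bar> \<le> m" "\<bar>t\<bar> \<le> m" using assms by (auto simp: m_def)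
  have "\<bar>s ^ p * t ^ q\<bar> \<le> m ^ p * m ^ q"
    unfolding abs_mult power_abs using m by (intro mult_mono power_mono) auto
  also have "\<dots> = m\<^sup>2 * m ^ (p + q - 2)" using assms(3) by (metis le_add_diff_inverse power_add)
  also have "\<dots> \<le> m\<^sup>2 * K ^ (p + q - 2)" using m by (intro mult_left_mono power_mono) auto
  finally have "\<bar>s ^ p * t ^ q\<bar> * K\<^sup>2 \<le> m\<^sup>2 * K ^ (p + q - 2) * K\<^sup>2" by (rule mult_right_mono) simp
  also have "\<dots> = m\<^sup>2 * (K\<^sup>2 * K ^ (p + q - 2))" by simp
  also have "K\<^sup>2 * K ^ (p + q - 2) = K ^ (p + q)" using assms(3) by (metis le_add_diff_inverse power_add)
  also have "m\<^sup>2 = max (s\<^sup>2) (t\<^sup>2)"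
    unfolding m_def by (auto simp: max_def abs_le_square_iff)
  finally show ?thesis .
qed

section \<open>Moments are of order \<epsilon>, and their rescaled limits are the cumulants\<close>

context bifree_family_radius
begin

text \<open>The geometric bound, uniform in \<epsilon> after division, on which coefficientwise
  convergence depends. In degree at least 2 it goes through the second moments; degree 1 has a bound
  of its own.\<close>

lemma moment_bound:
  assumes \<epsilon>: "0 < \<epsilon>" "\<epsilon> \<le> 1" and pq: "(p, q) \<noteq> (0, 0)"
  shows "\<bar>LINT x|N \<epsilon>. fst x ^ p * snd x ^ q\<bar> \<le> 8 * (2 / \<rho>) ^ (p + q) * \<epsilon>"
proof -
  interpret prob_space "N \<epsilon>" using borel_probD(1)[OF N[OF \<epsilon>(1)]] .
  note [measurable] = fst_measurable[OF N[OF \<epsilon>(1)]] snd_measurable[OF N[OF \<epsilon>(1)]]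
  define K where "K = 2 / \<rho>"
  have K: "K > 0" using \<rho> by (simp add: K_def)
  have x: "\<rho> / 8 = 1 / (4 * K)" by (simp add: K_def)
  note AE = family_identities(1)[OF \<epsilon>, folded K_def]
  \<comment> \<open>The two evaluation points x and -x, with x = \<rho> / 8 = 1 / (4 K).\<close>
  have b1: "of_real (\<rho> / 8) \<in> ball (0::complex) (\<rho> / 4)" "of_real (- \<rho> / 8) \<in> ball (0::complex) (\<rho> / 4)"
    using \<rho> by (auto simp: norm_divide)
  have f: "biresolvent (N \<epsilon>) (of_real y) 0 = of_real (LINT p|N \<epsilon>. 1 / (1 - y * fst p))" for y
    unfolding biresolvent_def integral_complex_of_real[symmetric] by simp
  have g: "biresolvent (N \<epsilon>) 0 (of_real y) = of_real (LINT p|N \<epsilon>. 1 / (1 - y * snd p))" for y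
    unfolding biresolvent_def integral_complex_of_real[symmetric] by simp
  have nf: "\<bar>(LINT p|N \<epsilon>. 1 / (1 - y * fst p)) - 1\<bar> \<le> \<epsilon> / 4" "\<bar>(LINT p|N \<epsilon>. 1 / (1 - y * snd p)) - 1\<bar> \<le> \<epsilon> / 4"
    if "of_real y \<in> ball (0::complex) (\<rho> / 4)" for y
  proof -
    have n: "norm (complex_of_real a - 1) = \<bar>a - 1\<bar>" for a
      using norm_of_real[of "a - 1", where 'a=complex] by (simp only: of_real_diff of_real_1)
    show "\<bar>(LINT p|N \<epsilon>. 1 / (1 - y * fst p)) - 1\<bar> \<le> \<epsilon> / 4" "\<bar>(LINT p|N \<epsilon>. 1 / (1 - y * snd p)) - 1\<bar> \<le> \<epsilon> / 4"
      using biresolvent_1_bound[OF \<epsilon> that] unfolding f g n .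
  qed
  have F: "(LINT p|N \<epsilon>. (fst p)\<^sup>2) \<le> 4 * K\<^sup>2 * \<epsilon>" "\<bar>LINT p|N \<epsilon>. fst p\<bar> \<le> 4 * K * \<epsilon>"
    by (rule moment_bounds_of_resolvent[OF _ K _ x]; use AE nf(1)[OF b1(1)] nf(1)[OF b1(2)] in simp)+
  have S: "(LINT p|N \<epsilon>. (snd p)\<^sup>2) \<le> 4 * K\<^sup>2 * \<epsilon>" "\<bar>LINT p|N \<epsilon>. snd p\<bar> \<le> 4 * K * \<epsilon>"
    by (rule moment_bounds_of_resolvent[OF _ K _ x]; use AE nf(2)[OF b1(1)] nf(2)[OF b1(2)] in simp)+
  have i: "integrable (N \<epsilon>) (\<lambda>x. fst x ^ p * snd x ^ q)" for p q
  proof (rule integrable_const_bound[where B="K ^ p * K ^ q"])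
    show "AE x in N \<epsilon>. norm (fst x ^ p * snd x ^ q) \<le> K ^ p * K ^ q"
      using AE by eventually_elim (auto simp: abs_mult power_abs intro!: mult_mono power_mono)
  qed measurable
  have i1: "integrable (N \<epsilon>) (\<lambda>x. (fst x)\<^sup>2)" using i[of 2 0] by simp
  have i2: "integrable (N \<epsilon>) (\<lambda>x. (snd x)\<^sup>2)" using i[of 0 2] by simp
  have "\<bar>LINT x|N \<epsilon>. fst x ^ p * snd x ^ q\<bar> \<le> 8 * K ^ (p + q) * \<epsilon>"
  proof (cases "p + q \<ge> 2")
    case True
    have "\<bar>LINT x|N \<epsilon>. fst x ^ p * snd x ^ q\<bar> * K\<^sup>2 \<le> (LINT x|N \<epsilon>. \<bar>fst x ^ p * snd x ^ q\<bar>) * K\<^sup>2"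
      by (intro mult_right_mono integral_abs_bound) auto
    also have "\<dots> = (LINT x|N \<epsilon>. \<bar>fst x ^ p * snd x ^ q\<bar> * K\<^sup>2)" by simp
    also have "\<dots> \<le> (LINT x|N \<epsilon>. ((fst x)\<^sup>2 + (snd x)\<^sup>2) * K ^ (p + q))"
    proof (rule integral_mono_AE)
      show "AE x in N \<epsilon>. \<bar>fst x ^ p * snd x ^ q\<bar> * K\<^sup>2 \<le> ((fst x)\<^sup>2 + (snd x)\<^sup>2) * K ^ (p + q)"
        using AE
      proof eventually_elim
        case (elim x)
        have "\<bar>fst x ^ p * snd x ^ q\<bar> * K\<^sup>2 \<le> max ((fst x)\<^sup>2) ((snd x)\<^sup>2) * K ^ (p + q)"
          using elim True by (intro monomial_bound) auto
        also have "\<dots> \<le> ((fst x)\<^sup>2 + (snd x)\<^sup>2) * K ^ (p + q)" using K by (intro mult_right_mono) auto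
        finally show ?case .
      qed
    qed (use i[of p q] i1 i2 in auto)
    also have "\<dots> = ((LINT x|N \<epsilon>. (fst x)\<^sup>2) + (LINT x|N \<epsilon>. (snd x)\<^sup>2)) * K ^ (p + q)" using i1 i2 by simp
    also have "\<dots> \<le> (4 * K\<^sup>2 * \<epsilon> + 4 * K\<^sup>2 * \<epsilon>) * K ^ (p + q)" using F S K by (intro mult_right_mono add_mono) auto
    also have "\<dots> = 8 * K ^ (p + q) * \<epsilon> * K\<^sup>2" by simp
    finally show ?thesis using K by simp
  next
    case False
    then have "(p = 1 \<and> q = 0) \<or> (p = 0 \<and> q = 1)" using pq by auto
    then have "\<bar>LINT x|N \<epsilon>. fst x ^ p * snd x ^ q\<bar> \<le> 4 * K ^ (p + q) * \<epsilon>" using F S by auto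
    also have "\<dots> \<le> 8 * K ^ (p + q) * \<epsilon>" using K \<epsilon> by (intro mult_right_mono) auto
    finally show ?thesis .
  qed
  then show ?thesis unfolding K_def .
qed

text \<open>The functions (\<Psi> - 1) / \<epsilon> tend to \<open>R\<close> near the origin, and
  their coefficients are the rescaled moments, bounded uniformly in \<epsilon>.\<close>

lemma moment_limit:
  assumes pq: "(p, q) \<noteq> (0, 0)"
  shows "((\<lambda>\<epsilon>. (LINT x|N \<epsilon>. fst x ^ p * snd x ^ q) / \<epsilon>) \<longlongrightarrow> \<kappa> p q) (at_right 0)"
proof -
  obtain A where A: "A \<ge> 0" "\<And>m n. \<bar>\<kappa> m n\<bar> \<le> A * (2 / r) ^ (m + n)" using coefficient_bound by blast
  define K where "K = 2 / \<rho>"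
  have K: "K > 0" using \<rho> by (simp add: K_def)
  define m where "m \<epsilon> p q = (LINT x|N \<epsilon>. fst x ^ p * snd x ^ q)" for \<epsilon> p q
  \<comment> \<open>The entry at (0, 0) is 0 because the constant term 1 of \<Psi> has been
    subtracted.\<close>
  define a where "a \<epsilon> p q = (if (p, q) = (0, 0) then 0 else complex_of_real (m \<epsilon> p q / \<epsilon>))" for \<epsilon> p q
  \<comment> \<open>\<open>K\<close> = 2 / \<rho> exceeds 2 / r, so rescaled moments and cumulants
    share one geometric bound.\<close>
  have \<kappa>b: "norm (complex_of_real (\<kappa> p q)) \<le> max A 8 * K ^ (p + q)" for p q
  proof -
    have "\<bar>\<kappa> p q\<bar> \<le> A * (2 / r) ^ (p + q)" by (rule A)
    also have "\<dots> \<le> max A 8 * K ^ (p + q)"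
      unfolding K_def using A(1) \<rho> \<rho>_le r_pos by (intro mult_mono power_mono divide_left_mono) auto
    finally show ?thesis by simp
  qed
  have ab: "norm (a \<epsilon> p q) \<le> max A 8 * K ^ (p + q)" if \<epsilon>: "0 < \<epsilon>" "\<epsilon> \<le> 1" for \<epsilon> p q
  proof (cases "(p, q) = (0, 0)")
    case False
    have "\<bar>m \<epsilon> p q\<bar> \<le> 8 * K ^ (p + q) * \<epsilon>" unfolding m_def K_def by (rule moment_bound[OF \<epsilon> False])
    then have "\<bar>m \<epsilon> p q\<bar> / \<epsilon> \<le> 8 * K ^ (p + q)" using \<epsilon> by (simp add: divide_le_eq)
    also have "\<dots> \<le> max A 8 * K ^ (p + q)" using K by (intro mult_right_mono) auto
    finally show ?thesis using False \<epsilon> unfolding a_def if_not_P[OF False] norm_of_real by simp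
  qed (use K A in \<open>auto simp: a_def\<close>)
  have "((\<lambda>\<epsilon>. a \<epsilon> p q) \<longlongrightarrow> complex_of_real (\<kappa> p q)) (at_right 0)"
  proof (rule coefficient_tendsto2[OF K, of "\<rho> / 4"])
    show "\<rho> / 4 > 0" "\<rho> / 4 \<le> 1 / (2 * K)" using \<rho> by (auto simp: K_def)
    show "\<forall>\<^sub>F \<epsilon> in at_right 0. \<forall>p q. norm (a \<epsilon> p q) \<le> max A 8 * K ^ (p + q)"
      using eventually_small by eventually_elim (use ab in blast)
    show "norm (complex_of_real (\<kappa> p q)) \<le> max A 8 * K ^ (p + q)" for p q by (rule \<kappa>b)
    fix u v :: complex assume uv: "norm u < \<rho> / 4" "norm v < \<rho> / 4"
    then have ub: "u \<in> ball 0 (\<rho> / 4)" and vb: "v \<in> ball 0 (\<rho> / 4)" by auto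
    have uv': "norm u \<le> 1 / (2 * K)" "norm v \<le> 1 / (2 * K)" "norm u \<le> r / 4" "norm v \<le> r / 4"
      using uv \<rho>_le \<rho> by (auto simp: K_def)
    have R: "(\<Sum>p. (\<Sum>q. of_real (\<kappa> p q) * v ^ q) * u ^ p) = R u v"
      using iterated_series(1)[OF A(2) uv'(3,4)] by (simp add: sums_iff)
    have "(\<Sum>p. (\<Sum>q. a \<epsilon> p q * v ^ q) * u ^ p) = (biresolvent (N \<epsilon>) u v - 1) / of_real \<epsilon>"
      if \<epsilon>: "0 < \<epsilon>" "\<epsilon> \<le> 1" for \<epsilon>
    proof -
      interpret prob_space "N \<epsilon>" using borel_probD(1)[OF N[OF \<epsilon>(1)]] .
      have e: "(\<lambda>p. (\<Sum>q. of_real (m \<epsilon> p q) * v ^ q) * u ^ p) sums biresolvent (N \<epsilon>) u v"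
        unfolding m_def
        by (rule biresolvent_expansion[OF N[OF \<epsilon>(1)] K family_identities(1)[OF \<epsilon>, folded K_def] uv'(1,2)])
      have inner: "(\<Sum>q. a \<epsilon> p q * v ^ q) = ((\<Sum>q. of_real (m \<epsilon> p q) * v ^ q) - (if p = 0 then 1 else 0)) / of_real \<epsilon>" for p
      proof -
        have "norm (a \<epsilon> p q) \<le> (max A 8 * K ^ p) * K ^ q" for q
          using ab[OF \<epsilon>, of p q] by (simp add: power_add mult.assoc)
        then have "summable (\<lambda>q. a \<epsilon> p q * v ^ q)"
          by (rule summable_norm_cancel[OF geometric_bound_sums(1)[OF K _ uv'(2)]])
        then have s: "(\<lambda>q. a \<epsilon> p q * v ^ q) sums (\<Sum>q. a \<epsilon> p q * v ^ q)" by (rule summable_sums)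
        have z: "(\<lambda>q. if q = 0 then (if p = 0 then 1 else 0) else (0 :: complex)) sums (if p = 0 then 1 else 0)"
          using sums_single[of 0 "\<lambda>_. if p = 0 then 1 else (0 :: complex)"] by simp
        have "(\<lambda>q. of_real \<epsilon> * (a \<epsilon> p q * v ^ q) + (if q = 0 then (if p = 0 then 1 else 0) else 0)) sums
          (of_real \<epsilon> * (\<Sum>q. a \<epsilon> p q * v ^ q) + (if p = 0 then 1 else 0))"
          by (intro sums_add sums_mult s z)
        also have "(\<lambda>q. of_real \<epsilon> * (a \<epsilon> p q * v ^ q) + (if q = 0 then (if p = 0 then 1 else 0) else 0)) =
          (\<lambda>q. of_real (m \<epsilon> p q) * v ^ q)"
          using \<epsilon> by (auto simp: a_def m_def fun_eq_iff prob_space)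
        finally show ?thesis using \<epsilon> by (simp add: sums_iff field_simps)
      qed
      have z: "(\<lambda>p. (if p = 0 then 1 else 0 :: complex) * u ^ p) sums 1"
        using sums_single[of 0 "\<lambda>_. 1 :: complex"] by (simp add: if_distrib[of "\<lambda>x. x * _"] cong: if_cong)
      have "(\<lambda>p. ((\<Sum>q. of_real (m \<epsilon> p q) * v ^ q) * u ^ p - (if p = 0 then 1 else 0) * u ^ p) / of_real \<epsilon>) sums
        ((biresolvent (N \<epsilon>) u v - 1) / of_real \<epsilon>)"
        by (intro sums_divide sums_diff e z)
      then show ?thesis unfolding inner by (simp add: sums_iff left_diff_distrib)
    qed
    note eq = this
    have "\<forall>\<^sub>F \<epsilon> in at_right 0. (biresolvent (N \<epsilon>) u v - 1) / of_real \<epsilon> = (\<Sum>p. (\<Sum>q. a \<epsilon> p q * v ^ q) * u ^ p)"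
      using eventually_small by eventually_elim (simp add: eq)
    then show "((\<lambda>\<epsilon>. \<Sum>p. (\<Sum>q. a \<epsilon> p q * v ^ q) * u ^ p) \<longlongrightarrow> (\<Sum>p. (\<Sum>q. of_real (\<kappa> p q) * v ^ q) * u ^ p)) (at_right 0)"
      unfolding R by (rule Lim_transform_eventually[OF biresolvent_derivative[OF ub vb]])
  qed
  moreover have "a \<epsilon> p q = complex_of_real (m \<epsilon> p q / \<epsilon>)" for \<epsilon> unfolding a_def using pq by (rule if_not_P)
  ultimately show ?thesis by (simp only: tendsto_of_real_iff m_def)
qed

end

section \<open>Weak limits\<close>

definition in_box :: "real \<Rightarrow> real \<times> real \<Rightarrow> bool" where
  "in_box c x \<longleftrightarrow> \<bar>fst x\<bar> \<le> c \<and> \<bar>snd x\<bar> \<le> c"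

lemma compact_box: "compact {x. in_box c x}"
proof -
  have "{x. in_box c x} = cbox (- c, - c) (c, c)"
    by (auto simp: in_box_def cbox_Pair_eq abs_le_iff)
  then show ?thesis by simp
qed

lemma box_bound:
  assumes "continuous_on UNIV (f :: real \<times> real \<Rightarrow> 'b::real_normed_vector)"
  obtains B where "B > 0" "\<And>x. in_box c x \<Longrightarrow> norm (f x) \<le> B"
proof -
  have "compact (f ` {x. in_box c x})"
    using assms by (intro compact_continuous_image compact_box) (auto intro: continuous_on_subset)
  then obtain B where "B > 0" "\<forall>y\<in>f ` {x. in_box c x}. norm y \<le> B"
    using bounded_pos compact_imp_bounded by blast
  then show ?thesis using that by auto
qed

lemma box_integrable:
  fixes f :: "real \<times> real \<Rightarrow> 'b::{banach, second_countable_topology}"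
  assumes M: "finite_borel M" and AE: "AE x in M. in_box c x" and f: "continuous_on UNIV f"
  shows "integrable M f"
proof -
  obtain B where "B > 0" and B: "\<And>x. in_box c x \<Longrightarrow> norm (f x) \<le> B" using box_bound[OF f] by blast
  show ?thesis
    by (rule finite_borel_integrable_AE_bounded[OF M borel_measurable_continuous_onI[OF f]])
       (use AE in eventually_elim, rule B)
qed

lemma box_integral_bound:
  fixes f :: "real \<times> real \<Rightarrow> real"
  assumes M: "finite_borel M" and AE: "AE x in M. in_box c x" and f: "continuous_on UNIV f"
    and B: "\<And>x. in_box c x \<Longrightarrow> \<bar>f x\<bar> \<le> B"
  shows "\<bar>LINT x|M. f x\<bar> \<le> B * measure M UNIV"
proof -
  interpret finite_measure M using finite_borelD(1)[OF M] .
  have "\<bar>LINT x|M. f x\<bar> \<le> (LINT x|M. \<bar>f x\<bar>)" by (rule integral_abs_bound)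
  also have "\<dots> \<le> (LINT x|M. B)"
    using AE box_integrable[OF M AE f] by (intro integral_mono_AE) (auto elim: eventually_mono intro: B)
  also have "\<dots> = B * measure M UNIV" using finite_borelD(3)[OF M] by (simp add: mult.commute)
  finally show ?thesis .
qed

lemma in_box_borel: "{x. in_box c x} \<in> sets borel"
  using compact_box by (intro borel_closed compact_imp_closed)

text \<open>The Borel right inverse \<Psi> moves the laws to [0, 1], where they are tight; a weak
  limit on the line, pushed forward by the curve \<Phi>, is the required \<open>L\<close>.
  Continuity of \<Phi> is enough: test functions are composed with \<Phi>, and \<Phi> (\<Psi> x) = x
  on the box.\<close>

lemma prob_box_compactness:
  fixes P :: "nat \<Rightarrow> (real \<times> real) measure"
  assumes P: "\<And>n. borel_prob (P n)" and c: "c > 0" and AE: "\<And>n. AE x in P n. in_box c x"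
  obtains s :: "nat \<Rightarrow> nat" and L where "strict_mono s" "borel_prob L" "AE x in L. in_box (2 * c) x"
    "\<And>f :: real \<times> real \<Rightarrow> real. continuous_on UNIV f \<Longrightarrow> (\<lambda>n. LINT x|P (s n). f x) \<longlonglongrightarrow> (LINT x|L. f x)"
proof -
  obtain \<Phi> :: "real \<Rightarrow> real \<times> real" and \<Psi> where \<Phi>: "continuous_on UNIV \<Phi>"
    and \<Psi>[measurable]: "\<Psi> \<in> borel_measurable borel"
    and inv: "\<And>x. in_box c x \<Longrightarrow> \<Phi> (\<Psi> x) = x" and \<Psi>01: "\<And>x. 0 \<le> \<Psi> x \<and> \<Psi> x \<le> 1"
    and \<Phi>b: "\<And>t. in_box (2 * c) (\<Phi> t)"
    using space_filling_curve[OF c] unfolding in_box_def by metis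
  have \<Psi>P: "\<Psi> \<in> borel_measurable (P n)" for n
    using finite_borel_borel_measurable[OF borel_probD(4)[OF P] \<Psi>] .
  have \<Phi>m: "\<Phi> \<in> borel_measurable borel" using borel_measurable_continuous_onI[OF \<Phi>] .
  define Q where "Q n = distr (P n) borel \<Psi>" for n
  have Q: "real_distribution (Q n)" for n
    unfolding Q_def using prob_space.real_distribution_distr[OF borel_probD(1)[OF P] \<Psi>P] .
  \<comment> \<open>Tightness is phrased with half-open intervals, hence a left end below 0.\<close>
  have "measure (Q n) {-1<..1} = 1" for n
  proof -
    have "measure (Q n) {-1<..1} = measure (P n) (\<Psi> -` {-1<..1} \<inter> space (P n))"
      unfolding Q_def by (rule measure_distr[OF \<Psi>P]) simp
    also have "\<Psi> -` {-1<..1} \<inter> space (P n) = space (P n)" 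
    proof -
      have "- 1 < \<Psi> x \<and> \<Psi> x \<le> 1" for x using \<Psi>01[of x] by linarith
      then show ?thesis by auto
    qed
    finally show ?thesis using prob_space.prob_space[OF borel_probD(1)[OF P]] by simp
  qed
  then have "tight Q"
    unfolding tight_def
  proof (intro conjI allI impI)
    fix e :: real assume "e > 0"
    then show "\<exists>a b. a < b \<and> (\<forall>n. measure (Q n) {a<..b} > 1 - e)"
      using \<open>\<And>n. measure (Q n) {-1<..1} = 1\<close> by (intro exI[of _ "-1"] exI[of _ 1]) simp
  qed (rule Q)
  then obtain s M where s: "strict_mono s" and M: "real_distribution M" and w: "weak_conv_m (Q \<circ> id \<circ> s) M"
    using tight_imp_convergent_subsubsequence[of Q id] strict_mono_id by blast
  interpret M: real_distribution M by fact
  define L where "L = distr M borel \<Phi>"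
  have \<Phi>M: "\<Phi> \<in> measurable M borel" using \<Phi>m by simp
  show ?thesis
  proof (rule that[of s L])
    show "strict_mono s" by fact
    show "borel_prob L" unfolding L_def borel_prob_def using M.prob_space_distr[OF \<Phi>M] by simp
    show "AE x in L. in_box (2 * c) x"
      unfolding L_def by (subst AE_distr_iff[OF \<Phi>M]) (use in_box_borel \<Phi>b in auto)
    fix f :: "real \<times> real \<Rightarrow> real" assume f: "continuous_on UNIV f"
    have fm: "f \<in> borel_measurable borel" using borel_measurable_continuous_onI[OF f] .
    obtain B where B: "\<And>x. in_box (2 * c) x \<Longrightarrow> norm (f x) \<le> B" using box_bound[OF f] by blast
    have f\<Phi>: "continuous_on UNIV (\<lambda>t. f (\<Phi> t))"
      by (rule continuous_on_compose2[OF f \<Phi>]) auto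
    have f\<Phi>m: "(\<lambda>t. f (\<Phi> t)) \<in> borel_measurable borel" using borel_measurable_continuous_onI[OF f\<Phi>] .
    have "(\<lambda>n. integral\<^sup>L ((Q \<circ> id \<circ> s) n) (\<lambda>t. f (\<Phi> t))) \<longlonglongrightarrow> integral\<^sup>L M (\<lambda>t. f (\<Phi> t))"
    proof (rule weak_conv_imp_integral_bdd_continuous_conv[where B=B])
      show "real_distribution ((Q \<circ> id \<circ> s) n)" for n using Q by simp
      show "isCont (\<lambda>t. f (\<Phi> t)) x" for x using f\<Phi> by (simp add: continuous_on_eq_continuous_at)
      show "norm (f (\<Phi> x)) \<le> B" for x using B \<Phi>b by blast
    qed (use M w in \<open>auto simp: comp_def\<close>)
    moreover have "integral\<^sup>L ((Q \<circ> id \<circ> s) n) (\<lambda>t. f (\<Phi> t)) = (LINT x|P (s n). f x)" for n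
    proof -
      have "integral\<^sup>L (Q (s n)) (\<lambda>t. f (\<Phi> t)) = (LINT x|P (s n). f (\<Phi> (\<Psi> x)))"
        unfolding Q_def by (rule integral_distr[OF \<Psi>P f\<Phi>m])
      also have "\<dots> = (LINT x|P (s n). f x)"
      proof (rule integral_cong_AE)
        show "(\<lambda>x. f (\<Phi> (\<Psi> x))) \<in> borel_measurable (P (s n))" using measurable_compose[OF \<Psi>P f\<Phi>m] .
        show "f \<in> borel_measurable (P (s n))" using finite_borel_borel_measurable[OF borel_probD(4)[OF P] fm] .
        show "AE x in P (s n). f (\<Phi> (\<Psi> x)) = f x" using AE by eventually_elim (simp add: inv)
      qed
      finally show ?thesis by simp
    qed
    moreover have "integral\<^sup>L M (\<lambda>t. f (\<Phi> t)) = (LINT x|L. f x)"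
      unfolding L_def by (rule integral_distr[OF \<Phi>M fm, symmetric])
    ultimately show "(\<lambda>n. LINT x|P (s n). f x) \<longlonglongrightarrow> (LINT x|L. f x)" by simp
  qed
qed

text \<open>Polynomial functions are generated inductively, so the claim is strengthened to a
  stability property: \<open>T\<close> collects the functions whose integrals converge against every
  monomial, and multiplication by g preserves \<open>T\<close>. In this form the product case is
  mere composition.\<close>

lemma polynomial_integral_tendsto:
  fixes M :: "'i \<Rightarrow> (real \<times> real) measure"
  assumes M: "\<forall>\<^sub>F i in F. finite_borel (M i) \<and> (AE x in M i. in_box c x)"
    and L: "finite_borel L" "AE x in L. in_box c x"
    and mom: "\<And>p q. ((\<lambda>i. LINT x|M i. fst x ^ p * snd x ^ q) \<longlongrightarrow> (LINT x|L. fst x ^ p * snd x ^ q)) F"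
    and g: "real_polynomial_function g"
  shows "((\<lambda>i. LINT x|M i. g x) \<longlongrightarrow> (LINT x|L. g x)) F"
proof -
  define T where "T = {h. continuous_on UNIV h \<and> (\<forall>p q.
    ((\<lambda>i. LINT x|M i. h x * (fst x ^ p * snd x ^ q)) \<longlongrightarrow> (LINT x|L. h x * (fst x ^ p * snd x ^ q))) F)}"
  have Tscale: "(\<lambda>x. a * h x) \<in> T" if "h \<in> T" for h a
    using that unfolding T_def by (auto intro!: continuous_intros tendsto_mult simp: mult.assoc)
  have Tsum: "(\<lambda>x. h x + k x) \<in> T" if "h \<in> T" "k \<in> T" for h k
  proof -
    have c: "continuous_on UNIV (\<lambda>x. h x * (fst x ^ p * snd x ^ q))" "continuous_on UNIV (\<lambda>x. k x * (fst x ^ p * snd x ^ q))"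
      for p q :: nat using that unfolding T_def by (auto intro!: continuous_intros)
    have split: "(LINT x|K. (h x + k x) * (fst x ^ p * snd x ^ q)) =
      (LINT x|K. h x * (fst x ^ p * snd x ^ q)) + (LINT x|K. k x * (fst x ^ p * snd x ^ q))"
      if "finite_borel K" "AE x in K. in_box c x" for K p q
      unfolding distrib_right by (intro Bochner_Integration.integral_add box_integrable[OF that] c)
    have "((\<lambda>i. LINT x|M i. (h x + k x) * (fst x ^ p * snd x ^ q)) \<longlongrightarrow> (LINT x|L. (h x + k x) * (fst x ^ p * snd x ^ q))) F" for p q
      unfolding split[OF L]
    proof (rule Lim_transform_eventually)
      show "((\<lambda>i. (LINT x|M i. h x * (fst x ^ p * snd x ^ q)) + (LINT x|M i. k x * (fst x ^ p * snd x ^ q))) \<longlongrightarrow>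
        (LINT x|L. h x * (fst x ^ p * snd x ^ q)) + (LINT x|L. k x * (fst x ^ p * snd x ^ q))) F"
        using that unfolding T_def by (intro tendsto_add) auto
      show "\<forall>\<^sub>F i in F. (LINT x|M i. h x * (fst x ^ p * snd x ^ q)) + (LINT x|M i. k x * (fst x ^ p * snd x ^ q)) =
        (LINT x|M i. (h x + k x) * (fst x ^ p * snd x ^ q))"
        using M by eventually_elim (simp add: split)
    qed
    then show ?thesis using that unfolding T_def by (auto intro!: continuous_intros)
  qed
  have Tfst: "(\<lambda>x. fst x * h x) \<in> T" if "h \<in> T" for h
  proof -
    have "fst x * h x * (fst x ^ p * snd x ^ q) = h x * (fst x ^ Suc p * snd x ^ q)" for x :: "real \<times> real" and p q
      by simp
    moreover have "continuous_on UNIV (\<lambda>x. fst x * h x)" using that unfolding T_def by (auto intro!: continuous_intros)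
    ultimately show ?thesis using that unfolding T_def by (simp only: mem_Collect_eq) blast
  qed
  have Tsnd: "(\<lambda>x. snd x * h x) \<in> T" if "h \<in> T" for h
  proof -
    have "snd x * h x * (fst x ^ p * snd x ^ q) = h x * (fst x ^ p * snd x ^ Suc q)" for x :: "real \<times> real" and p q
      by simp
    moreover have "continuous_on UNIV (\<lambda>x. snd x * h x)" using that unfolding T_def by (auto intro!: continuous_intros)
    ultimately show ?thesis using that unfolding T_def by (simp only: mem_Collect_eq) blast
  qed
  have one: "(\<lambda>_. 1) \<in> T" using mom unfolding T_def by simp
  have "\<forall>h\<in>T. (\<lambda>x. g x * h x) \<in> T"
    using g
  proof induction
    case (linear l)
    then interpret bounded_linear l .
    have l: "l x = l (1, 0) * fst x + l (0, 1) * snd x" for x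
    proof -
      have "x = fst x *\<^sub>R (1, 0) + snd x *\<^sub>R (0, 1)" by (simp add: prod_eq_iff)
      then have "l x = fst x *\<^sub>R l (1, 0) + snd x *\<^sub>R l (0, 1)" by (metis add scaleR)
      then show ?thesis by simp
    qed
    show ?case
    proof
      fix h assume h: "h \<in> T"
      have "(\<lambda>x. l (1, 0) * (fst x * h x) + l (0, 1) * (snd x * h x)) \<in> T"
        by (intro Tsum Tscale Tfst Tsnd h)
      also have "(\<lambda>x. l (1, 0) * (fst x * h x) + l (0, 1) * (snd x * h x)) = (\<lambda>x. l x * h x)"
        by (subst (3) l) (simp add: algebra_simps)
      finally show "(\<lambda>x. l x * h x) \<in> T" .
    qed
  next
    case (const a) then show ?case using Tscale by blast
  next
    case (add f g) then show ?case using Tsum by (simp add: distrib_right)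
  next
    case (mult f g) then show ?case by (simp add: mult.assoc)
  qed
  from bspec[OF this one] have "(\<lambda>x. g x * 1) \<in> T" by simp
  then have "\<forall>p q. ((\<lambda>i. LINT x|M i. g x * (fst x ^ p * snd x ^ q)) \<longlongrightarrow> (LINT x|L. g x * (fst x ^ p * snd x ^ q))) F"
    unfolding T_def by simp
  from this[rule_format, of 0 0] show ?thesis by simp
qed

text \<open>Stone-Weierstrass on the box reduces to polynomials, and convergence of the total masses
  makes the approximation error uniform.\<close>

lemma box_weak_convergence_of_moments:
  fixes M :: "'i \<Rightarrow> (real \<times> real) measure"
  assumes M: "\<forall>\<^sub>F i in F. finite_borel (M i) \<and> (AE x in M i. in_box c x)"
    and L: "finite_borel L" "AE x in L. in_box c x"
    and mom: "\<And>p q. ((\<lambda>i. LINT x|M i. fst x ^ p * snd x ^ q) \<longlongrightarrow> (LINT x|L. fst x ^ p * snd x ^ q)) F"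
    and f: "continuous_on UNIV (f :: real \<times> real \<Rightarrow> real)"
  shows "((\<lambda>i. LINT x|M i. f x) \<longlongrightarrow> (LINT x|L. f x)) F"
proof (rule tendstoI)
  fix e :: real assume e: "e > 0"
  define m where "m = measure L UNIV"
  have m: "m \<ge> 0" by (simp add: m_def)
  \<comment> \<open>\<open>m + 1\<close> eventually bounds the masses of all the \<open>M i\<close>,
    so each of the two approximation errors is at most e / 4.\<close>
  define d where "d = e / (4 * (m + 1))"
  have d: "d > 0" using e m by (simp add: d_def)
  have dm: "d * (m + 1) = e / 4"
  proof -
    define k where "k = m + 1"
    have "k > 0" using m by (simp add: k_def)
    then show ?thesis unfolding d_def k_def[symmetric] by simp
  qed
  obtain g where g: "real_polynomial_function g" "\<And>x. in_box c x \<Longrightarrow> \<bar>f x - g x\<bar> < d"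
    using Stone_Weierstrass_real_polynomial_function[OF compact_box continuous_on_subset[OF f subset_UNIV] d] by auto
  have gc: "continuous_on UNIV g"
    using continuous_real_polymonial_function[OF g(1)] continuous_at_imp_continuous_on by blast
  have fg: "\<bar>(LINT x|K. f x) - (LINT x|K. g x)\<bar> \<le> d * measure K UNIV"
    if "finite_borel K" "AE x in K. in_box c x" for K
  proof -
    have "(LINT x|K. f x) - (LINT x|K. g x) = (LINT x|K. f x - g x)"
      by (intro Bochner_Integration.integral_diff[symmetric] box_integrable[OF that] f gc)
    also have "\<bar>\<dots>\<bar> \<le> d * measure K UNIV"
      using g(2) by (intro box_integral_bound[OF that] continuous_intros f gc) (auto intro: less_imp_le)
    finally show ?thesis .
  qed
  have "((\<lambda>i. LINT x|M i. 1) \<longlongrightarrow> (LINT x|L. (1 :: real))) F" using mom[of 0 0] by simp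
  then have "\<forall>\<^sub>F i in F. (LINT x|M i. (1 :: real)) < m + 1"
    using finite_borelD[OF L(1)] by (intro order_tendstoD(2)) (auto simp: m_def)
  moreover have "\<forall>\<^sub>F i in F. dist (LINT x|M i. g x) (LINT x|L. g x) < e / 2"
    using tendstoD[OF polynomial_integral_tendsto[OF M L mom g(1)], of "e / 2"] e by simp
  ultimately show "\<forall>\<^sub>F i in F. dist (LINT x|M i. f x) (LINT x|L. f x) < e"
    using M
  proof eventually_elim
    case (elim i)
    have "measure (M i) UNIV < m + 1"
      using elim(1) finite_borelD(3)[of "M i"] elim(3) by simp
    then have "d * measure (M i) UNIV \<le> e / 4"
      using d unfolding dm[symmetric] by (intro mult_left_mono) auto
    then have "\<bar>(LINT x|M i. f x) - (LINT x|M i. g x)\<bar> \<le> e / 4"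
      using fg[of "M i"] elim(3) by linarith
    moreover have "d * m \<le> e / 4" using dm d by (simp add: distrib_left)
    then have "\<bar>(LINT x|L. f x) - (LINT x|L. g x)\<bar> \<le> e / 4" using fg[OF L] unfolding m_def by linarith
    moreover note elim(2)
    ultimately show ?case unfolding dist_real_def by linarith
  qed
qed

lemma finite_borel_scale:
  assumes M: "finite_borel M" and k: "k \<ge> 0"
  shows "finite_borel (density M (\<lambda>_. ennreal k))"
    and "\<And>f :: _ \<Rightarrow> real. f \<in> borel_measurable borel \<Longrightarrow> (LINT x|density M (\<lambda>_. ennreal k). f x) = k * (LINT x|M. f x)"
    and "AE x in M. Pr x \<Longrightarrow> AE x in density M (\<lambda>_. ennreal k). Pr x"
proof -
  show "finite_borel (density M (\<lambda>_. ennreal k))"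
    by (rule finite_borel_density[OF M]) (rule finite_measure.integrable_const[OF finite_borelD(1)[OF M]])
  show "(LINT x|density M (\<lambda>_. ennreal k). f x) = k * (LINT x|M. f x)" if "f \<in> borel_measurable borel" for f :: "_ \<Rightarrow> real"
    using integral_density[of f M "\<lambda>_. k"] finite_borel_borel_measurable[OF M that] k by simp
  show "AE x in density M (\<lambda>_. ennreal k). Pr x" if "AE x in M. Pr x"
    using that by (subst AE_density) (auto elim: eventually_mono)
qed

text \<open>Compactness has to produce just one measure with the prescribed moments, for which a
  subsequence of the normalised measures suffices. Convergence along the whole filter then follows
  from the moments.\<close>

lemma box_weak_limit_exists:
  fixes M :: "real \<Rightarrow> (real \<times> real) measure"
  assumes M: "\<forall>\<^sub>F \<epsilon> in at_right 0. finite_borel (M \<epsilon>) \<and> (AE x in M \<epsilon>. in_box c x)" and c: "c > 0"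
    and mom: "\<And>p q. ((\<lambda>\<epsilon>. LINT x|M \<epsilon>. fst x ^ p * snd x ^ q) \<longlongrightarrow> m p q) (at_right 0)"
  obtains L where "finite_borel L" "AE x in L. in_box (2 * c) x"
    "\<And>f :: real \<times> real \<Rightarrow> real. continuous_on UNIV f \<Longrightarrow> ((\<lambda>\<epsilon>. LINT x|M \<epsilon>. f x) \<longlongrightarrow> (LINT x|L. f x)) (at_right 0)"
proof -
  have big: "in_box (2 * c) x" if "in_box c x" for x using that c by (auto simp: in_box_def)
  have M2: "\<forall>\<^sub>F \<epsilon> in at_right 0. finite_borel (M \<epsilon>) \<and> (AE x in M \<epsilon>. in_box (2 * c) x)"
    using M by eventually_elim (auto elim: eventually_mono intro: big)
  have cm: "continuous_on UNIV (\<lambda>x :: real \<times> real. fst x ^ p * snd x ^ q)" for p q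
    by (intro continuous_intros)
  have "\<exists>L. finite_borel L \<and> (AE x in L. in_box (2 * c) x) \<and> (\<forall>p q. (LINT x|L. fst x ^ p * snd x ^ q) = m p q)"
  proof (cases "m 0 0 = 0")
    \<comment> \<open>A vanishing limit mass cannot be normalised. All moments are bounded by
      multiples of the mass, so the null measure is the limit.\<close>
    case True
    have "m p q = 0" for p q
    proof -
      obtain B where B: "\<And>x. in_box c x \<Longrightarrow> norm (fst x ^ p * snd x ^ q :: real) \<le> B" using box_bound[OF cm] by blast
      have "((\<lambda>\<epsilon>. LINT x|M \<epsilon>. fst x ^ p * snd x ^ q) \<longlongrightarrow> 0) (at_right 0)"
      proof (rule Lim_null_comparison)
        show "\<forall>\<^sub>F \<epsilon> in at_right 0. norm (LINT x|M \<epsilon>. fst x ^ p * snd x ^ q) \<le> B * (LINT x|M \<epsilon>. fst x ^ 0 * snd x ^ 0)"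
          using M
        proof eventually_elim
          case (elim \<epsilon>)
          then show ?case using box_integral_bound[of "M \<epsilon>" c _ B, OF _ _ cm] B finite_borelD(3)[of "M \<epsilon>"] by simp
        qed
        have "((\<lambda>\<epsilon>. B * (LINT x|M \<epsilon>. fst x ^ 0 * snd x ^ 0)) \<longlongrightarrow> B * m 0 0) (at_right 0)"
          by (intro tendsto_intros mom)
        then show "((\<lambda>\<epsilon>. B * (LINT x|M \<epsilon>. fst x ^ 0 * snd x ^ 0)) \<longlongrightarrow> 0) (at_right 0)" using True by simp
      qed
      then show ?thesis by (rule tendsto_unique[OF trivial_limit_at_right_real mom])
    qed
    moreover have "finite_borel (null_measure (borel :: (real \<times> real) measure))"
      unfolding finite_borel_def by (auto intro: finite_measureI)
    moreover have "AE x in null_measure (borel :: (real \<times> real) measure). in_box (2 * c) x"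
      using in_box_borel[of "2 * c"] by (intro AE_I[where N="- {x. in_box (2 * c) x}"]) auto
    ultimately show ?thesis by (intro exI[of _ "null_measure borel"]) simp
  next
    case False
    have "\<forall>\<^sub>F \<epsilon> in at_right 0. (LINT x|M \<epsilon>. fst x ^ 0 * snd x ^ 0) \<ge> 0" by simp
    then have "m 0 0 \<ge> 0" using tendsto_lowerbound[OF mom[of 0 0]] by simp
    then have m0: "m 0 0 > 0" using False by simp
    have "\<forall>\<^sub>F \<epsilon> in at_right 0. (LINT x|M \<epsilon>. fst x ^ 0 * snd x ^ 0) > 0"
      using order_tendstoD(1)[OF mom m0] .
    with M have "\<forall>\<^sub>F \<epsilon> in at_right 0. finite_borel (M \<epsilon>) \<and> (AE x in M \<epsilon>. in_box c x) \<and> measure (M \<epsilon>) UNIV > 0"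
    proof eventually_elim
      case (elim \<epsilon>)
      then show ?case using finite_borelD(3)[of "M \<epsilon>"] by simp
    qed
    then obtain b :: real where b: "b > 0" "\<And>\<epsilon>. 0 < \<epsilon> \<Longrightarrow> \<epsilon> < b \<Longrightarrow> finite_borel (M \<epsilon>)"
      "\<And>\<epsilon>. 0 < \<epsilon> \<Longrightarrow> \<epsilon> < b \<Longrightarrow> (AE x in M \<epsilon>. in_box c x)" "\<And>\<epsilon>. 0 < \<epsilon> \<Longrightarrow> \<epsilon> < b \<Longrightarrow> measure (M \<epsilon>) UNIV > 0"
      unfolding eventually_at_right_field by auto
    define t where "t n = b / (real n + 2)" for n :: nat
    have t: "0 < t n" "t n < b" for n using b(1) by (auto simp: t_def field_simps add_pos_nonneg)
    have "t \<longlonglongrightarrow> 0" unfolding t_def by real_asymp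
    then have tl: "filterlim t (at_right 0) sequentially"
      unfolding filterlim_at using t(1)[THEN less_imp_neq] t(1) by auto
    define w where "w n = measure (M (t n)) UNIV" for n
    have w: "w n > 0" for n unfolding w_def by (rule b(4)[OF t])
    have wl: "w \<longlonglongrightarrow> m 0 0"
    proof -
      have "(LINT x|M (t n). fst x ^ 0 * snd x ^ 0) = w n" for n
        using finite_borelD(3)[OF b(2)[OF t]] by (simp add: w_def)
      then show ?thesis using filterlim_compose[OF mom[of 0 0] tl] by simp
    qed
    define P where "P n = density (M (t n)) (\<lambda>_. ennreal (1 / w n))" for n
    note scale = finite_borel_scale[OF b(2)[OF t], of "1 / w n" for n]
    have iP: "(LINT x|P n. f x) = (LINT x|M (t n). f x) / w n" if "f \<in> borel_measurable borel" for n and f :: "_ \<Rightarrow> real"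
      unfolding P_def using scale(2)[OF _ that, of n] w[of n] by simp
    have Pb: "borel_prob (P n)" for n
    proof -
      have fb: "finite_borel (P n)" unfolding P_def using scale(1)[of n] w[of n] by simp
      have "measure (P n) UNIV = 1"
        using iP[of "\<lambda>_. 1" n] finite_borelD(3)[OF fb] finite_borelD(3)[OF b(2)[OF t]] w[of n] by (simp add: w_def)
      then have "emeasure (P n) UNIV = 1"
        using finite_measure.emeasure_eq_measure[OF finite_borelD(1)[OF fb]] by simp
      then show ?thesis
        using finite_borelD[OF fb] unfolding borel_prob_def by (auto intro: prob_spaceI)
    qed
    have PAE: "AE x in P n. in_box c x" for n
      unfolding P_def using scale(3)[OF _ b(3)[OF t], of n] w[of n] by simp
    obtain s L0 where s: "strict_mono s" and L0: "borel_prob L0" "AE x in L0. in_box (2 * c) x"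
      and lim: "\<And>f :: real \<times> real \<Rightarrow> real. continuous_on UNIV f \<Longrightarrow> (\<lambda>n. LINT x|P (s n). f x) \<longlonglongrightarrow> (LINT x|L0. f x)"
      by (rule prob_box_compactness[of P c, OF Pb c PAE]) blast
    define L where "L = density L0 (\<lambda>_. ennreal (m 0 0))"
    note scaleL = finite_borel_scale[OF borel_probD(4)[OF L0(1)] less_imp_le[OF m0], folded L_def]
    have "(LINT x|L. fst x ^ p * snd x ^ q) = m p q" for p q
    proof -
      let ?f = "\<lambda>x :: real \<times> real. fst x ^ p * snd x ^ q"
      have fm: "?f \<in> borel_measurable borel" using borel_measurable_continuous_onI[OF cm] .
      have "(\<lambda>n. w (s n) * (LINT x|P (s n). ?f x)) \<longlonglongrightarrow> m 0 0 * (LINT x|L0. ?f x)"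
        using LIMSEQ_subseq_LIMSEQ[OF wl s] by (intro tendsto_mult lim cm) (simp add: comp_def)
      moreover have "w (s n) * (LINT x|P (s n). ?f x) = (LINT x|M (t (s n)). ?f x)" for n
        using iP[OF fm] w[of "s n"] by simp
      moreover have "(\<lambda>n. LINT x|M (t (s n)). ?f x) \<longlonglongrightarrow> m p q"
        using LIMSEQ_subseq_LIMSEQ[OF filterlim_compose[OF mom tl] s] by (simp add: comp_def)
      ultimately have "m 0 0 * (LINT x|L0. ?f x) = m p q" using LIMSEQ_unique by auto
      then show ?thesis using scaleL(2)[OF fm] by simp
    qed
    then show ?thesis using scaleL(1) scaleL(3)[OF L0(2)] by (intro exI[of _ L]) simp
  qed
  then obtain L where L: "finite_borel L" "AE x in L. in_box (2 * c) x"
    and Lm: "\<And>p q. (LINT x|L. fst x ^ p * snd x ^ q) = m p q" by blast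
  show ?thesis
    by (rule that[OF L box_weak_convergence_of_moments[OF M2 L mom[folded Lm]]])
qed

section \<open>Limits of the weighted laws\<close>

context bifree_family_radius
begin

text \<open>A nonnegative quadratic form as weight covers s^2, t^2 and the squares of (s + t) / 2
  and (s - t) / 2 at once. Each moment of the weighted law is a combination of three rescaled
  moments of \<open>N \<epsilon>\<close>, all of degree at least 2.\<close>

lemma weighted_limit:
  fixes \<alpha> \<beta> \<gamma> :: real
  assumes nonneg: "\<And>s t. \<alpha> * s\<^sup>2 + 2 * \<beta> * (s * t) + \<gamma> * t\<^sup>2 \<ge> 0"
  obtains L where "finite_borel L" "AE x in L. in_box (4 / \<rho>) x"
    "\<And>f :: real \<times> real \<Rightarrow> real. continuous_on UNIV f \<Longrightarrow>
      ((\<lambda>\<epsilon>. (LINT x|N \<epsilon>. (\<alpha> * (fst x)\<^sup>2 + 2 * \<beta> * (fst x * snd x) + \<gamma> * (snd x)\<^sup>2) * f x) / \<epsilon>) \<longlongrightarrow> (LINT x|L. f x)) (at_right 0)"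
    "measure L UNIV = \<alpha> * \<kappa> 2 0 + 2 * \<beta> * \<kappa> 1 1 + \<gamma> * \<kappa> 0 2"
proof -
  define w where "w x = \<alpha> * (fst x)\<^sup>2 + 2 * \<beta> * (fst x * snd x) + \<gamma> * (snd x)\<^sup>2" for x :: "real \<times> real"
  have w0: "w x \<ge> 0" for x unfolding w_def by (rule nonneg)
  have wc: "continuous_on UNIV w" unfolding w_def by (intro continuous_intros)
  define M where "M \<epsilon> = density (N \<epsilon>) (\<lambda>x. ennreal (w x / \<epsilon>))" for \<epsilon>
  have box: "AE x in N \<epsilon>. in_box (2 / \<rho>) x" if "0 < \<epsilon>" "\<epsilon> \<le> 1" for \<epsilon>
    using family_identities(1)[OF that] unfolding in_box_def .
  have wi: "continuous_on UNIV (\<lambda>x. w x / \<epsilon>)" if "0 < \<epsilon>" for \<epsilon> using that by (intro continuous_intros wc) auto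
  have fb: "finite_borel (M \<epsilon>)" and Mbox: "AE x in M \<epsilon>. in_box (2 / \<rho>) x" if \<epsilon>: "0 < \<epsilon>" "\<epsilon> \<le> 1" for \<epsilon>
  proof -
    note Nfb = borel_probD(4)[OF N[OF \<epsilon>(1)]]
    show "finite_borel (M \<epsilon>)" unfolding M_def
      by (rule finite_borel_density[OF Nfb box_integrable[OF Nfb box[OF \<epsilon>] wi[OF \<epsilon>(1)]]])
    have "(\<lambda>x. ennreal (w x / \<epsilon>)) \<in> borel_measurable (N \<epsilon>)"
      using finite_borel_borel_measurable[OF Nfb borel_measurable_continuous_onI[OF wi[OF \<epsilon>(1)]]] by measurable
    then show "AE x in M \<epsilon>. in_box (2 / \<rho>) x"
      unfolding M_def using box[OF \<epsilon>] by (subst AE_density) (auto elim: eventually_mono)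
  qed
  have int: "(LINT x|M \<epsilon>. f x) = (LINT x|N \<epsilon>. w x * f x) / \<epsilon>"
    if \<epsilon>: "0 < \<epsilon>" "\<epsilon> \<le> 1" and f: "continuous_on UNIV f" for \<epsilon> and f :: "real \<times> real \<Rightarrow> real"
  proof -
    note Nfb = borel_probD(4)[OF N[OF \<epsilon>(1)]]
    have "(LINT x|M \<epsilon>. f x) = (LINT x|N \<epsilon>. (w x / \<epsilon>) *\<^sub>R f x)"
      unfolding M_def
      using finite_borel_borel_measurable[OF Nfb borel_measurable_continuous_onI[OF wi[OF \<epsilon>(1)]]]
        finite_borel_borel_measurable[OF Nfb borel_measurable_continuous_onI[OF f]] w0 \<epsilon>
      by (intro integral_density) auto
    also have "\<dots> = (LINT x|N \<epsilon>. (w x * f x) / \<epsilon>)" by simp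
    also have "\<dots> = (LINT x|N \<epsilon>. w x * f x) / \<epsilon>" by (rule Bochner_Integration.integral_divide_zero)
    finally show ?thesis .
  qed
  define m where "m p q = \<alpha> * \<kappa> (p + 2) q + 2 * \<beta> * \<kappa> (p + 1) (q + 1) + \<gamma> * \<kappa> p (q + 2)" for p q
  have mom: "((\<lambda>\<epsilon>. LINT x|M \<epsilon>. fst x ^ p * snd x ^ q) \<longlongrightarrow> m p q) (at_right 0)" for p q
  proof (rule Lim_transform_eventually)
    show "((\<lambda>\<epsilon>. \<alpha> * ((LINT x|N \<epsilon>. fst x ^ (p + 2) * snd x ^ q) / \<epsilon>) + 2 * \<beta> * ((LINT x|N \<epsilon>. fst x ^ (p + 1) * snd x ^ (q + 1)) / \<epsilon>)
        + \<gamma> * ((LINT x|N \<epsilon>. fst x ^ p * snd x ^ (q + 2)) / \<epsilon>)) \<longlongrightarrow> m p q) (at_right 0)"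
      unfolding m_def by (intro tendsto_add tendsto_mult tendsto_const moment_limit) auto
    show "\<forall>\<^sub>F \<epsilon> in at_right 0. \<alpha> * ((LINT x|N \<epsilon>. fst x ^ (p + 2) * snd x ^ q) / \<epsilon>) + 2 * \<beta> * ((LINT x|N \<epsilon>. fst x ^ (p + 1) * snd x ^ (q + 1)) / \<epsilon>)
        + \<gamma> * ((LINT x|N \<epsilon>. fst x ^ p * snd x ^ (q + 2)) / \<epsilon>) = (LINT x|M \<epsilon>. fst x ^ p * snd x ^ q)"
      using eventually_small
    proof eventually_elim
      case (elim \<epsilon>)
      then have \<epsilon>: "0 < \<epsilon>" "\<epsilon> \<le> 1" by auto
      have i: "integrable (N \<epsilon>) (\<lambda>x. fst x ^ p * snd x ^ q)" for p q
        by (rule box_integrable[OF borel_probD(4)[OF N[OF \<epsilon>(1)]] box[OF \<epsilon>]]) (intro continuous_intros)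
      have "(LINT x|M \<epsilon>. fst x ^ p * snd x ^ q) = (LINT x|N \<epsilon>. w x * (fst x ^ p * snd x ^ q)) / \<epsilon>"
        by (rule int[OF \<epsilon>]) (intro continuous_intros)
      also have "(\<lambda>x. w x * (fst x ^ p * snd x ^ q)) = (\<lambda>x. \<alpha> * (fst x ^ (p + 2) * snd x ^ q)
          + 2 * \<beta> * (fst x ^ (p + 1) * snd x ^ (q + 1)) + \<gamma> * (fst x ^ p * snd x ^ (q + 2)))"
        by (auto simp: w_def fun_eq_iff power_add power2_eq_square algebra_simps)
      also have "(LINT x|N \<epsilon>. \<alpha> * (fst x ^ (p + 2) * snd x ^ q)
          + 2 * \<beta> * (fst x ^ (p + 1) * snd x ^ (q + 1)) + \<gamma> * (fst x ^ p * snd x ^ (q + 2))) =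
          \<alpha> * (LINT x|N \<epsilon>. fst x ^ (p + 2) * snd x ^ q) + 2 * \<beta> * (LINT x|N \<epsilon>. fst x ^ (p + 1) * snd x ^ (q + 1))
          + \<gamma> * (LINT x|N \<epsilon>. fst x ^ p * snd x ^ (q + 2))"
        using i[of "p + 2" q] i[of "p + 1" "q + 1"] i[of p "q + 2"]
        by (simp del: power_Suc One_nat_def add_Suc_right add_2_eq_Suc' add: Suc_eq_plus1)
      finally show ?case by (simp add: add_divide_distrib)
    qed
  qed
  have Mev: "\<forall>\<^sub>F \<epsilon> in at_right 0. finite_borel (M \<epsilon>) \<and> (AE x in M \<epsilon>. in_box (2 / \<rho>) x)"
    using eventually_small by eventually_elim (use fb Mbox in blast)
  have "2 / \<rho> > 0" using \<rho> by simp
  then obtain L where L: "finite_borel L" "AE x in L. in_box (2 * (2 / \<rho>)) x"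
    "\<And>f :: real \<times> real \<Rightarrow> real. continuous_on UNIV f \<Longrightarrow> ((\<lambda>\<epsilon>. LINT x|M \<epsilon>. f x) \<longlongrightarrow> (LINT x|L. f x)) (at_right 0)"
    using box_weak_limit_exists[OF Mev _ mom] by blast
  show ?thesis
  proof (rule that[OF L(1)])
    show "AE x in L. in_box (4 / \<rho>) x" using L(2) by simp
    show "((\<lambda>\<epsilon>. (LINT x|N \<epsilon>. (\<alpha> * (fst x)\<^sup>2 + 2 * \<beta> * (fst x * snd x) + \<gamma> * (snd x)\<^sup>2) * f x) / \<epsilon>) \<longlongrightarrow> (LINT x|L. f x)) (at_right 0)"
      if f: "continuous_on UNIV f" for f
    proof (rule Lim_transform_eventually[OF L(3)[OF f]])
      show "\<forall>\<^sub>F \<epsilon> in at_right 0. (LINT x|M \<epsilon>. f x) =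
        (LINT x|N \<epsilon>. (\<alpha> * (fst x)\<^sup>2 + 2 * \<beta> * (fst x * snd x) + \<gamma> * (snd x)\<^sup>2) * f x) / \<epsilon>"
        using eventually_small by eventually_elim (use int[OF _ _ f] in \<open>auto simp: w_def\<close>)
    qed
    have "((\<lambda>\<epsilon>. LINT x|M \<epsilon>. fst x ^ 0 * snd x ^ 0) \<longlongrightarrow> (LINT x|L. fst x ^ 0 * snd x ^ 0)) (at_right 0)"
      by (rule L(3)) (intro continuous_intros)
    then have "(LINT x|L. fst x ^ 0 * snd x ^ 0) = m 0 0"
      by (rule tendsto_unique[OF trivial_limit_at_right_real _ mom])
    then show "measure L UNIV = \<alpha> * \<kappa> 2 0 + 2 * \<beta> * \<kappa> 1 1 + \<gamma> * \<kappa> 0 2"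
      using finite_borelD(3)[OF L(1)] by (simp add: m_def numeral_2_eq_2)
  qed
qed

end

section \<open>Cumulants of the generator\<close>

text \<open>Coefficients of index 1 and 2 as limits of quotients at 0, so that a functional equation
  can be compared order by order.\<close>

lemma power_series_quotient_limits:
  fixes a :: "nat \<Rightarrow> complex"
  assumes K: "K > 0" and a: "\<And>n. norm (a n) \<le> D * K ^ n"
    and f: "\<And>w. norm w < d \<Longrightarrow> (\<lambda>n. a n * w ^ n) sums f w" and d: "d > 0"
  shows "((\<lambda>w. (f w - a 0) / w) \<longlongrightarrow> a 1) (at 0)"
    and "((\<lambda>w. (f w - a 0 - a 1 * w) / w\<^sup>2) \<longlongrightarrow> a 2) (at 0)"
proof -
  have d': "\<forall>\<^sub>F w in at 0. w \<noteq> 0 \<and> norm w < d"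
    using d by (auto simp: eventually_at intro!: exI[of _ d])
  have s1: "(\<lambda>n. a (Suc n) * w ^ n) sums ((f w - a 0) / w)" if "w \<noteq> 0" "norm w < d" for w
  proof -
    have "(\<lambda>n. a (Suc n) * w ^ Suc n) sums (f w - a 0)"
      using f[OF that(2)] by (subst sums_Suc_iff) simp
    then have "(\<lambda>n. a (Suc n) * w ^ Suc n / w) sums ((f w - a 0) / w)" by (rule sums_divide)
    then show ?thesis using that(1) by simp
  qed
  have s2: "(\<lambda>n. a (Suc (Suc n)) * w ^ n) sums ((f w - a 0 - a 1 * w) / w\<^sup>2)" if "w \<noteq> 0" "norm w < d" for w
  proof -
    have "(\<lambda>n. a (Suc (Suc n)) * w ^ Suc n) sums ((f w - a 0) / w - a 1)"
      using s1[OF that] by (subst sums_Suc_iff) simp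
    then have "(\<lambda>n. a (Suc (Suc n)) * w ^ Suc n / w) sums (((f w - a 0) / w - a 1) / w)" by (rule sums_divide)
    moreover have "((f w - a 0) / w - a 1) / w = (f w - a 0 - a 1 * w) / w\<^sup>2"
      using that(1) by (simp add: field_simps power2_eq_square)
    ultimately show ?thesis using that(1) by simp
  qed
  have lim: "((\<lambda>w. \<Sum>n. b n * w ^ n) \<longlongrightarrow> b 0) (at 0)"
    if b: "\<And>n. norm (b n) \<le> C * K ^ n" for b :: "nat \<Rightarrow> complex" and C
  proof (rule powser_limit_0[where s="1 / (2 * K)" and a=b])
    show "1 / (2 * K) > 0" using K by simp
    show "(\<lambda>n. b n * x ^ n) sums (\<Sum>n. b n * x ^ n)" if "norm x < 1 / (2 * K)" for x
      using summable_norm_cancel[OF geometric_bound_sums(1)[OF K b less_imp_le[OF that]]] by (rule summable_sums)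
  qed
  have "((\<lambda>w. \<Sum>n. a (Suc n) * w ^ n) \<longlongrightarrow> a (Suc 0)) (at 0)"
    by (rule lim[of "\<lambda>n. a (Suc n)" "D * K"]) (use a[of "Suc _"] in \<open>simp add: mult.assoc\<close>)
  then show "((\<lambda>w. (f w - a 0) / w) \<longlongrightarrow> a 1) (at 0)"
    unfolding One_nat_def
  proof (rule Lim_transform_eventually)
    show "\<forall>\<^sub>F w in at 0. (\<Sum>n. a (Suc n) * w ^ n) = (f w - a 0) / w"
      using d' by eventually_elim (use s1 in \<open>simp add: sums_iff\<close>)
  qed
  have "((\<lambda>w. \<Sum>n. a (Suc (Suc n)) * w ^ n) \<longlongrightarrow> a (Suc (Suc 0))) (at 0)"
    by (rule lim[of "\<lambda>n. a (Suc (Suc n))" "D * K\<^sup>2"]) (use a[of "Suc (Suc _)"] in \<open>simp add: mult.assoc power2_eq_square\<close>)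
  then show "((\<lambda>w. (f w - a 0 - a 1 * w) / w\<^sup>2) \<longlongrightarrow> a 2) (at 0)"
    unfolding numeral_2_eq_2
  proof (rule Lim_transform_eventually)
    show "\<forall>\<^sub>F w in at 0. (\<Sum>n. a (Suc (Suc n)) * w ^ n) = (f w - a 0 - a 1 * w) / w ^ Suc (Suc 0)"
      using d' by eventually_elim (use s2 in \<open>simp add: sums_iff numeral_2_eq_2\<close>)
  qed
qed

text \<open>Comparison up to order two in g u = 1 + f (u g u): the linear terms agree, and the
  factor g u inside f adds a 1 b 1 to the quadratic one. This is the relation between moments and
  free cumulants in lowest order. The last two conclusions serve to compose limits along u g
  u.\<close>

lemma cumulants_of_functional_equation:
  fixes f g :: "complex \<Rightarrow> complex"
  assumes K: "K > 0" and d: "d > 0"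
    and a: "\<And>n. norm (a n) \<le> D * K ^ n" and b: "\<And>n. norm (b n) \<le> C * K ^ n"
    and f: "\<And>w. norm w < d \<Longrightarrow> (\<lambda>n. a n * w ^ n) sums f w"
    and g: "\<And>w. norm w < d \<Longrightarrow> (\<lambda>n. b n * w ^ n) sums g w"
    and a0: "a 0 = 0" and b0: "b 0 = 1"
    and eq: "\<And>u. norm u < d \<Longrightarrow> g u = 1 + f (u * g u)"
  shows "b 1 = a 1" "b 2 = a 2 + (a 1)\<^sup>2"
    and "filterlim (\<lambda>u. u * g u) (at 0) (at 0)" and "(g \<longlongrightarrow> 1) (at 0)"
proof -
  note fl = power_series_quotient_limits[OF K a f d] and gl = power_series_quotient_limits[OF K b g d]
  show g1: "(g \<longlongrightarrow> 1) (at 0)"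
    using powser_limit_0[of d b g] d g b0 by auto
  have d': "\<forall>\<^sub>F u in at 0. u \<noteq> 0 \<and> norm u < d"
    using d by (auto simp: eventually_at intro!: exI[of _ d])
  have gne: "\<forall>\<^sub>F u in at 0. g u \<noteq> 0" using tendsto_imp_eventually_ne[OF g1, of 0] by simp
  have ev: "\<forall>\<^sub>F u in at 0. u \<noteq> 0 \<and> norm u < d \<and> g u \<noteq> 0" using d' gne by eventually_elim auto
  have "((\<lambda>u. u * g u) \<longlongrightarrow> 0 * 1) (at 0)" by (intro tendsto_intros g1)
  then show z: "filterlim (\<lambda>u. u * g u) (at 0) (at 0)"
    unfolding filterlim_at using d' gne by (auto elim: eventually_elim2)
  have "((\<lambda>u. (f (u * g u) - a 0) / (u * g u) * g u) \<longlongrightarrow> a 1 * 1) (at 0)"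
    by (intro tendsto_mult g1 filterlim_compose[OF fl(1) z])
  then have "((\<lambda>u. (g u - b 0) / u) \<longlongrightarrow> a 1) (at 0)"
    unfolding mult_1_right
  proof (rule Lim_transform_eventually[OF _ eventually_mono[OF ev]])
    show "(f (u * g u) - a 0) / (u * g u) * g u = (g u - b 0) / u" if "u \<noteq> 0 \<and> norm u < d \<and> g u \<noteq> 0" for u
    proof -
      have "g u - b 0 = f (u * g u) - a 0" using eq[of u] that a0 b0 by (metis add_diff_cancel_left' diff_zero)
      then show ?thesis using that by simp
    qed
  qed
  then show b1: "b 1 = a 1" using gl(1) LIM_unique by blast
  have "((\<lambda>u. (f (u * g u) - a 0 - a 1 * (u * g u)) / (u * g u)\<^sup>2 * (g u)\<^sup>2 + a 1 * ((g u - b 0) / u)) \<longlongrightarrow> a 2 * 1\<^sup>2 + a 1 * b 1) (at 0)"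
    by (intro tendsto_add tendsto_mult tendsto_power tendsto_const g1 gl(1) filterlim_compose[OF fl(2) z])
  then have "((\<lambda>u. (g u - b 0 - b 1 * u) / u\<^sup>2) \<longlongrightarrow> a 2 * 1\<^sup>2 + a 1 * b 1) (at 0)"
  proof (rule Lim_transform_eventually[OF _ eventually_mono[OF ev]])
    show "(f (u * g u) - a 0 - a 1 * (u * g u)) / (u * g u)\<^sup>2 * (g u)\<^sup>2 + a 1 * ((g u - b 0) / u) = (g u - b 0 - b 1 * u) / u\<^sup>2"
      if "u \<noteq> 0 \<and> norm u < d \<and> g u \<noteq> 0" for u
    proof -
      have u: "u \<noteq> 0" "g u \<noteq> 0" using that by auto
      have f: "f (u * g u) = g u - 1" using eq[of u] that by (metis add_diff_cancel_left')
      have "(f (u * g u) - a 0 - a 1 * (u * g u)) / (u * g u)\<^sup>2 * (g u)\<^sup>2 = (g u - 1 - a 1 * (u * g u)) / u\<^sup>2"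
        using u unfolding f a0 by (simp add: power_mult_distrib)
      moreover have "a 1 * ((g u - b 0) / u) = (a 1 * u * (g u - 1)) / u\<^sup>2"
        using u unfolding b0 by (simp add: power2_eq_square)
      ultimately have "(f (u * g u) - a 0 - a 1 * (u * g u)) / (u * g u)\<^sup>2 * (g u)\<^sup>2 + a 1 * ((g u - b 0) / u) =
        ((g u - 1 - a 1 * (u * g u)) + a 1 * u * (g u - 1)) / u\<^sup>2"
        by (simp only: add_divide_distrib)
      also have "(g u - 1 - a 1 * (u * g u)) + a 1 * u * (g u - 1) = g u - b 0 - b 1 * u"
        unfolding b0 b1 by (simp add: algebra_simps)
      finally show ?thesis .
    qed
  qed
  then have "a 2 * 1\<^sup>2 + a 1 * b 1 = b 2" using gl(2) LIM_unique by blast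
  then show "b 2 = a 2 + (a 1)\<^sup>2" unfolding b1 by (simp add: power2_eq_square)
qed

lemma (in bidisc_series) iterated_series_0:
  assumes A: "\<And>m n. \<bar>\<kappa> m n\<bar> \<le> A * (2 / r) ^ (m + n)" and z: "norm z \<le> r / 4"
  shows "(\<lambda>m. of_real (\<kappa> m 0) * z ^ m) sums R z 0"
  using iterated_series(1)[OF A z, of 0] r_pos by simp

text \<open>The functional equations at \<epsilon> = 1, compared in low orders. The axes give the
  moments of the marginals; the mixed moment comes from the terms linear in v and, within these,
  linear in u.\<close>

lemma (in bidisc_series) cumulants:
  assumes prob: "borel_prob \<mu>" and R: "is_bifree_R \<mu> \<alpha> \<beta> R"
  shows "\<exists>c. AE x in \<mu>. in_box c x"
    and "(LINT x|\<mu>. fst x) = \<kappa> 1 0" "(LINT x|\<mu>. snd x) = \<kappa> 0 1"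
    and "(LINT x|\<mu>. (fst x)\<^sup>2) = \<kappa> 2 0 + (\<kappa> 1 0)\<^sup>2" "(LINT x|\<mu>. (snd x)\<^sup>2) = \<kappa> 0 2 + (\<kappa> 0 1)\<^sup>2"
    and "(LINT x|\<mu>. fst x * snd x) = \<kappa> 1 1 + \<kappa> 1 0 * \<kappa> 0 1"
proof -
  interpret sw: bidisc_series "\<lambda>z w. R w z" "\<lambda>m n. \<kappa> n m" r by (rule swap)
  interpret prob_space \<mu> using borel_probD(1)[OF prob] .
  obtain A where A: "A \<ge> 0" "\<And>m n. \<bar>\<kappa> m n\<bar> \<le> A * (2 / r) ^ (m + n)" using coefficient_bound by blast
  have A': "\<bar>\<kappa> n m\<bar> \<le> A * (2 / r) ^ (m + n)" for m n using A(2)[of n m] by (simp add: add.commute)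
  obtain \<rho> B where \<rho>r: "\<rho> \<le> r / 8" and sm: "1 * B * \<rho> \<le> 1 / 4" and "lipschitz_bidisc R \<rho> B"
    using choose_radius[of 1] by auto
  then interpret lipschitz_bidisc R \<rho> B by simp
  note ids = bifree_identities[OF zero_less_one sm prob, unfolded of_real_1 mult_1_left, OF R]
  define K where "K = 2 / \<rho>"
  have K: "K > 0" using \<rho> by (simp add: K_def)
  define d where "d = \<rho> / 4"
  have d: "d > 0" using \<rho> by (simp add: d_def)
  have dball: "u \<in> ball 0 (\<rho> / 4)" "norm u \<le> 1 / (2 * K)" "norm u \<le> r / 4" if "norm u < d" for u :: complex
    using that \<rho>r \<rho> by (auto simp: d_def K_def)
  have AE: "AE x in \<mu>. \<bar>fst x\<bar> \<le> K \<and> \<bar>snd x\<bar> \<le> K" using ids(2) unfolding K_def .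
  then show "\<exists>c. AE x in \<mu>. in_box c x" unfolding in_box_def by blast
  then have bx: "AE x in \<mu>. in_box K x" using AE unfolding in_box_def by blast
  define m where "m p q = (LINT x|\<mu>. fst x ^ p * snd x ^ q)" for p q
  have m00: "m 0 0 = 1" by (simp add: m_def prob_space)
  have mb: "\<bar>m p q\<bar> \<le> K ^ (p + q)" for p q
  proof -
    have "\<bar>m p q\<bar> \<le> K ^ (p + q) * measure \<mu> UNIV"
      unfolding m_def
    proof (rule box_integral_bound[OF borel_probD(4)[OF prob] bx])
      show "\<bar>fst x ^ p * snd x ^ q\<bar> \<le> K ^ (p + q)" if "in_box K x" for x
        using that unfolding abs_mult power_abs power_add in_box_def by (intro mult_mono power_mono) auto
    qed (intro continuous_intros)
    then show ?thesis using prob_space borel_probD(3)[OF prob] by simp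
  qed
  have \<kappa>b: "\<bar>\<kappa> p q\<bar> \<le> A * K ^ (p + q)" for p q
  proof -
    have "\<bar>\<kappa> p q\<bar> \<le> A * (2 / r) ^ (p + q)" by (rule A)
    also have "\<dots> \<le> A * K ^ (p + q)"
      unfolding K_def using A(1) \<rho> \<rho>r r_pos by (intro mult_left_mono power_mono divide_left_mono) auto
    finally show ?thesis .
  qed
  define a where "a u = biresolvent \<mu> u 0" for u
  define b where "b v = biresolvent \<mu> 0 v" for v
  have \<kappa>00: "\<kappa> 0 0 = 0"
  proof -
    have "(\<lambda>m. complex_of_real (\<kappa> m 0) * 0 ^ m) sums R 0 0" using iterated_series_0[OF A(2), of 0] r_pos by simp
    then have "R 0 0 = complex_of_real (\<kappa> 0 0)" using powser_zero[of "\<lambda>m. complex_of_real (\<kappa> m 0)"] by (simp add: sums_iff)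
    then show ?thesis using ids(1) by simp
  qed
  have as: "(\<lambda>p. of_real (m p 0) * u ^ p) sums a u" if "norm u < d" for u
    using biresolvent_expansion[OF prob K AE dball(2)[OF that], of 0] K unfolding a_def m_def by simp
  have \<mu>sw: "borel_prob (swap_measure \<mu>)" by (rule borel_prob_swap[OF prob])
  have AEsw: "AE x in swap_measure \<mu>. \<bar>fst x\<bar> \<le> K \<and> \<bar>snd x\<bar> \<le> K"
    by (subst AE_swap[OF prob]) (use in_box_borel[of K] AE in \<open>auto simp: in_box_def\<close>)
  have msw: "(LINT x|swap_measure \<mu>. fst x ^ p * snd x ^ q) = m q p" for p q
    by (subst integral_swap[OF prob]) (auto simp: m_def mult.commute)
  have \<Psi>s: "(\<lambda>q. (\<Sum>p. of_real (m p q) * u ^ p) * v ^ q) sums biresolvent \<mu> u v" if "norm u < d" "norm v < d" for u v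
    using biresolvent_expansion[OF \<mu>sw K AEsw dball(2)[OF that(2)] dball(2)[OF that(1)]]
    unfolding msw biresolvent_swap[OF prob] .
  have bs: "(\<lambda>p. of_real (m 0 p) * u ^ p) sums b u" if "norm u < d" for u
    using \<Psi>s[of 0 u] that d unfolding b_def by simp
  have fs: "(\<lambda>n. of_real (\<kappa> n 0) * z ^ n) sums R z 0" if "norm z < d" for z
    by (rule iterated_series_0[OF A(2) dball(3)[OF that]])
  have gs: "(\<lambda>n. of_real (\<kappa> 0 n) * z ^ n) sums R 0 z" if "norm z < d" for z
    by (rule sw.iterated_series_0[OF A' dball(3)[OF that]])
  have C1: "of_real (m 1 0) = complex_of_real (\<kappa> 1 0)" "of_real (m 2 0) = complex_of_real (\<kappa> 2 0) + (complex_of_real (\<kappa> 1 0))\<^sup>2"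
    "filterlim (\<lambda>u. u * a u) (at 0) (at 0)" "(a \<longlongrightarrow> 1) (at 0)"
  proof -
    have 1: "norm (complex_of_real (\<kappa> n 0)) \<le> A * K ^ n" for n using \<kappa>b[of n 0] by simp
    have 2: "norm (complex_of_real (m n 0)) \<le> 1 * K ^ n" for n using mb[of n 0] by simp
    have 3: "complex_of_real (\<kappa> 0 0) = 0" "complex_of_real (m 0 0) = 1" using \<kappa>00 m00 by auto
    have 4: "a u = 1 + R (u * a u) 0" if "norm u < d" for u using ids(4)[OF dball(1)[OF that]] by (simp add: a_def)
    note * = cumulants_of_functional_equation[OF K d 1 2 fs as 3 4]
    show "of_real (m 1 0) = complex_of_real (\<kappa> 1 0)" "of_real (m 2 0) = complex_of_real (\<kappa> 2 0) + (complex_of_real (\<kappa> 1 0))\<^sup>2"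
      "filterlim (\<lambda>u. u * a u) (at 0) (at 0)" "(a \<longlongrightarrow> 1) (at 0)"
      using * by blast+
  qed
  have C2: "of_real (m 0 1) = complex_of_real (\<kappa> 0 1)" "of_real (m 0 2) = complex_of_real (\<kappa> 0 2) + (complex_of_real (\<kappa> 0 1))\<^sup>2"
    "filterlim (\<lambda>u. u * b u) (at 0) (at 0)" "(b \<longlongrightarrow> 1) (at 0)"
  proof -
    have 1: "norm (complex_of_real (\<kappa> 0 n)) \<le> A * K ^ n" for n using \<kappa>b[of 0 n] by simp
    have 2: "norm (complex_of_real (m 0 n)) \<le> 1 * K ^ n" for n using mb[of 0 n] by simp
    have 3: "complex_of_real (\<kappa> 0 0) = 0" "complex_of_real (m 0 0) = 1" using \<kappa>00 m00 by auto
    have 4: "b u = 1 + R 0 (u * b u)" if "norm u < d" for u using ids(6)[OF dball(1)[OF that]] by (simp add: b_def)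
    note * = cumulants_of_functional_equation[OF K d 1 2 gs bs 3 4]
    show "of_real (m 0 1) = complex_of_real (\<kappa> 0 1)" "of_real (m 0 2) = complex_of_real (\<kappa> 0 2) + (complex_of_real (\<kappa> 0 1))\<^sup>2"
      "filterlim (\<lambda>u. u * b u) (at 0) (at 0)" "(b \<longlongrightarrow> 1) (at 0)"
      using * by blast+
  qed
  have m10: "m 1 0 = \<kappa> 1 0" "m 0 1 = \<kappa> 0 1" using C1(1) C2(1) by simp_all
  then show "(LINT x|\<mu>. fst x) = \<kappa> 1 0" "(LINT x|\<mu>. snd x) = \<kappa> 0 1" by (simp_all add: m_def)
  have "m 2 0 = \<kappa> 2 0 + (\<kappa> 1 0)\<^sup>2" "m 0 2 = \<kappa> 0 2 + (\<kappa> 0 1)\<^sup>2"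
    using C1(2) C2(2) by (simp_all only: of_real_power[symmetric] of_real_add[symmetric] of_real_eq_iff)
  then show "(LINT x|\<mu>. (fst x)\<^sup>2) = \<kappa> 2 0 + (\<kappa> 1 0)\<^sup>2" "(LINT x|\<mu>. (snd x)\<^sup>2) = \<kappa> 0 2 + (\<kappa> 0 1)\<^sup>2"
    by (simp_all add: m_def)
  \<comment> \<open>\<open>n q u\<close> is the coefficient of v ^ q in
    \<open>biresolvent \<mu> u v\<close>, and \<open>c q z\<close> is that of w ^ q in
    \<open>R z w\<close>.\<close>
  define n where "n q u = (\<Sum>p. of_real (m p q) * u ^ p :: complex)" for q u
  define c where "c q z = (\<Sum>p. of_real (\<kappa> p q) * z ^ p :: complex)" for q z
  have nb: "norm (n q u) \<le> 2 * K ^ q" if "norm u < d" for q u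
    unfolding n_def
    by (rule geometric_bound_sums(2)[OF K _ dball(2)[OF that]]) (use mb[of _ q] in \<open>simp add: power_add mult.commute\<close>)
  have cb: "norm (c q z) \<le> (2 * A) * K ^ q" if "norm z \<le> 1 / (2 * K)" for q z
  proof -
    have "norm (c q z) \<le> 2 * (A * K ^ q)" unfolding c_def
      by (rule geometric_bound_sums(2)[OF K _ that]) (use \<kappa>b[of _ q] in \<open>simp add: power_add mult.assoc mult.commute[of "K ^ q"]\<close>)
    then show ?thesis by simp
  qed
  have n0: "n 0 u = a u" if "norm u < d" for u using as[OF that] by (simp add: n_def sums_iff)
  have c0: "c 0 z = R z 0" if "norm z < d" for z using fs[OF that] by (simp add: c_def sums_iff)
  have c_zero: "c q 0 = of_real (\<kappa> 0 q)" for q unfolding c_def by (simp add: powser_zero)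
  have Rs: "(\<lambda>q. c q z * w ^ q) sums R z w" if "norm z < d" "norm w < d" for z w
    using sw.iterated_series(1)[OF A' dball(3)[OF that(2)] dball(3)[OF that(1)]] unfolding c_def .
  \<comment> \<open>The terms linear in v of the two-variable equation give n 1 = a (c 1 z - c 1 0)
    + a m 0 1 with z = u a. As c 1 0 = \<kappa> 0 1 = m 0 1, this collapses to a c 1 z.\<close>
  have n1: "n 1 u = a u * c 1 (u * a u)" if u: "norm u < d" "norm (u * a u) < d" for u
  proof -
    define z where "z = u * a u"
    have z: "norm z < d" using u(2) by (simp add: z_def)
    have L1: "((\<lambda>v. (biresolvent \<mu> u v - n 0 u) / v) \<longlongrightarrow> n 1 u) (at 0)"
      by (rule power_series_quotient_limits(1)[OF K, where D=2 and d=d]) (use nb[OF u(1)] \<Psi>s[OF u(1)] d in \<open>simp_all add: n_def\<close>)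
    have L2: "((\<lambda>w. (R z w - c 0 z) / w) \<longlongrightarrow> c 1 z) (at 0)"
      by (rule power_series_quotient_limits(1)[OF K, where D="2 * A" and d=d]) (use cb dball(2)[OF z] Rs[OF z] d in simp_all)
    have L3: "((\<lambda>w. (R 0 w - c 0 0) / w) \<longlongrightarrow> c 1 0) (at 0)"
      by (rule power_series_quotient_limits(1)[OF K, where D="2 * A" and d=d]) (use cb K Rs[of 0] d in simp_all)
    have L4: "((\<lambda>v. (b v - of_real (m 0 0)) / v) \<longlongrightarrow> of_real (m 0 1)) (at 0)"
      by (rule power_series_quotient_limits(1)[OF K, where D=1 and d=d and a="\<lambda>q. of_real (m 0 q)"]) (use mb[of 0] bs d in simp_all)
    have XL: "((\<lambda>v. biresolvent \<mu> u v) \<longlongrightarrow> n 0 u) (at 0)"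
      by (rule powser_limit_0[OF d \<Psi>s[OF u(1), folded n_def]])
    have "((\<lambda>v. biresolvent \<mu> u v * (((R z (v * b v) - c 0 z) / (v * b v) - (R 0 (v * b v) - c 0 0) / (v * b v)) * b v)
        + a u * ((b v - of_real (m 0 0)) / v)) \<longlongrightarrow> n 0 u * ((c 1 z - c 1 0) * 1) + a u * of_real (m 0 1)) (at 0)"
      by (intro tendsto_add tendsto_mult tendsto_diff tendsto_const XL C2(4) L4
          filterlim_compose[OF L2 C2(3)] filterlim_compose[OF L3 C2(3)])
    then have "((\<lambda>v. (biresolvent \<mu> u v - n 0 u) / v) \<longlongrightarrow> n 0 u * ((c 1 z - c 1 0) * 1) + a u * of_real (m 0 1)) (at 0)"
    proof (rule Lim_transform_eventually)
      have "\<forall>\<^sub>F v in at 0. norm v < d \<and> v \<noteq> 0" using d by (auto simp: eventually_at intro!: exI[of _ d])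
      moreover have "\<forall>\<^sub>F v in at 0. b v \<noteq> 0" using tendsto_imp_eventually_ne[OF C2(4), of 0] by simp
      ultimately show "\<forall>\<^sub>F v in at 0. biresolvent \<mu> u v * (((R z (v * b v) - c 0 z) / (v * b v) - (R 0 (v * b v) - c 0 0) / (v * b v)) * b v)
        + a u * ((b v - of_real (m 0 0)) / v) = (biresolvent \<mu> u v - n 0 u) / v"
      proof eventually_elim
        case (elim v)
        define X where "X = biresolvent \<mu> u v"
        define Y where "Y = R z (v * b v) - R z 0 - R 0 (v * b v)"
        have e: "X * (1 - Y) = a u * b v"
          using ids(7)[OF dball(1)[OF u(1)] dball(1), of v] elim unfolding X_def Y_def z_def a_def b_def by simp
        have "((R z (v * b v) - c 0 z) / (v * b v) - (R 0 (v * b v) - c 0 0) / (v * b v)) * b v = Y / v"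
          using elim unfolding diff_divide_distrib[symmetric] by (simp add: Y_def c0[OF z] c_zero \<kappa>00)
        moreover have "X * (Y / v) + a u * ((b v - 1) / v) = (X - a u) / v"
        proof -
          have "X * Y + a u * (b v - 1) = X - a u" using e by (simp add: algebra_simps)
          then show ?thesis by (metis add_divide_distrib times_divide_eq_right)
        qed
        ultimately show ?case using m00 n0[OF u(1)] by (simp add: X_def)
      qed
    qed
    then have "n 1 u = n 0 u * ((c 1 z - c 1 0) * 1) + a u * of_real (m 0 1)" using L1 LIM_unique by blast
    then show ?thesis using n0[OF u(1)] m10 unfolding z_def by (simp add: c_zero algebra_simps)
  qed
  have N1: "((\<lambda>u. (n 1 u - of_real (m 0 1)) / u) \<longlongrightarrow> of_real (m 1 1)) (at 0)"
  proof (rule power_series_quotient_limits(1)[OF K, where D=K and d=d and a="\<lambda>p. of_real (m p 1)"])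
    show "norm (complex_of_real (m p 1)) \<le> K * K ^ p" for p using mb[of p 1] by simp
    show "(\<lambda>p. complex_of_real (m p 1) * w ^ p) sums n 1 w" if "norm w < d" for w
      unfolding n_def
      by (rule summable_sums, rule summable_norm_cancel, rule geometric_bound_sums(1)[OF K _ dball(2)[OF that], of _ K])
         (use mb[of _ 1] in simp)
  qed (rule d)
  have C1': "((\<lambda>z. (c 1 z - of_real (\<kappa> 0 1)) / z) \<longlongrightarrow> of_real (\<kappa> 1 1)) (at 0)"
  proof (rule power_series_quotient_limits(1)[OF K, where D="A * K" and d=d and a="\<lambda>p. of_real (\<kappa> p 1)"])
    show "norm (complex_of_real (\<kappa> p 1)) \<le> A * K * K ^ p" for p using \<kappa>b[of p 1] by (simp add: mult.assoc)
    show "(\<lambda>p. complex_of_real (\<kappa> p 1) * w ^ p) sums c 1 w" if "norm w < d" for w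
      unfolding c_def
      by (rule summable_sums, rule summable_norm_cancel, rule geometric_bound_sums(1)[OF K _ dball(2)[OF that], of _ "A * K"])
         (use \<kappa>b[of _ 1] in \<open>simp add: mult.assoc\<close>)
  qed (rule d)
  have A1: "((\<lambda>u. (a u - of_real (m 0 0)) / u) \<longlongrightarrow> of_real (m 1 0)) (at 0)"
    by (rule power_series_quotient_limits(1)[OF K, where D=1 and d=d and a="\<lambda>p. of_real (m p 0)"]) (use mb[of _ 0] as d in simp_all)
  \<comment> \<open>The terms linear in u of a u c 1 (u a u): the argument of c 1 contributes
    \<kappa> 1 1 and the factor a contributes \<kappa> 0 1 m 1 0.\<close>
  have "((\<lambda>u. (a u)\<^sup>2 * ((c 1 (u * a u) - of_real (\<kappa> 0 1)) / (u * a u)) + of_real (\<kappa> 0 1) * ((a u - of_real (m 0 0)) / u))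
      \<longlongrightarrow> 1\<^sup>2 * of_real (\<kappa> 1 1) + of_real (\<kappa> 0 1) * of_real (m 1 0)) (at 0)"
    by (intro tendsto_add tendsto_mult tendsto_power tendsto_const A1 C1(4) filterlim_compose[OF C1' C1(3)])
  then have "((\<lambda>u. (n 1 u - of_real (m 0 1)) / u) \<longlongrightarrow> 1\<^sup>2 * of_real (\<kappa> 1 1) + of_real (\<kappa> 0 1) * of_real (m 1 0)) (at 0)"
  proof (rule Lim_transform_eventually)
    have "\<forall>\<^sub>F u in at 0. norm u < d \<and> u \<noteq> (0::complex)" using d by (auto simp: eventually_at intro!: exI[of _ d])
    moreover have "\<forall>\<^sub>F u in at 0. norm (u * a u) < d"
    proof -
      have "((\<lambda>u. u * a u) \<longlongrightarrow> 0) (at 0)" using C1(3) unfolding filterlim_at by blast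
      from order_tendstoD(2)[OF tendsto_norm_zero[OF this] d] show ?thesis .
    qed
    moreover have "\<forall>\<^sub>F u in at 0. a u \<noteq> 0" using tendsto_imp_eventually_ne[OF C1(4), of 0] by simp
    ultimately show "\<forall>\<^sub>F u in at 0. (a u)\<^sup>2 * ((c 1 (u * a u) - of_real (\<kappa> 0 1)) / (u * a u)) + of_real (\<kappa> 0 1) * ((a u - of_real (m 0 0)) / u)
      = (n 1 u - of_real (m 0 1)) / u"
    proof eventually_elim
      case (elim u)
      then have n: "n 1 u = a u * c 1 (u * a u)" using n1 by blast
      have "(a u)\<^sup>2 * ((c 1 (u * a u) - of_real (\<kappa> 0 1)) / (u * a u)) = a u * (c 1 (u * a u) - of_real (\<kappa> 0 1)) / u"
        using elim by (simp add: power2_eq_square)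
      then show ?case unfolding n m10 m00 by (simp add: add_divide_distrib[symmetric] algebra_simps diff_divide_distrib[symmetric])
    qed
  qed
  then have "1\<^sup>2 * of_real (\<kappa> 1 1) + of_real (\<kappa> 0 1) * of_real (m 1 0) = complex_of_real (m 1 1)"
    using N1 LIM_unique by blast
  then have "m 1 1 = \<kappa> 1 1 + \<kappa> 1 0 * \<kappa> 0 1"
    unfolding m10 by (simp add: of_real_mult[symmetric] of_real_add[symmetric] mult.commute del: of_real_mult of_real_add)
  then show "(LINT x|\<mu>. fst x * snd x) = \<kappa> 1 1 + \<kappa> 1 0 * \<kappa> 0 1" by (simp add: m_def)
qed

section \<open>Uniqueness of bi-free R-transforms\<close>

lemma is_R_transform_mono:
  assumes "is_R_transform m \<alpha> \<beta> f" "\<alpha>' \<le> \<alpha>" "\<beta>' \<le> \<beta>"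
  shows "is_R_transform m \<alpha>' \<beta>' f"
  using assms(1) stolz_pair_mono[OF assms(2,3)] unfolding is_R_transform_def
  by (auto intro: holomorphic_on_subset tendsto_within_subset)

text \<open>Lets a transform be exchanged for one that agrees with it merely near the
  origin.\<close>

lemma is_bifree_R_shrink:
  assumes R: "is_bifree_R \<mu> \<alpha> \<beta> R" and ab: "0 < \<alpha>'" "\<alpha>' \<le> \<alpha>" "0 < \<beta>'" "\<beta>' \<le> \<beta>"
    and eq: "\<And>z w. z \<in> stolz_pair \<alpha>' \<beta>' \<Longrightarrow> w \<in> stolz_pair \<alpha>' \<beta>' \<Longrightarrow> R' z w = R z w"
  shows "is_bifree_R \<mu> \<alpha>' \<beta>' R'"
proof -
  obtain R1 R2 where R1: "is_R_transform (marginal1 \<mu>) \<alpha> \<beta> R1" and R2: "is_R_transform (marginal2 \<mu>) \<alpha> \<beta> R2"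
    and h: "\<forall>z\<in>stolz_pair \<alpha> \<beta>. \<forall>w\<in>stolz_pair \<alpha> \<beta>.
           let h = cauchy_transform2 \<mu> (1 / z + R1 z) (1 / w + R2 w) / (z * w)
           in h \<noteq> 0 \<and> R z w = z * R1 z + w * R2 w + (1 - 1 / h)"
    using R unfolding is_bifree_R_def by blast
  have "\<forall>z\<in>stolz_pair \<alpha>' \<beta>'. \<forall>w\<in>stolz_pair \<alpha>' \<beta>'.
           let h = cauchy_transform2 \<mu> (1 / z + R1 z) (1 / w + R2 w) / (z * w)
           in h \<noteq> 0 \<and> R' z w = z * R1 z + w * R2 w + (1 - 1 / h)"
  proof (intro ballI)
    fix z w assume zw: "z \<in> stolz_pair \<alpha>' \<beta>'" "w \<in> stolz_pair \<alpha>' \<beta>'"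
    then have "z \<in> stolz_pair \<alpha> \<beta>" "w \<in> stolz_pair \<alpha> \<beta>" using stolz_pair_mono[OF ab(2,4)] by auto
    then show "let h = cauchy_transform2 \<mu> (1 / z + R1 z) (1 / w + R2 w) / (z * w)
           in h \<noteq> 0 \<and> R' z w = z * R1 z + w * R2 w + (1 - 1 / h)"
      using h eq[OF zw] by simp
  qed
  then show ?thesis
    using is_R_transform_mono[OF R1 ab(2,4)] is_R_transform_mono[OF R2 ab(2,4)] ab unfolding is_bifree_R_def by blast
qed

text \<open>G Z - G W is (W - Z) / (Z W) times the integral of \<open>q\<close>. For |x| \<le> c and
  |Z|, |W| \<ge> 8 c the real part of \<open>q x\<close> is at least 1 / 8, so the integral is not 0
  and W - Z must be.\<close>

lemma (in real_distribution) cauchy_transform_inj_at_infinity: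
  assumes c: "c > 0" and AE: "AE x in M. \<bar>x\<bar> \<le> c" and Z: "norm Z \<ge> 8 * c" "norm W \<ge> 8 * c"
    and eq: "cauchy_transform M Z = cauchy_transform M W"
  shows "Z = W"
proof -
  have ZW0: "Z \<noteq> 0" "W \<noteq> 0" using Z c by auto
  define q where "q x = 1 / ((1 - of_real x / Z) * (1 - of_real x / W))" for x :: real
  have q: "AE x in M. Z - of_real x \<noteq> 0 \<and> W - of_real x \<noteq> 0 \<and> norm (1 / (Z - of_real x)) \<le> 1 / c \<and>
      norm (1 / (W - of_real x)) \<le> 1 / c \<and> Re (q x) \<ge> 1 / 8 \<and> norm (q x) \<le> 4"
    using AE
  proof eventually_elim
    case (elim x)
    have small: "norm (of_real x / V) \<le> 1 / 8" if "norm V \<ge> 8 * c" for V :: complex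
    proof -
      have "norm (of_real x / V) \<le> c / (8 * c)"
        unfolding norm_divide using elim c that by (intro frac_le) auto
      then show ?thesis using c by simp
    qed
    have far: "V - of_real x \<noteq> 0 \<and> norm (1 / (V - of_real x)) \<le> 1 / c" if "norm V \<ge> 8 * c" for V :: complex
    proof -
      have "norm (V - of_real x) \<ge> c"
        using norm_triangle_ineq2[of V "of_real x"] that elim c by simp
      moreover have "norm (1 / (V - of_real x)) \<le> 1 / c"
        unfolding norm_divide norm_one using c calculation by (intro frac_le) auto
      ultimately show ?thesis using c by auto
    qed
    define a where "a = of_real x / Z"
    define b where "b = of_real x / W"
    have ab: "norm a \<le> 1 / 8" "norm b \<le> 1 / 8" using small Z by (auto simp: a_def b_def)
    have "norm (a * b) \<le> (1 / 8) * (1 / 8)" unfolding norm_mult using ab by (intro mult_mono) auto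
    then have abn: "norm (a * b) \<le> 1 / 8" by simp
    \<comment> \<open>The reciprocal of \<open>q x\<close>. Its real part is at least 1 - 3 / 8 and
      its norm at most 81 / 64; these are rounded to 1 / 2 and 2.\<close>
    define v where "v = (1 - a) * (1 - b)"
    have v: "v = 1 - a - b + a * b" by (simp add: v_def algebra_simps)
    have "Re v = 1 - Re a - Re b + Re (a * b)" unfolding v by simp
    then have Re: "Re v \<ge> 1 / 2"
      using abs_Re_le_cmod[of a] abs_Re_le_cmod[of b] abs_Re_le_cmod[of "a * b"] ab abn by linarith
    have "norm v \<le> norm (1 - a) * norm (1 - b)" by (simp add: v_def norm_mult)
    also have "\<dots> \<le> (1 + 1 / 8) * (1 + 1 / 8)"
      using norm_triangle_ineq4[of 1 a] norm_triangle_ineq4[of 1 b] ab by (intro mult_mono) auto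
    finally have nv: "norm v \<le> 2" by simp
    have nv': "norm v \<ge> 1 / 2" using Re complex_Re_le_cmod[of v] by linarith
    have qv: "q x = 1 / v" by (simp add: q_def v_def a_def b_def)
    have v0: "v \<noteq> 0" using Re by auto
    have "Re (1 / v) = Re v / (norm v)\<^sup>2" by (simp add: Re_divide cmod_power2)
    also have "\<dots> \<ge> (1 / 2) / 2\<^sup>2" using Re nv nv' v0 by (intro frac_le power_mono) auto
    finally have "Re (q x) \<ge> 1 / 8" unfolding qv by simp
    moreover have "norm (q x) \<le> 1 / (1 / 2)" unfolding qv norm_divide norm_one using nv' by (intro frac_le) auto
    ultimately show ?case using far Z by auto
  qed
  have iZ: "integrable M (\<lambda>x. 1 / (Z - of_real x))" and iW: "integrable M (\<lambda>x. 1 / (W - of_real x))"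
    using q by (auto intro!: integrable_const_bound[where B="1 / c"])
  have iq: "integrable M q"
  proof (rule integrable_const_bound[where B=4])
    show "q \<in> borel_measurable M" unfolding q_def by simp
  qed (use q in auto)
  have "0 = cauchy_transform M Z - cauchy_transform M W" using eq by simp
  also have "\<dots> = (LINT x|M. 1 / (Z - of_real x) - 1 / (W - of_real x))"
    unfolding cauchy_transform_def using iZ iW by simp
  also have "\<dots> = (LINT x|M. ((W - Z) / (Z * W)) * q x)"
  proof (rule integral_cong_AE)
    show "AE x in M. 1 / (Z - of_real x) - 1 / (W - of_real x) = ((W - Z) / (Z * W)) * q x"
      using q
    proof eventually_elim
      case (elim x)
      have "1 - of_real x / Z = (Z - of_real x) / Z" "1 - of_real x / W = (W - of_real x) / W"
        using ZW0 by (auto simp: field_simps)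
      then have "q x = Z * W / ((Z - of_real x) * (W - of_real x))" by (simp add: q_def)
      then have "((W - Z) / (Z * W)) * q x = (W - Z) / ((Z - of_real x) * (W - of_real x))" using ZW0 by simp
      then show ?case using elim by (simp add: diff_frac_eq)
    qed
  qed (use iZ iW iq in auto)
  also have "\<dots> = ((W - Z) / (Z * W)) * (LINT x|M. q x)" by simp
  finally have 0: "((W - Z) / (Z * W)) * (LINT x|M. q x) = 0" by simp
  have "(LINT x|M. 1 / 8) \<le> (LINT x|M. Re (q x))"
    using q iq by (intro integral_mono_AE) auto
  then have "Re (LINT x|M. q x) \<ge> 1 / 8" using iq prob_space by simp
  then have "(LINT x|M. q x) \<noteq> 0" by auto
  then show ?thesis using 0 ZW0 by simp
qed

text \<open>The inversion property only says that 1 / z + f z is some preimage of z under G. As z f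
  z tends to 0, this preimage is far from the origin for small z, where G is injective.\<close>

lemma R_transform_unique:
  assumes m: "real_distribution m" and c: "c > 0" and AE: "AE x in m. \<bar>x\<bar> \<le> c"
    and f: "is_R_transform m \<alpha> \<beta> f" and g: "is_R_transform m \<alpha>' \<beta>' g"
  shows "\<exists>s>0. \<forall>z\<in>stolz_pair \<alpha> \<beta> \<inter> stolz_pair \<alpha>' \<beta>'. norm z < s \<longrightarrow> f z = g z"
proof -
  interpret real_distribution m by fact
  have near: "\<exists>s>0. \<forall>z\<in>stolz_pair \<alpha> \<beta>. norm z < s \<longrightarrow> norm (z * f z) \<le> 1 / 2"
    if "is_R_transform m \<alpha> \<beta> f" for \<alpha> \<beta> f
  proof -
    have "\<forall>\<^sub>F z in at 0 within stolz_pair \<alpha> \<beta>. norm (z * f z) < 1 / 2"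
      by (rule order_tendstoD(2)[OF tendsto_norm_zero[OF is_R_transformD(4)[OF that]]]) simp
    then obtain s where "s > 0" "\<forall>z\<in>stolz_pair \<alpha> \<beta>. z \<noteq> 0 \<and> dist z 0 < s \<longrightarrow> norm (z * f z) < 1 / 2"
      unfolding eventually_at by blast
    then show ?thesis using stolz_pair_nonzero by (intro exI[of _ s]) (auto intro: less_imp_le)
  qed
  \<comment> \<open>|1 / z + h z| = |1 + z h z| / |z| is at least (1 / 2) / |z|, which exceeds 8 c
    for |z| < 1 / (16 c).\<close>
  have big: "norm (1 / z + h z) \<ge> 8 * c" if "norm (z * h z) \<le> 1 / 2" "norm z < 1 / (16 * c)" "z \<noteq> 0" for h and z :: complex
  proof -
    have "norm (1 + z * h z) \<ge> 1 / 2" using norm_triangle_ineq2[of 1 "- (z * h z)"] that(1) by simp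
    moreover have "1 / z + h z = (1 + z * h z) / z" using that(3) by (simp add: field_simps)
    moreover have "8 * c \<le> (1 / 2) / norm z" using that(2,3) c by (simp add: field_simps)
    ultimately show ?thesis
      using divide_right_mono[of "1 / 2" "norm (1 + z * h z)" "norm z"] by (simp add: norm_divide)
  qed
  obtain s1 where s1: "s1 > 0" "\<forall>z\<in>stolz_pair \<alpha> \<beta>. norm z < s1 \<longrightarrow> norm (z * f z) \<le> 1 / 2" using near[OF f] by blast
  obtain s2 where s2: "s2 > 0" "\<forall>z\<in>stolz_pair \<alpha>' \<beta>'. norm z < s2 \<longrightarrow> norm (z * g z) \<le> 1 / 2" using near[OF g] by blast
  show ?thesis
  proof (intro exI[of _ "min (min s1 s2) (1 / (16 * c))"] conjI ballI impI)
    show "min (min s1 s2) (1 / (16 * c)) > 0" using s1 s2 c by simp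
    fix z assume z: "z \<in> stolz_pair \<alpha> \<beta> \<inter> stolz_pair \<alpha>' \<beta>'" "norm z < min (min s1 s2) (1 / (16 * c))"
    then have z0: "z \<noteq> 0" using stolz_pair_nonzero by blast
    have "1 / z + f z = 1 / z + g z"
    proof (rule cauchy_transform_inj_at_infinity[OF c AE])
      show "norm (1 / z + f z) \<ge> 8 * c" "norm (1 / z + g z) \<ge> 8 * c"
        using z s1(2) s2(2) z0 by (auto intro!: big)
      show "cauchy_transform m (1 / z + f z) = cauchy_transform m (1 / z + g z)"
        using is_R_transformD(3)[OF f, of z] is_R_transformD(3)[OF g, of z] z by simp
    qed
    then show "f z = g z" by simp
  qed
qed

text \<open>The semigroup is defined through some transform of \<nu>, while the theorem speaks of a
  given one. The one-variable transforms determine h and with it R, so both versions agree on a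
  small product domain.\<close>

lemma bifree_R_unique:
  assumes \<nu>: "borel_prob \<nu>" and AE: "AE x in \<nu>. in_box c x"
    and R: "is_bifree_R \<nu> \<alpha> \<beta> R" and R': "is_bifree_R \<nu> \<alpha>' \<beta>' R'"
  shows "\<exists>a b. 0 < a \<and> 0 < b \<and> (\<forall>z\<in>stolz_pair a b. \<forall>w\<in>stolz_pair a b. R z w = R' z w)"
proof -
  define c' where "c' = \<bar>c\<bar> + 1"
  have c': "c' > 0" by (simp add: c'_def)
  have AEf: "AE x in \<nu>. \<bar>fst x\<bar> \<le> c'" "AE x in \<nu>. \<bar>snd x\<bar> \<le> c'"
    by (use AE in eventually_elim, auto simp: in_box_def c'_def)+
  have AE1: "AE x in marginal1 \<nu>. \<bar>x\<bar> \<le> c'" using AEf AE_marginal1[OF \<nu>] by blast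
  have "AE x in swap_measure \<nu>. \<bar>fst x\<bar> \<le> c'"
    by (subst AE_swap[OF \<nu>]) (use AEf in auto)
  then have AE2: "AE x in marginal2 \<nu>. \<bar>x\<bar> \<le> c'"
    using AE_marginal1[OF borel_prob_swap[OF \<nu>], of c', unfolded marginal_swap[OF \<nu>]] by blast
  note d1 = real_distribution_marginal1[OF \<nu>]
  note d2 = real_distribution_marginal1[OF borel_prob_swap[OF \<nu>], unfolded marginal_swap[OF \<nu>]]
  obtain R1 R2 where R12: "is_R_transform (marginal1 \<nu>) \<alpha> \<beta> R1" "is_R_transform (marginal2 \<nu>) \<alpha> \<beta> R2"
    and h: "\<forall>z\<in>stolz_pair \<alpha> \<beta>. \<forall>w\<in>stolz_pair \<alpha> \<beta>.
           let h = cauchy_transform2 \<nu> (1 / z + R1 z) (1 / w + R2 w) / (z * w)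
           in h \<noteq> 0 \<and> R z w = z * R1 z + w * R2 w + (1 - 1 / h)" and ab: "\<alpha> > 0" "\<beta> > 0"
    using R unfolding is_bifree_R_def by blast
  obtain R1' R2' where R12': "is_R_transform (marginal1 \<nu>) \<alpha>' \<beta>' R1'" "is_R_transform (marginal2 \<nu>) \<alpha>' \<beta>' R2'"
    and h': "\<forall>z\<in>stolz_pair \<alpha>' \<beta>'. \<forall>w\<in>stolz_pair \<alpha>' \<beta>'.
           let h = cauchy_transform2 \<nu> (1 / z + R1' z) (1 / w + R2' w) / (z * w)
           in h \<noteq> 0 \<and> R' z w = z * R1' z + w * R2' w + (1 - 1 / h)" and ab': "\<alpha>' > 0" "\<beta>' > 0"
    using R' unfolding is_bifree_R_def by blast
  obtain s1 where s1: "s1 > 0" "\<forall>z\<in>stolz_pair \<alpha> \<beta> \<inter> stolz_pair \<alpha>' \<beta>'. norm z < s1 \<longrightarrow> R1 z = R1' z"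
    using R_transform_unique[OF d1 c' AE1 R12(1) R12'(1)] by blast
  obtain s2 where s2: "s2 > 0" "\<forall>z\<in>stolz_pair \<alpha> \<beta> \<inter> stolz_pair \<alpha>' \<beta>'. norm z < s2 \<longrightarrow> R2 z = R2' z"
    using R_transform_unique[OF d2 c' AE2 R12(2) R12'(2)] by blast
  define a where "a = min \<alpha> \<alpha>'"
  define s where "s = min s1 s2"
  \<comment> \<open>Points of a Stolz pair with parameters a and b have modulus at most (a + 1) b,
    and this is kept below \<open>s\<close>.\<close>
  define b where "b = min (min \<beta> \<beta>') (s / (2 * (a + 1)))"
  have a: "a > 0" "a \<le> \<alpha>" "a \<le> \<alpha>'" using ab ab' by (auto simp: a_def)
  have s: "s > 0" using s1 s2 by (simp add: s_def)
  have b: "b > 0" "b \<le> \<beta>" "b \<le> \<beta>'" "b \<le> s / (2 * (a + 1))" unfolding b_def using ab ab' s a by auto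
  have "(a + 1) * b \<le> (a + 1) * (s / (2 * (a + 1)))" using a b by (intro mult_left_mono) auto
  also have "\<dots> = s / 2"
  proof -
    define k where "k = a + 1"
    have "k > 0" using a by (simp add: k_def)
    then show ?thesis unfolding k_def[symmetric] by simp
  qed
  finally have bs: "(a + 1) * b < s" using s by simp
  have z: "z \<in> stolz_pair \<alpha> \<beta> \<and> z \<in> stolz_pair \<alpha>' \<beta>' \<and> R1 z = R1' z \<and> R2 z = R2' z" if "z \<in> stolz_pair a b" for z
  proof -
    have "norm z < s" using norm_stolz_pair[OF a(1) that] bs by linarith
    moreover have "z \<in> stolz_pair \<alpha> \<beta>" "z \<in> stolz_pair \<alpha>' \<beta>'"
      using that stolz_pair_mono[OF a(2) b(2)] stolz_pair_mono[OF a(3) b(3)] by auto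
    ultimately show ?thesis using s1(2) s2(2) by (auto simp: s_def)
  qed
  have "R z w = R' z w" if "z \<in> stolz_pair a b" "w \<in> stolz_pair a b" for z w
    using z[OF that(1)] z[OF that(2)] h h' by (simp add: Let_def)
  then show ?thesis using a b by blast
qed

text \<open>Replaces the transform hidden in \<open>bifree_semigroup\<close> by the given
  \<open>R\<close>, on Stolz angles small enough for both.\<close>

lemma semigroup_bifree_R:
  assumes \<nu>: "borel_prob \<nu>" and AE: "AE x in \<nu>. in_box c x"
    and N: "bifree_semigroup \<nu> N" and R: "is_extended_bifree_R \<nu> R" and \<epsilon>: "\<epsilon> > 0"
  shows "borel_prob (N \<epsilon>)" "\<exists>\<alpha> \<beta>. is_bifree_R (N \<epsilon>) \<alpha> \<beta> (\<lambda>z w. of_real \<epsilon> * R z w)"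
proof -
  obtain R' where R': "is_extended_bifree_R \<nu> R'"
    and NR': "bifree_id (N \<epsilon>)" "is_extended_bifree_R (N \<epsilon>) (\<lambda>z w. of_real \<epsilon> * R' z w)"
    using N \<epsilon> unfolding bifree_semigroup_def by force
  show "borel_prob (N \<epsilon>)" using NR'(1) unfolding bifree_id_def by blast
  obtain \<alpha> \<beta> \<alpha>' \<beta>' where "is_bifree_R \<nu> \<alpha> \<beta> R" "is_bifree_R \<nu> \<alpha>' \<beta>' R'"
    using R R' unfolding is_extended_bifree_R_def by blast
  then obtain a b where ab: "0 < a" "0 < b" "\<forall>z\<in>stolz_pair a b. \<forall>w\<in>stolz_pair a b. R z w = R' z w"
    using bifree_R_unique[OF \<nu> AE] by blast
  obtain a' b' where N': "is_bifree_R (N \<epsilon>) a' b' (\<lambda>z w. of_real \<epsilon> * R' z w)"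
    using NR'(2) unfolding is_extended_bifree_R_def by blast
  then have ab': "a' > 0" "b' > 0" unfolding is_bifree_R_def by auto
  have sub: "stolz_pair (min a a') (min b b') \<subseteq> stolz_pair a b" by (rule stolz_pair_mono) auto
  have "is_bifree_R (N \<epsilon>) (min a a') (min b b') (\<lambda>z w. of_real \<epsilon> * R z w)"
    by (rule is_bifree_R_shrink[OF N']) (use ab ab' sub in auto)
  then show "\<exists>\<alpha> \<beta>. is_bifree_R (N \<epsilon>) \<alpha> \<beta> (\<lambda>z w. of_real \<epsilon> * R z w)" by blast
qed

section \<open>The integral representation\<close>

text \<open>After multiplication by cnj z the imaginary part is -Im z for every real x, so the bound
  is uniform in x without any condition on supports.\<close>

lemma norm_resolvent_nonreal:
  assumes "Im z \<noteq> 0"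
  shows "1 - z * of_real x \<noteq> 0" "norm (1 / (1 - z * of_real x)) \<le> norm z / \<bar>Im z\<bar>"
proof -
  have "cnj z * (1 - z * of_real x) = cnj z - of_real ((norm z)\<^sup>2 * x)"
    using complex_norm_square[of z] by (simp add: algebra_simps)
  then have "Im (cnj z * (1 - z * of_real x)) = - Im z" by simp
  then have "\<bar>Im z\<bar> \<le> norm (cnj z * (1 - z * of_real x))"
    using abs_Im_le_cmod[of "cnj z * (1 - z * of_real x)"] by simp
  then have le: "\<bar>Im z\<bar> \<le> norm z * norm (1 - z * of_real x)" by (simp add: norm_mult)
  then show nz: "1 - z * of_real x \<noteq> 0" using assms by auto
  show "norm (1 / (1 - z * of_real x)) \<le> norm z / \<bar>Im z\<bar>"
    using le nz assms by (simp add: norm_divide divide_le_eq pos_le_divide_eq mult.commute)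
qed

text \<open>The open sets \<open>S c\<close> exhaust the nonreal numbers as c decreases, and on each
  the resolvent is bounded by (1 / c) / c.\<close>

lemma resolvent_integral_holomorphic:
  fixes x :: "'a::topological_space \<Rightarrow> real" and k :: "'a \<Rightarrow> complex"
  assumes M: "finite_borel M" and x: "x \<in> borel_measurable borel" and k: "k \<in> borel_measurable borel"
    and kb: "\<And>p. norm (k p) \<le> D"
  shows "(\<lambda>z. LINT p|M. k p / (1 - z * of_real (x p))) holomorphic_on {z. Im z \<noteq> 0}"
proof -
  interpret finite_measure M using finite_borelD(1)[OF M] .
  note [measurable] = finite_borel_borel_measurable[OF M x] finite_borel_borel_measurable[OF M k]
  have D: "D \<ge> 0" using order_trans[OF norm_ge_zero kb] .
  define S where "S c = {z. c < \<bar>Im z\<bar>} \<inter> ball 0 (1 / c)" for c :: real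
  have o: "open (S c)" for c unfolding S_def by (intro open_Int open_ball open_Collect_less continuous_intros)
  have *: "(\<lambda>z. LINT p|M. k p / (1 - z * of_real (x p))) holomorphic_on S c" if c: "c > 0" for c
  proof (rule holomorphic_integral[OF o, where B="D * (1 / c / c)"])
    show "AE p in M. (\<lambda>z. k p / (1 - z * of_real (x p))) holomorphic_on S c"
      using c norm_resolvent_nonreal(1) by (intro AE_I2 holomorphic_intros) (auto simp: S_def)
    have "norm (k p / (1 - z * of_real (x p))) \<le> D * (1 / c / c)" if z: "z \<in> S c" for p z
    proof -
      have "Im z \<noteq> 0" using z c by (auto simp: S_def)
      then have "norm (1 / (1 - z * of_real (x p))) \<le> norm z / \<bar>Im z\<bar>" by (rule norm_resolvent_nonreal)
      also have "\<dots> \<le> 1 / c / c" using z c by (intro frac_le) (auto simp: S_def)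
      finally have "norm (k p) * norm (1 / (1 - z * of_real (x p))) \<le> D * (1 / c / c)"
        using kb[of p] D by (intro mult_mono) auto
      then show ?thesis by (simp add: norm_divide)
    qed
    then show "AE p in M. \<forall>z\<in>S c. norm (k p / (1 - z * of_real (x p))) \<le> D * (1 / c / c)" by auto
  qed simp
  have "(\<lambda>z. LINT p|M. k p / (1 - z * of_real (x p))) field_differentiable at z" if z: "Im z \<noteq> 0" for z
  proof -
    define c where "c = min (\<bar>Im z\<bar> / 2) (1 / (norm z + 1))"
    have c: "c > 0" "c \<le> \<bar>Im z\<bar> / 2" "c \<le> 1 / (norm z + 1)" using z by (auto simp: c_def add_nonneg_pos)
    have "c * (norm z + 1) \<le> 1" using c(3) pos_le_divide_eq[of "norm z + 1" c 1] by (simp add: add_nonneg_pos)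
    then have "norm z * c < 1" using c(1) by (simp add: distrib_left mult.commute)
    then have "c < \<bar>Im z\<bar>" "norm z < 1 / c"
      using z c by (auto simp: pos_less_divide_eq)
    then have "z \<in> S c" by (simp add: S_def)
    then show ?thesis using holomorphic_on_imp_differentiable_at[OF *[OF c(1)] o] by blast
  qed
  then show ?thesis
    by (auto simp: holomorphic_on_def intro: field_differentiable_at_within)
qed

lemma holomorphic2_on_fixed:
  assumes "holomorphic2_on R ((- \<real>) \<times> (- \<real>))"
  shows "Im w \<noteq> 0 \<Longrightarrow> (\<lambda>z. R z w) holomorphic_on {z. Im z \<noteq> 0}"
    and "Im z \<noteq> 0 \<Longrightarrow> (\<lambda>w. R z w) holomorphic_on {w. Im w \<noteq> 0}"
proof -
  have d: "\<exists>a b. ((\<lambda>z. R z w) has_field_derivative a) (at z) \<and> ((\<lambda>w. R z w) has_field_derivative b) (at w)"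
    if "Im z \<noteq> 0" "Im w \<noteq> 0" for z w
  proof -
    have "(z, w) \<in> (- \<real>) \<times> (- \<real>)" using that by (auto simp: complex_is_Real_iff)
    then obtain a b where D: "((\<lambda>(z, w). R z w) has_derivative (\<lambda>(u, v). a * u + b * v)) (at (z, w))"
      using assms unfolding holomorphic2_on_def by blast
    have "((\<lambda>z. (z, w)) has_derivative (\<lambda>h. (h, 0))) (at z)" by (auto intro!: derivative_eq_intros)
    from has_derivative_compose[OF this D] have 1: "((\<lambda>z. R z w) has_derivative (\<lambda>h. a * h)) (at z)" by simp
    have "((\<lambda>w. (z, w)) has_derivative (\<lambda>h. (0, h))) (at w)" by (auto intro!: derivative_eq_intros)
    from has_derivative_compose[OF this D] have 2: "((\<lambda>w. R z w) has_derivative (\<lambda>h. b * h)) (at w)" by simp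
    show ?thesis using 1 2 unfolding has_field_derivative_def by blast
  qed
  have o: "open {z. Im z \<noteq> 0}" by (intro open_Collect_neq continuous_intros)
  show "Im w \<noteq> 0 \<Longrightarrow> (\<lambda>z. R z w) holomorphic_on {z. Im z \<noteq> 0}" using d by (auto simp: holomorphic_on_open[OF o])
  show "Im z \<noteq> 0 \<Longrightarrow> (\<lambda>w. R z w) holomorphic_on {w. Im w \<noteq> 0}" using d by (auto simp: holomorphic_on_open[OF o])
qed

text \<open>The half-planes are two components, but each meets every disc about 0, so agreement near
  the origin reaches both.\<close>

lemma half_plane_continuation:
  assumes f: "f holomorphic_on {z. Im z \<noteq> 0}" and g: "g holomorphic_on {z. Im z \<noteq> 0}" and d: "d > 0"
    and eq: "\<And>z. Im z \<noteq> 0 \<Longrightarrow> norm z < d \<Longrightarrow> f z = g z" and z: "Im z \<noteq> 0"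
  shows "f z = g z"
proof -
  define \<sigma> :: real where "\<sigma> = sgn (Im z)"
  have \<sigma>: "\<sigma> \<in> {-1, 1}" and sz: "\<sigma> * Im z > 0" using z unfolding \<sigma>_def by (auto simp: sgn_if)
  let ?S = "{z. \<sigma> * Im z > 0}"
  have "?S = {z. Im z > 0} \<or> ?S = {z. Im z < 0}" using \<sigma> by auto
  then have conn: "connected ?S"
    using convex_halfspace_Im_gt[of 0] convex_halfspace_Im_lt[of 0] by (auto intro: convex_connected)
  have op: "open ?S" by (intro open_Collect_less continuous_intros)
  have sub: "?S \<subseteq> {z. Im z \<noteq> 0}" by auto
  have ne: "?S \<inter> ball 0 d \<noteq> {}"
  proof -
    have "Complex 0 (\<sigma> * (d / 2)) \<in> ?S \<inter> ball 0 d" using \<sigma> d by (auto simp: cmod_def)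
    then show ?thesis by blast
  qed
  show ?thesis
  proof (rule analytic_continuation_open[OF open_Int[OF op open_ball] op ne conn Int_lower1
      holomorphic_on_subset[OF f sub] holomorphic_on_subset[OF g sub]])
    show "f y = g y" if "y \<in> ?S \<inter> ball 0 d" for y using eq[of y] that sub by auto
    show "z \<in> ?S" using sz by simp
  qed
qed

text \<open>Weak limits are tested with real functions while the kernels are complex, so real and
  imaginary parts are passed to the limit separately.\<close>

lemma complex_limit_of_real:
  fixes M :: "real \<Rightarrow> (real \<times> real) measure" and w :: "real \<times> real \<Rightarrow> real" and f :: "real \<times> real \<Rightarrow> complex"
  assumes M: "\<forall>\<^sub>F \<epsilon> in F. finite_borel (M \<epsilon>) \<and> (AE x in M \<epsilon>. in_box c x)"
    and L: "finite_borel L" "AE x in L. in_box c' x" and w: "continuous_on UNIV w"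
    and lim: "\<And>f :: real \<times> real \<Rightarrow> real. continuous_on UNIV f \<Longrightarrow> ((\<lambda>\<epsilon>. (LINT x|M \<epsilon>. w x * f x) / \<epsilon>) \<longlongrightarrow> (LINT x|L. f x)) F"
    and f: "continuous_on UNIV f"
  shows "((\<lambda>\<epsilon>. (LINT x|M \<epsilon>. of_real (w x) * f x) / of_real \<epsilon>) \<longlongrightarrow> (LINT x|L. f x)) F"
proof -
  have Lf: "integrable L f" by (rule box_integrable[OF L f])
  have fr: "continuous_on UNIV (\<lambda>x. Re (f x))" "continuous_on UNIV (\<lambda>x. Im (f x))"
    by (intro continuous_intros f)+
  have wf: "continuous_on UNIV (\<lambda>x. of_real (w x) * f x)" by (intro continuous_intros f w)
  show ?thesis
    unfolding tendsto_complex_iff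
  proof
    have "\<forall>\<^sub>F \<epsilon> in F. (LINT x|M \<epsilon>. w x * Re (f x)) / \<epsilon> = Re ((LINT x|M \<epsilon>. of_real (w x) * f x) / of_real \<epsilon>)"
      using M
    proof eventually_elim
      case (elim \<epsilon>)
      then have "integrable (M \<epsilon>) (\<lambda>x. of_real (w x) * f x)" using box_integrable[OF _ _ wf] by blast
      from Bochner_Integration.integral_Re[OF this] show ?case by simp
    qed
    moreover have "((\<lambda>\<epsilon>. (LINT x|M \<epsilon>. w x * Re (f x)) / \<epsilon>) \<longlongrightarrow> Re (LINT x|L. f x)) F"
      using lim[OF fr(1)] Lf by simp
    ultimately show "((\<lambda>\<epsilon>. Re ((LINT x|M \<epsilon>. of_real (w x) * f x) / of_real \<epsilon>)) \<longlongrightarrow> Re (LINT x|L. f x)) F"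
      by (rule Lim_transform_eventually[rotated])
    have "\<forall>\<^sub>F \<epsilon> in F. (LINT x|M \<epsilon>. w x * Im (f x)) / \<epsilon> = Im ((LINT x|M \<epsilon>. of_real (w x) * f x) / of_real \<epsilon>)"
      using M
    proof eventually_elim
      case (elim \<epsilon>)
      then have "integrable (M \<epsilon>) (\<lambda>x. of_real (w x) * f x)" using box_integrable[OF _ _ wf] by blast
      from Bochner_Integration.integral_Im[OF this] show ?case by simp
    qed
    moreover have "((\<lambda>\<epsilon>. (LINT x|M \<epsilon>. w x * Im (f x)) / \<epsilon>) \<longlongrightarrow> Im (LINT x|L. f x)) F"
      using lim[OF fr(2)] Lf by simp
    ultimately show "((\<lambda>\<epsilon>. Im ((LINT x|M \<epsilon>. of_real (w x) * f x) / of_real \<epsilon>)) \<longlongrightarrow> Im (LINT x|L. f x)) F"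
      by (rule Lim_transform_eventually[rotated])
  qed
qed

section \<open>The representation near the origin and its continuation\<close>

context bifree_family_radius
begin

context
  fixes \<rho>1 \<rho>2 P Q :: "(real \<times> real) measure" and c :: real
  assumes fb: "finite_borel \<rho>1" "finite_borel \<rho>2" "finite_borel P" "finite_borel Q"
    and box: "AE x in \<rho>1. in_box c x" "AE x in \<rho>2. in_box c x" "AE x in P. in_box c x" "AE x in Q. in_box c x"
    and lim1: "\<And>f :: real \<times> real \<Rightarrow> real. continuous_on UNIV f \<Longrightarrow>
      ((\<lambda>\<epsilon>. (LINT x|N \<epsilon>. (fst x)\<^sup>2 * f x) / \<epsilon>) \<longlongrightarrow> (LINT x|\<rho>1. f x)) (at_right 0)"
    and lim2: "\<And>f :: real \<times> real \<Rightarrow> real. continuous_on UNIV f \<Longrightarrow>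
      ((\<lambda>\<epsilon>. (LINT x|N \<epsilon>. (snd x)\<^sup>2 * f x) / \<epsilon>) \<longlongrightarrow> (LINT x|\<rho>2. f x)) (at_right 0)"
    and limP: "\<And>f :: real \<times> real \<Rightarrow> real. continuous_on UNIV f \<Longrightarrow>
      ((\<lambda>\<epsilon>. (LINT x|N \<epsilon>. (fst x + snd x)\<^sup>2 / 4 * f x) / \<epsilon>) \<longlongrightarrow> (LINT x|P. f x)) (at_right 0)"
    and limQ: "\<And>f :: real \<times> real \<Rightarrow> real. continuous_on UNIV f \<Longrightarrow>
      ((\<lambda>\<epsilon>. (LINT x|N \<epsilon>. (fst x - snd x)\<^sup>2 / 4 * f x) / \<epsilon>) \<longlongrightarrow> (LINT x|Q. f x)) (at_right 0)"
begin

text \<open>The right-hand side of the representation, with the integral against the signed measure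
  written as a difference over \<open>P\<close> and \<open>Q\<close>.\<close>

definition "levy_form z w = of_real (\<kappa> 1 0) * z + of_real (\<kappa> 0 1) * w
  + (LINT x|\<rho>1. z\<^sup>2 / (1 - z * of_real (fst x))) + (LINT x|\<rho>2. w\<^sup>2 / (1 - w * of_real (snd x)))
  + ((LINT x|P. z * w / ((1 - z * of_real (fst x)) * (1 - w * of_real (snd x))))
    - (LINT x|Q. z * w / ((1 - z * of_real (fst x)) * (1 - w * of_real (snd x)))))" for z w :: complex

lemma family_box: "0 < \<epsilon> \<Longrightarrow> \<epsilon> \<le> 1 \<Longrightarrow> finite_borel (N \<epsilon>) \<and> (AE x in N \<epsilon>. in_box (2 / \<rho>) x)"
  using borel_probD(4)[OF N] family_identities(1) unfolding in_box_def by blast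

text \<open>Two evaluations of the limit of (\<Psi> - 1) / \<epsilon>: the functional equation gives
  \<open>R z w\<close> for small arguments, and expanding the kernel gives the integrals against the
  weak limits. Nonreal z and w keep the kernels continuous on the whole plane.\<close>

lemma levy_form_near_0:
  assumes z: "Im z \<noteq> 0" "norm z < \<rho> / 4" and w: "Im w \<noteq> 0" "norm w < \<rho> / 4"
  shows "R z w = levy_form z w"
proof -
  define X where "X x = 1 / (1 - z * of_real (fst x))" for x :: "real \<times> real"
  define Y where "Y x = 1 / (1 - w * of_real (snd x))" for x :: "real \<times> real"
  have Xc: "continuous_on UNIV X" unfolding X_def using norm_resolvent_nonreal(1)[OF z(1)] by (intro continuous_intros) auto
  have Yc: "continuous_on UNIV Y" unfolding Y_def using norm_resolvent_nonreal(1)[OF w(1)] by (intro continuous_intros) auto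
  have fam: "\<forall>\<^sub>F \<epsilon> in at_right 0. finite_borel (N \<epsilon>) \<and> (AE x in N \<epsilon>. in_box (2 / \<rho>) x)"
    using eventually_small by eventually_elim (use family_box in blast)
  have l1: "((\<lambda>\<epsilon>. (LINT x|N \<epsilon>. of_real ((fst x)\<^sup>2) * (z\<^sup>2 * X x)) / of_real \<epsilon>) \<longlongrightarrow> (LINT x|\<rho>1. z\<^sup>2 * X x)) (at_right 0)"
    by (rule complex_limit_of_real[OF fam fb(1) box(1) _ lim1]) (intro continuous_intros Xc, assumption, intro continuous_intros Xc)
  have l2: "((\<lambda>\<epsilon>. (LINT x|N \<epsilon>. of_real ((snd x)\<^sup>2) * (w\<^sup>2 * Y x)) / of_real \<epsilon>) \<longlongrightarrow> (LINT x|\<rho>2. w\<^sup>2 * Y x)) (at_right 0)"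
    by (rule complex_limit_of_real[OF fam fb(2) box(2) _ lim2]) (intro continuous_intros Yc, assumption, intro continuous_intros Yc)
  have l3: "((\<lambda>\<epsilon>. (LINT x|N \<epsilon>. of_real ((fst x + snd x)\<^sup>2 / 4) * (z * w * (X x * Y x))) / of_real \<epsilon>) \<longlongrightarrow> (LINT x|P. z * w * (X x * Y x))) (at_right 0)"
    by (rule complex_limit_of_real[OF fam fb(3) box(3) _ limP]) (intro continuous_intros, simp, assumption, intro continuous_intros Xc Yc)
  have l4: "((\<lambda>\<epsilon>. (LINT x|N \<epsilon>. of_real ((fst x - snd x)\<^sup>2 / 4) * (z * w * (X x * Y x))) / of_real \<epsilon>) \<longlongrightarrow> (LINT x|Q. z * w * (X x * Y x))) (at_right 0)"
    by (rule complex_limit_of_real[OF fam fb(4) box(4) _ limQ]) (intro continuous_intros, simp, assumption, intro continuous_intros Xc Yc)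
  have m1: "((\<lambda>\<epsilon>. of_real ((LINT x|N \<epsilon>. fst x) / \<epsilon>) * z) \<longlongrightarrow> of_real (\<kappa> 1 0) * z) (at_right 0)"
    using moment_limit[of 1 0] by (intro tendsto_mult tendsto_const tendsto_of_real) auto
  have m2: "((\<lambda>\<epsilon>. of_real ((LINT x|N \<epsilon>. snd x) / \<epsilon>) * w) \<longlongrightarrow> of_real (\<kappa> 0 1) * w) (at_right 0)"
    using moment_limit[of 0 1] by (intro tendsto_mult tendsto_const tendsto_of_real) auto
  have "levy_form z w = of_real (\<kappa> 1 0) * z + of_real (\<kappa> 0 1) * w + (LINT x|\<rho>1. z\<^sup>2 * X x) + (LINT x|\<rho>2. w\<^sup>2 * Y x)
    + ((LINT x|P. z * w * (X x * Y x)) - (LINT x|Q. z * w * (X x * Y x)))"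
    unfolding levy_form_def X_def Y_def by simp
  moreover have "((\<lambda>\<epsilon>. (biresolvent (N \<epsilon>) z w - 1) / of_real \<epsilon>) \<longlongrightarrow>
    of_real (\<kappa> 1 0) * z + of_real (\<kappa> 0 1) * w + (LINT x|\<rho>1. z\<^sup>2 * X x) + (LINT x|\<rho>2. w\<^sup>2 * Y x)
    + ((LINT x|P. z * w * (X x * Y x)) - (LINT x|Q. z * w * (X x * Y x)))) (at_right 0)"
  proof (rule Lim_transform_eventually[OF tendsto_add[OF tendsto_add[OF tendsto_add[OF tendsto_add[OF m1 m2] l1] l2] tendsto_diff[OF l3 l4]]])
    show "\<forall>\<^sub>F \<epsilon> in at_right 0. of_real ((LINT x|N \<epsilon>. fst x) / \<epsilon>) * z + of_real ((LINT x|N \<epsilon>. snd x) / \<epsilon>) * w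
      + (LINT x|N \<epsilon>. of_real ((fst x)\<^sup>2) * (z\<^sup>2 * X x)) / of_real \<epsilon> + (LINT x|N \<epsilon>. of_real ((snd x)\<^sup>2) * (w\<^sup>2 * Y x)) / of_real \<epsilon>
      + ((LINT x|N \<epsilon>. of_real ((fst x + snd x)\<^sup>2 / 4) * (z * w * (X x * Y x))) / of_real \<epsilon>
        - (LINT x|N \<epsilon>. of_real ((fst x - snd x)\<^sup>2 / 4) * (z * w * (X x * Y x))) / of_real \<epsilon>)
      = (biresolvent (N \<epsilon>) z w - 1) / of_real \<epsilon>"
      using eventually_small
    proof eventually_elim
      case (elim \<epsilon>)
      then have \<epsilon>: "0 < \<epsilon>" "\<epsilon> \<le> 1" by auto
      interpret prob_space "N \<epsilon>" using borel_probD(1)[OF N[OF \<epsilon>(1)]] .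
      have i: "integrable (N \<epsilon>) f" if "continuous_on UNIV f" for f :: "real \<times> real \<Rightarrow> complex"
        using family_box[OF \<epsilon>] box_integrable[OF _ _ that] by blast
      have c: "continuous_on UNIV (\<lambda>x :: real \<times> real. complex_of_real (fst x) * z)" "continuous_on UNIV (\<lambda>x :: real \<times> real. complex_of_real (snd x) * w)"
        "continuous_on UNIV (\<lambda>x. of_real ((fst x)\<^sup>2) * (z\<^sup>2 * X x))" "continuous_on UNIV (\<lambda>x. of_real ((snd x)\<^sup>2) * (w\<^sup>2 * Y x))"
        "continuous_on UNIV (\<lambda>x. of_real ((fst x + snd x)\<^sup>2 / 4) * (z * w * (X x * Y x)))"
        "continuous_on UNIV (\<lambda>x. of_real ((fst x - snd x)\<^sup>2 / 4) * (z * w * (X x * Y x)))"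
        "continuous_on UNIV (\<lambda>x. X x * Y x)"
        by (intro continuous_intros Xc Yc; simp)+
      \<comment> \<open>With X = 1 / (1 - z s) and Y = 1 / (1 - w t): X - 1 = z s + z^2 s^2 X,
        likewise for Y, and X Y - 1 = (X - 1) + (Y - 1) + (X - 1) (Y - 1), whose product term is z w
        s t X Y.\<close>
      have pt: "X x * Y x - 1 = complex_of_real (fst x) * z + complex_of_real (snd x) * w + of_real ((fst x)\<^sup>2) * (z\<^sup>2 * X x)
        + of_real ((snd x)\<^sup>2) * (w\<^sup>2 * Y x) + (of_real ((fst x + snd x)\<^sup>2 / 4) * (z * w * (X x * Y x))
        - of_real ((fst x - snd x)\<^sup>2 / 4) * (z * w * (X x * Y x)))" for x
      proof -
        define s where "s = complex_of_real (fst x)"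
        define t where "t = complex_of_real (snd x)"
        have X: "X x = 1 + z * s * X x" and Y: "Y x = 1 + w * t * Y x"
          using norm_resolvent_nonreal(1)[OF z(1), of "fst x"] norm_resolvent_nonreal(1)[OF w(1), of "snd x"]
          by (auto simp: X_def Y_def s_def t_def field_simps)
        have X2: "X x - 1 = z * s + z\<^sup>2 * s\<^sup>2 * X x"
        proof -
          have "X x - 1 = z * s * X x" using X by (metis add_diff_cancel_left')
          also have "\<dots> = z * s * (1 + z * s * X x)" using X by simp
          finally show ?thesis by (simp add: algebra_simps power2_eq_square)
        qed
        have Y2: "Y x - 1 = w * t + w\<^sup>2 * t\<^sup>2 * Y x"
        proof -
          have "Y x - 1 = w * t * Y x" using Y by (metis add_diff_cancel_left')
          also have "\<dots> = w * t * (1 + w * t * Y x)" using Y by simp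
          finally show ?thesis by (simp add: algebra_simps power2_eq_square)
        qed
        have XY: "(X x - 1) * (Y x - 1) = z * s * X x * (w * t * Y x)"
          using X Y by (metis add_diff_cancel_left')
        have "X x * Y x - 1 = (X x - 1) + (Y x - 1) + (X x - 1) * (Y x - 1)" by (simp add: algebra_simps)
        also have "\<dots> = (z * s + z\<^sup>2 * s\<^sup>2 * X x) + (w * t + w\<^sup>2 * t\<^sup>2 * Y x) + z * s * X x * (w * t * Y x)"
          unfolding XY unfolding X2 Y2 ..
        also have "z * s * X x * (w * t * Y x) = (s + t)\<^sup>2 / 4 * (z * w * (X x * Y x)) - (s - t)\<^sup>2 / 4 * (z * w * (X x * Y x))"
          by (simp add: field_simps power2_eq_square)
        finally show ?thesis unfolding s_def t_def by (simp add: algebra_simps)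
      qed
      have "biresolvent (N \<epsilon>) z w - 1 = (LINT x|N \<epsilon>. X x * Y x - 1)"
        using i[OF c(7)] unfolding biresolvent_def X_def Y_def by (simp add: prob_space)
      also have "\<dots> = (LINT x|N \<epsilon>. complex_of_real (fst x) * z + complex_of_real (snd x) * w + of_real ((fst x)\<^sup>2) * (z\<^sup>2 * X x)
        + of_real ((snd x)\<^sup>2) * (w\<^sup>2 * Y x) + (of_real ((fst x + snd x)\<^sup>2 / 4) * (z * w * (X x * Y x))
        - of_real ((fst x - snd x)\<^sup>2 / 4) * (z * w * (X x * Y x))))"
        by (simp only: pt)
      also have "\<dots> = (LINT x|N \<epsilon>. complex_of_real (fst x) * z) + (LINT x|N \<epsilon>. complex_of_real (snd x) * w)
        + (LINT x|N \<epsilon>. of_real ((fst x)\<^sup>2) * (z\<^sup>2 * X x)) + (LINT x|N \<epsilon>. of_real ((snd x)\<^sup>2) * (w\<^sup>2 * Y x))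
        + ((LINT x|N \<epsilon>. of_real ((fst x + snd x)\<^sup>2 / 4) * (z * w * (X x * Y x)))
        - (LINT x|N \<epsilon>. of_real ((fst x - snd x)\<^sup>2 / 4) * (z * w * (X x * Y x))))"
        by (simp only: Bochner_Integration.integral_add Bochner_Integration.integral_diff
            Bochner_Integration.integrable_add Bochner_Integration.integrable_diff i[OF c(1)] i[OF c(2)] i[OF c(3)] i[OF c(4)] i[OF c(5)] i[OF c(6)])
      also have "(LINT x|N \<epsilon>. complex_of_real (fst x) * z) = of_real (LINT x|N \<epsilon>. fst x) * z"
        by simp
      also have "(LINT x|N \<epsilon>. complex_of_real (snd x) * w) = of_real (LINT x|N \<epsilon>. snd x) * w"
        by simp
      finally have e: "biresolvent (N \<epsilon>) z w - 1 = of_real (LINT x|N \<epsilon>. fst x) * z + of_real (LINT x|N \<epsilon>. snd x) * w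
        + (LINT x|N \<epsilon>. of_real ((fst x)\<^sup>2) * (z\<^sup>2 * X x)) + (LINT x|N \<epsilon>. of_real ((snd x)\<^sup>2) * (w\<^sup>2 * Y x))
        + ((LINT x|N \<epsilon>. of_real ((fst x + snd x)\<^sup>2 / 4) * (z * w * (X x * Y x)))
        - (LINT x|N \<epsilon>. of_real ((fst x - snd x)\<^sup>2 / 4) * (z * w * (X x * Y x))))" .
      show ?case unfolding e of_real_divide by (simp add: add_divide_distrib diff_divide_distrib)
    qed
  qed
  ultimately show ?thesis
    using tendsto_unique[OF trivial_limit_at_right_real biresolvent_derivative, of z w] z w by simp
qed

lemma levy_form_holomorphic:
  shows "Im w \<noteq> 0 \<Longrightarrow> (\<lambda>z. levy_form z w) holomorphic_on {z. Im z \<noteq> 0}"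
    and "Im z \<noteq> 0 \<Longrightarrow> (\<lambda>w. levy_form z w) holomorphic_on {w. Im w \<noteq> 0}"
proof -
  have r: "(\<lambda>x. 1 / (1 - z * of_real (fst x))) \<in> borel_measurable borel"
    "(\<lambda>x. 1 / (1 - z * of_real (snd x))) \<in> borel_measurable borel" for z :: complex
    by measurable
  have f1: "(LINT x|M. z\<^sup>2 / (1 - z * of_real (f x))) = z\<^sup>2 * (LINT x|M. 1 / (1 - z * of_real (f x)))"
    for M and f :: "real \<times> real \<Rightarrow> real" and z :: complex
    by (subst Bochner_Integration.integral_mult_right_zero[symmetric]) simp
  have f2: "(LINT x|M. z * w / ((1 - z * of_real (fst x)) * (1 - w * of_real (snd x)))) =
    z * w * (LINT x|M. (1 / (1 - w * of_real (snd x))) / (1 - z * of_real (fst x)))" for M and z w :: complex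
    by (subst Bochner_Integration.integral_mult_right_zero[symmetric]) (simp add: mult.commute)
  have f3: "(LINT x|M. z * w / ((1 - z * of_real (fst x)) * (1 - w * of_real (snd x)))) =
    z * w * (LINT x|M. (1 / (1 - z * of_real (fst x))) / (1 - w * of_real (snd x)))" for M and z w :: complex
    by (subst Bochner_Integration.integral_mult_right_zero[symmetric]) simp
  show "(\<lambda>z. levy_form z w) holomorphic_on {z. Im z \<noteq> 0}" if "Im w \<noteq> 0"
    unfolding levy_form_def f1 f2
    by (intro holomorphic_intros resolvent_integral_holomorphic[where D=1]
        resolvent_integral_holomorphic[where D="norm w / \<bar>Im w\<bar>"] fb r fst_borel_measurable norm_resolvent_nonreal(2)[OF that]) auto
  show "(\<lambda>w. levy_form z w) holomorphic_on {w. Im w \<noteq> 0}" if "Im z \<noteq> 0"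
    unfolding levy_form_def f1 f3
    by (intro holomorphic_intros resolvent_integral_holomorphic[where D=1]
        resolvent_integral_holomorphic[where D="norm z / \<bar>Im z\<bar>"] fb r snd_borel_measurable norm_resolvent_nonreal(2)[OF that]) auto
qed

text \<open>Continuation in z for each small w, then in w for each z. At the origin both sides are
  0.\<close>

theorem levy_form_eq:
  assumes hol: "holomorphic2_on R ((- \<real>) \<times> (- \<real>))" and zw: "(z, w) \<in> (- \<real>) \<times> (- \<real>) \<union> {(0, 0)}"
  shows "R z w = levy_form z w"
proof (cases "(z, w) = (0, 0)")
  case True
  then show ?thesis using R_0_0' by (simp add: levy_form_def)
next
  case False
  then have z: "Im z \<noteq> 0" and w: "Im w \<noteq> 0" using zw by (auto simp: complex_is_Real_iff)
  have d: "\<rho> / 4 > 0" using \<rho> by simp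
  have 1: "R z w = levy_form z w" if w: "Im w \<noteq> 0" "norm w < \<rho> / 4" for w
    by (rule half_plane_continuation[OF holomorphic2_on_fixed(1)[OF hol w(1)] levy_form_holomorphic(1)[OF w(1)] d _ z])
       (rule levy_form_near_0[OF _ _ w])
  show ?thesis
    by (rule half_plane_continuation[OF holomorphic2_on_fixed(2)[OF hol z] levy_form_holomorphic(2)[OF z] d 1 w])
qed

lemmas levy_formula = levy_form_eq[unfolded levy_form_def]

end

end

section \<open>Limit measures\<close>

lemma variance_marginal1:
  assumes \<nu>: "borel_prob \<nu>" and box: "AE x in \<nu>. in_box c x"
  shows "prob_space.variance (marginal1 \<nu>) (\<lambda>x. x) = (LINT x|\<nu>. (fst x)\<^sup>2) - (LINT x|\<nu>. fst x)\<^sup>2"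
proof -
  interpret m: real_distribution "marginal1 \<nu>" by (rule real_distribution_marginal1[OF \<nu>])
  have i: "integrable (marginal1 \<nu>) f \<longleftrightarrow> integrable \<nu> (\<lambda>x. f (fst x))" "(LINT x|marginal1 \<nu>. f x) = (LINT x|\<nu>. f (fst x))"
    if "f \<in> borel_measurable borel" for f :: "real \<Rightarrow> real"
    unfolding marginal1_def using fst_measurable[OF \<nu>] that by (auto simp: integrable_distr_eq integral_distr)
  have c: "integrable \<nu> (\<lambda>x. fst x)" "integrable \<nu> (\<lambda>x. (fst x)\<^sup>2)"
    by (rule box_integrable[OF borel_probD(4)[OF \<nu>] box], intro continuous_intros)+
  show ?thesis
    using m.variance_eq[of "\<lambda>x. x"] c by (simp add: i)
qed

lemma variance_marginal2:
  assumes \<nu>: "borel_prob \<nu>" and box: "AE x in \<nu>. in_box c x"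
  shows "prob_space.variance (marginal2 \<nu>) (\<lambda>x. x) = (LINT x|\<nu>. (snd x)\<^sup>2) - (LINT x|\<nu>. snd x)\<^sup>2"
proof -
  have "AE x in swap_measure \<nu>. in_box c x"
    using box by (subst AE_swap[OF \<nu>]) (auto simp: in_box_borel in_box_def elim: eventually_mono)
  from variance_marginal1[OF borel_prob_swap[OF \<nu>] this] show ?thesis
    unfolding marginal_swap[OF \<nu>] by (simp add: integral_swap[OF \<nu>])
qed

lemma weakly_converges_unique:
  fixes L L' :: "(real \<times> real) measure"
  assumes "finite_borel L" "finite_borel L'" "weakly_converges M L (at_right (0::real))" "weakly_converges M L' (at_right 0)"
  shows "L = L'"
proof (rule finite_borel_eqI[OF assms(1,2)])
  fix f :: "real \<times> real \<Rightarrow> real" assume "continuous_on UNIV f" "bounded (range f)"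
  then show "(LINT x|L. f x) = (LINT x|L'. f x)"
    using assms(3,4) tendsto_unique[OF trivial_limit_at_right_real] unfolding weakly_converges_def by blast
qed

lemma signed_weakly_converges_unique:
  fixes L L' :: "(real \<times> real) set \<Rightarrow> real"
  assumes "signed_borel L" "signed_borel L'" "signed_weakly_converges M L (at_right (0::real))" "signed_weakly_converges M L' (at_right 0)"
  shows "L = L'"
proof (rule signed_borel_eqI[OF assms(1,2)])
  fix f :: "real \<times> real \<Rightarrow> real" assume "continuous_on UNIV f" "bounded (range f)"
  then show "signed_integral L f = signed_integral L' f"
    using assms(3,4) tendsto_unique[OF trivial_limit_at_right_real] unfolding signed_weakly_converges_def by blast
qed

lemma null_outside_box:
  assumes M: "finite_borel M" and box: "AE x in M. in_box c x" and A: "A \<in> sets borel" "A \<inter> {x. in_box c x} = {}"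
  shows "emeasure M A = 0"
proof -
  have "AE x in M. x \<notin> A" using box by eventually_elim (use A in auto)
  then show ?thesis using AE_iff_measurable[of A M "\<lambda>x. x \<notin> A"] A finite_borelD[OF M] by auto
qed

lemma compactly_supported_box:
  assumes "finite_borel M" "AE x in M. in_box c x"
  shows "compactly_supported M"
  unfolding compactly_supported_def
  using compact_box[of c] in_box_borel[of c] null_outside_box[OF assms, of "- {x. in_box c x}"]
  by (intro exI[of _ "{x. in_box c x}"]) auto

text \<open>For c > 0 the claim is nonnegativity at the minimum l = -b / c. A negative c is refuted
  by large l, and c = 0 forces b = 0.\<close>

lemma discriminant_bound:
  fixes a b c :: real
  assumes pos: "\<And>l. a + 2 * l * b + l\<^sup>2 * c \<ge> 0"
  shows "b\<^sup>2 \<le> a * c"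
proof (cases "c = 0")
  case True
  have "b = 0"
  proof (rule ccontr)
    assume b: "b \<noteq> 0"
    \<comment> \<open>For c = 0 the form is affine in l, and this l is where it takes the value
      -1.\<close>
    have "a + 2 * (- (a + 1) / (2 * b)) * b + (- (a + 1) / (2 * b))\<^sup>2 * c = -1"
      using b True by (simp add: field_simps)
    then show False using pos[of "- (a + 1) / (2 * b)"] by simp
  qed
  then show ?thesis using True by simp
next
  case False
  have "c > 0"
  proof (rule ccontr)
    assume "\<not> c > 0"
    then have c: "c < 0" using False by simp
    \<comment> \<open>Large enough that l |c| is at least |a| + 2 |b| + 1, so that the quadratic
      term outweighs the others; the added 1 ensures l \<ge> 1.\<close>
    define l where "l = (\<bar>a\<bar> + 2 * \<bar>b\<bar> + 1) / - c + 1"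
    have l: "l \<ge> 1" using divide_nonneg_pos[of "\<bar>a\<bar> + 2 * \<bar>b\<bar> + 1" "- c"] c unfolding l_def by linarith
    have "l * - c \<ge> \<bar>a\<bar> + 2 * \<bar>b\<bar> + 1" using c by (simp add: l_def field_simps)
    then have "l * (l * - c) \<ge> l * (\<bar>a\<bar> + 2 * \<bar>b\<bar> + 1)" using l by (intro mult_left_mono) auto
    moreover have "l * (\<bar>a\<bar> + 1) \<ge> 1 * (\<bar>a\<bar> + 1)" using l by (intro mult_right_mono) auto
    moreover have "2 * l * b \<le> 2 * l * \<bar>b\<bar>" using l by (intro mult_left_mono) auto
    ultimately have "a + 2 * l * b + l\<^sup>2 * c < 0" by (simp add: power2_eq_square algebra_simps)
    then show False using pos[of l] by simp
  qed
  then have "a + 2 * (- b / c) * b + (- b / c)\<^sup>2 * c = a - b\<^sup>2 / c"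
    by (simp add: power2_eq_square field_simps)
  then have "b\<^sup>2 / c \<le> a" using pos[of "- b / c"] by simp
  then show ?thesis using \<open>c > 0\<close> by (simp add: divide_le_eq)
qed

text \<open>Tent functions decrease to the indicator of the origin. Being continuous, they can be
  inserted into weak limits, whereas the indicator cannot.\<close>

lemma point_mass_approximation:
  fixes M :: "(real \<times> real) measure"
  assumes M: "finite_borel M"
  shows "(\<lambda>k. LINT x|M. max 0 (1 - real k * norm x)) \<longlonglongrightarrow> measure M {(0, 0)}"
proof -
  interpret finite_measure M using finite_borelD(1)[OF M] .
  have m: "(\<lambda>x :: real \<times> real. max 0 (1 - real k * norm x)) \<in> borel_measurable M" for k
    by (intro finite_borel_borel_measurable[OF M] borel_measurable_continuous_onI continuous_intros)
  have s: "{(0, 0)} \<in> sets M" using finite_borelD(2)[OF M] by simp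
  have "(\<lambda>k. LINT x|M. max 0 (1 - real k * norm x)) \<longlonglongrightarrow> (LINT x|M. indicator {(0, 0)} x)"
  proof (rule integral_dominated_convergence[where w="\<lambda>_. 1"])
    show "AE x in M. (\<lambda>k. max 0 (1 - real k * norm x)) \<longlonglongrightarrow> indicator {(0, 0)} x"
    proof (rule AE_I2)
      fix x :: "real \<times> real"
      show "(\<lambda>k. max 0 (1 - real k * norm x)) \<longlonglongrightarrow> indicator {(0, 0)} x"
      proof (cases "x = (0, 0)")
        case True
        then show ?thesis by (simp add: zero_prod_def[symmetric])
      next
        case False
        then have n: "norm x > 0" by (simp add: zero_prod_def)
        obtain K where K: "real K * norm x > 1" using ex_less_of_nat_mult[OF n, of 1] by auto
        have "max 0 (1 - real k * norm x) = 0" if "k \<ge> K" for k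
        proof -
          have "real K * norm x \<le> real k * norm x" using that by (intro mult_right_mono) auto
          then show ?thesis using K by simp
        qed
        then have "\<forall>\<^sub>F k in sequentially. max 0 (1 - real k * norm x) = 0" unfolding eventually_sequentially by blast
        then show ?thesis using False by (auto intro: tendsto_eventually)
      qed
    qed
  qed (use m s in auto)
  then show ?thesis using s finite_borelD(3)[OF M] by simp
qed

theorem theorem4p2:
  fixes \<nu> :: "(real \<times> real) measure"
    and N :: "real \<Rightarrow> (real \<times> real) measure"
    and R :: "complex \<Rightarrow> complex \<Rightarrow> complex"
    and \<kappa> :: "nat \<Rightarrow> nat \<Rightarrow> real"
    and r :: real
  assumes "bifree_id \<nu>" and "compactly_supported \<nu>"
    and "bifree_semigroup \<nu> N"
    and "is_extended_bifree_R \<nu> R"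
    and "r > 0"
    and "\<And>z w. norm z < r \<Longrightarrow> norm w < r \<Longrightarrow>
           ((\<lambda>(m, n). of_real (\<kappa> m n) * z ^ m * w ^ n) has_sum R z w) UNIV"
  shows "\<exists>!(\<rho>1 :: (real \<times> real) measure, \<rho>2 :: (real \<times> real) measure, \<rho> :: (real \<times> real) set \<Rightarrow> real).
    finite_borel \<rho>1 \<and> compactly_supported \<rho>1 \<and>
    finite_borel \<rho>2 \<and> compactly_supported \<rho>2 \<and>
    signed_borel \<rho> \<and> signed_compactly_supported \<rho> \<and>
    \<comment> \<open>(1)\<close>
    (\<forall>\<epsilon>>0. integrable (N \<epsilon>) (\<lambda>(s, t). s\<^sup>2) \<and> integrable (N \<epsilon>) (\<lambda>(s, t). t\<^sup>2)) \<and>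
    weakly_converges (\<lambda>\<epsilon>. density (N \<epsilon>) (\<lambda>(s, t). ennreal (s\<^sup>2 / \<epsilon>))) \<rho>1 (at_right 0) \<and>
    weakly_converges (\<lambda>\<epsilon>. density (N \<epsilon>) (\<lambda>(s, t). ennreal (t\<^sup>2 / \<epsilon>))) \<rho>2 (at_right 0) \<and>
    signed_weakly_converges (\<lambda>\<epsilon>. times_measure (\<lambda>(s, t). s * t / \<epsilon>) (N \<epsilon>)) \<rho> (at_right 0) \<and>
    ((\<lambda>\<epsilon>. 1 / \<epsilon> * (LINT (s, t)|N \<epsilon>. s)) \<longlongrightarrow> \<kappa> 1 0) (at_right 0) \<and>
    ((\<lambda>\<epsilon>. 1 / \<epsilon> * (LINT (s, t)|N \<epsilon>. t)) \<longlongrightarrow> \<kappa> 0 1) (at_right 0) \<and>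
    \<comment> \<open>(2)\<close>
    (\<forall>(z, w) \<in> (- \<real>) \<times> (- \<real>) \<union> {(0, 0)}.
       R z w = of_real (\<kappa> 1 0) * z + of_real (\<kappa> 0 1) * w
         + (LINT (s, t)|\<rho>1. z\<^sup>2 / (1 - z * of_real s))
         + (LINT (s, t)|\<rho>2. w\<^sup>2 / (1 - w * of_real t))
         + signed_integral \<rho> (\<lambda>(s, t). z * w / ((1 - z * of_real s) * (1 - w * of_real t)))) \<and>
    \<comment> \<open>(3)\<close>
    measure \<rho>1 UNIV = prob_space.variance (marginal1 \<nu>) (\<lambda>x. x) \<and>
    measure \<rho>2 UNIV = prob_space.variance (marginal2 \<nu>) (\<lambda>x. x) \<and>
    \<rho> UNIV = covariance \<nu> \<and>
    times_measure (\<lambda>(s, t). t) \<rho>1 = times_signed (\<lambda>(s, t). s) \<rho> \<and>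
    times_measure (\<lambda>(s, t). s) \<rho>2 = times_signed (\<lambda>(s, t). t) \<rho> \<and>
    \<bar>\<rho> {(0, 0)}\<bar>\<^sup>2 \<le> measure \<rho>1 {(0, 0)} * measure \<rho>2 {(0, 0)}"
proof -
  have \<nu>: "borel_prob \<nu>" using assms(1) unfolding bifree_id_def by blast
  interpret bidisc_series R \<kappa> r using assms(5,6) by unfold_locales
  obtain \<alpha> \<beta> where R\<nu>: "is_bifree_R \<nu> \<alpha> \<beta> R" and hol: "holomorphic2_on R ((- \<real>) \<times> (- \<real>))"
    using assms(4) unfolding is_extended_bifree_R_def by blast
  note cum = cumulants[OF \<nu> R\<nu>]
  obtain c0 where box\<nu>: "AE x in \<nu>. in_box c0 x" using cum(1) by blast
  interpret bifree_family R \<kappa> r N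
    by unfold_locales (rule semigroup_bifree_R[OF \<nu> box\<nu> assms(3,4)], assumption)+
  obtain \<rho>0 B where "\<rho>0 \<le> r / 8" "1 * B * \<rho>0 \<le> 1 / 4" "lipschitz_bidisc R \<rho>0 B"
    using choose_radius[of 1] by auto
  then interpret bifree_family_radius R \<kappa> r N \<rho>0 B
    by (intro bifree_family_radius.intro bifree_family_radius_axioms.intro bifree_family_axioms) auto
  \<comment> \<open>A common box for all four limit measures: half-width 2 / \<rho>0 for the laws,
    doubled by the space-filling curve.\<close>
  define c where "c = 4 / \<rho>0"
  obtain r1 where r1: "finite_borel r1" "AE x in r1. in_box c x" "measure r1 UNIV = \<kappa> 2 0"
    and lim1: "\<And>f :: real \<times> real \<Rightarrow> real. continuous_on UNIV f \<Longrightarrow>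
      ((\<lambda>\<epsilon>. (LINT x|N \<epsilon>. (fst x)\<^sup>2 * f x) / \<epsilon>) \<longlongrightarrow> (LINT x|r1. f x)) (at_right 0)"
    by (rule weighted_limit[of 1 0 0]) (auto simp: c_def)
  obtain r2 where r2: "finite_borel r2" "AE x in r2. in_box c x" "measure r2 UNIV = \<kappa> 0 2"
    and lim2: "\<And>f :: real \<times> real \<Rightarrow> real. continuous_on UNIV f \<Longrightarrow>
      ((\<lambda>\<epsilon>. (LINT x|N \<epsilon>. (snd x)\<^sup>2 * f x) / \<epsilon>) \<longlongrightarrow> (LINT x|r2. f x)) (at_right 0)"
    by (rule weighted_limit[of 0 0 1]) (auto simp: c_def)
  have sqP: "1 / 4 * s\<^sup>2 + 2 * (1 / 4) * (s * t) + 1 / 4 * t\<^sup>2 = (s + t)\<^sup>2 / 4" for s t :: real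
    by (simp add: power2_eq_square algebra_simps add_divide_distrib)
  have sqQ: "1 / 4 * s\<^sup>2 + 2 * (- 1 / 4) * (s * t) + 1 / 4 * t\<^sup>2 = (s - t)\<^sup>2 / 4" for s t :: real
    by (simp add: power2_eq_square algebra_simps add_divide_distrib diff_divide_distrib)
  obtain P where P: "finite_borel P" "AE x in P. in_box c x"
      "measure P UNIV = 1 / 4 * \<kappa> 2 0 + 2 * (1 / 4) * \<kappa> 1 1 + 1 / 4 * \<kappa> 0 2"
    and limP: "\<And>f :: real \<times> real \<Rightarrow> real. continuous_on UNIV f \<Longrightarrow>
      ((\<lambda>\<epsilon>. (LINT x|N \<epsilon>. (fst x + snd x)\<^sup>2 / 4 * f x) / \<epsilon>) \<longlongrightarrow> (LINT x|P. f x)) (at_right 0)"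
  proof (rule weighted_limit[of "1 / 4" "1 / 4" "1 / 4"])
    show "1 / 4 * s\<^sup>2 + 2 * (1 / 4) * (s * t) + 1 / 4 * t\<^sup>2 \<ge> 0" for s t :: real unfolding sqP by simp
  qed (unfold sqP, auto simp: c_def)
  obtain Q where Q: "finite_borel Q" "AE x in Q. in_box c x"
      "measure Q UNIV = 1 / 4 * \<kappa> 2 0 + 2 * (- 1 / 4) * \<kappa> 1 1 + 1 / 4 * \<kappa> 0 2"
    and limQ: "\<And>f :: real \<times> real \<Rightarrow> real. continuous_on UNIV f \<Longrightarrow>
      ((\<lambda>\<epsilon>. (LINT x|N \<epsilon>. (fst x - snd x)\<^sup>2 / 4 * f x) / \<epsilon>) \<longlongrightarrow> (LINT x|Q. f x)) (at_right 0)"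
  proof (rule weighted_limit[of "1 / 4" "- 1 / 4" "1 / 4"])
    show "1 / 4 * s\<^sup>2 + 2 * (- 1 / 4) * (s * t) + 1 / 4 * t\<^sup>2 \<ge> 0" for s t :: real unfolding sqQ by simp
  qed (unfold sqQ, auto simp: c_def)
  \<comment> \<open>\<open>P\<close> and \<open>Q\<close> need not be mutually singular. Integrals
    against \<open>\<rho>\<close> are computed from them below, without determining its Jordan
    parts.\<close>
  define \<rho> where "\<rho> A = measure P A - measure Q A" for A
  have \<rho>: "signed_borel \<rho>" unfolding \<rho>_def by (rule signed_borel_diff_measure[OF P(1) Q(1)])
  \<comment> \<open>Each \<epsilon> gets a box of its own here, since integrability is claimed for
    all \<epsilon> > 0 and not just for small ones.\<close>
  have boxN: "finite_borel (N \<epsilon>)" "\<exists>c. AE x in N \<epsilon>. in_box c x" if "\<epsilon> > 0" for \<epsilon>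
    using borel_probD(4)[OF N[OF that]] AE_bounded[OF that] unfolding in_box_def by auto
  have Nint: "integrable (N \<epsilon>) f" if "\<epsilon> > 0" "continuous_on UNIV f" for \<epsilon> and f :: "real \<times> real \<Rightarrow> real"
    using boxN[OF that(1)] box_integrable[OF _ _ that(2)] by blast
  have pos: "\<forall>\<^sub>F \<epsilon> in at_right 0. \<epsilon> > (0::real)" by (auto simp: eventually_at_filter)
  have limST: "((\<lambda>\<epsilon>. (LINT x|N \<epsilon>. (fst x * snd x) * f x) / \<epsilon>) \<longlongrightarrow> (LINT x|P. f x) - (LINT x|Q. f x)) (at_right 0)"
    if f: "continuous_on UNIV f" for f :: "real \<times> real \<Rightarrow> real"
  proof (rule Lim_transform_eventually[OF tendsto_diff[OF limP[OF f] limQ[OF f]]])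
    show "\<forall>\<^sub>F \<epsilon> in at_right 0. (LINT x|N \<epsilon>. (fst x + snd x)\<^sup>2 / 4 * f x) / \<epsilon> - (LINT x|N \<epsilon>. (fst x - snd x)\<^sup>2 / 4 * f x) / \<epsilon> =
      (LINT x|N \<epsilon>. (fst x * snd x) * f x) / \<epsilon>"
      using pos
    proof eventually_elim
      case (elim \<epsilon>)
      have "(LINT x|N \<epsilon>. (fst x + snd x)\<^sup>2 / 4 * f x) - (LINT x|N \<epsilon>. (fst x - snd x)\<^sup>2 / 4 * f x) =
        (LINT x|N \<epsilon>. (fst x + snd x)\<^sup>2 / 4 * f x - (fst x - snd x)\<^sup>2 / 4 * f x)"
        by (rule Bochner_Integration.integral_diff[symmetric]; rule Nint[OF elim]; intro continuous_intros f; simp)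
      also have "\<dots> = (LINT x|N \<epsilon>. (fst x * snd x) * f x)"
        by (intro Bochner_Integration.integral_cong refl) (simp add: power2_eq_square algebra_simps diff_divide_distrib add_divide_distrib)
      finally show ?case by (simp only: diff_divide_distrib[symmetric])
    qed
  qed
  \<comment> \<open>A bound on the common box suffices, because \<open>P\<close> and
    \<open>Q\<close> live there.\<close>
  have sint: "signed_integral \<rho> f = (LINT x|P. f x) - (LINT x|Q. f x)"
    if f: "f \<in> borel_measurable borel" and b: "\<And>x. in_box c x \<Longrightarrow> norm (f x) \<le> b"
    for f :: "real \<times> real \<Rightarrow> 'b::{banach, second_countable_topology}" and b
    unfolding \<rho>_def
    by (rule signed_integral_diff_measure[OF P(1) Q(1) f, where B=b])
       (rule eventually_mono[OF P(2)], erule b, rule eventually_mono[OF Q(2)], erule b)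
  have sintc: "signed_integral \<rho> f = (LINT x|P. f x) - (LINT x|Q. f x)"
    if f: "continuous_on UNIV f" for f :: "real \<times> real \<Rightarrow> 'b::{banach, second_countable_topology}"
  proof -
    obtain b where "\<And>x. in_box c x \<Longrightarrow> norm (f x) \<le> b" using box_bound[OF f] by blast
    then show ?thesis by (rule sint[OF borel_measurable_continuous_onI[OF f]])
  qed
  have w: "weakly_converges (\<lambda>\<epsilon>. density (N \<epsilon>) (\<lambda>x. ennreal (g x / \<epsilon>))) L (at_right 0)"
    if lim: "\<And>f :: real \<times> real \<Rightarrow> real. continuous_on UNIV f \<Longrightarrow> ((\<lambda>\<epsilon>. (LINT x|N \<epsilon>. g x * f x) / \<epsilon>) \<longlongrightarrow> (LINT x|L. f x)) (at_right 0)"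
      and g: "continuous_on UNIV g" "\<And>x. g x \<ge> 0" for g and L
    unfolding weakly_converges_def
  proof (intro allI impI)
    fix f :: "real \<times> real \<Rightarrow> real" assume f: "continuous_on UNIV f" "bounded (range f)"
    show "((\<lambda>\<epsilon>. LINT x|density (N \<epsilon>) (\<lambda>x. ennreal (g x / \<epsilon>)). f x) \<longlongrightarrow> (LINT x|L. f x)) (at_right 0)"
    proof (rule Lim_transform_eventually[OF lim[OF f(1)]])
      show "\<forall>\<^sub>F \<epsilon> in at_right 0. (LINT x|N \<epsilon>. g x * f x) / \<epsilon> = (LINT x|density (N \<epsilon>) (\<lambda>x. ennreal (g x / \<epsilon>)). f x)"
        using pos
      proof eventually_elim
        case (elim \<epsilon>)
        have "continuous_on UNIV (\<lambda>x. g x / \<epsilon>)" using elim by (intro continuous_intros g) auto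
        then have "(\<lambda>x. g x / \<epsilon>) \<in> borel_measurable (N \<epsilon>)" "f \<in> borel_measurable (N \<epsilon>)"
          using finite_borel_borel_measurable[OF boxN(1)[OF elim]] borel_measurable_continuous_onI f(1) by blast+
        then have "(LINT x|density (N \<epsilon>) (\<lambda>x. ennreal (g x / \<epsilon>)). f x) = (LINT x|N \<epsilon>. (g x / \<epsilon>) *\<^sub>R f x)"
          using g(2) elim by (intro integral_density) auto
        also have "\<dots> = (LINT x|N \<epsilon>. (g x * f x) / \<epsilon>)" by simp
        also have "\<dots> = (LINT x|N \<epsilon>. g x * f x) / \<epsilon>" by (rule Bochner_Integration.integral_divide_zero)
        finally show ?case by simp
      qed
    qed
  qed
  have w1: "weakly_converges (\<lambda>\<epsilon>. density (N \<epsilon>) (\<lambda>(s, t). ennreal (s\<^sup>2 / \<epsilon>))) r1 (at_right 0)"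
    unfolding case_prod_unfold by (rule w[OF lim1]) (auto intro!: continuous_intros)
  have w2: "weakly_converges (\<lambda>\<epsilon>. density (N \<epsilon>) (\<lambda>(s, t). ennreal (t\<^sup>2 / \<epsilon>))) r2 (at_right 0)"
    unfolding case_prod_unfold by (rule w[OF lim2]) (auto intro!: continuous_intros)
  have w3: "signed_weakly_converges (\<lambda>\<epsilon>. times_measure (\<lambda>(s, t). s * t / \<epsilon>) (N \<epsilon>)) \<rho> (at_right 0)"
    unfolding signed_weakly_converges_def case_prod_unfold
  proof (intro allI impI)
    fix f :: "real \<times> real \<Rightarrow> real" assume f: "continuous_on UNIV f" "bounded (range f)"
    obtain b where b: "\<And>x. \<bar>f x\<bar> \<le> b" using f(2) unfolding bounded_iff by auto
    show "((\<lambda>\<epsilon>. signed_integral (times_measure (\<lambda>x. fst x * snd x / \<epsilon>) (N \<epsilon>)) f) \<longlongrightarrow> signed_integral \<rho> f) (at_right 0)"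
      unfolding sintc[OF f(1)]
    proof (rule Lim_transform_eventually[OF limST[OF f(1)]])
      show "\<forall>\<^sub>F \<epsilon> in at_right 0. (LINT x|N \<epsilon>. (fst x * snd x) * f x) / \<epsilon> = signed_integral (times_measure (\<lambda>x. fst x * snd x / \<epsilon>) (N \<epsilon>)) f"
        using pos
      proof eventually_elim
        case (elim \<epsilon>)
        have "integrable (N \<epsilon>) (\<lambda>x. fst x * snd x / \<epsilon>)" using elim by (intro Nint continuous_intros) auto
        from signed_integral_times_measure[OF boxN(1)[OF elim] this borel_measurable_continuous_onI[OF f(1)] b]
        have "signed_integral (times_measure (\<lambda>x. fst x * snd x / \<epsilon>) (N \<epsilon>)) f = (LINT x|N \<epsilon>. ((fst x * snd x) * f x) / \<epsilon>)" by simp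
        also have "\<dots> = (LINT x|N \<epsilon>. (fst x * snd x) * f x) / \<epsilon>" by (rule Bochner_Integration.integral_divide_zero)
        finally show ?case by simp
      qed
    qed
  qed
  have k1: "((\<lambda>\<epsilon>. 1 / \<epsilon> * (LINT (s, t)|N \<epsilon>. s)) \<longlongrightarrow> \<kappa> 1 0) (at_right 0)"
    using moment_limit[of 1 0] by (simp add: case_prod_unfold)
  have k2: "((\<lambda>\<epsilon>. 1 / \<epsilon> * (LINT (s, t)|N \<epsilon>. t)) \<longlongrightarrow> \<kappa> 0 1) (at_right 0)"
    using moment_limit[of 0 1] by (simp add: case_prod_unfold)
  have int2: "\<forall>\<epsilon>>0. integrable (N \<epsilon>) (\<lambda>(s, t). s\<^sup>2) \<and> integrable (N \<epsilon>) (\<lambda>(s, t). t\<^sup>2)"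
    unfolding case_prod_unfold by (intro allI impI conjI Nint continuous_intros)
  have levy: "R z w = of_real (\<kappa> 1 0) * z + of_real (\<kappa> 0 1) * w
      + (LINT (s, t)|r1. z\<^sup>2 / (1 - z * of_real s))
      + (LINT (s, t)|r2. w\<^sup>2 / (1 - w * of_real t))
      + signed_integral \<rho> (\<lambda>(s, t). z * w / ((1 - z * of_real s) * (1 - w * of_real t)))"
    if zw: "(z, w) \<in> (- \<real>) \<times> (- \<real>) \<union> {(0, 0)}" for z w
  proof -
    \<comment> \<open>For nonreal z and w no denominator vanishes; at the origin all of them are
      1.\<close>
    have nz: "1 - z * complex_of_real s \<noteq> 0" "1 - w * complex_of_real s \<noteq> 0" for s
      using zw norm_resolvent_nonreal(1)[of z s] norm_resolvent_nonreal(1)[of w s] by (auto simp: complex_is_Real_iff)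
    have cont: "continuous_on UNIV (\<lambda>x :: real \<times> real. z * w / ((1 - z * of_real (fst x)) * (1 - w * of_real (snd x))))"
      using nz by (intro continuous_intros) auto
    show ?thesis
      unfolding case_prod_unfold sintc[OF cont]
      by (rule levy_formula[OF r1(1) r2(1) P(1) Q(1) r1(2) r2(2) P(2) Q(2) lim1 lim2 limP limQ hol zw])
  qed
  have formula: "\<forall>(z, w) \<in> (- \<real>) \<times> (- \<real>) \<union> {(0, 0)}.
       R z w = of_real (\<kappa> 1 0) * z + of_real (\<kappa> 0 1) * w
         + (LINT (s, t)|r1. z\<^sup>2 / (1 - z * of_real s))
         + (LINT (s, t)|r2. w\<^sup>2 / (1 - w * of_real t))
         + signed_integral \<rho> (\<lambda>(s, t). z * w / ((1 - z * of_real s) * (1 - w * of_real t)))"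
    by (rule ballI, unfold case_prod_unfold, rule levy[unfolded case_prod_unfold]) simp
  \<comment> \<open>\<open>\<kappa> 2 0\<close> is both the mass of \<open>r1\<close> and, by the
    cumulant formulas, second moment minus squared mean.\<close>
  have var1: "measure r1 UNIV = prob_space.variance (marginal1 \<nu>) (\<lambda>x. x)"
    unfolding variance_marginal1[OF \<nu> box\<nu>] cum(2,4) r1(3) by simp
  have var2: "measure r2 UNIV = prob_space.variance (marginal2 \<nu>) (\<lambda>x. x)"
    unfolding variance_marginal2[OF \<nu> box\<nu>] cum(3,5) r2(3) by simp
  \<comment> \<open>In the difference of the masses of \<open>P\<close> and \<open>Q\<close> the
    pure terms cancel and the mixed ones add up to \<open>\<kappa> 1 1\<close>.\<close>
  have cov: "\<rho> UNIV = covariance \<nu>"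
    unfolding covariance_def case_prod_unfold cum(2,3,6) \<rho>_def P(3) Q(3) by simp
  \<comment> \<open>Before the limit both sides carry the same weight, as in s^2 t = (s t) s.
    Testing with f g and f h gives equal limits for every continuous bounded f, and the densities g,
    -h, h over \<open>L\<close>, \<open>P\<close>, \<open>Q\<close> form a relation determined by
    such tests.\<close>
  have ident: "times_measure g L A = times_signed h \<rho> A"
    if L: "finite_borel L" "AE x in L. in_box c x" and g: "continuous_on UNIV g" and h: "continuous_on UNIV h"
      and lim: "\<And>f :: real \<times> real \<Rightarrow> real. continuous_on UNIV f \<Longrightarrow> ((\<lambda>\<epsilon>. (LINT x|N \<epsilon>. k x * f x) / \<epsilon>) \<longlongrightarrow> (LINT x|L. f x)) (at_right 0)"
      and k: "\<And>x. k x * g x = fst x * snd x * h x"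
    for g h k :: "real \<times> real \<Rightarrow> real" and L A
  proof (cases "A \<in> sets borel")
    case True
    let ?M = "\<lambda>j::nat. [L, P, Q] ! j"
    let ?c = "\<lambda>j::nat. [g, \<lambda>x. - h x, h] ! j"
    have j: "j = 0 \<or> j = 1 \<or> j = 2" if "j \<in> {..<3}" for j :: nat using that by auto
    have hc: "continuous_on UNIV (\<lambda>x. - h x)" using h by (intro continuous_intros)
    have "(\<Sum>j<3. LINT x|?M j. indicator A x * ?c j x) = 0"
    proof (rule sum_integral_determined[OF _ _ _ _ True])
      show "finite_borel (?M j)" if "j \<in> {..<3}" for j using j[OF that] L P Q by auto
      show "integrable (?M j) (?c j)" if "j \<in> {..<3}" for j
        using j[OF that] box_integrable[OF L g] box_integrable[OF P(1,2) hc] box_integrable[OF Q(1,2) h] by auto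
      show "(\<Sum>j<3. LINT x|?M j. f x * ?c j x) = 0" if f: "continuous_on UNIV f" for f :: "real \<times> real \<Rightarrow> real"
      proof -
        have fg: "continuous_on UNIV (\<lambda>x. f x * g x)" "continuous_on UNIV (\<lambda>x. f x * h x)"
          using f g h by (auto intro!: continuous_intros)
        have eq: "(fst x * snd x) * (f x * h x) = k x * (f x * g x)" for x using k[of x] by (simp add: ac_simps)
        have "((\<lambda>\<epsilon>. (LINT x|N \<epsilon>. k x * (f x * g x)) / \<epsilon>) \<longlongrightarrow> (LINT x|P. f x * h x) - (LINT x|Q. f x * h x)) (at_right 0)"
          using limST[OF fg(2)] unfolding eq .
        then have "(LINT x|L. f x * g x) = (LINT x|P. f x * h x) - (LINT x|Q. f x * h x)"
          by (rule tendsto_unique[OF trivial_limit_at_right_real lim[OF fg(1)]])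
        then show ?thesis by (simp add: eval_nat_numeral)
      qed
    qed auto
    then have e: "(LINT x|L. indicator A x * g x) = (LINT x|P. indicator A x * h x) - (LINT x|Q. indicator A x * h x)"
      by (simp add: eval_nat_numeral)
    obtain b where b: "b > 0" "\<And>x. in_box c x \<Longrightarrow> norm (h x) \<le> b" using box_bound[OF h] by blast
    have "signed_integral \<rho> (\<lambda>x. indicator A x * h x) = (LINT x|P. indicator A x * h x) - (LINT x|Q. indicator A x * h x)"
    proof (rule sint[of _ b])
      show "(\<lambda>x. indicator A x * h x) \<in> borel_measurable borel"
        using borel_measurable_continuous_onI[OF h] True by measurable
      show "norm (indicator A x * h x) \<le> b" if "in_box c x" for x
        using b(1) b(2)[OF that] by (auto simp: indicator_def)
    qed
    then show ?thesis
      using e True by (simp add: times_measure_def times_signed_def set_lebesgue_integral_def)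
  qed (simp add: times_measure_def times_signed_def)
  have id1: "times_measure (\<lambda>(s, t). t) r1 = times_signed (\<lambda>(s, t). s) \<rho>"
    unfolding case_prod_unfold
    by (rule ext, rule ident[OF r1(1,2) _ _ lim1]) (auto intro!: continuous_intros simp: power2_eq_square)
  have id2: "times_measure (\<lambda>(s, t). s) r2 = times_signed (\<lambda>(s, t). t) \<rho>"
    unfolding case_prod_unfold
    by (rule ext, rule ident[OF r2(1,2) _ _ lim2]) (auto intro!: continuous_intros simp: power2_eq_square)
  \<comment> \<open>Integrating (s + l t)^2 against a tent function, letting \<epsilon> tend to 0
    and then shrinking the tent leaves the point masses as coefficients of a quadratic in l that is
    nowhere negative.\<close>
  have atom: "\<bar>\<rho> {(0, 0)}\<bar>\<^sup>2 \<le> measure r1 {(0, 0)} * measure r2 {(0, 0)}"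
  proof -
    define e where "e k x = max 0 (1 - real k * norm x)" for k and x :: "real \<times> real"
    have ec: "continuous_on UNIV (e k)" for k unfolding e_def by (intro continuous_intros)
    have "measure r1 {(0, 0)} + 2 * l * \<rho> {(0, 0)} + l\<^sup>2 * measure r2 {(0, 0)} \<ge> 0" for l
    proof (rule LIMSEQ_le_const)
      show "(\<lambda>k. (LINT x|r1. e k x) + 2 * l * ((LINT x|P. e k x) - (LINT x|Q. e k x)) + l\<^sup>2 * (LINT x|r2. e k x))
        \<longlonglongrightarrow> measure r1 {(0, 0)} + 2 * l * \<rho> {(0, 0)} + l\<^sup>2 * measure r2 {(0, 0)}"
        unfolding e_def \<rho>_def by (intro tendsto_intros point_mass_approximation r1 r2 P Q)
      have "0 \<le> (LINT x|r1. e k x) + 2 * l * ((LINT x|P. e k x) - (LINT x|Q. e k x)) + l\<^sup>2 * (LINT x|r2. e k x)" for k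
      proof (rule tendsto_lowerbound[OF _ _ trivial_limit_at_right_real])
        show "((\<lambda>\<epsilon>. (LINT x|N \<epsilon>. (fst x)\<^sup>2 * e k x) / \<epsilon> + 2 * l * ((LINT x|N \<epsilon>. (fst x * snd x) * e k x) / \<epsilon>)
          + l\<^sup>2 * ((LINT x|N \<epsilon>. (snd x)\<^sup>2 * e k x) / \<epsilon>)) \<longlongrightarrow>
          (LINT x|r1. e k x) + 2 * l * ((LINT x|P. e k x) - (LINT x|Q. e k x)) + l\<^sup>2 * (LINT x|r2. e k x)) (at_right 0)"
          by (intro tendsto_intros lim1 lim2 limST ec)
        show "\<forall>\<^sub>F \<epsilon> in at_right 0. 0 \<le> (LINT x|N \<epsilon>. (fst x)\<^sup>2 * e k x) / \<epsilon> + 2 * l * ((LINT x|N \<epsilon>. (fst x * snd x) * e k x) / \<epsilon>)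
          + l\<^sup>2 * ((LINT x|N \<epsilon>. (snd x)\<^sup>2 * e k x) / \<epsilon>)"
          using pos
        proof eventually_elim
          case (elim \<epsilon>)
          have i: "integrable (N \<epsilon>) (\<lambda>x. (fst x)\<^sup>2 * e k x)" "integrable (N \<epsilon>) (\<lambda>x. (fst x * snd x) * e k x)" "integrable (N \<epsilon>) (\<lambda>x. (snd x)\<^sup>2 * e k x)"
            by (rule Nint[OF elim], intro continuous_intros ec)+
          have "0 \<le> (LINT x|N \<epsilon>. (fst x + l * snd x)\<^sup>2 * e k x)"
            by (intro Bochner_Integration.integral_nonneg) (simp add: e_def)
          also have "(\<lambda>x. (fst x + l * snd x)\<^sup>2 * e k x) = (\<lambda>x. (fst x)\<^sup>2 * e k x + 2 * l * ((fst x * snd x) * e k x) + l\<^sup>2 * ((snd x)\<^sup>2 * e k x))"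
            by (simp add: fun_eq_iff power2_eq_square algebra_simps)
          also have "(LINT x|N \<epsilon>. (fst x)\<^sup>2 * e k x + 2 * l * ((fst x * snd x) * e k x) + l\<^sup>2 * ((snd x)\<^sup>2 * e k x)) =
            (LINT x|N \<epsilon>. (fst x)\<^sup>2 * e k x) + 2 * l * (LINT x|N \<epsilon>. (fst x * snd x) * e k x) + l\<^sup>2 * (LINT x|N \<epsilon>. (snd x)\<^sup>2 * e k x)"
            using i by (simp only: Bochner_Integration.integral_add Bochner_Integration.integrable_add
                Bochner_Integration.integrable_mult_right Bochner_Integration.integral_mult_right_zero)
          finally have "0 \<le> ((LINT x|N \<epsilon>. (fst x)\<^sup>2 * e k x) + 2 * l * (LINT x|N \<epsilon>. (fst x * snd x) * e k x) + l\<^sup>2 * (LINT x|N \<epsilon>. (snd x)\<^sup>2 * e k x)) / \<epsilon>"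
            using elim by simp
          then show ?case by (simp add: add_divide_distrib)
        qed
      qed
      then show "\<exists>n0. \<forall>k\<ge>n0. 0 \<le> (LINT x|r1. e k x) + 2 * l * ((LINT x|P. e k x) - (LINT x|Q. e k x)) + l\<^sup>2 * (LINT x|r2. e k x)"
        by blast
    qed
    then have "(\<rho> {(0, 0)})\<^sup>2 \<le> measure r1 {(0, 0)} * measure r2 {(0, 0)}" by (rule discriminant_bound)
    then show ?thesis by simp
  qed
  have supp: "signed_compactly_supported \<rho>"
    unfolding signed_compactly_supported_def
  proof (intro exI[of _ "{x. in_box c x}"] conjI ballI impI compact_box)
    fix A :: "(real \<times> real) set" assume A: "A \<in> sets borel" "A \<inter> {x. in_box c x} = {}"
    show "\<rho> A = 0"
      using null_outside_box[OF P(1,2) A] null_outside_box[OF Q(1,2) A] by (simp add: \<rho>_def measure_def)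
  qed
  show ?thesis
  proof (rule ex1I[of _ "(r1, r2, \<rho>)"], goal_cases)
    case 1
    show ?case
      unfolding prod.case
      by (intro conjI r1(1) r2(1) \<rho> compactly_supported_box[OF r1(1,2)] compactly_supported_box[OF r2(1,2)] supp
          int2 w1 w2 w3 k1 k2 formula var1 var2 cov id1 id2 atom)
  next
    case (2 x)
    obtain a b d where x: "x = (a, b, d)" by (cases x)
    \<comment> \<open>Weak limits are unique, since bounded continuous functions determine finite
      and signed Borel measures on the plane.\<close>
    have "finite_borel a" "finite_borel b" "signed_borel d"
      "weakly_converges (\<lambda>\<epsilon>. density (N \<epsilon>) (\<lambda>(s, t). ennreal (s\<^sup>2 / \<epsilon>))) a (at_right 0)"
      "weakly_converges (\<lambda>\<epsilon>. density (N \<epsilon>) (\<lambda>(s, t). ennreal (t\<^sup>2 / \<epsilon>))) b (at_right 0)"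
      "signed_weakly_converges (\<lambda>\<epsilon>. times_measure (\<lambda>(s, t). s * t / \<epsilon>) (N \<epsilon>)) d (at_right 0)"
      using 2[unfolded x prod.case] by - (elim conjE, assumption)+
    then show ?case
      using weakly_converges_unique[OF _ r1(1) _ w1] weakly_converges_unique[OF _ r2(1) _ w2]
        signed_weakly_converges_unique[OF _ \<rho> _ w3] unfolding x by simp
  qed
qed

end
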